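(* Let $\mathcal{X}$ be a Banach space with a fundamental biorthogonal system $\{e_\alpha;\varphi_\alpha\}_{\alpha\in\Gamma}$. Consider the dense subspace $\mathcal{Y}$ of $\mathcal{X}$ given by $\mathcal{Y}:=\mathrm{span}\{e_\alpha\}_{\alpha\in\Gamma}$ (a normed space with the norm inherited from $\mathcal{X}$). Then: (i) $\mathcal{Y}$ admits a polyhedral and LFC norm; (ii) $\mathcal{Y}$ admits a $C^\infty$-smooth and LFC norm; (iii) $\mathcal{Y}$ admits a $C^\infty$-smooth and LFC bump; (iv) $\mathcal{Y}$ admits locally finite, $\sigma$-uniformly discrete $C^\infty$-smooth and LFC partitions of unity; (v) $\mathcal{Y}$ admits a $C^1$-smooth LUR norm. Moreover, norms as in (i), norms as in (ii), and norms as in (v) are each dense in the set of all equivalent norms on $\mathcal{Y}$.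
   Context: All normed spaces are over the reals, and $\mathcal{X},\mathcal{Y}$ denote infinite-dimensional normed spaces. $\mathcal{X}^*$ is the (topological) dual. "$\mathcal{Y}$ admits a norm with property $P$" means that there is a norm on $\mathcal{Y}$, equivalent to the given one, with property $P$. Biorthogonal systems: a biorthogonal system in a normed space $\mathcal{X}$ is a system $\{e_\alpha;\varphi_\alpha\}_{\alpha\in\Gamma}$ with $e_\alpha\in\mathcal{X}$, $\varphi_\alpha\in\mathcal{X}^*$ and $\langle\varphi_\alpha,e_\beta\rangle=\delta_{\alpha,\beta}$ for all $\alpha,\beta\in\Gamma$. It is fundamental if $\mathrm{span}\{e_\alpha\}_{\alpha\in\Gamma}$ (the linear span, i.e. the set of finite linear combinations) is dense in $\mathcal{X}$. Polyhedral: a finite-dimensional normed space is polyhedral if its unit ball is a finite intersection of closed half-spaces; an infinite-dimensional normed space (or its norm) is polyhedral if every finite-dimensional subspace of it is polyhedral. Smoothness: a norm on $\mathcal{Y}$ is $C^k$-smooth if its $k$-th Fréchet derivative exists and is continuous at every point of $\mathcal{Y}\setminus\{0\}$; it is $C^\infty$-smooth if it is $C^k$-smooth for every $k\in\mathbb{N}$. LFC (locally depends on finitely many coordinates): a norm $\|\cdot\|$ on $\mathcal{Y}$ is LFC if for each $x$ in the unit sphere of $(\mathcal{Y},\|\cdot\|)$ there are an open neighbourhood $U$ of $x$ and functionals $\psi_1,\dots,\psi_k\in\mathcal{Y}^*$ such that $\|y\|=\|z\|$ for all $y,z\in U$ with $\langle\psi_j,y\rangle=\langle\psi_j,z\rangle$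 for $j=1,\dots,k$. A function $f:\mathcal{Y}\to\mathbb{R}$ is LFC if for every $x\in\mathcal{Y}$ there are an open neighbourhood $U$ of $x$ and $\psi_1,\dots,\psi_k\in\mathcal{Y}^*$ such that $f(y)=f(z)$ for all $y,z\in U$ with $\langle\psi_j,y\rangle=\langle\psi_j,z\rangle$ for $j=1,\dots,k$. Bump: a function $f:\mathcal{Y}\to\mathbb{R}$, not identically zero, with bounded support. LUR: a normed space $(\mathcal{Y},\|\cdot\|)$ (or its norm) is locally uniformly rotund (LUR) if for every $x$ in its unit sphere and every sequence $(x_n)$ in its unit sphere with $\|x_n+x\|\to 2$ one has $x_n\to x$. Partitions of unity: a partition of unity on $\mathcal{Y}$ is a family $\{f_\gamma\}_{\gamma\in\Lambda}$ of functions $f_\gamma:\mathcal{Y}\to[0,1]$ with $\sum_{\gamma}f_\gamma(x)=1$ for every $x\in\mathcal{Y}$. It is subordinated to an open cover if each set $\{f_\gamma\neq0\}$ is contained in some member of the cover. It is locally finite if the family of sets $\{f_\gamma\ne0\}$ is locally finite (each point has a neighbourhood meeting only finitely many of them). It is $\sigma$-uniformly discrete if $\Lambda=\bigcup_{n\in\mathbb{N}}\Lambda_n$ where, for each $n$, the family $(\{f_\gamma\neq0\})_{\gamma\in\Lambda_n}$ is uniformly discrete, i.e. there is $d_n>0$ such that the distance between any two sets of the family with distinct indices is at least $d_n$. "$\mathcal{Y}$ admits locally finite, $\sigma$-uniformly discrete $C^\infty$-smooth and LFC partitions of unity" means that for every open cover of $\mathcal{Y}$ there is a locally finite, $\sigma$-uniformly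 discrete partition of unity subordinated to it that consists of functions that are $C^\infty$-smooth and LFC on $\mathcal{Y}$. Density of norms: norms with property $P$ are dense in the set of all equivalent norms on $\mathcal{Y}$ if for every equivalent norm $\|\cdot\|$ on $\mathcal{Y}$ and every $\varepsilon>0$ there is a norm $|||\cdot|||$ on $\mathcal{Y}$ with property $P$ such that $(1-\varepsilon)|||\cdot|||\le\|\cdot\|\le(1+\varepsilon)|||\cdot|||$. *)

theory Defs
  imports "HOL-Analysis.Analysis"
begin

text \<open>
  A normed space is represented here either by a type of class \<open>real_normed_vector\<close> or by a linear
  subspace \<open>S\<close> of such a type, carrying the inherited norm. In the second case all notions are
  relative to \<open>S\<close>: functions on \<open>S\<close> are functions on the ambient type whose values outside \<open>S\<close>
  are never used, and open sets are those of \<open>top_of_set S\<close>. Equivalent norms induce the same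
  topology, dual space and Fr\'echet derivatives, so these are always expressed by the inherited
  norm.
\<close>

definition finite_dimensional :: "'a::real_vector set \<Rightarrow> bool" where
  "finite_dimensional F \<longleftrightarrow> (\<exists>B. finite B \<and> F = span B)"

definition biorthogonal_system ::
    "'i set \<Rightarrow> ('i \<Rightarrow> 'a::real_normed_vector) \<Rightarrow> ('i \<Rightarrow> 'a \<Rightarrow>\<^sub>L real) \<Rightarrow> bool" where
  "biorthogonal_system \<Gamma> e \<phi> \<longleftrightarrow>
     (\<forall>\<alpha>\<in>\<Gamma>. \<forall>\<beta>\<in>\<Gamma>. blinfun_apply (\<phi> \<alpha>) (e \<beta>) = (if \<alpha> = \<beta> then 1 else 0))"

definition fundamental_biorthogonal_system ::
    "'i set \<Rightarrow> ('i \<Rightarrow> 'a::real_normed_vector) \<Rightarrow> ('i \<Rightarrow> 'a \<Rightarrow>\<^sub>L real) \<Rightarrow> bool" where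
  "fundamental_biorthogonal_system \<Gamma> e \<phi> \<longleftrightarrow>
     biorthogonal_system \<Gamma> e \<phi> \<and> closure (span (e ` \<Gamma>)) = UNIV"

definition dual_on :: "'a::real_normed_vector set \<Rightarrow> ('a \<Rightarrow> real) set" where
  "dual_on S = {\<psi>. (\<forall>x\<in>S. \<forall>y\<in>S. \<psi> (x + y) = \<psi> x + \<psi> y) \<and>
                   (\<forall>c. \<forall>x\<in>S. \<psi> (c *\<^sub>R x) = c * \<psi> x) \<and>
                   (\<exists>C. \<forall>x\<in>S. \<bar>\<psi> x\<bar> \<le> C * norm x)}"


subsection \<open>Equivalent norms\<close>

definition norm_on :: "'a::real_vector set \<Rightarrow> ('a \<Rightarrow> real) \<Rightarrow> bool" where
  "norm_on S N \<longleftrightarrow>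
     (\<forall>x\<in>S. 0 \<le> N x \<and> (N x = 0 \<longleftrightarrow> x = 0)) \<and>
     (\<forall>c. \<forall>x\<in>S. N (c *\<^sub>R x) = \<bar>c\<bar> * N x) \<and>
     (\<forall>x\<in>S. \<forall>y\<in>S. N (x + y) \<le> N x + N y)"

definition equivalent_norm_on :: "'a::real_normed_vector set \<Rightarrow> ('a \<Rightarrow> real) \<Rightarrow> bool" where
  "equivalent_norm_on S N \<longleftrightarrow>
     norm_on S N \<and> (\<exists>c>0. \<exists>C>0. \<forall>x\<in>S. c * norm x \<le> N x \<and> N x \<le> C * norm x)"

definition admits_norm ::
    "'a::real_normed_vector set \<Rightarrow> (('a \<Rightarrow> real) \<Rightarrow> bool) \<Rightarrow> bool" where
  "admits_norm S P \<longleftrightarrow> (\<exists>N. equivalent_norm_on S N \<and> P N)"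

definition norms_dense ::
    "'a::real_normed_vector set \<Rightarrow> (('a \<Rightarrow> real) \<Rightarrow> bool) \<Rightarrow> bool" where
  "norms_dense S P \<longleftrightarrow>
     (\<forall>N. equivalent_norm_on S N \<longrightarrow>
       (\<forall>\<epsilon>>0. \<exists>M. equivalent_norm_on S M \<and> P M \<and>
          (\<forall>x\<in>S. (1 - \<epsilon>) * M x \<le> N x \<and> N x \<le> (1 + \<epsilon>) * M x)))"


subsection \<open>Polyhedral norms\<close>

definition closed_halfspace_on :: "'a::real_normed_vector set \<Rightarrow> 'a set \<Rightarrow> bool" where
  "closed_halfspace_on F H \<longleftrightarrow>
     (\<exists>\<psi>\<in>dual_on F. \<exists>b. (\<exists>x\<in>F. \<psi> x \<noteq> 0) \<and> H = {x\<in>F. \<psi> x \<le> b})"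

text \<open>The intersection with \<open>F\<close> provides the empty intersection, needed for \<open>F = {0}\<close>.\<close>

definition polyhedral_ball :: "'a::real_normed_vector set \<Rightarrow> ('a \<Rightarrow> real) \<Rightarrow> bool" where
  "polyhedral_ball F N \<longleftrightarrow>
     (\<exists>\<H>. finite \<H> \<and> (\<forall>H\<in>\<H>. closed_halfspace_on F H) \<and> {x\<in>F. N x \<le> 1} = F \<inter> \<Inter>\<H>)"

definition polyhedral_norm_on :: "'a::real_normed_vector set \<Rightarrow> ('a \<Rightarrow> real) \<Rightarrow> bool" where
  "polyhedral_norm_on S N \<longleftrightarrow>
     (\<forall>F. subspace F \<and> F \<subseteq> S \<and> finite_dimensional F \<longrightarrow> polyhedral_ball F N)"


subsection \<open>Local dependence on finitely many coordinates\<close>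

definition lfc_at :: "'a::real_normed_vector set \<Rightarrow> ('a \<Rightarrow> real) \<Rightarrow> 'a \<Rightarrow> bool" where
  "lfc_at S f x \<longleftrightarrow>
     (\<exists>U \<Psi>. openin (top_of_set S) U \<and> x \<in> U \<and> finite \<Psi> \<and> \<Psi> \<subseteq> dual_on S \<and>
        (\<forall>y\<in>U. \<forall>z\<in>U. (\<forall>\<psi>\<in>\<Psi>. \<psi> y = \<psi> z) \<longrightarrow> f y = f z))"

definition lfc_norm_on :: "'a::real_normed_vector set \<Rightarrow> ('a \<Rightarrow> real) \<Rightarrow> bool" where
  "lfc_norm_on S N \<longleftrightarrow> (\<forall>x\<in>S. N x = 1 \<longrightarrow> lfc_at S N x)"

definition lfc_on :: "'a::real_normed_vector set \<Rightarrow> ('a \<Rightarrow> real) \<Rightarrow> bool" where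
  "lfc_on S f \<longleftrightarrow> (\<forall>x\<in>S. lfc_at S f x)"


subsection \<open>Higher Fr\'echet derivatives\<close>

text \<open>
  The \<open>j\<close>-th Fr\'echet derivative at a point is an element of
  \<open>L(S, L(S, \<dots> L(S, \<real>)\<dots>))\<close>. Since this type depends on \<open>j\<close>, it is replaced, as usual, by the
  isometric space of bounded \<open>j\<close>-linear forms on \<open>S\<close>; a \<open>j\<close>-tuple is a list of length \<open>j\<close>. The norm
  of that space is the supremum over \<open>unit_tuples S j\<close>, so that convergence in it is uniform
  convergence on this set.
\<close>

definition tuples :: "'a set \<Rightarrow> nat \<Rightarrow> 'a list set" where
  "tuples S j = {vs. length vs = j \<and> set vs \<subseteq> S}"

definition unit_tuples :: "'a::real_normed_vector set \<Rightarrow> nat \<Rightarrow> 'a list set" where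
  "unit_tuples S j = tuples (S \<inter> cball 0 1) j"

definition bounded_multilinear_on ::
    "'a::real_normed_vector set \<Rightarrow> nat \<Rightarrow> ('a list \<Rightarrow> real) \<Rightarrow> bool" where
  "bounded_multilinear_on S j T \<longleftrightarrow>
     (\<forall>vs\<in>tuples S j. \<forall>i<j.
        (\<forall>v\<in>S. \<forall>w\<in>S. T (vs[i := v + w]) = T (vs[i := v]) + T (vs[i := w])) \<and>
        (\<forall>c. \<forall>v\<in>S. T (vs[i := c *\<^sub>R v]) = c * T (vs[i := v]))) \<and>
     (\<exists>C. \<forall>vs\<in>tuples S j. \<bar>T vs\<bar> \<le> C * prod_list (map norm vs))"

text \<open>
  \<open>T\<close> maps points of \<open>U\<close> to \<open>j\<close>-linear forms; its derivative at \<open>x\<close> is the \<open>(j+1)\<close>-linear form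
  \<open>A\<close>, whose first argument is the increment.
\<close>

definition has_frechet_derivative_on ::
    "'a::real_normed_vector set \<Rightarrow> 'a set \<Rightarrow> nat \<Rightarrow> ('a \<Rightarrow> 'a list \<Rightarrow> real) \<Rightarrow> ('a list \<Rightarrow> real) \<Rightarrow> 'a \<Rightarrow> bool"
  where
  "has_frechet_derivative_on S U j T A x \<longleftrightarrow>
     bounded_multilinear_on S (Suc j) A \<and>
     uniform_limit (unit_tuples S j)
       (\<lambda>y vs. (T y vs - T x vs - A ((y - x) # vs)) / norm (y - x)) (\<lambda>vs. 0) (at x within U)"

text \<open>
  \<open>U\<close> is meant to be open in \<open>S\<close>; \<open>D j x\<close> is the \<open>j\<close>-th derivative of \<open>f\<close> at \<open>x\<close>.
\<close>

definition Ck_on :: "'a::real_normed_vector set \<Rightarrow> 'a set \<Rightarrow> nat \<Rightarrow> ('a \<Rightarrow> real) \<Rightarrow> bool" where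
  "Ck_on S U k f \<longleftrightarrow>
     (\<exists>D. (\<forall>x\<in>U. D 0 x [] = f x) \<and>
          (\<forall>j<k. \<forall>x\<in>U. has_frechet_derivative_on S U j (D j) (D (Suc j) x) x) \<and>
          (\<forall>x\<in>U. uniform_limit (unit_tuples S k) (D k) (D k x) (at x within U)))"

definition Cinf_on :: "'a::real_normed_vector set \<Rightarrow> 'a set \<Rightarrow> ('a \<Rightarrow> real) \<Rightarrow> bool" where
  "Cinf_on S U f \<longleftrightarrow> (\<forall>k. Ck_on S U k f)"

definition Ck_norm_on :: "'a::real_normed_vector set \<Rightarrow> nat \<Rightarrow> ('a \<Rightarrow> real) \<Rightarrow> bool" where
  "Ck_norm_on S k N \<longleftrightarrow> Ck_on S (S - {0}) k N"

definition Cinf_norm_on :: "'a::real_normed_vector set \<Rightarrow> ('a \<Rightarrow> real) \<Rightarrow> bool" where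
  "Cinf_norm_on S N \<longleftrightarrow> (\<forall>k. Ck_norm_on S k N)"


subsection \<open>Bumps, rotundity, partitions of unity\<close>

definition bump_on :: "'a::real_normed_vector set \<Rightarrow> ('a \<Rightarrow> real) \<Rightarrow> bool" where
  "bump_on S f \<longleftrightarrow> (\<exists>x\<in>S. f x \<noteq> 0) \<and> bounded {x\<in>S. f x \<noteq> 0}"

definition LUR_norm_on :: "'a::real_vector set \<Rightarrow> ('a \<Rightarrow> real) \<Rightarrow> bool" where
  "LUR_norm_on S N \<longleftrightarrow>
     (\<forall>x\<in>S. \<forall>u::nat \<Rightarrow> 'a. N x = 1 \<longrightarrow> (\<forall>n. u n \<in> S \<and> N (u n) = 1) \<longrightarrow>
        (\<lambda>n. N (u n + x)) \<longlonglongrightarrow> 2 \<longrightarrow> (\<lambda>n. N (u n - x)) \<longlonglongrightarrow> 0)"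

definition partition_of_unity_on ::
    "'a set \<Rightarrow> 'l set \<Rightarrow> ('l \<Rightarrow> 'a \<Rightarrow> real) \<Rightarrow> bool" where
  "partition_of_unity_on S \<Lambda> f \<longleftrightarrow>
     (\<forall>\<gamma>\<in>\<Lambda>. \<forall>x\<in>S. f \<gamma> x \<in> {0..1}) \<and> (\<forall>x\<in>S. ((\<lambda>\<gamma>. f \<gamma> x) has_sum 1) \<Lambda>)"

definition subordinated_on ::
    "'a set \<Rightarrow> 'l set \<Rightarrow> ('l \<Rightarrow> 'a \<Rightarrow> real) \<Rightarrow> 'a set set \<Rightarrow> bool" where
  "subordinated_on S \<Lambda> f \<U> \<longleftrightarrow> (\<forall>\<gamma>\<in>\<Lambda>. \<exists>V\<in>\<U>. {x\<in>S. f \<gamma> x \<noteq> 0} \<subseteq> V)"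

definition locally_finite_on ::
    "'a::topological_space set \<Rightarrow> 'l set \<Rightarrow> ('l \<Rightarrow> 'a \<Rightarrow> real) \<Rightarrow> bool" where
  "locally_finite_on S \<Lambda> f \<longleftrightarrow>
     (\<forall>x\<in>S. \<exists>U. openin (top_of_set S) U \<and> x \<in> U \<and> finite {\<gamma>\<in>\<Lambda>. \<exists>y\<in>U. f \<gamma> y \<noteq> 0})"

definition uniformly_discrete_on ::
    "'a::metric_space set \<Rightarrow> 'l set \<Rightarrow> ('l \<Rightarrow> 'a \<Rightarrow> real) \<Rightarrow> bool" where
  "uniformly_discrete_on S \<Lambda> f \<longleftrightarrow>
     (\<exists>d>0. \<forall>\<gamma>\<in>\<Lambda>. \<forall>\<delta>\<in>\<Lambda>. \<gamma> \<noteq> \<delta> \<longrightarrow>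
        (\<forall>x\<in>S. \<forall>y\<in>S. f \<gamma> x \<noteq> 0 \<longrightarrow> f \<delta> y \<noteq> 0 \<longrightarrow> d \<le> dist x y))"

definition sigma_uniformly_discrete_on ::
    "'a::metric_space set \<Rightarrow> 'l set \<Rightarrow> ('l \<Rightarrow> 'a \<Rightarrow> real) \<Rightarrow> bool" where
  "sigma_uniformly_discrete_on S \<Lambda> f \<longleftrightarrow>
     (\<exists>L::nat \<Rightarrow> 'l set. \<Lambda> = (\<Union>n. L n) \<and> (\<forall>n. uniformly_discrete_on S (L n) f))"

text \<open>
  One cannot quantify existentially over the type of the indices, so they are taken from
  \<open>nat \<times> ('a \<Rightarrow> real)\<close>. This is no restriction: members vanishing on \<open>S\<close> can be dropped from a
  partition, and two other members with distinct indices in the same \<open>\<Lambda>\<^sub>n\<close> are different functions,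
  so each remaining index \<open>\<gamma>\<close> can be replaced by \<open>(n, f \<gamma>)\<close> with the least \<open>n\<close> such that
  \<open>\<gamma> \<in> \<Lambda>\<^sub>n\<close>.
\<close>

definition admits_smooth_lfc_partitions_on :: "'a::real_normed_vector set \<Rightarrow> bool" where
  "admits_smooth_lfc_partitions_on S \<longleftrightarrow>
     (\<forall>\<U>. (\<forall>V\<in>\<U>. openin (top_of_set S) V) \<and> S \<subseteq> \<Union>\<U> \<longrightarrow>
       (\<exists>(\<Lambda> :: (nat \<times> ('a \<Rightarrow> real)) set) f.
          partition_of_unity_on S \<Lambda> f \<and> subordinated_on S \<Lambda> f \<U> \<and>
          locally_finite_on S \<Lambda> f \<and> sigma_uniformly_discrete_on S \<Lambda> f \<and>
          (\<forall>\<gamma>\<in>\<Lambda>. Cinf_on S S (f \<gamma>) \<and> lfc_on S (f \<gamma>))))"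

end

theory Submission
  imports Defs
begin

text \<open>
  Every equivalent norm on \<open>Y\<close> extends to \<open>X\<close> and is approximated, by a Troyanski type renorming, by
  a norm \<open>N\<close> that is locally uniformly rotund at the points of \<open>Y\<close>. Rotundity at \<open>x\<close> gives a functional
  \<open>g\<close> that is large at \<open>x\<close> but has norm less than 1 on each hyperplane \<open>{\<phi>\<^sub>\<beta> = 0}\<close> with \<open>\<phi>\<^sub>\<beta> x \<noteq> 0\<close>.
  As the supports of points of \<open>Y\<close> are finite, compactness and recursion over the finite sets of indices
  then yield functionals \<open>g\<close> of norm at most \<open>1 + \<epsilon>\<close> such that on each \<open>span (e ` A)\<close> with \<open>A\<close> finite, all
  but finitely many of them are bounded by \<open>N\<close>, while the remaining ones exceed \<open>N\<close> by a margin. Their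
  supremum is the polyhedral norm. The gauge of the set where the sum of smooth convex penalties of the
  \<open>g\<close> is at most 1 is the smooth norm; it yields the bumps, and products of bumps yield the partitions.
  A weighted square sum of smooth norms converging to \<open>N\<close> is the \<open>C\<^sup>1\<close> locally uniformly rotund norm.
\<close>

text \<open>The tension is between closeness and local finiteness: the functionals may exceed
  \<open>N\<close> by a factor of at most \<open>1 + \<epsilon>\<close>, yet near each point only
  finitely many may count. Norming functionals of \<open>N\<close> alone could crowd at
  \<open>N x\<close> in infinite number. The gap between \<open>N\<close> and
  \<open>\<tau> * N\<close> prevents this, and it survives in a neighbourhood because all
  functionals are Lipschitz with one constant \<open>K\<close>. Rotundity is asked for at points of
  \<open>Y\<close> only, where finite supports allow a countable square sum of auxiliary norms to
  suffice. The margin also serves the smooth norm: along every ray the penalties reach total 1 while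
  \<open>N\<close> is still below 1, that is, where their sum is locally finite. Differentiating the
  equation that defines the gauge expresses its derivative by smooth functions of the gauge itself,
  so each order of smoothness yields the next. For the partitions, points are sorted by the size of
  their support and a lower bound on their nonzero coordinates, which keeps different supports
  uniformly apart. The smooth norms need not be rotund; their convergence to \<open>N\<close>
  recovers rotundity at the end.\<close>

definition seminorm_on :: "'a::real_vector set \<Rightarrow> ('a \<Rightarrow> real) \<Rightarrow> bool" where
  "seminorm_on S p \<longleftrightarrow>
     (\<forall>x\<in>S. 0 \<le> p x) \<and> (\<forall>c. \<forall>x\<in>S. p (c *\<^sub>R x) = \<bar>c\<bar> * p x) \<and>
     (\<forall>x\<in>S. \<forall>y\<in>S. p (x + y) \<le> p x + p y)"

lemma seminorm_on_nonneg: "seminorm_on S p \<Longrightarrow> x \<in> S \<Longrightarrow> 0 \<le> p x"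
  and seminorm_on_scale: "seminorm_on S p \<Longrightarrow> x \<in> S \<Longrightarrow> p (c *\<^sub>R x) = \<bar>c\<bar> * p x"
  and seminorm_on_triangle: "seminorm_on S p \<Longrightarrow> x \<in> S \<Longrightarrow> y \<in> S \<Longrightarrow> p (x + y) \<le> p x + p y"
  by (auto simp: seminorm_on_def)

lemma seminorm_on_mono: "seminorm_on T p \<Longrightarrow> S \<subseteq> T \<Longrightarrow> seminorm_on S p"
  by (auto simp: seminorm_on_def subset_iff)

lemma seminorm_on_zero: "seminorm_on S p \<Longrightarrow> 0 \<in> S \<Longrightarrow> p 0 = 0"
  using seminorm_on_scale[of S p 0 0] by simp

lemma seminorm_on_uminus: "seminorm_on S p \<Longrightarrow> x \<in> S \<Longrightarrow> p (- x) = p x"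
  using seminorm_on_scale[of S p x "-1"] by simp

lemma seminorm_on_diff_le:
  assumes "seminorm_on S p" "subspace S" "x \<in> S" "y \<in> S"
  shows "\<bar>p x - p y\<bar> \<le> p (x - y)"
proof -
  have d: "x - y \<in> S" "y - x \<in> S"
    using assms by (auto simp: subspace_diff)
  have "p x \<le> p (x - y) + p y" "p y \<le> p (y - x) + p x"
    using seminorm_on_triangle[OF assms(1) d(1) assms(4)] seminorm_on_triangle[OF assms(1) d(2) assms(3)]
    by simp_all
  moreover have "p (y - x) = p (x - y)"
    using seminorm_on_uminus[OF assms(1) d(1)] by simp
  ultimately show ?thesis by linarith
qed

lemma norm_on_iff_seminorm_on:
  assumes "subspace S"
  shows "norm_on S N \<longleftrightarrow> seminorm_on S N \<and> (\<forall>x\<in>S. N x = 0 \<longrightarrow> x = 0)"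
  using seminorm_on_zero[of S N] subspace_0[OF assms]
  unfolding norm_on_def seminorm_on_def by blast

lemma equivalent_norm_onI:
  assumes "subspace S" "seminorm_on S N" "0 < c" "0 < C"
    and "\<And>x. x \<in> S \<Longrightarrow> c * norm x \<le> N x" "\<And>x. x \<in> S \<Longrightarrow> N x \<le> C * norm x"
  shows "equivalent_norm_on S N"
proof -
  have "x = 0" if "x \<in> S" "N x = 0" for x
    using assms(3) assms(5)[OF that(1)] that(2) by (simp add: mult_le_0_iff)
  then show ?thesis
    using assms unfolding equivalent_norm_on_def norm_on_iff_seminorm_on[OF assms(1)] by blast
qed

lemma seminorm_on_SUP:
  assumes "subspace S" "I \<noteq> {}" "\<And>i. i \<in> I \<Longrightarrow> seminorm_on S (p i)"
    and bdd: "\<And>x. x \<in> S \<Longrightarrow> bdd_above ((\<lambda>i. p i x) ` I)"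
  shows "seminorm_on S (\<lambda>x. SUP i\<in>I. p i x)"
proof -
  have le: "p i x \<le> (SUP i\<in>I. p i x)" if "i \<in> I" "x \<in> S" for i x
    using that bdd by (meson cSUP_upper)
  obtain i0 where i0: "i0 \<in> I" using assms(2) by blast
  have scale_le: "(SUP i\<in>I. p i (c *\<^sub>R x)) \<le> \<bar>c\<bar> * (SUP i\<in>I. p i x)" if "x \<in> S" for c x
    using assms(2)
  proof (rule cSUP_least)
    fix i assume i: "i \<in> I"
    show "p i (c *\<^sub>R x) \<le> \<bar>c\<bar> * (SUP i\<in>I. p i x)"
      using seminorm_on_scale[OF assms(3)[OF i] that, of c] le[OF i that] by (simp add: mult_left_mono)
  qed
  show ?thesis
    unfolding seminorm_on_def
  proof (intro conjI ballI allI)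
    fix x assume x: "x \<in> S"
    show "0 \<le> (SUP i\<in>I. p i x)"
      using le[OF i0 x] seminorm_on_nonneg[OF assms(3)[OF i0] x] by linarith
    fix c
    show "(SUP i\<in>I. p i (c *\<^sub>R x)) = \<bar>c\<bar> * (SUP i\<in>I. p i x)"
    proof (rule antisym[OF scale_le[OF x]])
      show "\<bar>c\<bar> * (SUP i\<in>I. p i x) \<le> (SUP i\<in>I. p i (c *\<^sub>R x))"
      proof (cases "c = 0")
        case True
        then show ?thesis
          using le[OF i0 subspace_0[OF assms(1)]] seminorm_on_zero[OF assms(3)[OF i0] subspace_0[OF assms(1)]]
          by simp
      next
        case False
        have "(SUP i\<in>I. p i ((1/c) *\<^sub>R (c *\<^sub>R x))) \<le> \<bar>1/c\<bar> * (SUP i\<in>I. p i (c *\<^sub>R x))"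
          by (rule scale_le) (use x assms(1) subspace_scale in blast)
        then show ?thesis using False by (simp add: field_simps)
      qed
    qed
  next
    fix x y assume xy: "x \<in> S" "y \<in> S"
    show "(SUP i\<in>I. p i (x + y)) \<le> (SUP i\<in>I. p i x) + (SUP i\<in>I. p i y)"
      using assms(2)
    proof (rule cSUP_least)
      fix i assume i: "i \<in> I"
      show "p i (x + y) \<le> (SUP i\<in>I. p i x) + (SUP i\<in>I. p i y)"
        using seminorm_on_triangle[OF assms(3)[OF i] xy] le[OF i xy(1)] le[OF i xy(2)] by linarith
    qed
  qed
qed

lemma seminorm_on_L2_set:
  assumes "subspace S" "\<And>i. i \<in> I \<Longrightarrow> seminorm_on S (p i)"
  shows "seminorm_on S (\<lambda>x. L2_set (\<lambda>i. p i x) I)"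
  unfolding seminorm_on_def
proof (intro conjI ballI allI)
  fix x assume x: "x \<in> S"
  show "0 \<le> L2_set (\<lambda>i. p i x) I" by simp
  fix c
  have "L2_set (\<lambda>i. p i (c *\<^sub>R x)) I = L2_set (\<lambda>i. \<bar>c\<bar> * p i x) I"
    by (rule L2_set_cong) (use seminorm_on_scale[OF assms(2) x] in auto)
  then show "L2_set (\<lambda>i. p i (c *\<^sub>R x)) I = \<bar>c\<bar> * L2_set (\<lambda>i. p i x) I"
    by (simp add: L2_set_right_distrib)
next
  fix x y assume xy: "x \<in> S" "y \<in> S"
  then have "L2_set (\<lambda>i. p i (x + y)) I \<le> L2_set (\<lambda>i. p i x + p i y) I"
    using assms by (intro L2_set_mono) (auto intro: seminorm_on_triangle seminorm_on_nonneg subspace_add)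
  then show "L2_set (\<lambda>i. p i (x + y)) I \<le> L2_set (\<lambda>i. p i x) I + L2_set (\<lambda>i. p i y) I"
    using L2_set_triangle_ineq[of "\<lambda>i. p i x" "\<lambda>i. p i y" I] by linarith
qed

text \<open>Minkowski's inequality is available for partial sums through
  \<open>seminorm_on_L2_set\<close> and survives in the limit.\<close>

lemma seminorm_on_sqrt_suminf:
  fixes p :: "nat \<Rightarrow> 'a::real_vector \<Rightarrow> real"
  assumes S: "subspace S" and p: "\<And>m. seminorm_on S (p m)"
    and sm: "\<And>x. x \<in> S \<Longrightarrow> summable (\<lambda>m. (p m x)\<^sup>2)"
  shows "seminorm_on S (\<lambda>x. sqrt (\<Sum>m. (p m x)\<^sup>2))"
  unfolding seminorm_on_def
proof (intro conjI ballI allI)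
  fix x assume x: "x \<in> S"
  show "0 \<le> sqrt (\<Sum>m. (p m x)\<^sup>2)" using suminf_nonneg[OF sm[OF x]] by simp
  fix c
  have "(\<Sum>m. (p m (c *\<^sub>R x))\<^sup>2) = (\<Sum>m. c\<^sup>2 * (p m x)\<^sup>2)"
    by (simp add: seminorm_on_scale[OF p x] power_mult_distrib)
  also have "\<dots> = c\<^sup>2 * (\<Sum>m. (p m x)\<^sup>2)" using sm[OF x] by (rule suminf_mult)
  finally show "sqrt (\<Sum>m. (p m (c *\<^sub>R x))\<^sup>2) = \<bar>c\<bar> * sqrt (\<Sum>m. (p m x)\<^sup>2)"
    by (simp add: real_sqrt_mult)
next
  fix x y assume xy: "x \<in> S" "y \<in> S"
  let ?B = "sqrt (\<Sum>m. (p m x)\<^sup>2) + sqrt (\<Sum>m. (p m y)\<^sup>2)"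
  have part: "L2_set (\<lambda>m. p m z) {..<n} \<le> sqrt (\<Sum>m. (p m z)\<^sup>2)" if "z \<in> S" for z n
    unfolding L2_set_def using sum_le_suminf[OF sm[OF that], of "{..<n}"] by simp
  have "(\<Sum>m<n. (p m (x + y))\<^sup>2) \<le> ?B\<^sup>2" for n
  proof -
    have "L2_set (\<lambda>m. p m (x + y)) {..<n} \<le> L2_set (\<lambda>m. p m x) {..<n} + L2_set (\<lambda>m. p m y) {..<n}"
      using seminorm_on_triangle[OF seminorm_on_L2_set[OF S p] xy] .
    also have "\<dots> \<le> ?B" by (intro add_mono part xy)
    finally have "sqrt (\<Sum>m<n. (p m (x + y))\<^sup>2) \<le> ?B" by (simp add: L2_set_def)
    then show ?thesis by (rule sqrt_le_D)
  qed
  then have "(\<Sum>m. (p m (x + y))\<^sup>2) \<le> ?B\<^sup>2"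
    by (intro suminf_le_const sm subspace_add S xy)
  moreover have "0 \<le> ?B" using suminf_nonneg[OF sm] xy by simp
  ultimately show "sqrt (\<Sum>m. (p m (x + y))\<^sup>2) \<le> ?B"
    by (rule real_le_lsqrt[rotated])
qed

text \<open>Local uniform rotundity is used in its homogeneous form: \<open>u\<^sub>n \<rightarrow> x\<close> whenever
  \<open>defect N x u\<^sub>n \<rightarrow> 0\<close>.\<close>

definition defect :: "('a::real_vector \<Rightarrow> real) \<Rightarrow> 'a \<Rightarrow> 'a \<Rightarrow> real" where
  "defect p x y = 2 * (p x)\<^sup>2 + 2 * (p y)\<^sup>2 - (p (x + y))\<^sup>2"

text \<open>The sequence is not normalised, unlike in \<open>LUR_norm_on\<close>: the terms of a
  square sum have different unit spheres, so only a homogeneous condition passes between the sum and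
  its terms.\<close>

definition rotund_on :: "'a::real_vector set \<Rightarrow> ('a \<Rightarrow> real) \<Rightarrow> bool" where
  "rotund_on S N \<longleftrightarrow> (\<forall>x\<in>S. \<forall>u. (\<forall>n. u n \<in> S) \<longrightarrow>
     (\<lambda>n::nat. defect N x (u n)) \<longlonglongrightarrow> 0 \<longrightarrow> (\<lambda>n. N (u n - x)) \<longlonglongrightarrow> 0)"

text \<open>It comes from the triangle inequality at \<open>x + y\<close>. A vanishing defect thus
  forces \<open>p y\<close> towards \<open>p x\<close>.\<close>

lemma defect_ge_square:
  assumes "seminorm_on S p" "subspace S" "x \<in> S" "y \<in> S"
  shows "(p x - p y)\<^sup>2 \<le> defect p x y"
proof -
  have "(p (x + y))\<^sup>2 \<le> (p x + p y)\<^sup>2"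
    using assms by (intro power_mono seminorm_on_triangle) (auto intro: seminorm_on_nonneg subspace_add)
  then show ?thesis by (simp add: defect_def power2_eq_square algebra_simps)
qed

lemma defect_nonneg:
  assumes "seminorm_on S p" "subspace S" "x \<in> S" "y \<in> S"
  shows "0 \<le> defect p x y"
  using defect_ge_square[OF assms] by (smt (verit) zero_le_power2)

text \<open>On the unit sphere the defect is \<open>4 - (N (u n + x))\<^sup>2\<close>.\<close>

lemma LUR_norm_on_if_rotund_on:
  assumes "rotund_on S N" shows "LUR_norm_on S N"
  unfolding LUR_norm_on_def
proof (intro ballI allI impI)
  fix x u assume x: "x \<in> S" "N x = 1" and u: "\<forall>n::nat. u n \<in> S \<and> N (u n) = 1"
    and lim: "(\<lambda>n. N (u n + x)) \<longlonglongrightarrow> 2"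
  have "(\<lambda>n. 4 - (N (u n + x))\<^sup>2) \<longlonglongrightarrow> 4 - 2\<^sup>2" by (intro tendsto_intros lim)
  then have "(\<lambda>n. defect N x (u n)) \<longlonglongrightarrow> 0"
    using x u by (simp add: defect_def add.commute)
  then show "(\<lambda>n. N (u n - x)) \<longlonglongrightarrow> 0"
    using assms x u unfolding rotund_on_def by blast
qed

text \<open>Defects add up in a square sum and none is negative; so a vanishing defect of the sum
  makes the defect of each term vanish.\<close>

lemma defect_sqrt_suminf:
  assumes S: "subspace S" and p: "\<And>m. seminorm_on S (p m)"
    and sm: "\<And>x. x \<in> S \<Longrightarrow> summable (\<lambda>m. (p m x)\<^sup>2)" and xy: "x \<in> S" "y \<in> S"
  shows "defect (p m) x y \<le> defect (\<lambda>x. sqrt (\<Sum>m::nat. (p m x)\<^sup>2)) x y"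
proof -
  have xy': "x + y \<in> S" using S xy by (rule subspace_add)
  have s: "(\<lambda>m. (p m z)\<^sup>2) sums (sqrt (\<Sum>m. (p m z)\<^sup>2))\<^sup>2" if "z \<in> S" for z
    using suminf_nonneg[OF sm[OF that]] summable_sums[OF sm[OF that]] by simp
  have *: "(\<lambda>m. defect (p m) x y) sums defect (\<lambda>x. sqrt (\<Sum>m. (p m x)\<^sup>2)) x y"
    unfolding defect_def by (intro sums_add sums_diff sums_mult s xy xy')
  have "sum (\<lambda>m. defect (p m) x y) {m} \<le> (\<Sum>m. defect (p m) x y)"
    by (rule sum_le_suminf) (use * defect_nonneg[OF p S xy] in \<open>auto simp: sums_iff\<close>)
  then show ?thesis using * by (simp add: sums_iff)
qed

text \<open>The extension is the infimal convolution of \<open>N\<close> and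
  \<open>C * norm\<close>. It agrees with \<open>N\<close> on \<open>S\<close> because
  \<open>C * norm\<close> dominates \<open>N\<close> there. Norming functionals and distances are
  formed on the whole space later, hence the extension.\<close>

lemma equivalent_norm_on_extend:
  fixes N :: "'a::real_normed_vector \<Rightarrow> real"
  assumes S: "subspace S" and N: "equivalent_norm_on S N"
  obtains N' where "equivalent_norm_on UNIV N'" "\<And>x. x \<in> S \<Longrightarrow> N' x = N x"
proof -
  obtain c C where c: "c > 0" "c \<le> C" "\<And>x. x \<in> S \<Longrightarrow> c * norm x \<le> N x" "\<And>x. x \<in> S \<Longrightarrow> N x \<le> C * norm x"
    and sN: "seminorm_on S N"
  proof -
    obtain c C where c: "c > 0" "C > 0" "\<And>x. x \<in> S \<Longrightarrow> c * norm x \<le> N x" "\<And>x. x \<in> S \<Longrightarrow> N x \<le> C * norm x"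
      and sN: "seminorm_on S N"
      using N unfolding equivalent_norm_on_def norm_on_iff_seminorm_on[OF S] by metis
    \<comment> \<open>\<open>C\<close> is enlarged to reach \<open>c \<le> C\<close>, on which the
      lower bound \<open>Fge\<close> rests.\<close>
    have "N x \<le> max c C * norm x" if "x \<in> S" for x
      using c(4)[OF that] mult_right_mono[of C "max c C" "norm x"] by simp
    then show thesis using c(1,3) sN by (intro that[of c "max c C"]) simp_all
  qed
  define F where "F x y = N y + C * norm (x - y)" for x y
  define N' where "N' x = (INF y\<in>S. F x y)" for x
  have ne: "S \<noteq> {}" using subspace_0[OF S] by blast
  have Fge: "c * norm x \<le> F x y" if "y \<in> S" for x y
  proof -
    have "c * norm x \<le> c * (norm y + norm (x - y))"
      using c(1) norm_triangle_sub[of x y] by simp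
    also have "\<dots> \<le> N y + C * norm (x - y)"
      using c(3)[OF that] mult_right_mono[OF c(2) norm_ge_zero[of "x - y"]] by (simp add: distrib_left)
    finally show ?thesis by (simp add: F_def)
  qed
  have bdd: "bdd_below (F x ` S)" for x
    using Fge by (intro bdd_belowI2)
  have le: "N' x \<le> F x y" if "y \<in> S" for x y
    unfolding N'_def by (rule cINF_lower[OF bdd that])
  have ge: "b \<le> N' x" if "\<And>y. y \<in> S \<Longrightarrow> b \<le> F x y" for b x
    unfolding N'_def using ne that by (rule cINF_greatest)
  have N0: "N 0 = 0" by (rule seminorm_on_zero[OF sN subspace_0[OF S]])
  have upper: "N' x \<le> C * norm x" for x
    using le[of 0 x] subspace_0[OF S] N0 by (simp add: F_def)
  have lower: "c * norm x \<le> N' x" for x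
    using Fge by (rule ge)
  have scale_le: "N' (a *\<^sub>R x) \<le> \<bar>a\<bar> * N' x" if "a \<noteq> 0" for a x
  proof -
    have "N' (a *\<^sub>R x) / \<bar>a\<bar> \<le> N' x"
    proof (rule ge)
      fix y assume y: "y \<in> S"
      have "N' (a *\<^sub>R x) \<le> F (a *\<^sub>R x) (a *\<^sub>R y)" using y S by (intro le subspace_scale)
      also have "\<dots> = \<bar>a\<bar> * F x y"
        using seminorm_on_scale[OF sN y] by (simp add: F_def distrib_left flip: scaleR_diff_right)
      finally show "N' (a *\<^sub>R x) / \<bar>a\<bar> \<le> F x y" using that by (simp add: field_simps)
    qed
    then show ?thesis using that by (simp add: field_simps)
  qed
  have scale: "N' (a *\<^sub>R x) = \<bar>a\<bar> * N' x" for a x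
  proof (cases "a = 0")
    case True
    then show ?thesis using upper[of 0] lower[of 0] by simp
  next
    case False
    have "N' ((1/a) *\<^sub>R (a *\<^sub>R x)) \<le> \<bar>1/a\<bar> * N' (a *\<^sub>R x)"
      by (rule scale_le) (use False in simp)
    then show ?thesis using False scale_le[OF False, of x] by (simp add: field_simps)
  qed
  have triangle: "N' (x + y) \<le> N' x + N' y" for x y
  proof -
    have "N' (x + y) - N' y \<le> N' x"
    proof (rule ge)
      fix u assume u: "u \<in> S"
      have "N' (x + y) - F x u \<le> N' y"
      proof (rule ge)
        fix v assume v: "v \<in> S"
        have "N' (x + y) \<le> F (x + y) (u + v)" using u v S by (intro le subspace_add)
        also have "\<dots> \<le> F x u + F y v"
        proof -
          have "norm (x + y - (u + v)) \<le> norm (x - u) + norm (y - v)"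
            by (metis add_diff_add norm_triangle_ineq)
          then have "C * norm (x + y - (u + v)) \<le> C * norm (x - u) + C * norm (y - v)"
            using c(1,2) by (metis distrib_left mult_left_mono order_trans less_imp_le)
          then show ?thesis using seminorm_on_triangle[OF sN u v] by (simp add: F_def)
        qed
        finally show "N' (x + y) - F x u \<le> F y v" by simp
      qed
      then show "N' (x + y) - N' y \<le> F x u" by simp
    qed
    then show ?thesis by simp
  qed
  have "seminorm_on UNIV N'"
    unfolding seminorm_on_def
    by (intro conjI ballI allI scale triangle) (rule order_trans[OF _ lower], use c(1) in simp)
  then have "equivalent_norm_on UNIV N'"
    by (rule equivalent_norm_onI[OF subspace_UNIV _ c(1), of _ C]) (use c lower upper in auto)
  moreover have "N' x = N x" if x: "x \<in> S" for x
  proof (rule antisym)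
    show "N' x \<le> N x" using le[OF x, of x] by (simp add: F_def)
    show "N x \<le> N' x"
    proof (rule ge)
      fix y assume y: "y \<in> S"
      have xy: "x - y \<in> S" using S x y by (rule subspace_diff)
      have "N x \<le> N y + N (x - y)" using seminorm_on_triangle[OF sN y xy] by simp
      then show "N x \<le> F x y" using c(4)[OF xy] by (simp add: F_def)
    qed
  qed
  ultimately show ?thesis by (rule that)
qed

subsection \<open>Dominated linear functionals\<close>

definition sublinear :: "('a::real_vector \<Rightarrow> real) \<Rightarrow> bool" where
  "sublinear q \<longleftrightarrow> (\<forall>x y. q (x + y) \<le> q x + q y) \<and> (\<forall>c\<ge>0. \<forall>x. q (c *\<^sub>R x) = c * q x)"

lemma sublinear_minus_ge: "sublinear q \<Longrightarrow> - q (- x) \<le> q x"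
  and sublinear_0: "sublinear q \<Longrightarrow> q 0 = 0"
proof -
  assume q: "sublinear q"
  have "q (0 *\<^sub>R 0) = 0 * q 0" using q unfolding sublinear_def by blast
  then show "q 0 = 0" by simp
  moreover have "q (x + - x) \<le> q x + q (- x)" using q unfolding sublinear_def by blast
  ultimately show "- q (- x) \<le> q x" by simp
qed

text \<open>The reduction step of the Hahn-Banach theorem: \<open>q\<close> is minimised along the
  ray of \<open>z\<close> after subtracting its growth. The choice \<open>t = 0\<close> gives the
  second property, \<open>t = 1\<close> at \<open>- z\<close> the third.\<close>

lemma sublinear_shift:
  assumes q: "sublinear q"
  obtains q' where "sublinear q'" "\<And>x. q' x \<le> q x" "q' (- z) \<le> - q z"
proof -
  define F where "F x t = q (x + t *\<^sub>R z) - t * q z" for x t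
  define q' where "q' x = (INF t\<in>{0..}. F x t)" for x
  have add: "q (x + y) \<le> q x + q y" and scale: "c \<ge> 0 \<Longrightarrow> q (c *\<^sub>R x) = c * q x" for x y c
    using q by (auto simp: sublinear_def)
  have "- q (- x) \<le> F x t" if "t \<ge> 0" for x t
    using add[of "x + t *\<^sub>R z" "- x"] scale[OF that, of z] by (simp add: F_def)
  then have bdd: "bdd_below (F x ` {0..})" for x
    by (intro bdd_belowI2) auto
  have le: "q' x \<le> F x t" if "t \<ge> 0" for x t
    unfolding q'_def by (rule cINF_lower[OF bdd]) (use that in simp)
  have ge: "b \<le> q' x" if "\<And>t. t \<ge> 0 \<Longrightarrow> b \<le> F x t" for b x
    unfolding q'_def by (rule cINF_greatest) (use that in auto)
  have q'0: "q' 0 = 0"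
    using le[of 0 0] ge[of 0 0] scale sublinear_0[OF q] by (fastforce simp: F_def)
  have scale_le: "q' (c *\<^sub>R x) \<le> c * q' x" if "c > 0" for c x
  proof -
    have "q' (c *\<^sub>R x) / c \<le> q' x"
    proof (rule ge)
      fix t :: real assume t: "t \<ge> 0"
      have "q' (c *\<^sub>R x) \<le> F (c *\<^sub>R x) (c * t)" using t that by (intro le) simp
      also have "\<dots> = c * F x t"
        using scale[of c "x + t *\<^sub>R z"] that by (simp add: F_def algebra_simps)
      finally show "q' (c *\<^sub>R x) / c \<le> F x t" using that by (simp add: field_simps)
    qed
    then show ?thesis using that by (simp add: field_simps)
  qed
  have "q' (c *\<^sub>R x) = c * q' x" if "c \<ge> 0" for c x
  proof (cases "c = 0")
    case False
    then have "c > 0" using that by simp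
    then show ?thesis
      using scale_le[of c x] scale_le[of "1/c" "c *\<^sub>R x"] by (simp add: field_simps)
  qed (use q'0 in simp)
  moreover have "q' (x + y) \<le> q' x + q' y" for x y
  proof -
    have "q' (x + y) - q' y \<le> F x s" if s: "s \<ge> 0" for s
    proof -
      have "q' (x + y) - F x s \<le> F y t" if t: "t \<ge> 0" for t
      proof -
        have "q' (x + y) \<le> F (x + y) (s + t)" using s t by (intro le) simp
        also have "\<dots> \<le> F x s + F y t"
          using add[of "x + s *\<^sub>R z" "y + t *\<^sub>R z"] by (simp add: F_def algebra_simps)
        finally show ?thesis by simp
      qed
      then have "q' (x + y) - F x s \<le> q' y" by (rule ge)
      then show ?thesis by simp
    qed
    then have "q' (x + y) - q' y \<le> q' x" by (rule ge)
    then show ?thesis by simp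
  qed
  ultimately have "sublinear q'" by (simp add: sublinear_def)
  then show ?thesis
    using le[of 0] le[of 1 "- z"] sublinear_0[OF q] by (intro that) (auto simp: F_def)
qed

text \<open>A minimal sublinear functional is odd, as otherwise \<open>sublinear_shift\<close> would produce a
  smaller one; hence it is linear.\<close>

lemma linear_below_sublinear:
  assumes p: "sublinear p"
  obtains f where "linear f" "\<And>x. f x \<le> p x"
proof -
  define Q where "Q = {q. sublinear q \<and> (\<forall>x. q x \<le> p x)}"
  \<comment> \<open>Pointwise order reversed: a maximal element for Zorn's lemma is a minimal
    functional, and a chain is bounded by its pointwise infimum, which exists since
    \<open>- p (- x)\<close> lies below all members.\<close>
  define R :: "('a \<Rightarrow> real) \<Rightarrow> ('a \<Rightarrow> real) \<Rightarrow> bool"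
    where "R = (\<lambda>q q'. \<forall>x. q' x \<le> q x)"
  have "partial_order_on Q (relation_of R Q)"
    by (rule partial_order_on_relation_ofI) (auto simp: R_def fun_eq_iff intro: order_trans antisym)
  moreover have "\<exists>u\<in>Q. \<forall>a\<in>C. R a u" if C: "C \<in> Chains (relation_of R Q)" for C
  proof (cases "C = {}")
    case True
    then show ?thesis using p by (auto simp: Q_def)
  next
    case ne: False
    have CQ: "q \<in> Q" if "q \<in> C" for q using C that by (auto simp: Chains_def relation_of_def)
    have tot: "R q q' \<or> R q' q" if "q \<in> C" "q' \<in> C" for q q'
      using C that by (auto simp: Chains_def relation_of_def)
    define u where "u x = (INF q\<in>C. q x)" for x
    have lb: "- p (- x) \<le> q x" if "q \<in> C" for q x
      using CQ[OF that] sublinear_minus_ge[of q x] unfolding Q_def by (smt (verit) mem_Collect_eq)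
    have bdd: "bdd_below ((\<lambda>q. q x) ` C)" for x
      using lb by (intro bdd_belowI2)
    have le: "u x \<le> q x" if "q \<in> C" for x q
      unfolding u_def by (rule cINF_lower[OF bdd that])
    have ge: "b \<le> u x" if "\<And>q. q \<in> C \<Longrightarrow> b \<le> q x" for b x
      unfolding u_def using ne that by (rule cINF_greatest)
    have "u (x + y) \<le> u x + u y" for x y
    proof -
      have "u (x + y) - u y \<le> q x" if q: "q \<in> C" for q
      proof -
        have "u (x + y) - q x \<le> q' y" if q': "q' \<in> C" for q'
        proof -
          \<comment> \<open>In a chain the smaller of \<open>q\<close> and \<open>q'\<close> lies
            below both, so a single sublinear \<open>r\<close> handles both summands.\<close>
          obtain r where r: "r \<in> C" "r x \<le> q x" "r y \<le> q' y"
            using tot[OF q q'] q q' unfolding R_def by blast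
          have "u (x + y) \<le> r x + r y"
            using le[OF r(1), of "x + y"] CQ[OF r(1)] unfolding Q_def sublinear_def by (smt (verit) mem_Collect_eq)
          then show ?thesis using r by simp
        qed
        then have "u (x + y) - q x \<le> u y" by (rule ge)
        then show ?thesis by simp
      qed
      then have "u (x + y) - u y \<le> u x" by (rule ge)
      then show ?thesis by simp
    qed
    moreover have "u (c *\<^sub>R x) = c * u x" if c: "c \<ge> 0" for c x
    proof -
      have sc: "q (c *\<^sub>R x) = c * q x" if "q \<in> C" for q x
        using CQ[OF that] c unfolding Q_def sublinear_def by blast
      show ?thesis
      proof (cases "c = 0")
        case True
        have q0: "q 0 = 0" if "q \<in> C" for q
          using CQ[OF that] sublinear_0 unfolding Q_def by blast
        then have "u 0 = 0"
          using ne le[of _ 0] ge[of 0 0] by (metis antisym ex_in_conv order_refl)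
        then show ?thesis using True by simp
      next
        case False
        then have c: "c > 0" using c by simp
        have "c * u x \<le> u (c *\<^sub>R x)"
          using c le by (intro ge) (simp add: sc mult_left_mono)
        moreover have "u (c *\<^sub>R x) / c \<le> u x"
          using c le[of _ "c *\<^sub>R x"] by (intro ge) (simp add: sc field_simps)
        ultimately show ?thesis using c by (simp add: field_simps)
      qed
    qed
    moreover have "u x \<le> p x" for x
    proof -
      obtain q where "q \<in> C" using ne by blast
      then show ?thesis using le[of q x] CQ[of q] by (auto simp: Q_def intro: order_trans)
    qed
    ultimately have "u \<in> Q" by (simp add: Q_def sublinear_def)
    then show ?thesis using le by (auto simp: R_def)
  qed
  ultimately have "\<exists>m\<in>Q. \<forall>a\<in>Q. R m a \<longrightarrow> a = m"
    by (rule predicate_Zorn)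
  then obtain m where m: "m \<in> Q" and min: "\<And>a. a \<in> Q \<Longrightarrow> (\<And>x. a x \<le> m x) \<Longrightarrow> a = m"
    unfolding R_def by blast
  have sub: "sublinear m" using m by (simp add: Q_def)
  have odd: "m (- z) = - m z" for z
  proof -
    obtain q where q: "sublinear q" "\<And>x. q x \<le> m x" "q (- z) \<le> - m z"
      using sublinear_shift[OF sub] by blast
    then have "q \<in> Q" using m by (auto simp: Q_def intro: order_trans)
    then have "q = m" using min q(2) by blast
    then show ?thesis using q(3) sublinear_minus_ge[OF sub, of "z"] by simp
  qed
  have "linear m"
  proof (rule linearI)
    fix x y
    have "m (- x + - y) \<le> m (- x) + m (- y)" "m (x + y) \<le> m x + m y"
      using sub unfolding sublinear_def by blast+
    then show "m (x + y) = m x + m y" using odd[of "x + y"] by (simp add: odd)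
  next
    fix c x
    show "m (c *\<^sub>R x) = c *\<^sub>R m x"
    proof (cases "c \<ge> 0")
      case True then show ?thesis using sub by (simp add: sublinear_def)
    next
      case False
      then have "0 \<le> - c" by simp
      then have "m ((- c) *\<^sub>R (- x)) = (- c) * m (- x)" using sub unfolding sublinear_def by blast
      then show ?thesis by (simp add: odd)
    qed
  qed
  then show ?thesis using m by (intro that) (auto simp: Q_def)
qed

text \<open>One shift at \<open>z\<close> precedes the passage to a linear functional: whatever is
  linear and below \<open>q\<close> has \<open>f (- z) \<le> - p z\<close>, which makes it norming
  at \<open>z\<close>.\<close>

lemma norming_functional:
  assumes p: "seminorm_on UNIV p"
  obtains f where "linear f" "\<And>x. \<bar>f x\<bar> \<le> p x" "f z = p z"
proof -
  have "sublinear p" using p by (simp add: sublinear_def seminorm_on_def)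
  then obtain q where q: "sublinear q" "\<And>x. q x \<le> p x" "q (- z) \<le> - p z"
    using sublinear_shift[of p z] by blast
  obtain f where f: "linear f" "\<And>x. f x \<le> q x"
    using linear_below_sublinear[OF q(1)] by blast
  have fp: "f x \<le> p x" for x using f(2)[of x] q(2)[of x] by linarith
  moreover have "\<bar>f x\<bar> \<le> p x" for x
    using fp[of x] fp[of "- x"] linear_neg[OF f(1), of x] seminorm_on_uminus[OF p, of x] by simp
  moreover have "f z \<ge> p z"
    using f(2)[of "- z"] q(3) linear_neg[OF f(1), of z] by simp
  ultimately show ?thesis using f(1) by (intro that[of f]) (auto intro: antisym)
qed

section \<open>Defects of suprema and distances to subspaces\<close>

text \<open>The index is one that nearly attains the supremum at \<open>x + y\<close>; both
  estimates then follow from \<open>p i \<le> G\<close> at \<open>x\<close> and \<open>y\<close>. If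
  the defect of \<open>G\<close> is small, this \<open>p i\<close> has small defect and is nearly
  maximal at \<open>x\<close>.\<close>

lemma defect_SUP:
  assumes S: "subspace S" and I: "I \<noteq> {}" and p: "\<And>i. i \<in> I \<Longrightarrow> seminorm_on S (p i)"
    and bdd: "\<And>x. x \<in> S \<Longrightarrow> bdd_above ((\<lambda>i. p i x) ` I)"
    and xy: "x \<in> S" "y \<in> S" and "0 < \<eta>"
    and G: "\<And>x. G x = (SUP i\<in>I. p i x)"
  obtains i where "i \<in> I" "defect (p i) x y \<le> defect G x y + \<eta>"
    "2 * ((G x)\<^sup>2 - (p i x)\<^sup>2) \<le> defect G x y + \<eta>"
proof -
  have xy': "x + y \<in> S" using S xy by (rule subspace_add)
  have nn: "0 \<le> p i z" if "i \<in> I" "z \<in> S" for i z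
    using p that by (metis seminorm_on_nonneg)
  have le: "p i z \<le> G z" if "i \<in> I" "z \<in> S" for i z
    unfolding G using that bdd by (meson cSUP_upper)
  have sq: "(p i z)\<^sup>2 \<le> (G z)\<^sup>2" if "i \<in> I" "z \<in> S" for i z
    using le nn that by (meson power_mono)
  obtain i where i: "i \<in> I" "(G (x + y))\<^sup>2 - \<eta> \<le> (p i (x + y))\<^sup>2"
  \<comment> \<open>If the square is at most \<open>\<eta>\<close>, any index will do; otherwise
    \<open>?r\<close> is the root of a positive number.\<close>
  proof (cases "(G (x + y))\<^sup>2 \<le> \<eta>")
    case True
    then show ?thesis using that I zero_le_power2 by (metis diff_le_0_iff_le ex_in_conv order_trans)
  next
    case False
    let ?r = "sqrt ((G (x + y))\<^sup>2 - \<eta>)"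
    obtain j where "j \<in> I" using I by blast
    then have "0 \<le> G (x + y)" using le nn xy' by (meson order_trans)
    then have "?r < G (x + y)"
      using \<open>0 < \<eta>\<close> by (intro real_less_lsqrt) auto
    then obtain i where i: "i \<in> I" "?r < p i (x + y)"
      unfolding G using less_cSUP_iff[OF I bdd[OF xy']] by blast
    then have "?r\<^sup>2 \<le> (p i (x + y))\<^sup>2"
      using False by (intro power_mono) auto
    then show ?thesis using that[OF i(1)] False by simp
  qed
  have "(p i x - p i y)\<^sup>2 \<le> defect (p i) x y" by (rule defect_ge_square[OF p[OF i(1)] S xy])
  then have d: "0 \<le> defect (p i) x y" by (smt (verit) zero_le_power2)
  show ?thesis
  proof (rule that[OF i(1)])
    show "defect (p i) x y \<le> defect G x y + \<eta>"
      using i(2) sq[OF i(1) xy(1)] sq[OF i(1) xy(2)] by (simp add: defect_def)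
    show "2 * ((G x)\<^sup>2 - (p i x)\<^sup>2) \<le> defect G x y + \<eta>"
      using d i(2) sq[OF i(1) xy(2)] by (simp add: defect_def)
  qed
qed

lemma le_infdist:
  assumes "V \<noteq> {}" "\<And>y. y \<in> V \<Longrightarrow> b \<le> dist x y"
  shows "b \<le> infdist x V"
  unfolding infdist_notempty[OF assms(1)] using assms by (rule cINF_greatest)

lemma seminorm_on_infdist:
  fixes V :: "'a::real_normed_vector set"
  assumes V: "subspace V"
  shows "seminorm_on UNIV (\<lambda>x. infdist x V)"
proof -
  have ne: "V \<noteq> {}" using subspace_0[OF V] by blast
  have scale_le: "infdist (c *\<^sub>R x) V \<le> \<bar>c\<bar> * infdist x V" if "c \<noteq> 0" for c x
  proof -
    have "infdist (c *\<^sub>R x) V / \<bar>c\<bar> \<le> infdist x V"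
    proof (rule le_infdist[OF ne])
      fix y assume "y \<in> V"
      then have "infdist (c *\<^sub>R x) V \<le> dist (c *\<^sub>R x) (c *\<^sub>R y)"
        using V by (intro infdist_le subspace_scale)
      also have "\<dots> = \<bar>c\<bar> * dist x y" by (simp add: dist_norm flip: scaleR_diff_right)
      finally show "infdist (c *\<^sub>R x) V / \<bar>c\<bar> \<le> dist x y" using that by (simp add: field_simps)
    qed
    then show ?thesis using that by (simp add: field_simps)
  qed
  have "infdist (c *\<^sub>R x) V = \<bar>c\<bar> * infdist x V" for c x
  proof (cases "c = 0")
    case True
    then show ?thesis using subspace_0[OF V] by simp
  next
    case False
    then show ?thesis
      using scale_le[OF False, of x] scale_le[of "1/c" "c *\<^sub>R x"] by (simp add: field_simps)
  qed
  moreover have "infdist (x + y) V \<le> infdist x V + infdist y V" for x y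
  proof -
    have "infdist (x + y) V - infdist y V \<le> dist x u" if u: "u \<in> V" for u
    proof -
      have "infdist (x + y) V - dist x u \<le> dist y v" if v: "v \<in> V" for v
      proof -
        have "infdist (x + y) V \<le> dist (x + y) (u + v)" using u v V by (intro infdist_le subspace_add)
        also have "\<dots> \<le> dist x u + dist y v" by (rule dist_triangle_add)
        finally show ?thesis by simp
      qed
      then have "infdist (x + y) V - dist x u \<le> infdist y V" by (rule le_infdist[OF ne])
      then show ?thesis by simp
    qed
    then have "infdist (x + y) V - infdist y V \<le> infdist x V" by (rule le_infdist[OF ne])
    then show ?thesis by simp
  qed
  ultimately show ?thesis by (simp add: seminorm_on_def infdist_nonneg)
qed

lemma seminorm_on_abs_blinfun: "seminorm_on S (\<lambda>x. \<bar>blinfun_apply (f :: 'a::real_normed_vector \<Rightarrow>\<^sub>L real) x\<bar>)"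
  by (auto simp: seminorm_on_def blinfun.bilinear_simps abs_mult abs_triangle_ineq)

section \<open>Biorthogonal systems: coordinates and finite supports\<close>

locale normalized_biorthogonal =
  fixes \<Gamma> :: "'i set" and e :: "'i \<Rightarrow> 'a::real_normed_vector" and \<phi> :: "'i \<Rightarrow> 'a \<Rightarrow>\<^sub>L real"
  assumes biorth: "biorthogonal_system \<Gamma> e \<phi>"
    and norm_le_1: "\<And>\<alpha>. \<alpha> \<in> \<Gamma> \<Longrightarrow> norm (\<phi> \<alpha>) \<le> 1"
begin

definition Y :: "'a set" where "Y = span (e ` \<Gamma>)"

definition supp :: "'a \<Rightarrow> 'i set" where "supp x = {\<alpha>\<in>\<Gamma>. \<phi> \<alpha> x \<noteq> 0}"

lemma subspace_Y: "subspace Y"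
  by (simp add: Y_def)

lemma \<phi>_e: "\<alpha> \<in> \<Gamma> \<Longrightarrow> \<beta> \<in> \<Gamma> \<Longrightarrow> \<phi> \<alpha> (e \<beta>) = (if \<alpha> = \<beta> then 1 else 0)"
  using biorth unfolding biorthogonal_system_def by blast

text \<open>This is the purpose of the normalisation: all coordinates are Lipschitz with the same
  constant 1.\<close>

lemma abs_\<phi>_le: "\<alpha> \<in> \<Gamma> \<Longrightarrow> \<bar>\<phi> \<alpha> x\<bar> \<le> norm x"
  using norm_blinfun[of "\<phi> \<alpha>" x] norm_le_1[of \<alpha>] mult_right_mono[of "norm (\<phi> \<alpha>)" 1 "norm x"] by simp

lemma span_subset_Y: "A \<subseteq> \<Gamma> \<Longrightarrow> span (e ` A) \<subseteq> Y"
  unfolding Y_def by (intro span_mono image_mono)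

lemma span_expansion:
  assumes A: "finite A" "A \<subseteq> \<Gamma>" and x: "x \<in> span (e ` A)"
  shows "x = (\<Sum>\<alpha>\<in>A. \<phi> \<alpha> x *\<^sub>R e \<alpha>)"
proof -
  let ?L = "\<lambda>x. \<Sum>\<alpha>\<in>A. \<phi> \<alpha> x *\<^sub>R e \<alpha>"
  have "subspace {x. x = ?L x}"
    by (auto simp: subspace_def blinfun.bilinear_simps scaleR_left_distrib sum.distrib
        simp flip: scaleR_scaleR scaleR_sum_right)
  moreover have "?L (e \<beta>) = e \<beta>" if "\<beta> \<in> A" for \<beta>
  proof -
    have "?L (e \<beta>) = (\<Sum>\<alpha>\<in>A. if \<alpha> = \<beta> then e \<beta> else 0)"
      using A that by (intro sum.cong) (auto simp: \<phi>_e subset_iff)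
    then show ?thesis using A that by simp
  qed
  then have "e ` A \<subseteq> {x. x = ?L x}" by auto
  ultimately have "span (e ` A) \<subseteq> {x. x = ?L x}" by (intro span_minimal)
  then show ?thesis using x by blast
qed

lemma \<phi>_eq_0:
  assumes A: "A \<subseteq> \<Gamma>" and x: "x \<in> span (e ` A)" and \<alpha>: "\<alpha> \<in> \<Gamma> - A"
  shows "\<phi> \<alpha> x = 0"
proof -
  have "subspace {x. \<phi> \<alpha> x = 0}" by (auto simp: subspace_def blinfun.bilinear_simps)
  moreover have "e ` A \<subseteq> {x. \<phi> \<alpha> x = 0}" using A \<alpha> by (auto simp: \<phi>_e subset_iff)
  ultimately have "span (e ` A) \<subseteq> {x. \<phi> \<alpha> x = 0}" by (intro span_minimal)
  then show ?thesis using x by blast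
qed

lemma supp_subset: "A \<subseteq> \<Gamma> \<Longrightarrow> x \<in> span (e ` A) \<Longrightarrow> supp x \<subseteq> A"
  using \<phi>_eq_0 unfolding supp_def by blast

lemma supp_subset_\<Gamma>: "supp x \<subseteq> \<Gamma>"
  by (auto simp: supp_def)

lemma finite_span:
  assumes "x \<in> Y"
  obtains A where "finite A" "A \<subseteq> \<Gamma>" "x \<in> span (e ` A)"
proof -
  obtain t where t: "finite t" "t \<subseteq> e ` \<Gamma>" "x \<in> span t"
    using assms unfolding Y_def span_explicit by (auto intro: span_sum span_scale span_base)
  then show ?thesis using that by (metis finite_subset_image)
qed

lemma finite_supp: "x \<in> Y \<Longrightarrow> finite (supp x)"
  by (meson finite_span finite_subset supp_subset)

lemma in_span_supp:
  assumes "x \<in> Y" shows "x \<in> span (e ` supp x)"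
proof -
  obtain A where A: "finite A" "A \<subseteq> \<Gamma>" "x \<in> span (e ` A)" by (rule finite_span[OF assms])
  have "x = (\<Sum>\<alpha>\<in>A. \<phi> \<alpha> x *\<^sub>R e \<alpha>)" by (rule span_expansion[OF A])
  also have "\<dots> = (\<Sum>\<alpha>\<in>supp x. \<phi> \<alpha> x *\<^sub>R e \<alpha>)"
    using A(1,2) supp_subset[OF A(2,3)] by (intro sum.mono_neutral_right) (auto simp: supp_def)
  finally show ?thesis
    by (metis (no_types, lifting) imageI span_base span_scale span_sum)
qed

lemma supp_nonempty: "x \<in> Y \<Longrightarrow> x \<noteq> 0 \<Longrightarrow> supp x \<noteq> {}"
  using in_span_supp by fastforce

subsection \<open>Rotund renormings\<close>

text \<open>The coordinates in \<open>A\<close> and the distance to their span together control the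
  distance to a point of that span, see \<open>norm_diff_le_infdist\<close>. The weight
  \<open>k\<close> decides between the two: if it is large, missing a nonzero coordinate costs more
  than the distance can gain.\<close>

definition H :: "'i set \<Rightarrow> nat \<Rightarrow> 'a \<Rightarrow> real" where
  "H A k x = sqrt (real k * (\<Sum>\<alpha>\<in>A. (\<phi> \<alpha> x)\<^sup>2) + (infdist x (span (e ` A)))\<^sup>2)"

text \<open>At most \<open>n\<close> elements rather than exactly \<open>n\<close>, so that the
  empty set always belongs to it and no supremum is taken over nothing.\<close>

definition subs :: "nat \<Rightarrow> 'i set set" where
  "subs n = {A. A \<subseteq> \<Gamma> \<and> finite A \<and> card A \<le> n}"

definition G :: "nat \<Rightarrow> nat \<Rightarrow> 'a \<Rightarrow> real" where
  "G n k x = (SUP A\<in>subs n. H A k x)"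

lemma H_sq: "(H A k x)\<^sup>2 = real k * (\<Sum>\<alpha>\<in>A. (\<phi> \<alpha> x)\<^sup>2) + (infdist x (span (e ` A)))\<^sup>2"
  unfolding H_def by (rule real_sqrt_pow2) (simp add: sum_nonneg)

lemma seminorm_on_H:
  assumes "finite A"
  shows "seminorm_on UNIV (H A k)"
proof -
  define p where "p i x = (case i of None \<Rightarrow> infdist x (span (e ` A)) | Some \<alpha> \<Rightarrow> sqrt k * \<bar>\<phi> \<alpha> x\<bar>)" for i x
  have "seminorm_on UNIV (p i)" for i
  proof (cases i)
    case None
    then show ?thesis using seminorm_on_infdist[OF subspace_span] by (simp add: p_def[abs_def])
  next
    case (Some \<alpha>)
    then show ?thesis
      using seminorm_on_abs_blinfun[of UNIV "\<phi> \<alpha>"] unfolding seminorm_on_def p_def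
      by (simp flip: distrib_left) (simp add: mult_left_mono)
  qed
  then have "seminorm_on UNIV (\<lambda>x. L2_set (\<lambda>i. p i x) (insert None (Some ` A)))"
    by (intro seminorm_on_L2_set) auto
  moreover have "L2_set (\<lambda>i. p i x) (insert None (Some ` A)) = H A k x" for x
  proof -
    have "(\<Sum>i\<in>insert None (Some ` A). (p i x)\<^sup>2) = (infdist x (span (e ` A)))\<^sup>2 + (\<Sum>\<alpha>\<in>A. (p (Some \<alpha>) x)\<^sup>2)"
      using assms by (subst sum.insert) (auto simp: p_def sum.reindex)
    also have "\<dots> = (infdist x (span (e ` A)))\<^sup>2 + real k * (\<Sum>\<alpha>\<in>A. (\<phi> \<alpha> x)\<^sup>2)"
      by (simp add: p_def power_mult_distrib sum_distrib_left)
    finally show ?thesis by (simp add: L2_set_def H_def add.commute)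
  qed
  ultimately show ?thesis by simp
qed

lemma infdist_span_le: "infdist x (span B) \<le> norm x"
  using infdist_le[OF span_zero, of x B] by simp

lemma H_le:
  assumes "A \<in> subs n"
  shows "(H A k x)\<^sup>2 \<le> (real k * n + 1) * (norm x)\<^sup>2" "H A k x \<le> sqrt (real k * n + 1) * norm x"
proof -
  have "(\<Sum>\<alpha>\<in>A. (\<phi> \<alpha> x)\<^sup>2) \<le> (\<Sum>\<alpha>\<in>A. (norm x)\<^sup>2)"
    using assms abs_\<phi>_le by (intro sum_mono) (auto simp: subs_def abs_le_square_iff[symmetric] subset_iff)
  also have "\<dots> \<le> real n * (norm x)\<^sup>2"
    using assms by (auto simp: subs_def intro: mult_right_mono)
  finally have "real k * (\<Sum>\<alpha>\<in>A. (\<phi> \<alpha> x)\<^sup>2) \<le> real k * (real n * (norm x)\<^sup>2)"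
    by (rule mult_left_mono) simp
  moreover have "(infdist x (span (e ` A)))\<^sup>2 \<le> (norm x)\<^sup>2"
    by (intro power_mono infdist_span_le infdist_nonneg)
  ultimately show *: "(H A k x)\<^sup>2 \<le> (real k * n + 1) * (norm x)\<^sup>2"
    unfolding H_sq by (simp add: algebra_simps)
  then have "H A k x \<le> sqrt ((real k * n + 1) * (norm x)\<^sup>2)" by (rule real_le_rsqrt)
  then show "H A k x \<le> sqrt (real k * n + 1) * norm x" by (simp add: real_sqrt_mult)
qed

lemma subs_nonempty: "subs n \<noteq> {}"
  unfolding subs_def by force

lemma bdd_above_H: "bdd_above ((\<lambda>A. H A k x) ` subs n)"
  using H_le(2) by (intro bdd_aboveI2)

lemma seminorm_on_G: "seminorm_on UNIV (G n k)"
  unfolding G_def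
  by (intro seminorm_on_SUP subs_nonempty bdd_above_H seminorm_on_H) (auto simp: subs_def)

lemma G_le: "G n k x \<le> sqrt (real k * n + 1) * norm x"
  unfolding G_def using subs_nonempty H_le(2) by (rule cSUP_least)

lemma le_G: "A \<in> subs n \<Longrightarrow> H A k x \<le> G n k x"
  unfolding G_def by (rule cSUP_upper[OF _ bdd_above_H])

text \<open>For large \<open>k\<close> the supremum defining \<open>G (card S) k x\<close> is attained only at \<open>A = S = supp x\<close>, with
  a gap, so that rotundity of \<open>G\<close> at \<open>x\<close> is inherited by \<open>H S k\<close>.\<close>

lemma defect_G_eventually:
  assumes x: "x \<in> Y" and k: "\<And>\<alpha>. \<alpha> \<in> supp x \<Longrightarrow> (norm x)\<^sup>2 + 1 < real k * (\<phi> \<alpha> x)\<^sup>2"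
    and lim: "(\<lambda>j::nat. defect (G (card (supp x)) k) x (u j)) \<longlonglongrightarrow> 0"
  shows "(\<lambda>j. defect (H (supp x) k) x (u j)) \<longlonglongrightarrow> 0"
proof -
  let ?S = "supp x" and ?n = "card (supp x)"
  have S: "?S \<in> subs ?n" using x by (simp add: subs_def finite_supp supp_subset_\<Gamma>)
  have HS: "(H ?S k x)\<^sup>2 = real k * (\<Sum>\<alpha>\<in>?S. (\<phi> \<alpha> x)\<^sup>2)"
    using in_span_supp[OF x] by (simp add: H_sq)
  \<comment> \<open>A competitor with at most \<open>card ?S\<close> elements misses some
    \<open>\<beta>\<close> of the support. It loses \<open>k\<close> times the square of that
    coordinate, more than \<open>norm x\<close> squared plus 1, while its distance term gains at
    most \<open>norm x\<close> squared.\<close>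
  have gap: "(H A k x)\<^sup>2 + 1 \<le> (G ?n k x)\<^sup>2" if A: "A \<in> subs ?n" "A \<noteq> ?S" for A
  proof -
    obtain \<beta> where \<beta>: "\<beta> \<in> ?S" "\<beta> \<notin> A"
      using A S card_seteq[of A ?S] by (auto simp: subs_def)
    have "(\<Sum>\<alpha>\<in>A. (\<phi> \<alpha> x)\<^sup>2) = (\<Sum>\<alpha>\<in>A \<inter> ?S. (\<phi> \<alpha> x)\<^sup>2)"
      using A(1) by (intro sum.mono_neutral_right) (auto simp: subs_def supp_def)
    also have "\<dots> \<le> (\<Sum>\<alpha>\<in>?S - {\<beta>}. (\<phi> \<alpha> x)\<^sup>2)"
      using \<beta> S by (intro sum_mono2) (auto simp: subs_def)
    also have "\<dots> = (\<Sum>\<alpha>\<in>?S. (\<phi> \<alpha> x)\<^sup>2) - (\<phi> \<beta> x)\<^sup>2"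
      using \<beta> S by (simp add: sum_diff1 subs_def)
    finally have "real k * (\<Sum>\<alpha>\<in>A. (\<phi> \<alpha> x)\<^sup>2) \<le> real k * ((\<Sum>\<alpha>\<in>?S. (\<phi> \<alpha> x)\<^sup>2) - (\<phi> \<beta> x)\<^sup>2)"
      by (rule mult_left_mono) simp
    moreover have "(infdist x (span (e ` A)))\<^sup>2 \<le> (norm x)\<^sup>2"
      by (intro power_mono infdist_span_le infdist_nonneg)
    ultimately have "(H A k x)\<^sup>2 + 1 \<le> (H ?S k x)\<^sup>2"
      unfolding HS using k[OF \<beta>(1)] by (simp add: H_sq algebra_simps)
    also have "\<dots> \<le> (G ?n k x)\<^sup>2"
      using le_G[OF S] by (intro power_mono) (auto simp: H_def sum_nonneg)
    finally show ?thesis .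
  qed
  \<comment> \<open>The bound 2 is twice the gap: it excludes every index but the support, as
    \<open>defect_SUP\<close> bounds twice the loss at \<open>x\<close>.\<close>
  have pick: "defect (H ?S k) x (u j) \<le> defect (G ?n k) x (u j) + \<eta>"
    if \<eta>: "0 < \<eta>" "defect (G ?n k) x (u j) + \<eta> < 2" for \<eta> j
  proof -
    obtain A where A: "A \<in> subs ?n" "defect (H A k) x (u j) \<le> defect (G ?n k) x (u j) + \<eta>"
      "2 * ((G ?n k x)\<^sup>2 - (H A k x)\<^sup>2) \<le> defect (G ?n k) x (u j) + \<eta>"
    proof (rule defect_SUP[where p="\<lambda>A. H A k" and I="subs ?n" and G="G ?n k" and x=x and y="u j",
          OF subspace_UNIV subs_nonempty _ bdd_above_H UNIV_I UNIV_I \<eta>(1) G_def])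
      show "seminorm_on UNIV (H A k)" if "A \<in> subs ?n" for A
        using that by (intro seminorm_on_H) (simp add: subs_def)
    qed
    have "A = ?S"
    proof (rule ccontr)
      assume "A \<noteq> ?S"
      then have "1 \<le> (G ?n k x)\<^sup>2 - (H A k x)\<^sup>2" using gap[OF A(1)] by (simp add: algebra_simps)
      moreover have "(G ?n k x)\<^sup>2 - (H A k x)\<^sup>2 < 1" using A(3) \<eta>(2) by (simp add: algebra_simps)
      ultimately show False by simp
    qed
    then show ?thesis using A(2) by simp
  qed
  have ev: "\<forall>\<^sub>F j in sequentially. norm (defect (H ?S k) x (u j)) \<le> defect (G ?n k) x (u j)"
  proof -
    have "\<forall>\<^sub>F j in sequentially. defect (G ?n k) x (u j) < 1" using lim by (rule order_tendstoD) simp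
    then show ?thesis
    proof eventually_elim
      case (elim j)
      have "defect (H ?S k) x (u j) \<le> defect (G ?n k) x (u j)"
      \<comment> \<open>The error of \<open>defect_SUP\<close> is sent to 0; capping it at 1 keeps
        \<open>pick\<close> applicable.\<close>
      proof (rule field_le_epsilon)
        fix \<eta> :: real assume "0 < \<eta>"
        have "defect (H ?S k) x (u j) \<le> defect (G ?n k) x (u j) + min \<eta> 1"
          using \<open>0 < \<eta>\<close> elim by (intro pick) auto
        then show "defect (H ?S k) x (u j) \<le> defect (G ?n k) x (u j) + \<eta>" by simp
      qed
      moreover have "0 \<le> defect (H ?S k) x (u j)"
        by (rule defect_nonneg[OF seminorm_on_H[OF finite_supp[OF x]] subspace_UNIV]) auto
      ultimately show ?case by simp
    qed
  qed
  show ?thesis by (rule Lim_null_comparison[OF ev lim])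
qed

text \<open>By the parallelogram identity a linear coordinate contributes exactly the square of its
  difference, so coordinates converge with the defect.\<close>

lemma defect_H:
  "defect (H A k) x y = real k * (\<Sum>\<alpha>\<in>A. (\<phi> \<alpha> x - \<phi> \<alpha> y)\<^sup>2) + defect (\<lambda>x. infdist x (span (e ` A))) x y"
proof -
  have "(\<Sum>\<alpha>\<in>A. (\<phi> \<alpha> x - \<phi> \<alpha> y)\<^sup>2) =
      2 * (\<Sum>\<alpha>\<in>A. (\<phi> \<alpha> x)\<^sup>2) + 2 * (\<Sum>\<alpha>\<in>A. (\<phi> \<alpha> y)\<^sup>2) - (\<Sum>\<alpha>\<in>A. (\<phi> \<alpha> (x + y))\<^sup>2)"
    by (simp add: blinfun.bilinear_simps sum_distrib_left power2_eq_square algebra_simps flip: sum.distrib sum_subtractf)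
  then show ?thesis by (simp only: defect_def H_sq) (simp add: algebra_simps)
qed

text \<open>A point \<open>y\<close> of the span differs from \<open>x\<close> by a vector with
  finitely many coordinates, each at most \<open>norm (u - y)\<close> plus the coordinate error of
  \<open>u\<close>. The infimum over \<open>y\<close> gives the estimate.\<close>

lemma norm_diff_le_infdist:
  assumes A: "finite A" "A \<subseteq> \<Gamma>" and x: "x \<in> span (e ` A)"
  shows "norm (u - x) \<le> (1 + (\<Sum>\<alpha>\<in>A. norm (e \<alpha>))) * infdist u (span (e ` A))
    + (\<Sum>\<alpha>\<in>A. \<bar>\<phi> \<alpha> u - \<phi> \<alpha> x\<bar> * norm (e \<alpha>))"
proof -
  let ?K = "1 + (\<Sum>\<alpha>\<in>A. norm (e \<alpha>))" and ?T = "\<Sum>\<alpha>\<in>A. \<bar>\<phi> \<alpha> u - \<phi> \<alpha> x\<bar> * norm (e \<alpha>)"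
  have K: "0 < ?K" by (simp add: add_pos_nonneg sum_nonneg)
  have "(norm (u - x) - ?T) / ?K \<le> infdist u (span (e ` A))"
  proof (rule le_infdist)
    show "span (e ` A) \<noteq> {}" using span_zero by blast
    fix y assume y: "y \<in> span (e ` A)"
    have "y - x = (\<Sum>\<alpha>\<in>A. \<phi> \<alpha> (y - x) *\<^sub>R e \<alpha>)"
      by (rule span_expansion[OF A span_diff[OF y x]])
    then have "norm (y - x) \<le> (\<Sum>\<alpha>\<in>A. \<bar>\<phi> \<alpha> (y - x)\<bar> * norm (e \<alpha>))"
      using norm_sum[of "\<lambda>\<alpha>. \<phi> \<alpha> (y - x) *\<^sub>R e \<alpha>" A] by simp
    also have "\<dots> \<le> (\<Sum>\<alpha>\<in>A. (norm (u - y) + \<bar>\<phi> \<alpha> u - \<phi> \<alpha> x\<bar>) * norm (e \<alpha>))"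
    proof (intro sum_mono mult_right_mono)
      fix \<alpha> assume "\<alpha> \<in> A"
      then have "\<bar>\<phi> \<alpha> (u - y)\<bar> \<le> norm (u - y)" using A abs_\<phi>_le by blast
      then show "\<bar>\<phi> \<alpha> (y - x)\<bar> \<le> norm (u - y) + \<bar>\<phi> \<alpha> u - \<phi> \<alpha> x\<bar>"
        by (simp add: blinfun.bilinear_simps)
    qed simp
    also have "\<dots> = norm (u - y) * (\<Sum>\<alpha>\<in>A. norm (e \<alpha>)) + ?T"
      by (simp add: distrib_right sum.distrib sum_distrib_left)
    finally have "norm (u - x) \<le> ?K * norm (u - y) + ?T"
      using norm_triangle_ineq[of "u - y" "y - x"] by (simp add: algebra_simps)
    then show "(norm (u - x) - ?T) / ?K \<le> dist u y"
      using K by (simp add: dist_norm field_simps)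
  qed
  then show ?thesis using K by (simp add: field_simps)
qed

text \<open>The new norm is the square sum of \<open>N\<close> and small multiples of all
  \<open>G n k\<close>. Countably many suffice: a given \<open>x\<close> uses only
  \<open>n = card (supp x)\<close> and one \<open>k\<close> that is large enough for its finitely
  many nonzero coordinates.\<close>

theorem rotund_renorming:
  assumes N: "equivalent_norm_on UNIV N" and "0 < \<epsilon>"
  obtains N' where "equivalent_norm_on UNIV N'" "rotund_on Y N'"
    "\<And>x. N x \<le> N' x" "\<And>x. N' x \<le> (1 + \<epsilon>) * N x"
proof -
  obtain c C where c: "c > 0" "C > 0" "\<And>x. c * norm x \<le> N x" "\<And>x. N x \<le> C * norm x"
    and sN: "seminorm_on UNIV N"
    using N unfolding equivalent_norm_on_def norm_on_iff_seminorm_on[OF subspace_UNIV] by auto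
  \<comment> \<open>Since \<open>c * norm x \<le> N x\<close>, all that is added to the square of
    \<open>N x\<close> is then at most \<open>\<epsilon>\<close> times that square.\<close>
  define \<delta> where "\<delta> = c\<^sup>2 * \<epsilon>"
  have \<delta>: "\<delta> > 0" using c(1) \<open>0 < \<epsilon>\<close> by (simp add: \<delta>_def)
  define n where "n m = fst (prod_decode m)" for m
  define k where "k m = snd (prod_decode m)" for m
  \<comment> \<open>The denominator cancels the bound \<open>G_le\<close>; what remains is a
    geometric series of sum \<open>\<delta>\<close> times the square of the norm.\<close>
  define d where "d m = sqrt (\<delta> * (1/2) ^ Suc m / (real (k m) * n m + 1))" for m
  have kn: "0 < real (k m) * n m + 1" for m by (simp add: add_nonneg_pos)
  have d: "d m > 0" for m
    unfolding d_def using \<delta> kn[of m] by (intro real_sqrt_gt_zero divide_pos_pos) simp_all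
  define p where "p m = (case m of 0 \<Rightarrow> N | Suc m \<Rightarrow> (\<lambda>x. d m * G (n m) (k m) x))" for m
  have p: "seminorm_on UNIV (p m)" for m
  proof (cases m)
    case 0 then show ?thesis using sN by (simp add: p_def)
  next
    case (Suc j)
    then show ?thesis
      using seminorm_on_G[of "n j" "k j"] d[of j] unfolding seminorm_on_def p_def
      by (simp flip: distrib_left)
  qed
  have p_le: "(p (Suc m) x)\<^sup>2 \<le> \<delta> * (norm x)\<^sup>2 * (1/2) ^ Suc m" for m x
  proof -
    have "(p (Suc m) x)\<^sup>2 = (d m)\<^sup>2 * (G (n m) (k m) x)\<^sup>2" by (simp add: p_def power_mult_distrib)
    also have "\<dots> \<le> (d m)\<^sup>2 * (sqrt (real (k m) * n m + 1) * norm x)\<^sup>2"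
      by (intro mult_left_mono power_mono G_le seminorm_on_nonneg[OF seminorm_on_G]) auto
    also have "\<dots> = \<delta> * (norm x)\<^sup>2 * (1/2) ^ Suc m"
    proof -
      define D where "D = real (k m) * n m + 1"
      have "0 < D" using kn by (simp add: D_def)
      then show ?thesis
        using \<delta> unfolding d_def D_def[symmetric] by (simp add: power_mult_distrib)
    qed
    finally show ?thesis .
  qed
  have geo: "(\<lambda>m. \<delta> * (norm x)\<^sup>2 * (1/2) ^ Suc m) sums (\<delta> * (norm x)\<^sup>2)" for x :: 'a
    using sums_mult[OF power_half_series, of "\<delta> * (norm x)\<^sup>2"] by simp
  have sum_Suc: "summable (\<lambda>m. (p (Suc m) x)\<^sup>2)" for x
    by (rule summable_comparison_test[OF _ sums_summable[OF geo[of x]]]) (use p_le in auto)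
  then have sm: "summable (\<lambda>m. (p m x)\<^sup>2)" for x
    using summable_Suc_iff[of "\<lambda>m. (p m x)\<^sup>2" for x] by blast
  define N' where "N' x = sqrt (\<Sum>m. (p m x)\<^sup>2)" for x
  have sN': "seminorm_on UNIV N'"
    unfolding N'_def by (intro seminorm_on_sqrt_suminf p sm) simp
  have N'_eq: "(\<Sum>m. (p m x)\<^sup>2) = (N x)\<^sup>2 + (\<Sum>m. (p (Suc m) x)\<^sup>2)" for x
    using suminf_split_head[OF sm, of x] by (simp add: p_def)
  have Nnn: "0 \<le> N x" for x using sN by (simp add: seminorm_on_def)
  have lower: "N x \<le> N' x" for x
    unfolding N'_def N'_eq using suminf_nonneg[OF sum_Suc] by (intro real_le_rsqrt) simp
  have upper: "N' x \<le> (1 + \<epsilon>) * N x" for x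
  proof -
    have "(\<Sum>m. (p (Suc m) x)\<^sup>2) \<le> \<delta> * (norm x)\<^sup>2"
      using suminf_le[OF p_le sum_Suc sums_summable[OF geo]] sums_unique[OF geo[of x], symmetric]
      by (rule ord_le_eq_trans)
    also have "\<dots> = \<epsilon> * (c * norm x)\<^sup>2" by (simp add: \<delta>_def power_mult_distrib)
    also have "\<dots> \<le> \<epsilon> * (N x)\<^sup>2"
      using c \<open>0 < \<epsilon>\<close> by (intro mult_left_mono power_mono) auto
    finally have "(\<Sum>m. (p m x)\<^sup>2) \<le> (1 + \<epsilon>) * (N x)\<^sup>2" by (simp add: N'_eq algebra_simps)
    also have "\<dots> \<le> (1 + \<epsilon>)\<^sup>2 * (N x)\<^sup>2"
      using \<open>0 < \<epsilon>\<close> by (intro mult_right_mono) (auto simp: power2_eq_square algebra_simps)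
    finally show ?thesis
      unfolding N'_def using Nnn[of x] \<open>0 < \<epsilon>\<close> by (intro real_le_lsqrt) (auto simp: power_mult_distrib)
  qed
  have eq': "equivalent_norm_on UNIV N'"
  proof (rule equivalent_norm_onI[OF subspace_UNIV sN' c(1), of "(1 + \<epsilon>) * C"])
    show "c * norm x \<le> N' x" for x using c(3) lower order_trans by blast
    show "N' x \<le> (1 + \<epsilon>) * C * norm x" for x
      using upper[of x] c(4)[of x] \<open>0 < \<epsilon>\<close> by (smt (verit) mult.assoc mult_left_mono)
  qed (use c \<open>0 < \<epsilon>\<close> in auto)
  have "rotund_on Y N'"
    unfolding rotund_on_def
  proof (intro ballI allI impI)
    fix x u assume x: "x \<in> Y" and lim: "(\<lambda>j::nat. defect N' x (u j)) \<longlonglongrightarrow> 0"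
    let ?S = "supp x"
    have fS: "finite ?S" using x by (rule finite_supp)
    \<comment> \<open>The thresholds of the finitely many coordinates are summed. A successor is
      taken so that \<open>K\<close> is positive even for an empty support.\<close>
    obtain K :: nat where K: "\<And>\<alpha>. \<alpha> \<in> ?S \<Longrightarrow> (norm x)\<^sup>2 + 1 < real K * (\<phi> \<alpha> x)\<^sup>2" "K > 0"
    proof -
      have "\<forall>\<alpha>\<in>?S. \<exists>q::nat. ((norm x)\<^sup>2 + 1) / (\<phi> \<alpha> x)\<^sup>2 < q" using reals_Archimedean2 by blast
      then obtain q :: "'i \<Rightarrow> nat" where q: "\<And>\<alpha>. \<alpha> \<in> ?S \<Longrightarrow> ((norm x)\<^sup>2 + 1) / (\<phi> \<alpha> x)\<^sup>2 < q \<alpha>" by metis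
      have "(norm x)\<^sup>2 + 1 < real (Suc (sum q ?S)) * (\<phi> \<alpha> x)\<^sup>2" if a: "\<alpha> \<in> ?S" for \<alpha>
      proof -
        have "q \<alpha> \<le> sum q ?S" using fS a by (intro member_le_sum) auto
        then have "real (q \<alpha>) \<le> real (Suc (sum q ?S))" by linarith
        then have "((norm x)\<^sup>2 + 1) / (\<phi> \<alpha> x)\<^sup>2 < real (Suc (sum q ?S))"
          using q[OF a] by linarith
        moreover have "0 < (\<phi> \<alpha> x)\<^sup>2" using a by (simp add: supp_def)
        ultimately show ?thesis by (simp only: pos_divide_less_eq)
      qed
      then show thesis using that by blast
    qed
    define m where "m = prod_encode (card ?S, K)"
    have m: "n m = card ?S" "k m = K" by (simp_all add: n_def k_def m_def)
    let ?G = "G (card ?S) K"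
    have "(d m)\<^sup>2 * defect ?G x y \<le> defect N' x y" for y
    proof -
      have "defect (p (Suc m)) x y \<le> defect N' x y"
        unfolding N'_def by (intro defect_sqrt_suminf[OF subspace_UNIV p] sm) auto
      moreover have "defect (p (Suc m)) x y = (d m)\<^sup>2 * defect ?G x y"
        by (simp add: p_def defect_def m power_mult_distrib algebra_simps)
      ultimately show ?thesis by simp
    qed
    then have le: "norm (defect ?G x (u j)) \<le> defect N' x (u j) / (d m)\<^sup>2" for j
      using d[of m] defect_nonneg[OF seminorm_on_G subspace_UNIV UNIV_I UNIV_I, of "card ?S" K x "u j"]
      by (simp add: field_simps)
    have "(\<lambda>j. defect N' x (u j) / (d m)\<^sup>2) \<longlonglongrightarrow> 0"
      using lim by (rule tendsto_divide_zero)
    then have "(\<lambda>j. defect ?G x (u j)) \<longlonglongrightarrow> 0"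
      by (rule Lim_null_comparison[OF always_eventually[OF allI[OF le]]])
    then have limH: "(\<lambda>j. defect (H ?S K) x (u j)) \<longlonglongrightarrow> 0"
      using K(1) by (intro defect_G_eventually x)
    let ?D = "\<lambda>x. infdist x (span (e ` ?S))"
    have Dx: "?D x = 0" using in_span_supp[OF x] by simp
    have D2: "(?D y)\<^sup>2 \<le> defect ?D x y" for y
      using defect_ge_square[OF seminorm_on_infdist[OF subspace_span] subspace_UNIV, of x y "e ` ?S"] Dx
      by simp
    have sq: "(?D (u j))\<^sup>2 \<le> defect (H ?S K) x (u j)" for j
    proof -
      have "0 \<le> real K * (\<Sum>\<alpha>\<in>?S. (\<phi> \<alpha> x - \<phi> \<alpha> (u j))\<^sup>2)" by (simp add: sum_nonneg)
      then show ?thesis using D2[of "u j"] unfolding defect_H by linarith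
    qed
    have phi: "(\<phi> \<alpha> (u j) - \<phi> \<alpha> x)\<^sup>2 \<le> defect (H ?S K) x (u j)" if "\<alpha> \<in> ?S" for j \<alpha>
    proof -
      have "(\<phi> \<alpha> (u j) - \<phi> \<alpha> x)\<^sup>2 \<le> (\<Sum>\<alpha>\<in>?S. (\<phi> \<alpha> x - \<phi> \<alpha> (u j))\<^sup>2)"
        using member_le_sum[OF that, of "\<lambda>\<alpha>. (\<phi> \<alpha> x - \<phi> \<alpha> (u j))\<^sup>2"] fS by (simp add: power2_commute)
      also have "\<dots> \<le> real K * (\<Sum>\<alpha>\<in>?S. (\<phi> \<alpha> x - \<phi> \<alpha> (u j))\<^sup>2)"
        using mult_right_mono[of 1 "real K" "\<Sum>\<alpha>\<in>?S. (\<phi> \<alpha> x - \<phi> \<alpha> (u j))\<^sup>2"] K(2) by (simp add: sum_nonneg)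
      also have "\<dots> \<le> defect (H ?S K) x (u j)"
        using D2[of "u j"] zero_le_power2[of "?D (u j)"] unfolding defect_H by linarith
      finally show ?thesis .
    qed
    have sqz: "v \<longlonglongrightarrow> 0" if "\<And>j. (v j)\<^sup>2 \<le> defect (H ?S K) x (u j)" for v :: "nat \<Rightarrow> real"
    proof -
      have "(\<lambda>j. (v j)\<^sup>2) \<longlonglongrightarrow> 0"
        by (rule Lim_null_comparison[OF always_eventually limH]) (use that in simp)
      then have "(\<lambda>j. sqrt ((v j)\<^sup>2)) \<longlonglongrightarrow> sqrt 0" by (rule tendsto_real_sqrt)
      then show ?thesis by (simp add: tendsto_rabs_zero_iff)
    qed
    let ?B = "\<lambda>j. C * (1 + \<epsilon>) * ((1 + (\<Sum>\<alpha>\<in>?S. norm (e \<alpha>))) * ?D (u j) + (\<Sum>\<alpha>\<in>?S. \<bar>\<phi> \<alpha> (u j) - \<phi> \<alpha> x\<bar> * norm (e \<alpha>)))"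
    have lim0: "?B \<longlonglongrightarrow> C * (1 + \<epsilon>) * ((1 + (\<Sum>\<alpha>\<in>?S. norm (e \<alpha>))) * 0 + (\<Sum>\<alpha>\<in>?S. \<bar>0\<bar> * norm (e \<alpha>)))"
      by (intro tendsto_intros sqz sq phi)
    have le_B: "norm (N' (u j - x)) \<le> ?B j" for j
    proof -
      have "N' (u j - x) \<le> (1 + \<epsilon>) * (C * norm (u j - x))"
        using upper[of "u j - x"] c(4)[of "u j - x"] \<open>0 < \<epsilon>\<close> by (smt (verit) mult_left_mono)
      also have "\<dots> = C * (1 + \<epsilon>) * norm (u j - x)" by simp
      also have "\<dots> \<le> ?B j"
        using norm_diff_le_infdist[OF fS supp_subset_\<Gamma> in_span_supp[OF x]] c(2) \<open>0 < \<epsilon>\<close>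
        by (intro mult_left_mono) auto
      finally show ?thesis using seminorm_on_nonneg[OF sN', of "u j - x"] by simp
    qed
    show "(\<lambda>j. N' (u j - x)) \<longlonglongrightarrow> 0"
      by (rule Lim_null_comparison[OF always_eventually[OF allI[OF le_B]]]) (use lim0 in simp)
  qed
  then show ?thesis using that eq' lower upper by blast
qed

end

section \<open>Adapted families of functionals: recursion over finite sets and compactness\<close>

text \<open>Well-founded recursion with a choice at each stage. By \<open>cong\<close>,
  \<open>R A f\<close> sees \<open>f\<close> on proper subsets of \<open>A\<close> only, so the
  truncation of \<open>f\<close> that \<open>wfrec\<close> performs does no harm.\<close>

lemma finite_psubset_choice:
  fixes R :: "'i set \<Rightarrow> ('i set \<Rightarrow> 'b) \<Rightarrow> 'b \<Rightarrow> bool"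
  assumes ex: "\<And>A f. finite A \<Longrightarrow> (\<And>B. B \<subset> A \<Longrightarrow> R B f (f B)) \<Longrightarrow> \<exists>X. R A f X"
    and cong: "\<And>A f g X. (\<And>B. B \<subset> A \<Longrightarrow> f B = g B) \<Longrightarrow> R A f X = R A g X"
  shows "\<exists>f. \<forall>A. finite A \<longrightarrow> R A f (f A)"
proof -
  define f where "f = wfrec finite_psubset (\<lambda>f A. SOME X. R A f X)"
  have f: "f A = (SOME X. R A f X)" if "finite A" for A
  proof -
    have "f A = (SOME X. R A (cut f finite_psubset A) X)"
      unfolding f_def by (subst wfrec) auto
    moreover have "R A (cut f finite_psubset A) X = R A f X" for X
      by (rule cong) (use that in \<open>auto simp: cut_def finite_psubset_def\<close>)
    ultimately show ?thesis by simp
  qed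
  have "R A f (f A)" if "finite A" for A
    using that
  proof (induction A rule: finite_psubset_induct)
    case (psubset A)
    then have "\<exists>X. R A f X" by (intro ex) auto
    then show ?case unfolding f[OF psubset(1)] by (rule someI_ex)
  qed
  then show ?thesis by blast
qed

text \<open>The ambient space need not be finite-dimensional, so compactness is built up by adding
  one segment at a time. Coefficients outside \<open>A\<close> are unrestricted but do not enter the
  sum.\<close>

lemma compact_coefficient_box:
  fixes e :: "'i \<Rightarrow> 'a::real_normed_vector"
  assumes "finite A"
  shows "compact ((\<lambda>c. \<Sum>\<alpha>\<in>A. c \<alpha> *\<^sub>R e \<alpha>) ` {c. \<forall>\<alpha>\<in>A. \<bar>c \<alpha>\<bar> \<le> R})"
  using assms
proof (induction A rule: finite_induct)
  case empty
  have "(\<lambda>c. \<Sum>\<alpha>\<in>{}. c \<alpha> *\<^sub>R e \<alpha>) ` {c. \<forall>\<alpha>\<in>{}. \<bar>c \<alpha>\<bar> \<le> R} = {0}" by auto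
  then show ?case by simp
next
  case (insert a A)
  let ?C = "(\<lambda>c. \<Sum>\<alpha>\<in>A. c \<alpha> *\<^sub>R e \<alpha>) ` {c. \<forall>\<alpha>\<in>A. \<bar>c \<alpha>\<bar> \<le> R}"
  let ?T = "(\<lambda>t. t *\<^sub>R e a) ` {-R..R}"
  have "(\<lambda>c. \<Sum>\<alpha>\<in>insert a A. c \<alpha> *\<^sub>R e \<alpha>) ` {c. \<forall>\<alpha>\<in>insert a A. \<bar>c \<alpha>\<bar> \<le> R} = {x + y | x y. x \<in> ?T \<and> y \<in> ?C}"
    (is "?L = ?R")
  proof (intro equalityI subsetI)
    fix z assume "z \<in> ?L"
    then obtain c where c: "z = (\<Sum>\<alpha>\<in>insert a A. c \<alpha> *\<^sub>R e \<alpha>)" "\<forall>\<alpha>\<in>insert a A. \<bar>c \<alpha>\<bar> \<le> R" by auto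
    then have "z = c a *\<^sub>R e a + (\<Sum>\<alpha>\<in>A. c \<alpha> *\<^sub>R e \<alpha>)" using insert(1,2) by simp
    moreover have "c a *\<^sub>R e a \<in> ?T" using c(2) by (intro imageI) auto
    moreover have "(\<Sum>\<alpha>\<in>A. c \<alpha> *\<^sub>R e \<alpha>) \<in> ?C" using c(2) by blast
    ultimately show "z \<in> ?R" by blast
  next
    fix z assume "z \<in> ?R"
    then obtain t c where tc: "z = t *\<^sub>R e a + (\<Sum>\<alpha>\<in>A. c \<alpha> *\<^sub>R e \<alpha>)" "t \<in> {-R..R}" "\<forall>\<alpha>\<in>A. \<bar>c \<alpha>\<bar> \<le> R" by auto
    have "z = (\<Sum>\<alpha>\<in>insert a A. (c(a := t)) \<alpha> *\<^sub>R e \<alpha>)"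
      using insert(1,2) tc(1) by (auto intro!: sum.cong)
    moreover have "c(a := t) \<in> {c. \<forall>\<alpha>\<in>insert a A. \<bar>c \<alpha>\<bar> \<le> R}" using tc insert(2) by auto
    ultimately show "z \<in> ?L" by blast
  qed
  moreover have "compact ?T" by (intro compact_continuous_image continuous_intros) simp
  ultimately show ?case using insert(3) by (simp only: compact_sums)
qed

lemma seminorm_on_lipschitz:
  assumes "seminorm_on UNIV p" "\<And>x. p x \<le> C * norm x"
  shows "\<bar>p x - p y\<bar> \<le> C * norm (x - y)"
  using seminorm_on_diff_le[OF assms(1) subspace_UNIV, of x y] assms(2)[of "x - y"] by simp

lemma continuous_on_lipschitz:
  fixes f :: "'a::real_normed_vector \<Rightarrow> real"
  assumes "\<And>x y. x \<in> S \<Longrightarrow> y \<in> S \<Longrightarrow> \<bar>f x - f y\<bar> \<le> C * norm (x - y)"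
  shows "continuous_on S f"
proof (rule continuous_onI)
  fix x and \<epsilon> :: real assume "x \<in> S" "0 < \<epsilon>"
  \<comment> \<open>\<open>C\<close> may be 0 or negative, hence the positive constant
    \<open>\<bar>C\<bar> + 1\<close>.\<close>
  have "dist (f y) (f x) \<le> \<epsilon>" if "y \<in> S" "dist y x < \<epsilon> / (\<bar>C\<bar> + 1)" for y
  proof -
    have "\<bar>f y - f x\<bar> \<le> C * norm (y - x)" using assms that(1) \<open>x \<in> S\<close> by blast
    also have "\<dots> \<le> (\<bar>C\<bar> + 1) * norm (y - x)" by (intro mult_right_mono) auto
    also have "\<dots> \<le> \<epsilon>" using that(2) by (simp add: dist_norm field_simps)
    finally show ?thesis by (simp add: dist_real_def)
  qed
  then show "\<exists>d>0. \<forall>x'\<in>S. dist x' x < d \<longrightarrow> dist (f x') (f x) \<le> \<epsilon>"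
    using \<open>0 < \<epsilon>\<close> by (intro exI[of _ "\<epsilon> / (\<bar>C\<bar> + 1)"]) (auto simp: add_nonneg_pos)
qed

context normalized_biorthogonal
begin

text \<open>The biorthogonal functionals bound the coordinates on the sphere by
  \<open>1 / c\<close>, which places it in a compact box.\<close>

lemma compact_sphere:
  assumes N: "equivalent_norm_on UNIV N" and A: "finite A" "A \<subseteq> \<Gamma>"
  shows "compact {x \<in> span (e ` A). N x = 1}"
proof -
  obtain c C where c: "c > 0" "C > 0" "\<And>x. c * norm x \<le> N x" "\<And>x. N x \<le> C * norm x"
    and sN: "seminorm_on UNIV N"
    using N unfolding equivalent_norm_on_def norm_on_iff_seminorm_on[OF subspace_UNIV] by auto
  let ?B = "(\<lambda>c. \<Sum>\<alpha>\<in>A. c \<alpha> *\<^sub>R e \<alpha>) ` {k. \<forall>\<alpha>\<in>A. \<bar>k \<alpha>\<bar> \<le> 1 / c}"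
  have "{x \<in> span (e ` A). N x = 1} = ?B \<inter> N -` {1}"
  proof (intro equalityI subsetI)
    fix x assume x: "x \<in> {x \<in> span (e ` A). N x = 1}"
    have "\<bar>\<phi> \<alpha> x\<bar> \<le> 1 / c" if "\<alpha> \<in> A" for \<alpha>
    proof -
      have "\<bar>\<phi> \<alpha> x\<bar> \<le> norm x" using that A abs_\<phi>_le by blast
      moreover have "norm x \<le> 1 / c" using c(3)[of x] x c(1) by (simp add: field_simps)
      ultimately show ?thesis by linarith
    qed
    moreover have "x = (\<Sum>\<alpha>\<in>A. \<phi> \<alpha> x *\<^sub>R e \<alpha>)" using x by (intro span_expansion A) simp
    ultimately have "x \<in> ?B" by (intro image_eqI[of _ _ "\<lambda>\<alpha>. \<phi> \<alpha> x"]) auto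
    then show "x \<in> ?B \<inter> N -` {1}" using x by simp
  next
    fix x assume "x \<in> ?B \<inter> N -` {1}"
    then obtain k where "x = (\<Sum>\<alpha>\<in>A. k \<alpha> *\<^sub>R e \<alpha>)" "N x = 1" by blast
    then show "x \<in> {x \<in> span (e ` A). N x = 1}"
      by (simp add: span_sum span_scale span_base)
  qed
  moreover have "closed (N -` {1})"
    using continuous_on_lipschitz[of UNIV N C] seminorm_on_lipschitz[OF sN c(4)]
    by (intro continuous_closed_vimage) (auto simp: continuous_on_eq_continuous_at)
  ultimately show ?thesis
    by (simp only: compact_Int_closed compact_coefficient_box[OF A(1)])
qed

text \<open>Rotundity at \<open>x\<^sub>0\<close> makes a norming functional of \<open>x\<^sub>0\<close> have norm less than 1 on every hyperplane
  \<open>{\<phi>\<^sub>\<beta> = 0}\<close> that misses \<open>x\<^sub>0\<close>; rescaling it turns this into the last two properties.\<close>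

lemma exposing_functional:
  assumes N: "equivalent_norm_on UNIV N" and rot: "rotund_on Y N"
    and x0: "x0 \<in> Y" "x0 \<noteq> 0" and "0 < \<epsilon>"
  obtains f where "bounded_linear f" "\<And>x. \<bar>f x\<bar> \<le> (1 + \<epsilon>) * N x" "N x0 < f x0"
    "\<And>x \<beta>. x \<in> Y \<Longrightarrow> \<beta> \<in> supp x0 \<Longrightarrow> \<phi> \<beta> x = 0 \<Longrightarrow> \<bar>f x\<bar> \<le> N x"
proof -
  obtain c C where c: "c > 0" "C > 0" "\<And>x. c * norm x \<le> N x" "\<And>x. N x \<le> C * norm x"
    and sN: "seminorm_on UNIV N"
    using N unfolding equivalent_norm_on_def norm_on_iff_seminorm_on[OF subspace_UNIV] by auto
  have Nnn: "0 \<le> N x" for x using sN by (simp add: seminorm_on_def)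
  have Nscale: "N (t *\<^sub>R x) = \<bar>t\<bar> * N x" for t x using sN by (simp add: seminorm_on_def)
  have Npos: "0 < N x" if "x \<noteq> 0" for x
    using c(1) c(3)[of x] that by (smt (verit) mult_pos_pos zero_less_norm_iff)
  obtain f where f: "linear f" "\<And>x. \<bar>f x\<bar> \<le> N x" "f x0 = N x0"
    using norming_functional[OF sN] by blast
  \<comment> \<open>Otherwise the hyperplane contains vectors \<open>y n\<close> with
    \<open>N (y n) = N x0\<close> and \<open>f (y n)\<close> tending to \<open>f x0\<close>. Then
    \<open>N (x0 + y n)\<close> tends to \<open>2 * N x0\<close>, and rotundity draws
    \<open>y n\<close> to \<open>x0\<close>, off which the hyperplane keeps a positive
    distance.\<close>
  have "\<exists>q. 0 < q \<and> q < 1 \<and> (\<forall>x\<in>Y. \<phi> \<beta> x = 0 \<longrightarrow> \<bar>f x\<bar> \<le> q * N x)" if \<beta>: "\<beta> \<in> supp x0" for \<beta>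
  proof (rule ccontr)
    assume "\<not> ?thesis"
    then have *: "\<exists>x\<in>Y. \<phi> \<beta> x = 0 \<and> q * N x < \<bar>f x\<bar>" if "0 < q" "q < 1" for q
      using that by (metis not_less)
    \<comment> \<open>It tends to 1 and starts at \<open>1/2\<close>, so that all values are
      strictly between 0 and 1.\<close>
    define q where "q n = 1 - inverse (real (Suc (Suc n)))" for n
    have q: "0 < q n" "q n < 1" for n by (simp_all add: q_def inverse_eq_divide)
    obtain x where x: "\<And>n. x n \<in> Y" "\<And>n. \<phi> \<beta> (x n) = 0" "\<And>n. q n * N (x n) < \<bar>f (x n)\<bar>"
      using *[OF q] by metis
    have Nx: "0 < N (x n)" for n
    proof (rule ccontr)
      assume "\<not> 0 < N (x n)"
      then have "N (x n) = 0" using Nnn[of "x n"] by simp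
      then show False using x(3)[of n] f(2)[of "x n"] by simp
    qed
    \<comment> \<open>The sign makes \<open>f (y n)\<close> positive; the other factors place
      \<open>y n\<close> on the \<open>N\<close>-sphere through \<open>x0\<close>.\<close>
    define y where "y n = (sgn (f (x n)) * N x0 / N (x n)) *\<^sub>R x n" for n
    have yY: "y n \<in> Y" for n using x(1) subspace_scale[OF subspace_Y] by (simp add: y_def)
    have y\<beta>: "\<phi> \<beta> (y n) = 0" for n by (simp add: y_def blinfun.bilinear_simps x)
    have "sgn (f (x n)) \<noteq> 0" for n
      using x(3)[of n] mult_pos_pos[OF q(1)[of n] Nx[of n]] by (auto simp: sgn_zero_iff)
    then have Ny: "N (y n) = N x0" for n
      using Nx[of n] Npos[OF x0(2)] by (simp add: y_def Nscale abs_mult abs_sgn_eq sgn_zero_iff)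
    have fy: "q n * N x0 \<le> f (y n)" for n
    proof -
      have "f (y n) = \<bar>f (x n)\<bar> * N x0 / N (x n)"
        by (simp add: y_def linear_scale[OF f(1)] abs_sgn)
      moreover have "q n \<le> \<bar>f (x n)\<bar> / N (x n)" using x(3)[of n] Nx[of n] by (simp add: field_simps)
      then have "q n * N x0 \<le> \<bar>f (x n)\<bar> / N (x n) * N x0" using Nnn by (rule mult_right_mono)
      ultimately show ?thesis by simp
    qed
    have bound: "norm (defect N x0 (y n)) \<le> 4 * (N x0)\<^sup>2 - ((1 + q n) * N x0)\<^sup>2" for n
    proof -
      have "(1 + q n) * N x0 \<le> f (x0 + y n)"
        using fy[of n] f(3) by (simp add: linear_add[OF f(1)] algebra_simps)
      also have "\<dots> \<le> N (x0 + y n)" using f(2)[of "x0 + y n"] by simp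
      finally have "((1 + q n) * N x0)\<^sup>2 \<le> (N (x0 + y n))\<^sup>2"
        using q[of n] Nnn by (intro power_mono) auto
      moreover have "0 \<le> defect N x0 (y n)" by (rule defect_nonneg[OF sN subspace_UNIV]) auto
      ultimately show ?thesis by (simp add: defect_def Ny)
    qed
    have "q \<longlonglongrightarrow> 1 - 0"
      unfolding q_def by (intro tendsto_intros LIMSEQ_Suc[OF LIMSEQ_inverse_real_of_nat])
    then have "(\<lambda>n. 4 * (N x0)\<^sup>2 - ((1 + q n) * N x0)\<^sup>2) \<longlonglongrightarrow> 4 * (N x0)\<^sup>2 - ((1 + (1 - 0)) * N x0)\<^sup>2"
      by (intro tendsto_intros)
    then have "(\<lambda>n. 4 * (N x0)\<^sup>2 - ((1 + q n) * N x0)\<^sup>2) \<longlonglongrightarrow> 0" by (simp add: power_mult_distrib)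
    then have "(\<lambda>n. defect N x0 (y n)) \<longlonglongrightarrow> 0"
      by (rule Lim_null_comparison[OF always_eventually[OF allI[OF bound]]])
    then have lim: "(\<lambda>n. N (y n - x0)) \<longlonglongrightarrow> 0"
      using rot x0(1) yY unfolding rotund_on_def by blast
    have "c * \<bar>\<phi> \<beta> x0\<bar> \<le> N (y n - x0)" for n
    proof -
      have "\<bar>\<phi> \<beta> x0\<bar> \<le> norm (y n - x0)"
        using abs_\<phi>_le[of \<beta> "y n - x0"] \<beta> y\<beta> by (simp add: supp_def blinfun.bilinear_simps)
      then show ?thesis using c(3)[of "y n - x0"] c(1) by (meson mult_left_mono less_imp_le order_trans)
    qed
    then have "c * \<bar>\<phi> \<beta> x0\<bar> \<le> 0" by (intro LIMSEQ_le_const[OF lim]) auto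
    then show False using c(1) \<beta> by (simp add: supp_def mult_le_0_iff)
  qed
  then obtain q where q: "\<And>\<beta>. \<beta> \<in> supp x0 \<Longrightarrow> 0 < q \<beta> \<and> q \<beta> < 1"
    "\<And>\<beta> x. \<beta> \<in> supp x0 \<Longrightarrow> x \<in> Y \<Longrightarrow> \<phi> \<beta> x = 0 \<Longrightarrow> \<bar>f x\<bar> \<le> q \<beta> * N x"
    by metis
  define Q where "Q = Max (q ` supp x0)"
  have fin: "finite (q ` supp x0)" "q ` supp x0 \<noteq> {}"
    using finite_supp supp_nonempty x0 by auto
  have Q: "0 < Q" "Q < 1" using Max_in[OF fin] q(1) unfolding Q_def by auto
  have Qge: "q \<beta> \<le> Q" if "\<beta> \<in> supp x0" for \<beta> using fin that unfolding Q_def by simp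
  \<comment> \<open>The largest factor that respects both upper bounds. It exceeds 1, which gives
    the strict inequality at \<open>x0\<close>.\<close>
  define t where "t = min (1 + \<epsilon>) (1 / Q)"
  have t: "1 < t" "t \<le> 1 + \<epsilon>" "t * Q \<le> 1"
    using Q \<open>0 < \<epsilon>\<close> by (auto simp: t_def min_def field_simps)
  show ?thesis
  proof (rule that[of "\<lambda>x. t * f x"])
    show "\<bar>t * f x\<bar> \<le> (1 + \<epsilon>) * N x" for x
      using t f(2)[of x] by (simp add: abs_mult mult_mono)
    show "N x0 < t * f x0" using t(1) f(3) Npos[OF x0(2)] by simp
    show "\<bar>t * f x\<bar> \<le> N x" if "x \<in> Y" "\<beta> \<in> supp x0" "\<phi> \<beta> x = 0" for x \<beta>
    proof -
      have "\<bar>f x\<bar> \<le> Q * N x"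
        using q(2)[OF that(2,1,3)] Qge[OF that(2)] Nnn[of x] by (meson mult_right_mono order_trans)
      then have "t * \<bar>f x\<bar> \<le> t * Q * N x" using t(1) by simp
      also have "\<dots> \<le> N x" using t(3) Nnn[of x] mult_right_mono[of "t * Q" 1 "N x"] by simp
      finally show ?thesis using t(1) by (simp add: abs_mult)
    qed
    show "bounded_linear (\<lambda>x. t * f x)"
    proof (rule bounded_linear_intro)
      show "norm (t * f x) \<le> norm x * (t * C)" for x
        using f(2)[of x] c(4)[of x] t(1) by (simp add: abs_mult) (smt (verit) mult.commute mult.left_commute mult_left_mono)
    qed (auto simp: linear_add[OF f(1)] linear_scale[OF f(1)] algebra_simps)
  qed
qed

text \<open>The margin \<open>\<tau>\<close> is stored with \<open>g\<close> because the penalty of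
  \<open>g\<close> is scaled by it, see \<open>pen\<close>. One finite \<open>J\<close> has to serve
  a whole span: polyhedrality needs this uniformity, while statements near a point \<open>x\<close>
  use only \<open>A = supp x\<close>.\<close>

definition adapted :: "('a \<Rightarrow> real) \<Rightarrow> real \<Rightarrow> (('a \<Rightarrow> real) \<times> real) set \<Rightarrow> bool" where
  "adapted N K I \<longleftrightarrow>
     (\<forall>(g, \<tau>)\<in>I. bounded_linear g \<and> (\<forall>x. \<bar>g x\<bar> \<le> K * N x) \<and> 1 < \<tau>) \<and>
     (\<forall>A. finite A \<and> A \<subseteq> \<Gamma> \<longrightarrow> (\<exists>J\<subseteq>I. finite J \<and>
        (\<forall>x\<in>span (e ` A). (\<forall>(g, \<tau>)\<in>I - J. \<bar>g x\<bar> \<le> N x) \<and>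
           (x \<noteq> 0 \<longrightarrow> (\<exists>(g, \<tau>)\<in>J. \<tau> * N x < g x)))))"

text \<open>The functionals attached to \<open>A\<close> are chosen after those attached to its proper subsets: only the
  compact part of the sphere of \<open>span (e ` A)\<close> that the latter do not cover is left, and all its points
  have support exactly \<open>A\<close>.\<close>

theorem adapted_family:
  assumes N: "equivalent_norm_on UNIV N" and rot: "rotund_on Y N" and "0 < \<epsilon>"
  obtains I where "adapted N (1 + \<epsilon>) I"
proof -
  have sN: "seminorm_on UNIV N" and N0: "\<And>x. N x = 0 \<longleftrightarrow> x = 0"
    using N seminorm_on_zero unfolding equivalent_norm_on_def norm_on_iff_seminorm_on[OF subspace_UNIV] by auto
  \<comment> \<open>By the last clause a functional attached to \<open>A\<close> stays below
    \<open>N\<close> where some coordinate in \<open>A\<close> vanishes, hence on the span of every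
    index set that does not contain \<open>A\<close>.\<close>
  define good :: "'i set \<Rightarrow> ('a \<Rightarrow> real) \<times> real \<Rightarrow> bool"
    where "good A = (\<lambda>(g, \<tau>). bounded_linear g \<and> (\<forall>x. \<bar>g x\<bar> \<le> (1 + \<epsilon>) * N x) \<and> 1 < \<tau> \<and>
      (\<forall>x\<in>Y. \<forall>\<beta>\<in>A. \<phi> \<beta> x = 0 \<longrightarrow> \<bar>g x\<bar> \<le> N x))" for A
  define R where "R A f X \<longleftrightarrow> (A \<subseteq> \<Gamma> \<longrightarrow> finite X \<and> (\<forall>i\<in>X. good A i) \<and>
      (\<forall>x\<in>span (e ` A). N x = 1 \<longrightarrow> (\<exists>(g, \<tau>)\<in>X \<union> \<Union>(f ` {B. B \<subset> A}). \<tau> < g x)))"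
    for A f and X :: "(('a \<Rightarrow> real) \<times> real) set"
  have "\<exists>F. \<forall>A. finite A \<longrightarrow> R A F (F A)"
  proof (rule finite_psubset_choice)
    fix A and f :: "'i set \<Rightarrow> (('a \<Rightarrow> real) \<times> real) set"
    assume fin: "finite A" and IH: "\<And>B. B \<subset> A \<Longrightarrow> R B f (f B)"
    show "\<exists>X. R A f X"
    proof (cases "A \<subseteq> \<Gamma>")
      case False
      then show ?thesis by (simp add: R_def)
    next
      case A: True
      define P where "P = \<Union>(f ` {B. B \<subset> A})"
      have fP: "finite (f B)" "\<forall>i\<in>f B. good B i" if "B \<subset> A" for B
        using IH[OF that] that A unfolding R_def by auto
      have "finite {B. B \<subset> A}"
        by (rule finite_subset[of _ "Pow A"]) (use fin in auto)
      then have P1: "finite P" using fP(1) unfolding P_def by blast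
      have P2: "bounded_linear (fst i)" if "i \<in> P" for i
      proof -
        obtain B where "B \<subset> A" "i \<in> f B" using \<open>i \<in> P\<close> by (auto simp: P_def)
        then have "good B i" using fP(2) by simp
        then show ?thesis by (simp add: good_def case_prod_beta)
      qed
      define K where "K = {x \<in> span (e ` A). N x = 1} \<inter> (\<Inter>(g, \<tau>)\<in>P. {x. g x \<le> \<tau>})"
      have "closed (\<Inter>(g, \<tau>)\<in>P. {x. g x \<le> \<tau>})"
        using P2 by (intro closed_INT ballI) (simp add: case_prod_beta closed_Collect_le linear_continuous_on)
      then have "compact K"
        unfolding K_def by (intro compact_Int_closed compact_sphere N fin A)
      \<comment> \<open>The midpoint of 1 and \<open>g x\<close> is a margin above 1 that
        \<open>g\<close> still exceeds near \<open>x\<close>.\<close>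
      have "\<forall>x\<in>K. \<exists>g. good A (g, (1 + g x) / 2) \<and> 1 < g x"
      proof
        fix x assume "x \<in> K"
        then have x: "x \<in> span (e ` A)" "N x = 1" "\<And>g \<tau>. (g, \<tau>) \<in> P \<Longrightarrow> g x \<le> \<tau>"
          by (auto simp: K_def)
        have xY: "x \<in> Y" using x(1) span_subset_Y[OF A] by blast
        \<comment> \<open>A smaller support is a proper subset of \<open>A\<close>, so an earlier
          functional exceeds its margin at \<open>x\<close>, against the choice of
          \<open>K\<close>.\<close>
        have "supp x = A"
        proof (rule ccontr)
          assume "supp x \<noteq> A"
          then have B: "supp x \<subset> A" using supp_subset[OF A x(1)] by blast
          have "\<exists>(g, \<tau>)\<in>f (supp x) \<union> \<Union>(f ` {C. C \<subset> supp x}). \<tau> < g x"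
            using IH[OF B] in_span_supp[OF xY] x(2) supp_subset_\<Gamma>[of x] unfolding R_def by simp
          then obtain i where i: "i \<in> f (supp x) \<union> \<Union>(f ` {C. C \<subset> supp x})" "snd i < fst i x"
            unfolding case_prod_beta by (rule bexE)
          have "f (supp x) \<union> \<Union>(f ` {C. C \<subset> supp x}) \<subseteq> P"
            unfolding P_def using B psubset_trans by (intro Un_least Union_mono image_mono UN_upper) blast+
          then have "i \<in> P" using i(1) by (rule subsetD)
          then show False using x(3)[of "fst i" "snd i"] i(2) by simp
        qed
        moreover have "x \<noteq> 0" using x(2) N0 by force
        ultimately obtain g where "bounded_linear g" "\<And>x. \<bar>g x\<bar> \<le> (1 + \<epsilon>) * N x" "1 < g x"
          "\<And>y \<beta>. y \<in> Y \<Longrightarrow> \<beta> \<in> A \<Longrightarrow> \<phi> \<beta> y = 0 \<Longrightarrow> \<bar>g y\<bar> \<le> N y"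
          using exposing_functional[OF N rot xY _ \<open>0 < \<epsilon>\<close>, unfolded x(2)] by blast
        then show "\<exists>g. good A (g, (1 + g x) / 2) \<and> 1 < g x" by (intro exI[of _ g]) (auto simp: good_def)
      qed
      then obtain h where "\<forall>x\<in>K. good A (h x, (1 + h x x) / 2) \<and> 1 < h x x"
        by (rule bchoice[THEN exE])
      then have h: "\<And>x. x \<in> K \<Longrightarrow> good A (h x, (1 + h x x) / 2)" "\<And>x. x \<in> K \<Longrightarrow> 1 < h x x"
        by simp_all
      define U where "U x = {y. (1 + h x x) / 2 < h x y}" for x
      have "open (U x)" if "x \<in> K" for x
      proof -
        have "bounded_linear (h x)" using h(1)[OF that] by (simp add: good_def)
        then show ?thesis
          unfolding U_def by (rule open_Collect_less[OF continuous_on_const linear_continuous_on])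
      qed
      moreover have "K \<subseteq> (\<Union>x\<in>K. U x)" using h(2) by (auto simp: U_def field_simps)
      ultimately obtain D where D: "D \<subseteq> K" "finite D" "K \<subseteq> (\<Union>x\<in>D. U x)"
        by (rule compactE_image[OF \<open>compact K\<close>])
      have "R A f ((\<lambda>x. (h x, (1 + h x x) / 2)) ` D)" (is "R A f ?X")
        unfolding R_def P_def[symmetric]
      proof (intro impI conjI ballI)
        show "finite ?X" using D(2) by simp
        show "good A i" if "i \<in> ?X" for i using that h(1) D(1) by auto
        fix x assume x: "x \<in> span (e ` A)" "N x = 1"
        show "\<exists>(g, \<tau>)\<in>?X \<union> P. \<tau> < g x"
        proof (cases "x \<in> K")
          case True
          then obtain y where "y \<in> D" "x \<in> U y" using D(3) by blast
          then show ?thesis by (intro bexI[of _ "(h y, (1 + h y y) / 2)"]) (auto simp: U_def)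
        next
          case False
          then obtain i where "i \<in> P" "snd i < fst i x" using x by (auto simp: K_def case_prod_beta not_le)
          then show ?thesis by (intro bexI[of _ i]) (auto simp: case_prod_beta)
        qed
      qed
      then show ?thesis by blast
    qed
  next
    fix A X and f g :: "'i set \<Rightarrow> (('a \<Rightarrow> real) \<times> real) set"
    assume "\<And>B. B \<subset> A \<Longrightarrow> f B = g B"
    then have "\<Union>(f ` {B. B \<subset> A}) = \<Union>(g ` {B. B \<subset> A})" by auto
    then show "R A f X = R A g X" by (simp only: R_def)
  qed
  then obtain F where F: "\<And>A. finite A \<Longrightarrow> R A F (F A)" by blast
  define I where "I = \<Union>(F ` {A. finite A \<and> A \<subseteq> \<Gamma>})"
  have good: "good A i" if "i \<in> F A" "finite A" "A \<subseteq> \<Gamma>" for A i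
    using F[OF that(2)] that unfolding R_def by blast
  have "adapted N (1 + \<epsilon>) I"
    unfolding adapted_def
  proof (intro conjI allI impI)
    show "\<forall>(g, \<tau>)\<in>I. bounded_linear g \<and> (\<forall>x. \<bar>g x\<bar> \<le> (1 + \<epsilon>) * N x) \<and> 1 < \<tau>"
      using good unfolding I_def good_def by fastforce
    fix A assume A: "finite A \<and> A \<subseteq> \<Gamma>"
    \<comment> \<open>The functionals attached to subsets of \<open>A\<close>. Any other is attached
      to a set with an index outside \<open>A\<close>, whose coordinate vanishes on the span over
      \<open>A\<close>.\<close>
    define J where "J = \<Union>(F ` {B. B \<subseteq> A})"
    have "J \<subseteq> I" using A finite_subset unfolding J_def I_def by (intro Union_mono image_mono) auto
    moreover have "finite J"
    proof -
      have "finite (F B)" if "B \<subseteq> A" for B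
        using F[of B] that A finite_subset[OF that] unfolding R_def by blast
      then show ?thesis using A unfolding J_def by auto
    qed
    moreover have "\<bar>g x\<bar> \<le> N x" if x: "x \<in> span (e ` A)" and i: "(g, \<tau>) \<in> I - J" for x g \<tau>
    proof -
      obtain B where B: "finite B" "B \<subseteq> \<Gamma>" "(g, \<tau>) \<in> F B" "\<not> B \<subseteq> A"
        using i unfolding I_def J_def by blast
      then obtain \<beta> where \<beta>: "\<beta> \<in> B" "\<beta> \<notin> A" by blast
      have "\<phi> \<beta> x = 0" by (rule \<phi>_eq_0[of A]) (use A B \<beta> x in auto)
      moreover have "x \<in> Y" using A x span_subset_Y by blast
      ultimately show ?thesis using good[OF B(3,1,2)] \<beta>(1) unfolding good_def by blast
    qed
    moreover have "\<exists>(g, \<tau>)\<in>J. \<tau> * N x < g x" if x: "x \<in> span (e ` A)" "x \<noteq> 0" for x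
    proof -
      have Nx: "0 < N x" using N0[of x] x(2) seminorm_on_nonneg[OF sN, of x] by simp
      have "(1 / N x) *\<^sub>R x \<in> span (e ` A)" using x(1) by (rule span_scale)
      moreover have "N ((1 / N x) *\<^sub>R x) = 1" using seminorm_on_scale[OF sN, of x "1 / N x"] Nx by simp
      ultimately have "\<exists>(g, \<tau>)\<in>F A \<union> \<Union>(F ` {B. B \<subset> A}). \<tau> < g ((1 / N x) *\<^sub>R x)"
        using F[of A] A unfolding R_def by simp
      then obtain g \<tau> where g: "(g, \<tau>) \<in> F A \<union> \<Union>(F ` {B. B \<subset> A})" "\<tau> < g ((1 / N x) *\<^sub>R x)"
        by auto
      then have "(g, \<tau>) \<in> J" unfolding J_def by auto
      moreover from this \<open>J \<subseteq> I\<close> have "bounded_linear g" using good unfolding I_def good_def by fastforce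
      then have "g ((1 / N x) *\<^sub>R x) = g x / N x" by (simp add: linear_simps)
      then have "\<tau> * N x < g x" using g(2) Nx by (simp only: pos_less_divide_eq)
      ultimately show ?thesis by auto
    qed
    ultimately show "\<exists>J\<subseteq>I. finite J \<and> (\<forall>x\<in>span (e ` A). (\<forall>(g, \<tau>)\<in>I - J. \<bar>g x\<bar> \<le> N x) \<and>
           (x \<noteq> 0 \<longrightarrow> (\<exists>(g, \<tau>)\<in>J. \<tau> * N x < g x)))"
      by (intro exI[of _ J] conjI ballI impI) auto
  qed
  then show ?thesis by (rule that)
qed

end

section \<open>Calculus of functions whose derivatives involve finitely many fixed
  functionals\<close>

text \<open>\<open>lform L y\<close> is the functional \<open>\<Sum> a(y) \<psi>\<close>, where \<open>(a, \<psi>)\<close> ranges over \<open>L\<close>. All functions below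
  have derivatives of this shape, which makes them \<open>C\<^sup>k\<close> as soon as the coefficients \<open>a\<close> are \<open>C\<^sup>k\<^sup>-\<^sup>1\<close>.\<close>

definition lform :: "(('a \<Rightarrow> real) \<times> ('a \<Rightarrow> real)) list \<Rightarrow> 'a \<Rightarrow> 'a \<Rightarrow> real" where
  "lform L y v = (\<Sum>(a, \<psi>)\<leftarrow>L. a y * \<psi> v)"

lemma lform_Nil [simp]: "lform [] y v = 0"
  and lform_Cons [simp]: "lform ((a, \<psi>) # L) y v = a y * \<psi> v + lform L y v"
  and lform_append [simp]: "lform (L @ M) y v = lform L y v + lform M y v"
  by (simp_all add: lform_def)

lemma lform_scale: "lform (map (\<lambda>(a, \<psi>). (\<lambda>y. c y * a y, \<psi>)) L) y v = c y * lform L y v"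
  by (induction L) (auto simp: algebra_simps)

lemma lform_affine:
  "lform (map (\<lambda>(a, \<psi>). (\<lambda>y. a (T y), \<lambda>v. c * \<psi> v)) L) y v = lform L (T y) (c *\<^sub>R v)"
  if "\<forall>(a, \<psi>)\<in>set L. bounded_linear \<psi>"
  using that by (induction L) (auto simp: linear_simps)

lemma bounded_linear_lform:
  "\<forall>(a, \<psi>)\<in>set L. bounded_linear \<psi> \<Longrightarrow> bounded_linear (lform L y)"
proof (induction L)
  case Nil
  have "lform [] y = (\<lambda>_. 0)" by (auto simp: fun_eq_iff)
  then show ?case by (simp add: bounded_linear_zero)
next
  case (Cons p L)
  obtain a \<psi> where p: "p = (a, \<psi>)" by (cases p)
  have "lform (p # L) y = (\<lambda>v. a y * \<psi> v + lform L y v)" by (auto simp: fun_eq_iff p)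
  then show ?case
    using Cons by (auto simp: p intro!: bounded_linear_add bounded_linear_const_mult)
qed

text \<open>Coefficients are considered on \<open>W\<close>, derivatives within \<open>S\<close>, so
  shrinking \<open>W\<close> leaves the derivatives untouched. The functionals do not depend on
  \<open>y\<close>; differentiating again concerns scalar coefficients only.\<close>

primrec smooth :: "nat \<Rightarrow> 'a::real_normed_vector set \<Rightarrow> 'a set \<Rightarrow> ('a \<Rightarrow> real) \<Rightarrow> bool" where
  "smooth 0 S W f \<longleftrightarrow> continuous_on W f"
| "smooth (Suc k) S W f \<longleftrightarrow> (\<exists>L. (\<forall>(a, \<psi>)\<in>set L. smooth k S W a \<and> bounded_linear \<psi>) \<and>
     (\<forall>y\<in>W. (f has_derivative lform L y) (at y within S)))"

declare smooth.simps(2) [simp del]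

lemma smooth_continuous_on:
  assumes "smooth k S W f" "W \<subseteq> S" shows "continuous_on W f"
proof (cases k)
  case 0 then show ?thesis using assms by simp
next
  case (Suc n)
  then obtain L where "\<And>y. y \<in> W \<Longrightarrow> (f has_derivative lform L y) (at y within S)"
    using assms(1) by (auto simp: smooth.simps(2))
  then show ?thesis
    unfolding continuous_on_eq_continuous_within
    by (meson assms(2) has_derivative_continuous continuous_within_subset)
qed

lemma smooth_Suc_imp: "W \<subseteq> S \<Longrightarrow> smooth (Suc k) S W f \<Longrightarrow> smooth k S W f"
proof (induction k arbitrary: f)
  case 0
  then show ?case using smooth_continuous_on[of 1 S W f] by simp
next
  case (Suc k)
  obtain L where L: "\<forall>(a, \<psi>)\<in>set L. smooth (Suc k) S W a \<and> bounded_linear \<psi>"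
    "\<forall>y\<in>W. (f has_derivative lform L y) (at y within S)"
    using Suc.prems(2) unfolding smooth.simps(2)[of "Suc k"] by blast
  then have "\<forall>(a, \<psi>)\<in>set L. smooth k S W a \<and> bounded_linear \<psi>"
    using Suc.IH[OF Suc.prems(1)] by auto
  then show ?case unfolding smooth.simps(2)[of k] using L(2) by blast
qed

lemma smooth_subset: "smooth k S W f \<Longrightarrow> V \<subseteq> W \<Longrightarrow> smooth k S V f"
proof (induction k arbitrary: f)
  case 0 then show ?case by (auto intro: continuous_on_subset)
next
  case (Suc k)
  obtain L where "\<forall>(a, \<psi>)\<in>set L. smooth k S W a \<and> bounded_linear \<psi>"
    "\<forall>y\<in>W. (f has_derivative lform L y) (at y within S)"
    using Suc.prems(1) unfolding smooth.simps(2) by blast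
  then show ?case
    unfolding smooth.simps(2) using Suc.IH Suc.prems(2) by (intro exI[of _ L]) auto
qed

lemma smooth_const: "smooth k S W (\<lambda>_. c)"
proof (induction k arbitrary: c)
  case (Suc k)
  show ?case
    unfolding smooth.simps(2)
    by (rule exI[of _ "[]"]) (auto intro!: derivative_eq_intros simp: fun_eq_iff)
qed simp

lemma smooth_bounded_linear:
  assumes "bounded_linear \<psi>" shows "smooth k S W \<psi>"
proof (cases k)
  case 0 then show ?thesis using assms by (simp add: linear_continuous_on)
next
  case (Suc n)
  have "lform [(\<lambda>_. 1, \<psi>)] y = \<psi>" for y by (auto simp: fun_eq_iff)
  then show ?thesis
    unfolding Suc smooth.simps(2)
    using assms smooth_const bounded_linear_imp_has_derivative
    by (intro exI[of _ "[(\<lambda>_. 1, \<psi>)]"]) auto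
qed

lemma smooth_cong:
  assumes W: "openin (top_of_set S) W" and eq: "\<And>x. x \<in> W \<Longrightarrow> f x = g x" and f: "smooth k S W f"
  shows "smooth k S W g"
proof (cases k)
  case 0 then show ?thesis using f eq continuous_on_cong[of W W f g] by simp
next
  case (Suc n)
  have "(g has_derivative f') (at y within S)" if y: "y \<in> W" and d: "(f has_derivative f') (at y within S)" for y f'
  proof -
    obtain e where e: "0 < e" "\<And>x'. x' \<in> S \<Longrightarrow> dist x' y < e \<Longrightarrow> x' \<in> W"
      using W y unfolding openin_euclidean_subtopology_iff by blast
    show ?thesis
      by (rule has_derivative_transform_within[OF d e(1)]) (use W y e eq openin_imp_subset in blast)+
  qed
  moreover obtain L where "\<forall>(a, \<psi>)\<in>set L. smooth n S W a \<and> bounded_linear \<psi>"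
    "\<forall>y\<in>W. (f has_derivative lform L y) (at y within S)"
    using f unfolding Suc smooth.simps(2) by blast
  ultimately show ?thesis unfolding Suc smooth.simps(2) by blast
qed

lemma smooth_add: "smooth k S W f \<Longrightarrow> smooth k S W g \<Longrightarrow> smooth k S W (\<lambda>x. f x + g x)"
proof (cases k)
  case (Suc n)
  assume f: "smooth k S W f" and g: "smooth k S W g"
  obtain L where L: "\<forall>(a, \<psi>)\<in>set L. smooth n S W a \<and> bounded_linear \<psi>"
    "\<And>y. y \<in> W \<Longrightarrow> (f has_derivative lform L y) (at y within S)"
    using f unfolding Suc smooth.simps(2) by blast
  obtain M where M: "\<forall>(a, \<psi>)\<in>set M. smooth n S W a \<and> bounded_linear \<psi>"
    "\<And>y. y \<in> W \<Longrightarrow> (g has_derivative lform M y) (at y within S)"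
    using g unfolding Suc smooth.simps(2) by blast
  show ?thesis
    unfolding Suc smooth.simps(2)
  proof (intro exI[of _ "L @ M"] conjI ballI)
    show "case i of (a, \<psi>) \<Rightarrow> smooth n S W a \<and> bounded_linear \<psi>" if "i \<in> set (L @ M)" for i
      using that L(1) M(1) by auto
    fix y assume "y \<in> W"
    then show "((\<lambda>x. f x + g x) has_derivative lform (L @ M) y) (at y within S)"
      using has_derivative_add[OF L(2) M(2)] by (simp add: lform_append[abs_def])
  qed
qed (auto intro: continuous_on_add)

lemma smooth_mult: "W \<subseteq> S \<Longrightarrow> smooth k S W f \<Longrightarrow> smooth k S W g \<Longrightarrow> smooth k S W (\<lambda>x. f x * g x)"
proof (induction k arbitrary: f g)
  case 0 then show ?case by (auto intro: continuous_on_mult)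
next
  case (Suc n)
  note f = Suc.prems(2) and g = Suc.prems(3)
  have f': "smooth n S W f" and g': "smooth n S W g"
    using f g Suc.prems(1) smooth_Suc_imp by blast+
  obtain L where L: "\<forall>(a, \<psi>)\<in>set L. smooth n S W a \<and> bounded_linear \<psi>"
    "\<And>y. y \<in> W \<Longrightarrow> (f has_derivative lform L y) (at y within S)"
    using f unfolding smooth.simps(2) by blast
  obtain M where M: "\<forall>(a, \<psi>)\<in>set M. smooth n S W a \<and> bounded_linear \<psi>"
    "\<And>y. y \<in> W \<Longrightarrow> (g has_derivative lform M y) (at y within S)"
    using g unfolding smooth.simps(2) by blast
  let ?L = "map (\<lambda>(a, \<psi>). (\<lambda>y. f y * a y, \<psi>)) M @ map (\<lambda>(a, \<psi>). (\<lambda>y. g y * a y, \<psi>)) L"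
  show ?case
    unfolding smooth.simps(2)
  proof (intro exI[of _ ?L] conjI ballI)
    show "case i of (a, \<psi>) \<Rightarrow> smooth n S W a \<and> bounded_linear \<psi>" if "i \<in> set ?L" for i
    proof -
      have *: "smooth n S W (\<lambda>y. f y * a y)" "smooth n S W (\<lambda>y. g y * a y)" if "smooth n S W a" for a
        using Suc.IH[OF Suc.prems(1) f' that] Suc.IH[OF Suc.prems(1) g' that] by auto
      show ?thesis using that L(1) M(1) * by auto
    qed
    fix y assume y: "y \<in> W"
    have "lform ?L y = (\<lambda>v. f y * lform M y v + lform L y v * g y)"
      by (auto simp: fun_eq_iff lform_scale)
    then show "((\<lambda>x. f x * g x) has_derivative lform ?L y) (at y within S)"
      using has_derivative_mult[OF L(2)[OF y] M(2)[OF y]] by simp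
  qed
qed

text \<open>A class closed under differentiation replaces the sequence of higher derivatives; it is
  the induction invariant of \<open>smooth_compose\<close>.\<close>

definition smooth_real :: "real set \<Rightarrow> (real \<Rightarrow> real) \<Rightarrow> bool" where
  "smooth_real T \<theta> \<longleftrightarrow> (\<exists>C. \<theta> \<in> C \<and> (\<forall>f\<in>C. \<exists>f'\<in>C. \<forall>t\<in>T. (f has_real_derivative f' t) (at t)))"

lemma smooth_compose:
  assumes "smooth_real T \<theta>" "smooth k S W f" "W \<subseteq> S" "f ` W \<subseteq> T"
  shows "smooth k S W (\<lambda>x. \<theta> (f x))"
proof -
  obtain C where C: "\<theta> \<in> C" "\<And>h. h \<in> C \<Longrightarrow> \<exists>h'\<in>C. \<forall>t\<in>T. (h has_real_derivative h' t) (at t)"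
    using assms(1) unfolding smooth_real_def by blast
  have "smooth k S W (\<lambda>x. h (f x))" if "h \<in> C" for h
    using that assms(2)
  proof (induction k arbitrary: h)
    case 0
    obtain h' where "\<forall>t\<in>T. (h has_real_derivative h' t) (at t)" using C(2)[OF 0(1)] by blast
    then have "continuous_on T h" by (meson DERIV_continuous_on has_field_derivative_at_within)
    then show ?case
      using 0 assms(4) by (auto intro: continuous_on_compose2)
  next
    case (Suc n)
    obtain h' where h': "h' \<in> C" "\<And>t. t \<in> T \<Longrightarrow> (h has_real_derivative h' t) (at t)"
      using C(2)[OF Suc.prems(1)] by blast
    have "smooth n S W f" using Suc.prems(2) assms(3) smooth_Suc_imp by blast
    then have sh': "smooth n S W (\<lambda>x. h' (f x))" by (rule Suc.IH[OF h'(1)])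
    obtain L where L: "\<forall>(a, \<psi>)\<in>set L. smooth n S W a \<and> bounded_linear \<psi>"
      "\<And>y. y \<in> W \<Longrightarrow> (f has_derivative lform L y) (at y within S)"
      using Suc.prems(2) unfolding smooth.simps(2) by blast
    let ?L = "map (\<lambda>(a, \<psi>). (\<lambda>y. h' (f y) * a y, \<psi>)) L"
    show ?case
      unfolding smooth.simps(2)
    proof (intro exI[of _ ?L] conjI ballI)
      show "case i of (a, \<psi>) \<Rightarrow> smooth n S W a \<and> bounded_linear \<psi>" if "i \<in> set ?L" for i
        using that L(1) smooth_mult[OF assms(3) sh'] by auto
      fix y assume y: "y \<in> W"
      have "((\<lambda>x. h (f x)) has_derivative (\<lambda>v. h' (f y) * lform L y v)) (at y within S)"
        using has_derivative_compose[OF L(2)[OF y], of h "(*) (h' (f y))"] h'(2)[of "f y"] assms(4) y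
        by (auto simp: has_field_derivative_def)
      then show "((\<lambda>x. h (f x)) has_derivative lform ?L y) (at y within S)"
        by (simp add: lform_scale[of "\<lambda>y. h' (f y)", abs_def])
    qed
  qed
  then show ?thesis using C(1) by blast
qed

lemma smooth_affine:
  assumes "subspace S" "b \<in> S" "smooth k S W f" "(\<lambda>y. c *\<^sub>R y + b) ` V \<subseteq> W"
  shows "smooth k S V (\<lambda>y. f (c *\<^sub>R y + b))"
  using assms(3)
proof (induction k arbitrary: f)
  case 0
  then show ?case
    using assms(4) by (auto intro!: continuous_on_compose2[of W f] continuous_intros)
next
  case (Suc n)
  obtain L where L: "\<forall>(a, \<psi>)\<in>set L. smooth n S W a \<and> bounded_linear \<psi>"
    "\<And>y. y \<in> W \<Longrightarrow> (f has_derivative lform L y) (at y within S)"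
    using Suc.prems unfolding smooth.simps(2) by blast
  let ?T = "\<lambda>y. c *\<^sub>R y + b"
  let ?L = "map (\<lambda>(a, \<psi>). (\<lambda>y. a (?T y), \<lambda>v. c * \<psi> v)) L"
  show ?case
    unfolding smooth.simps(2)
  proof (intro exI[of _ ?L] conjI ballI)
    show "case i of (a, \<psi>) \<Rightarrow> smooth n S V a \<and> bounded_linear \<psi>" if "i \<in> set ?L" for i
      using that L(1) Suc.IH by (auto intro: bounded_linear_const_mult)
    fix y assume y: "y \<in> V"
    have "?T ` S \<subseteq> S" using assms(1,2) by (auto intro: subspace_add subspace_scale)
    then have "(f has_derivative lform L (?T y)) (at (?T y) within ?T ` S)"
      using L(2)[of "?T y"] y assms(4) by (blast intro: has_derivative_subset)
    moreover have "(?T has_derivative (\<lambda>v. c *\<^sub>R v)) (at y within S)"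
      by (auto intro!: derivative_eq_intros)
    ultimately have "((\<lambda>x. f (?T x)) has_derivative (\<lambda>v. lform L (?T y) (c *\<^sub>R v))) (at y within S)"
      by (intro has_derivative_in_compose[of ?T "\<lambda>v. c *\<^sub>R v" y S f])
    moreover have "lform ?L y = (\<lambda>v. lform L (?T y) (c *\<^sub>R v))"
      using lform_affine[of L ?T c y] L(1) by (auto simp: fun_eq_iff)
    ultimately show "((\<lambda>x. f (?T x)) has_derivative lform ?L y) (at y within S)" by simp
  qed
qed

lemma smooth_sum:
  "finite I \<Longrightarrow> (\<And>i. i \<in> I \<Longrightarrow> smooth k S W (f i)) \<Longrightarrow> smooth k S W (\<lambda>x. \<Sum>i\<in>I. f i x)"
  by (induction I rule: finite_induct) (auto intro: smooth_const smooth_add)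

lemma smooth_real_inverse: "smooth_real {t. t \<noteq> 0} inverse"
  unfolding smooth_real_def
proof (intro exI[of _ "range (\<lambda>(c::real, n::nat) t. c * inverse t ^ n)"] conjI ballI)
  show "inverse \<in> range (\<lambda>(c::real, n::nat) t. c * inverse t ^ n)"
    by (rule image_eqI[of _ _ "(1, 1)"]) (auto simp: fun_eq_iff)
  fix f assume "f \<in> range (\<lambda>(c::real, n::nat) t. c * inverse t ^ n)"
  then obtain c n where f: "f = (\<lambda>t. c * inverse t ^ n)" by auto
  have "(f has_real_derivative (- c * n) * inverse t ^ (n + 1)) (at t)" if "t \<noteq> 0" for t
    using DERIV_cmult[OF DERIV_power[OF DERIV_inverse[OF that]], of c n]
    unfolding f by (cases n) (simp_all add: algebra_simps)
  then show "\<exists>f'\<in>range (\<lambda>(c::real, n::nat) t. c * inverse t ^ n).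
      \<forall>t\<in>{t. t \<noteq> 0}. (f has_real_derivative f' t) (at t)"
    by (intro bexI[of _ "\<lambda>t. (- c * n) * inverse t ^ (n + 1)"]) (auto intro!: image_eqI[of _ _ "(- c * n, n + 1)"])
qed

subsection \<open>From iterated directional derivatives to Fr\'echet derivatives\<close>

text \<open>Being determined by \<open>f\<close> alone, iterated directional derivatives can be computed from different
  local representations of \<open>f\<close>.\<close>

primrec dirD :: "'a::real_normed_vector list \<Rightarrow> ('a \<Rightarrow> real) \<Rightarrow> 'a \<Rightarrow> real" where
  "dirD [] f x = f x"
| "dirD (w # vs) f x = deriv (\<lambda>t. dirD vs f (x + t *\<^sub>R w)) 0"

lemma eventually_on_line:
  fixes w :: "'a::real_normed_vector"
  assumes "openin (top_of_set S) W" "subspace S" "x \<in> W" "w \<in> S"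
  shows "\<forall>\<^sub>F t in nhds 0. x + t *\<^sub>R w \<in> W"
proof -
  obtain T where T: "open T" "W = S \<inter> T" using assms(1) openin_open by blast
  have "continuous_on UNIV (\<lambda>t. x + t *\<^sub>R w)" by (intro continuous_intros)
  then have "open ((\<lambda>t. x + t *\<^sub>R w) -` T)" using T(1) by (metis open_vimage)
  moreover have "0 \<in> (\<lambda>t. x + t *\<^sub>R w) -` T" using assms(3) T by simp
  ultimately have "\<forall>\<^sub>F t in nhds 0. t \<in> (\<lambda>t. x + t *\<^sub>R w) -` T" by (rule eventually_nhds_in_open)
  then show ?thesis
    using T assms by (auto elim!: eventually_mono intro!: subspace_add subspace_scale)
qed

lemma lform_has_derivative:
  assumes "\<And>a \<psi>. (a, \<psi>) \<in> set L \<Longrightarrow> ((\<lambda>t. h a t) has_real_derivative h' a) (at 0)"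
  shows "((\<lambda>t. \<Sum>(a, \<psi>)\<leftarrow>L. h a t * \<psi> v) has_real_derivative (\<Sum>(a, \<psi>)\<leftarrow>L. h' a * \<psi> v)) (at 0)"
  using assms by (induction L) (auto intro!: derivative_eq_intros split: prod.splits)

context
  fixes S W :: "'a::real_normed_vector set"
  assumes S: "subspace S" and W: "openin (top_of_set S) W"
begin

text \<open>\<open>deriv\<close> has a value even where no derivative exists. This predicate ensures
  that the iterated values in \<open>dirD\<close> are genuine derivatives.\<close>

definition line_differentiable :: "nat \<Rightarrow> ('a \<Rightarrow> real) \<Rightarrow> bool" where
  "line_differentiable k f \<longleftrightarrow> (\<forall>x\<in>W. \<forall>vs. set vs \<subseteq> S \<longrightarrow> length vs < k \<longrightarrow> (\<forall>w\<in>S.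
     ((\<lambda>t. dirD vs f (x + t *\<^sub>R w)) has_real_derivative dirD (w # vs) f x) (at 0)))"

text \<open>The head of the list is differentiated last, so the last entry is the direction of the
  first differentiation. That one is absorbed by the functionals \<open>\<psi>\<close>, and the
  remaining entries act on the coefficients.\<close>

lemma dirD_snoc_aux:
  assumes L: "\<And>a \<psi>. (a, \<psi>) \<in> set L \<Longrightarrow> bounded_linear \<psi>"
    "\<And>a \<psi>. (a, \<psi>) \<in> set L \<Longrightarrow> line_differentiable k a"
    and f: "\<And>y. y \<in> W \<Longrightarrow> (f has_derivative lform L y) (at y within S)"
    and "x \<in> W" "set vs \<subseteq> S" "v \<in> S"
  shows "length vs \<le> k \<Longrightarrow> dirD (vs @ [v]) f x = (\<Sum>(a, \<psi>)\<leftarrow>L. dirD vs a x * \<psi> v)"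
    and "length vs < k \<Longrightarrow> w \<in> S \<Longrightarrow> ((\<lambda>t. dirD (vs @ [v]) f (x + t *\<^sub>R w)) has_real_derivative
      (\<Sum>(a, \<psi>)\<leftarrow>L. dirD (w # vs) a x * \<psi> v)) (at 0)"
proof -
  have line: "((\<lambda>t. f (x + t *\<^sub>R v)) has_real_derivative lform L x v) (at 0)" if "x \<in> W" "v \<in> S" for x v
  proof -
    have xS: "(\<lambda>t. x + t *\<^sub>R v) ` UNIV \<subseteq> S"
      using that openin_imp_subset[OF W] S by (auto intro: subspace_add subspace_scale)
    have "((\<lambda>t. x + t *\<^sub>R v) has_derivative (\<lambda>t. t *\<^sub>R v)) (at 0)"
      by (auto intro!: derivative_eq_intros)
    moreover have "(f has_derivative lform L x) (at (x + 0 *\<^sub>R v) within (\<lambda>t. x + t *\<^sub>R v) ` UNIV)"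
      using f[OF that(1)] xS by (auto intro: has_derivative_subset)
    ultimately have "((\<lambda>t. f (x + t *\<^sub>R v)) has_derivative (\<lambda>t. lform L x (t *\<^sub>R v))) (at 0)"
      by (rule has_derivative_in_compose)
    moreover have "bounded_linear (lform L x)" using L(1) by (intro bounded_linear_lform) auto
    then have "(\<lambda>t. lform L x (t *\<^sub>R v)) = (*) (lform L x v)" by (auto simp: fun_eq_iff linear_simps)
    ultimately show ?thesis by (simp add: has_field_derivative_def)
  qed
  have step: "((\<lambda>t. dirD (vs @ [v]) f (x + t *\<^sub>R w)) has_real_derivative
      (\<Sum>(a, \<psi>)\<leftarrow>L. dirD (w # vs) a x * \<psi> v)) (at 0)"
    if eq: "\<And>x. x \<in> W \<Longrightarrow> dirD (vs @ [v]) f x = (\<Sum>(a, \<psi>)\<leftarrow>L. dirD vs a x * \<psi> v)"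
      and x: "x \<in> W" "w \<in> S" "set vs \<subseteq> S" "length vs < k" for x w vs
  proof -
    have "((\<lambda>t. \<Sum>(a, \<psi>)\<leftarrow>L. dirD vs a (x + t *\<^sub>R w) * \<psi> v) has_real_derivative
        (\<Sum>(a, \<psi>)\<leftarrow>L. dirD (w # vs) a x * \<psi> v)) (at 0)"
      by (rule lform_has_derivative) (use L(2) x in \<open>auto simp: line_differentiable_def\<close>)
    \<comment> \<open>The formula is known on \<open>W\<close> only, but short steps from
      \<open>x\<close> along \<open>w\<close> stay in \<open>W\<close>.\<close>
    moreover have "\<forall>\<^sub>F t in nhds 0. dirD (vs @ [v]) f (x + t *\<^sub>R w) = (\<Sum>(a, \<psi>)\<leftarrow>L. dirD vs a (x + t *\<^sub>R w) * \<psi> v)"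
      using eventually_on_line[OF W S x(1,2)] by eventually_elim (rule eq)
    ultimately show ?thesis
      by (subst DERIV_cong_ev[OF refl _ refl])
  qed
  have eq: "dirD (vs @ [v]) f x = (\<Sum>(a, \<psi>)\<leftarrow>L. dirD vs a x * \<psi> v)"
    if "x \<in> W" "set vs \<subseteq> S" "length vs \<le> k" for x vs
    using that
  proof (induction vs arbitrary: x)
    case Nil
    then show ?case using DERIV_imp_deriv[OF line[OF Nil(1) assms(6)]] by (simp add: lform_def)
  next
    case (Cons w vs)
    have "((\<lambda>t. dirD (vs @ [v]) f (x + t *\<^sub>R w)) has_real_derivative
      (\<Sum>(a, \<psi>)\<leftarrow>L. dirD (w # vs) a x * \<psi> v)) (at 0)"
      by (rule step) (use Cons in auto)
    then have "deriv (\<lambda>t. dirD (vs @ [v]) f (x + t *\<^sub>R w)) 0 = (\<Sum>(a, \<psi>)\<leftarrow>L. dirD (w # vs) a x * \<psi> v)"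
      by (rule DERIV_imp_deriv)
    then show ?case by simp
  qed
  show "length vs \<le> k \<Longrightarrow> dirD (vs @ [v]) f x = (\<Sum>(a, \<psi>)\<leftarrow>L. dirD vs a x * \<psi> v)"
    using eq assms by blast
  show "length vs < k \<Longrightarrow> w \<in> S \<Longrightarrow> ((\<lambda>t. dirD (vs @ [v]) f (x + t *\<^sub>R w)) has_real_derivative
      (\<Sum>(a, \<psi>)\<leftarrow>L. dirD (w # vs) a x * \<psi> v)) (at 0)"
    by (rule step) (use eq assms in auto)
qed

lemma smooth_line_differentiable: "smooth k S W f \<Longrightarrow> line_differentiable k f"
proof (induction k arbitrary: f)
  case 0 then show ?case by (simp add: line_differentiable_def)
next
  case (Suc k)
  obtain L where L: "\<forall>(a, \<psi>)\<in>set L. smooth k S W a \<and> bounded_linear \<psi>"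
    "\<And>y. y \<in> W \<Longrightarrow> (f has_derivative lform L y) (at y within S)"
    using Suc.prems unfolding smooth.simps(2) by blast
  have L1: "bounded_linear \<psi>" "line_differentiable k a" if "(a, \<psi>) \<in> set L" for a \<psi>
    using L(1) that Suc.IH by auto
  show ?case
    unfolding line_differentiable_def
  proof (intro ballI allI impI)
    fix x vs w assume x: "x \<in> W" "set vs \<subseteq> S" "length vs < Suc k" "w \<in> S"
    show "((\<lambda>t. dirD vs f (x + t *\<^sub>R w)) has_real_derivative dirD (w # vs) f x) (at 0)"
    proof (cases vs rule: rev_cases)
      case Nil
      have d: "(f has_derivative lform L x) (at x within S)" by (rule L(2)[OF x(1)])
      have xS: "(\<lambda>t. x + t *\<^sub>R w) ` UNIV \<subseteq> S"
        using x openin_imp_subset[OF W] S by (auto intro: subspace_add subspace_scale)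
      have "((\<lambda>t. f (x + t *\<^sub>R w)) has_derivative (\<lambda>t. lform L x (t *\<^sub>R w))) (at 0)"
      proof (rule has_derivative_in_compose[of "\<lambda>t. x + t *\<^sub>R w" "\<lambda>t. t *\<^sub>R w" 0 UNIV])
        show "((\<lambda>t. x + t *\<^sub>R w) has_derivative (\<lambda>t. t *\<^sub>R w)) (at 0)"
          by (auto intro!: derivative_eq_intros)
        show "(f has_derivative lform L x) (at (x + 0 *\<^sub>R w) within (\<lambda>t. x + t *\<^sub>R w) ` UNIV)"
          using d xS by (auto intro: has_derivative_subset)
      qed
      moreover have "bounded_linear (lform L x)" using L1(1) by (intro bounded_linear_lform) auto
      then have "(\<lambda>t. lform L x (t *\<^sub>R w)) = (*) (lform L x w)" by (auto simp: fun_eq_iff linear_simps)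
      ultimately have "((\<lambda>t. f (x + t *\<^sub>R w)) has_real_derivative lform L x w) (at 0)"
        by (simp add: has_field_derivative_def)
      moreover from this have "deriv (\<lambda>t. f (x + t *\<^sub>R w)) 0 = lform L x w" by (rule DERIV_imp_deriv)
      ultimately show ?thesis by (simp add: Nil)
    next
      case (snoc us v)
      have "((\<lambda>t. dirD (us @ [v]) f (x + t *\<^sub>R w)) has_real_derivative
          (\<Sum>(a, \<psi>)\<leftarrow>L. dirD (w # us) a x * \<psi> v)) (at 0)"
        by (rule dirD_snoc_aux(2)[OF L1 L(2)]) (use x snoc in auto)
      moreover from this have "deriv (\<lambda>t. dirD (us @ [v]) f (x + t *\<^sub>R w)) 0 = (\<Sum>(a, \<psi>)\<leftarrow>L. dirD (w # us) a x * \<psi> v)"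
        by (rule DERIV_imp_deriv)
      ultimately show ?thesis by (simp add: snoc)
    qed
  qed
qed

lemma dirD_snoc:
  assumes L: "\<forall>(a, \<psi>)\<in>set L. smooth k S W a \<and> bounded_linear \<psi>"
    and f: "\<And>y. y \<in> W \<Longrightarrow> (f has_derivative lform L y) (at y within S)"
    and x: "x \<in> W" "vs \<in> tuples S (Suc j)" "j \<le> k"
  shows "dirD vs f x = (\<Sum>(a, \<psi>)\<leftarrow>L. dirD (butlast vs) a x * \<psi> (last vs))"
proof (cases vs rule: rev_cases)
  case Nil then show ?thesis using x by (simp add: tuples_def)
next
  case (snoc us v)
  have "dirD (us @ [v]) f x = (\<Sum>(a, \<psi>)\<leftarrow>L. dirD us a x * \<psi> v)"
    by (rule dirD_snoc_aux(1)[where k=k]) (use L f x snoc smooth_line_differentiable in \<open>auto simp: tuples_def\<close>)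
  then show ?thesis by (simp add: snoc)
qed

end

lemma tuples_update: "vs \<in> tuples S j \<Longrightarrow> z \<in> S \<Longrightarrow> vs[i := z] \<in> tuples S j"
  using set_update_subset_insert[of vs i z] by (auto simp: tuples_def)

lemma bounded_multilinear_on_cong:
  assumes S: "subspace S" and eq: "\<And>vs. vs \<in> tuples S j \<Longrightarrow> T vs = T' vs"
    and T: "bounded_multilinear_on S j T"
  shows "bounded_multilinear_on S j T'"
proof -
  obtain C where C: "\<And>vs. vs \<in> tuples S j \<Longrightarrow> \<bar>T vs\<bar> \<le> C * prod_list (map norm vs)"
    using T unfolding bounded_multilinear_on_def by blast
  show ?thesis
    unfolding bounded_multilinear_on_def
  proof (intro conjI ballI allI impI)
    fix vs i v w assume vs: "vs \<in> tuples S j" "i < j" "v \<in> S" "w \<in> S"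
    show "T' (vs[i := v + w]) = T' (vs[i := v]) + T' (vs[i := w])"
      using T vs tuples_update[OF vs(1)] subspace_add[OF S vs(3,4)]
      unfolding bounded_multilinear_on_def by (simp flip: eq)
  next
    fix vs i c v assume vs: "vs \<in> tuples S j" "i < j" "v \<in> S"
    show "T' (vs[i := c *\<^sub>R v]) = c * T' (vs[i := v])"
      using T vs tuples_update[OF vs(1)] subspace_scale[OF S vs(3)]
      unfolding bounded_multilinear_on_def by (simp flip: eq)
  next
    show "\<exists>C. \<forall>vs\<in>tuples S j. \<bar>T' vs\<bar> \<le> C * prod_list (map norm vs)"
      using C eq by (intro exI[of _ C]) simp
  qed
qed

lemma bounded_multilinear_on_zero: "bounded_multilinear_on S j (\<lambda>_. 0)"
  unfolding bounded_multilinear_on_def by (auto intro: exI[of _ 0])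

lemma bounded_multilinear_on_add:
  assumes T: "bounded_multilinear_on S j T" and T': "bounded_multilinear_on S j T'"
  shows "bounded_multilinear_on S j (\<lambda>vs. T vs + T' vs)"
proof -
  obtain C where C: "\<And>vs. vs \<in> tuples S j \<Longrightarrow> \<bar>T vs\<bar> \<le> C * prod_list (map norm vs)"
    using T unfolding bounded_multilinear_on_def by blast
  obtain C' where C': "\<And>vs. vs \<in> tuples S j \<Longrightarrow> \<bar>T' vs\<bar> \<le> C' * prod_list (map norm vs)"
    using T' unfolding bounded_multilinear_on_def by blast
  have "\<bar>T vs + T' vs\<bar> \<le> (C + C') * prod_list (map norm vs)" if "vs \<in> tuples S j" for vs
    using C[OF that] C'[OF that] by (simp add: distrib_right)
  then have "\<exists>C. \<forall>vs\<in>tuples S j. \<bar>T vs + T' vs\<bar> \<le> C * prod_list (map norm vs)" by blast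
  then show ?thesis
    using T T' unfolding bounded_multilinear_on_def by (simp add: algebra_simps)
qed

lemma bounded_multilinear_on_snoc:
  assumes T: "bounded_multilinear_on S i T" and \<psi>: "bounded_linear \<psi>"
  shows "bounded_multilinear_on S (Suc i) (\<lambda>vs. T (butlast vs) * \<psi> (last vs))"
proof -
  have snoc: "\<exists>us v. vs = us @ [v] \<and> us \<in> tuples S i \<and> v \<in> S" if "vs \<in> tuples S (Suc i)" for vs
    using that by (cases vs rule: rev_cases) (auto simp: tuples_def)
  obtain C where C: "\<And>vs. vs \<in> tuples S i \<Longrightarrow> \<bar>T vs\<bar> \<le> C * prod_list (map norm vs)"
    using T unfolding bounded_multilinear_on_def by blast
  obtain K where K: "K > 0" "\<And>v. \<bar>\<psi> v\<bar> \<le> norm v * K"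
    using bounded_linear.pos_bounded[OF \<psi>] by auto
  show ?thesis
    unfolding bounded_multilinear_on_def
  proof (intro conjI ballI allI impI)
    fix vs l v w assume vs: "vs \<in> tuples S (Suc i)" "l < Suc i" "v \<in> S" "w \<in> S"
    obtain us z where us: "vs = us @ [z]" "us \<in> tuples S i" "z \<in> S" using snoc[OF vs(1)] by blast
    have len: "length us = i" using us(2) by (simp add: tuples_def)
    show "T (butlast (vs[l := v + w])) * \<psi> (last (vs[l := v + w])) =
      T (butlast (vs[l := v])) * \<psi> (last (vs[l := v])) + T (butlast (vs[l := w])) * \<psi> (last (vs[l := w]))"
    proof (cases "l = i")
      case True
      then show ?thesis using us len \<psi> by (simp add: list_update_append linear_simps algebra_simps)
    next
      case False
      then have "l < i" using vs(2) by simp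
      then have "T (us[l := v + w]) = T (us[l := v]) + T (us[l := w])"
        using T us(2) vs unfolding bounded_multilinear_on_def by blast
      then show ?thesis using us len \<open>l < i\<close> by (simp add: list_update_append1 algebra_simps)
    qed
  next
    fix vs l c v assume vs: "vs \<in> tuples S (Suc i)" "l < Suc i" "v \<in> S"
    obtain us z where us: "vs = us @ [z]" "us \<in> tuples S i" "z \<in> S" using snoc[OF vs(1)] by blast
    have len: "length us = i" using us(2) by (simp add: tuples_def)
    show "T (butlast (vs[l := c *\<^sub>R v])) * \<psi> (last (vs[l := c *\<^sub>R v])) =
      c * (T (butlast (vs[l := v])) * \<psi> (last (vs[l := v])))"
    proof (cases "l = i")
      case True
      then show ?thesis using us len \<psi> by (simp add: list_update_append linear_simps)
    next
      case False
      then have "l < i" using vs(2) by simp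
      then have "T (us[l := c *\<^sub>R v]) = c * T (us[l := v])"
        using T us(2) vs unfolding bounded_multilinear_on_def by blast
      then show ?thesis using us len \<open>l < i\<close> by (simp add: list_update_append1)
    qed
  next
    have "\<bar>T (butlast vs) * \<psi> (last vs)\<bar> \<le> (C * K) * prod_list (map norm vs)" if vs: "vs \<in> tuples S (Suc i)" for vs
    proof -
      obtain us z where us: "vs = us @ [z]" "us \<in> tuples S i" "z \<in> S" using snoc[OF vs] by blast
      have "\<bar>T us\<bar> * \<bar>\<psi> z\<bar> \<le> (C * prod_list (map norm us)) * (norm z * K)"
        using C[OF us(2)] K(2)[of z] by (intro mult_mono) (auto intro: order_trans[OF abs_ge_zero])
      then show ?thesis by (simp add: us abs_mult mult_ac)
    qed
    then show "\<exists>C. \<forall>vs\<in>tuples S (Suc i). \<bar>T (butlast vs) * \<psi> (last vs)\<bar> \<le> C * prod_list (map norm vs)"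
      by blast
  qed
qed

lemma bounded_multilinear_on_lform:
  fixes L :: "('c \<times> ('a::real_normed_vector \<Rightarrow> real)) list" and T :: "'c \<Rightarrow> 'a list \<Rightarrow> real"
  assumes "\<And>a \<psi>. (a, \<psi>) \<in> set L \<Longrightarrow> bounded_multilinear_on S i (T a) \<and> bounded_linear \<psi>"
  shows "bounded_multilinear_on S (Suc i) (\<lambda>vs. \<Sum>(a, \<psi>)\<leftarrow>L. T a (butlast vs) * \<psi> (last vs))"
  using assms
proof (induction L)
  case Nil
  then show ?case by (simp add: bounded_multilinear_on_zero)
next
  case (Cons p L)
  obtain a \<psi> where p: "p = (a, \<psi>)" by (cases p)
  have "bounded_multilinear_on S (Suc i) (\<lambda>vs. T a (butlast vs) * \<psi> (last vs))"
    using Cons.prems[of a \<psi>] by (intro bounded_multilinear_on_snoc) (auto simp: p)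
  moreover have "bounded_multilinear_on S (Suc i) (\<lambda>vs. \<Sum>(a, \<psi>)\<leftarrow>L. T a (butlast vs) * \<psi> (last vs))"
    using Cons by auto
  ultimately show ?case by (simp add: p bounded_multilinear_on_add)
qed

lemma uniform_limit_snoc:
  fixes \<psi> :: "'a::real_normed_vector \<Rightarrow> real" and F :: "'b \<Rightarrow> 'a list \<Rightarrow> real"
  assumes F: "uniform_limit (unit_tuples S i) F (\<lambda>_. 0) l" and \<psi>: "bounded_linear \<psi>"
  shows "uniform_limit (unit_tuples S (Suc i)) (\<lambda>y vs. F y (butlast vs) * \<psi> (last vs)) (\<lambda>_. 0) l"
proof (rule uniform_limitI)
  fix \<epsilon> :: real assume "0 < \<epsilon>"
  obtain K where K: "K > 0" "\<And>v. \<bar>\<psi> v\<bar> \<le> norm v * K"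
    using bounded_linear.pos_bounded[OF \<psi>] by auto
  have "\<forall>\<^sub>F y in l. \<forall>vs\<in>unit_tuples S i. dist (F y vs) 0 < \<epsilon> / K"
    using F \<open>0 < \<epsilon>\<close> K(1) by (intro uniform_limitD) auto
  then show "\<forall>\<^sub>F y in l. \<forall>vs\<in>unit_tuples S (Suc i). dist (F y (butlast vs) * \<psi> (last vs)) 0 < \<epsilon>"
  proof eventually_elim
    case (elim y)
    show ?case
    proof
      fix vs assume "vs \<in> unit_tuples S (Suc i)"
      then obtain us z where us: "vs = us @ [z]" "us \<in> unit_tuples S i" "norm z \<le> 1"
        by (cases vs rule: rev_cases) (auto simp: unit_tuples_def tuples_def)
      have "\<bar>\<psi> z\<bar> \<le> K" using K(2)[of z] mult_right_mono[OF us(3), of K] K(1) by linarith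
      then have "\<bar>F y us\<bar> * \<bar>\<psi> z\<bar> \<le> \<bar>F y us\<bar> * K" by (rule mult_left_mono) simp
      also have "\<dots> < \<epsilon>" using elim us(2) K(1) by (simp add: field_simps)
      finally show "dist (F y (butlast vs) * \<psi> (last vs)) 0 < \<epsilon>" by (simp add: us abs_mult)
    qed
  qed
qed

lemma uniform_limit_lform:
  fixes L :: "('c \<times> ('a::real_normed_vector \<Rightarrow> real)) list" and F :: "'c \<Rightarrow> 'b \<Rightarrow> 'a list \<Rightarrow> real"
  assumes "\<And>a \<psi>. (a, \<psi>) \<in> set L \<Longrightarrow> uniform_limit (unit_tuples S i) (F a) (\<lambda>_. 0) l \<and> bounded_linear \<psi>"
  shows "uniform_limit (unit_tuples S (Suc i)) (\<lambda>y vs. \<Sum>(a, \<psi>)\<leftarrow>L. F a y (butlast vs) * \<psi> (last vs)) (\<lambda>_. 0) l"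
  using assms
proof (induction L)
  case Nil
  then show ?case by (simp add: uniform_limit_const)
next
  case (Cons p L)
  obtain a \<psi> where p: "p = (a, \<psi>)" by (cases p)
  have 1: "uniform_limit (unit_tuples S (Suc i)) (\<lambda>y vs. F a y (butlast vs) * \<psi> (last vs)) (\<lambda>_. 0) l"
    using Cons.prems[of a \<psi>] by (intro uniform_limit_snoc) (auto simp: p)
  have 2: "uniform_limit (unit_tuples S (Suc i)) (\<lambda>y vs. \<Sum>(a, \<psi>)\<leftarrow>L. F a y (butlast vs) * \<psi> (last vs)) (\<lambda>_. 0) l"
    using Cons by auto
  show ?case using uniform_limit_add[OF 1 2] by (simp add: p)
qed

lemma sum_list_lform_diff:
  "(\<Sum>(a, \<psi>)\<leftarrow>L. A a * \<psi> v) - (\<Sum>(a, \<psi>)\<leftarrow>L. B a * \<psi> v) = (\<Sum>(a, \<psi>)\<leftarrow>L. (A a - B a) * \<psi> (v::'a) :: real)"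
  by (induction L) (auto simp: algebra_simps)

lemma sum_list_lform_divide:
  "(\<Sum>(a, \<psi>)\<leftarrow>L. A a * \<psi> v) / c = (\<Sum>(a, \<psi>)\<leftarrow>L. A a / c * \<psi> (v::'a) :: real)"
  by (induction L) (auto simp: add_divide_distrib)

context
  fixes S W :: "'a::real_normed_vector set"
  assumes S: "subspace S" and W: "openin (top_of_set S) W"
begin

lemma eventually_in_W: "\<forall>\<^sub>F y in at x within W. y \<in> W"
  by (simp add: eventually_at_filter)

text \<open>A form of order \<open>Suc i\<close> is a finite sum of forms of order \<open>i\<close>
  of the coefficients, each times a functional of the last argument. Hence boundedness, continuity
  and differentiability all pass from the coefficients to \<open>f\<close>; the order 0 case is the
  definition of the derivative.\<close>

lemma smooth_dirD:
  "smooth k S W f \<Longrightarrow> j \<le> k \<Longrightarrow> x \<in> W \<Longrightarrow>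
    bounded_multilinear_on S j (\<lambda>vs. dirD vs f x) \<and>
    uniform_limit (unit_tuples S j) (\<lambda>y vs. dirD vs f y - dirD vs f x) (\<lambda>_. 0) (at x within W) \<and>
    (j < k \<longrightarrow> uniform_limit (unit_tuples S j)
      (\<lambda>y vs. (dirD vs f y - dirD vs f x - dirD ((y - x) # vs) f x) / norm (y - x)) (\<lambda>_. 0) (at x within W))"
proof (induction j arbitrary: k f)
  case 0
  have u0: "unit_tuples S 0 = {[]}" by (auto simp: unit_tuples_def tuples_def)
  have "bounded_multilinear_on S 0 (\<lambda>vs. dirD vs f x)"
    by (auto simp: bounded_multilinear_on_def tuples_def)
  moreover have "continuous_on W f" using 0(1) openin_imp_subset[OF W] by (rule smooth_continuous_on)
  then have "((\<lambda>y. f y - f x) \<longlongrightarrow> f x - f x) (at x within W)"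
    using 0(3) by (intro tendsto_intros) (auto simp: continuous_on_def)
  then have "uniform_limit {[]} (\<lambda>y vs. dirD vs f y - dirD vs f x) (\<lambda>_. 0) (at x within W)"
    by (simp add: uniform_limit_singleton)
  moreover have "uniform_limit {[]}
      (\<lambda>y vs. (dirD vs f y - dirD vs f x - dirD ((y - x) # vs) f x) / norm (y - x)) (\<lambda>_. 0) (at x within W)" if "0 < k"
  proof -
    obtain n where n: "k = Suc n" using \<open>0 < k\<close> by (cases k) auto
    obtain L where L: "\<forall>(a, \<psi>)\<in>set L. smooth n S W a \<and> bounded_linear \<psi>"
      "\<And>y. y \<in> W \<Longrightarrow> (f has_derivative lform L y) (at y within S)"
      using 0(1) unfolding n smooth.simps(2) by blast
    have "(f has_derivative lform L x) (at x within W)"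
      using L(2)[OF 0(3)] openin_imp_subset[OF W] by (rule has_derivative_subset)
    then have "((\<lambda>y. (1 / norm (y - x)) *\<^sub>R (f y - (f x + lform L x (y - x)))) \<longlongrightarrow> 0) (at x within W)"
      by (simp add: has_derivative_within)
    moreover have "\<forall>\<^sub>F y in at x within W. (1 / norm (y - x)) *\<^sub>R (f y - (f x + lform L x (y - x))) =
        (dirD [] f y - dirD [] f x - dirD [y - x] f x) / norm (y - x)"
      using eventually_in_W
    proof eventually_elim
      case (elim y)
      have "[y - x] \<in> tuples S (Suc 0)"
        using elim 0(3) openin_imp_subset[OF W] S by (auto simp: tuples_def intro: subspace_diff)
      then have "dirD [y - x] f x = (\<Sum>(a, \<psi>)\<leftarrow>L. dirD (butlast [y - x]) a x * \<psi> (last [y - x]))"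
        using dirD_snoc[OF S W L 0(3), of "[y - x]" 0] by (simp del: dirD.simps)
      also have "\<dots> = lform L x (y - x)" by (simp add: lform_def)
      finally show ?case by (simp del: dirD.simps(2))
    qed
    ultimately show ?thesis
      unfolding uniform_limit_singleton by (rule Lim_transform_eventually)
  qed
  ultimately show ?case by (simp only: u0) blast
next
  case (Suc i)
  obtain n where n: "k = Suc n" "i \<le> n" using Suc.prems(2) by (cases k) auto
  obtain L where L: "\<forall>(a, \<psi>)\<in>set L. smooth n S W a \<and> bounded_linear \<psi>"
    "\<And>y. y \<in> W \<Longrightarrow> (f has_derivative lform L y) (at y within S)"
    using Suc.prems(1) unfolding n smooth.simps(2) by blast
  note IH = Suc.IH[OF _ n(2) Suc.prems(3)]
  have eq: "dirD vs f y = (\<Sum>(a, \<psi>)\<leftarrow>L. dirD (butlast vs) a y * \<psi> (last vs))"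
    if "y \<in> W" "vs \<in> tuples S (Suc i)" for y vs
    using dirD_snoc[OF S W L that n(2)] by simp
  have unit: "unit_tuples S j \<subseteq> tuples S j" for j by (auto simp: unit_tuples_def tuples_def)
  have "bounded_multilinear_on S (Suc i) (\<lambda>vs. \<Sum>(a, \<psi>)\<leftarrow>L. dirD (butlast vs) a x * \<psi> (last vs))"
    by (rule bounded_multilinear_on_lform[where T="\<lambda>a vs. dirD vs a x"]) (use L(1) IH in auto)
  then have 1: "bounded_multilinear_on S (Suc i) (\<lambda>vs. dirD vs f x)"
    by (rule bounded_multilinear_on_cong[OF S, rotated]) (use eq Suc.prems(3) in auto)
  have "uniform_limit (unit_tuples S (Suc i))
      (\<lambda>y vs. \<Sum>(a, \<psi>)\<leftarrow>L. (dirD (butlast vs) a y - dirD (butlast vs) a x) * \<psi> (last vs)) (\<lambda>_. 0) (at x within W)"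
    by (rule uniform_limit_lform[where F="\<lambda>a y vs. dirD vs a y - dirD vs a x"]) (use L(1) IH in auto)
  moreover have "\<forall>\<^sub>F y in at x within W. \<forall>vs\<in>unit_tuples S (Suc i).
      (\<Sum>(a, \<psi>)\<leftarrow>L. (dirD (butlast vs) a y - dirD (butlast vs) a x) * \<psi> (last vs)) = dirD vs f y - dirD vs f x"
    using eventually_in_W
  proof eventually_elim
    case (elim y)
    then show ?case using eq unit Suc.prems(3) by (auto simp: subset_iff simp flip: sum_list_lform_diff)
  qed
  ultimately have 2: "uniform_limit (unit_tuples S (Suc i)) (\<lambda>y vs. dirD vs f y - dirD vs f x) (\<lambda>_. 0) (at x within W)"
    by (subst (asm) uniform_limit_cong) auto
  have 3: "uniform_limit (unit_tuples S (Suc i))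
      (\<lambda>y vs. (dirD vs f y - dirD vs f x - dirD ((y - x) # vs) f x) / norm (y - x)) (\<lambda>_. 0) (at x within W)"
    if "Suc i < k"
  proof -
    have "i < n" using that n by simp
    let ?F = "\<lambda>a y vs. (dirD vs a y - dirD vs a x - dirD ((y - x) # vs) a x) / norm (y - x)"
    have "uniform_limit (unit_tuples S (Suc i))
        (\<lambda>y vs. \<Sum>(a, \<psi>)\<leftarrow>L. ?F a y (butlast vs) * \<psi> (last vs)) (\<lambda>_. 0) (at x within W)"
      by (rule uniform_limit_lform[where F="?F"]) (use L(1) IH \<open>i < n\<close> in auto)
    moreover have "\<forall>\<^sub>F y in at x within W. \<forall>vs\<in>unit_tuples S (Suc i).
        (\<Sum>(a, \<psi>)\<leftarrow>L. ?F a y (butlast vs) * \<psi> (last vs)) =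
        (dirD vs f y - dirD vs f x - dirD ((y - x) # vs) f x) / norm (y - x)"
      using eventually_in_W
    proof eventually_elim
      case (elim y)
      show ?case
      proof
        fix vs assume "vs \<in> unit_tuples S (Suc i)"
        then have vs: "vs \<in> tuples S (Suc i)" using unit by blast
        then have ne: "vs \<noteq> []" by (auto simp: tuples_def)
        have "(y - x) # vs \<in> tuples S (Suc (Suc i))"
          using vs elim Suc.prems(3) openin_imp_subset[OF W] S by (auto simp: tuples_def intro: subspace_diff)
        then have "dirD ((y - x) # vs) f x = (\<Sum>(a, \<psi>)\<leftarrow>L. dirD (butlast ((y - x) # vs)) a x * \<psi> (last ((y - x) # vs)))"
          using \<open>i < n\<close> by (intro dirD_snoc[OF S W L Suc.prems(3)]) auto
        also have "\<dots> = (\<Sum>(a, \<psi>)\<leftarrow>L. dirD ((y - x) # butlast vs) a x * \<psi> (last vs))"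
          using ne by (simp del: dirD.simps(2))
        finally have e: "dirD ((y - x) # vs) f x = (\<Sum>(a, \<psi>)\<leftarrow>L. dirD ((y - x) # butlast vs) a x * \<psi> (last vs))" .
        show "(\<Sum>(a, \<psi>)\<leftarrow>L. ?F a y (butlast vs) * \<psi> (last vs)) =
            (dirD vs f y - dirD vs f x - dirD ((y - x) # vs) f x) / norm (y - x)"
          unfolding e eq[OF elim vs] eq[OF Suc.prems(3) vs] sum_list_lform_diff
          by (rule sum_list_lform_divide[symmetric])
      qed
    qed
    ultimately show ?thesis by (subst (asm) uniform_limit_cong) auto
  qed
  show ?case using 1 2 3 by blast
qed

end

lemma Ck_on_if_smooth:
  fixes S :: "'a::real_normed_vector set"
  assumes S: "subspace S" and U: "openin (top_of_set S) U"
    and f: "\<And>x. x \<in> U \<Longrightarrow> \<exists>W. openin (top_of_set S) W \<and> x \<in> W \<and> smooth k S W f"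
  shows "Ck_on S U k f"
proof -
  have main: "bounded_multilinear_on S j (\<lambda>vs. dirD vs f x) \<and>
    uniform_limit (unit_tuples S j) (\<lambda>y vs. dirD vs f y - dirD vs f x) (\<lambda>_. 0) (at x within U) \<and>
    (j < k \<longrightarrow> uniform_limit (unit_tuples S j)
      (\<lambda>y vs. (dirD vs f y - dirD vs f x - dirD ((y - x) # vs) f x) / norm (y - x)) (\<lambda>_. 0) (at x within U))"
    if x: "x \<in> U" and j: "j \<le> k" for x j
  proof -
    obtain V where V: "openin (top_of_set S) V" "x \<in> V" "smooth k S V f" using f[OF x] by blast
    define W where "W = V \<inter> U"
    have W: "openin (top_of_set S) W" "x \<in> W" "smooth k S W f"
      using V U x by (auto simp: W_def intro: smooth_subset)
    obtain T where T: "open T" "W = S \<inter> T" using W(1) openin_open by blast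
    have "W \<inter> T = U \<inter> T" using T(2) openin_imp_subset[OF U] by (auto simp: W_def)
    \<comment> \<open>\<open>W\<close> and \<open>U\<close> agree near \<open>x\<close>, and
      \<open>dirD\<close> does not depend on the representation valid in \<open>W\<close>, so the
      limits carry over.\<close>
    then have "at x within W = at x within U"
      using T W(2) by (intro at_within_nhd[of x T]) auto
    then show ?thesis using smooth_dirD[OF S W(1) W(3) j W(2)] by simp
  qed
  have "uniform_limit (unit_tuples S k) (\<lambda>y vs. dirD vs f y) (\<lambda>vs. dirD vs f x) (at x within U)" if "x \<in> U" for x
    using main[OF that, of k] by (simp add: uniform_limit_iff dist_real_def)
  moreover have "has_frechet_derivative_on S U j (\<lambda>x vs. dirD vs f x) (\<lambda>vs. dirD vs f x) x" if "x \<in> U" "j < k" for x j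
    using main[OF that(1), of j] main[OF that(1), of "Suc j"] that(2)
    unfolding has_frechet_derivative_on_def by auto
  ultimately show ?thesis
    unfolding Ck_on_def by (intro exI[of _ "\<lambda>j x vs. dirD vs f x"]) auto
qed

subsection \<open>Germs of smooth functions of finitely many coordinates\<close>

text \<open>The neighbourhood may shrink with \<open>k\<close>, which is harmless for
  \<open>Cinf_on\<close>. A property of a point allows each point to use its own local
  formula.\<close>

definition nice_at :: "'a::real_normed_vector set \<Rightarrow> ('a \<Rightarrow> real) \<Rightarrow> 'a \<Rightarrow> bool" where
  "nice_at S f x \<longleftrightarrow> (\<forall>k. \<exists>W. openin (top_of_set S) W \<and> x \<in> W \<and> smooth k S W f) \<and> lfc_at S f x"

lemma Cinf_on_if_nice_at:
  "subspace S \<Longrightarrow> openin (top_of_set S) U \<Longrightarrow> (\<And>x. x \<in> U \<Longrightarrow> nice_at S f x) \<Longrightarrow> Cinf_on S U f"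
  unfolding Cinf_on_def
proof
  assume *: "subspace S" "openin (top_of_set S) U" "\<And>x. x \<in> U \<Longrightarrow> nice_at S f x"
  show "Ck_on S U k f" for k
    by (rule Ck_on_if_smooth[OF *(1,2)]) (use *(3) in \<open>simp add: nice_at_def\<close>)
qed

lemma lfc_atE:
  assumes "lfc_at S f x"
  obtains U \<Psi> where "openin (top_of_set S) U" "x \<in> U" "finite \<Psi>" "\<Psi> \<subseteq> dual_on S"
    "\<forall>y\<in>U. \<forall>z\<in>U. (\<forall>\<psi>\<in>\<Psi>. \<psi> y = \<psi> z) \<longrightarrow> f y = f z"
  using assms unfolding lfc_at_def by (elim exE conjE)

lemma lfc_atI:
  assumes "openin (top_of_set S) U" "x \<in> U" "finite \<Psi>" "\<Psi> \<subseteq> dual_on S"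
    "\<And>y z. y \<in> U \<Longrightarrow> z \<in> U \<Longrightarrow> (\<And>\<psi>. \<psi> \<in> \<Psi> \<Longrightarrow> \<psi> y = \<psi> z) \<Longrightarrow> f y = f z"
  shows "lfc_at S f x"
proof -
  have "\<forall>y\<in>U. \<forall>z\<in>U. (\<forall>\<psi>\<in>\<Psi>. \<psi> y = \<psi> z) \<longrightarrow> f y = f z"
  proof (intro ballI impI)
    fix y z assume "y \<in> U" "z \<in> U" "\<forall>\<psi>\<in>\<Psi>. \<psi> y = \<psi> z"
    then show "f y = f z" by (intro assms(5)) simp_all
  qed
  with assms(1-4) show ?thesis unfolding lfc_at_def by (intro exI[of _ U] exI[of _ \<Psi>] conjI)
qed

lemma lfc_at_combine:
  assumes "lfc_at S f x" "lfc_at S g x"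
  shows "lfc_at S (\<lambda>y. h (f y) (g y)) x"
proof -
  obtain U \<Psi> where U: "openin (top_of_set S) U" "x \<in> U" "finite \<Psi>" "\<Psi> \<subseteq> dual_on S"
    "\<forall>y\<in>U. \<forall>z\<in>U. (\<forall>\<psi>\<in>\<Psi>. \<psi> y = \<psi> z) \<longrightarrow> f y = f z"
    by (rule lfc_atE[OF assms(1)])
  obtain V \<Xi> where V: "openin (top_of_set S) V" "x \<in> V" "finite \<Xi>" "\<Xi> \<subseteq> dual_on S"
    "\<forall>y\<in>V. \<forall>z\<in>V. (\<forall>\<psi>\<in>\<Xi>. \<psi> y = \<psi> z) \<longrightarrow> g y = g z"
    by (rule lfc_atE[OF assms(2)])
  show ?thesis
  proof (rule lfc_atI[of S "U \<inter> V" x "\<Psi> \<union> \<Xi>"])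
    fix y z assume "y \<in> U \<inter> V" "z \<in> U \<inter> V" "\<And>\<psi>. \<psi> \<in> \<Psi> \<union> \<Xi> \<Longrightarrow> \<psi> y = \<psi> z"
    then have "f y = f z" "g y = g z" using U(5) V(5) by auto
    then show "h (f y) (g y) = h (f z) (g z)" by simp
  qed (use U V in auto)
qed

lemma lfc_at_cong:
  assumes "openin (top_of_set S) U" "x \<in> U" "\<And>y. y \<in> U \<Longrightarrow> f y = g y" "lfc_at S f x"
  shows "lfc_at S g x"
proof -
  obtain V \<Xi> where V: "openin (top_of_set S) V" "x \<in> V" "finite \<Xi>" "\<Xi> \<subseteq> dual_on S"
    "\<forall>y\<in>V. \<forall>z\<in>V. (\<forall>\<psi>\<in>\<Xi>. \<psi> y = \<psi> z) \<longrightarrow> f y = f z"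
    by (rule lfc_atE[OF assms(4)])
  show ?thesis
  proof (rule lfc_atI[of S "U \<inter> V" x \<Xi>])
    fix y z assume "y \<in> U \<inter> V" "z \<in> U \<inter> V" "\<And>\<psi>. \<psi> \<in> \<Xi> \<Longrightarrow> \<psi> y = \<psi> z"
    then show "g y = g z" using V(5) by (simp flip: assms(3))
  qed (use assms V in auto)
qed

lemma dual_on_bounded_linear:
  assumes "bounded_linear \<psi>" shows "\<psi> \<in> dual_on S"
proof -
  obtain K where "\<And>x. norm (\<psi> x) \<le> norm x * K"
    using bounded_linear.bounded[OF assms] by blast
  then have "\<forall>x\<in>S. \<bar>\<psi> x\<bar> \<le> K * norm x" by (simp add: mult.commute)
  then show ?thesis using assms by (auto simp: dual_on_def linear_simps)
qed

lemma nice_at_cong: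
  assumes "openin (top_of_set S) U" "x \<in> U" "\<And>y. y \<in> U \<Longrightarrow> f y = g y" "nice_at S f x"
  shows "nice_at S g x"
  unfolding nice_at_def
proof (intro conjI allI)
  fix k
  obtain W where W: "openin (top_of_set S) W" "x \<in> W" "smooth k S W f"
    using assms(4) unfolding nice_at_def by blast
  have o: "openin (top_of_set S) (U \<inter> W)" using assms(1) W(1) by (rule openin_Int)
  have "smooth k S (U \<inter> W) g"
    by (rule smooth_cong[OF o _ smooth_subset[OF W(3)]]) (use assms(3) in auto)
  then show "\<exists>W. openin (top_of_set S) W \<and> x \<in> W \<and> smooth k S W g"
    using o assms(2) W(2) by blast
next
  show "lfc_at S g x" using assms unfolding nice_at_def by (blast intro: lfc_at_cong)
qed

lemma nice_at_const: "x \<in> S \<Longrightarrow> nice_at S (\<lambda>_. c) x"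
  unfolding nice_at_def
proof (intro conjI allI)
  assume x: "x \<in> S"
  show "\<exists>W. openin (top_of_set S) W \<and> x \<in> W \<and> smooth k S W (\<lambda>_. c)" for k
    using x by (intro exI[of _ S]) (simp add: smooth_const)
  show "lfc_at S (\<lambda>_. c) x"
    by (rule lfc_atI[of S S x "{}"]) (use x in auto)
qed

lemma nice_at_binary:
  assumes "nice_at S f x" "nice_at S g x"
    and "\<And>k W. W \<subseteq> S \<Longrightarrow> smooth k S W f \<Longrightarrow> smooth k S W g \<Longrightarrow> smooth k S W (\<lambda>y. h (f y) (g y))"
  shows "nice_at S (\<lambda>y. h (f y) (g y)) x"
  unfolding nice_at_def
proof (intro conjI allI)
  fix k
  obtain V where V: "openin (top_of_set S) V" "x \<in> V" "smooth k S V f"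
    using assms(1) unfolding nice_at_def by blast
  obtain W where W: "openin (top_of_set S) W" "x \<in> W" "smooth k S W g"
    using assms(2) unfolding nice_at_def by blast
  have o: "openin (top_of_set S) (V \<inter> W)" using V(1) W(1) by (rule openin_Int)
  have "smooth k S (V \<inter> W) (\<lambda>y. h (f y) (g y))"
    by (intro assms(3) smooth_subset[OF V(3)] smooth_subset[OF W(3)]) (use openin_imp_subset[OF o] in auto)
  then show "\<exists>W. openin (top_of_set S) W \<and> x \<in> W \<and> smooth k S W (\<lambda>y. h (f y) (g y))"
    using o V(2) W(2) by blast
next
  show "lfc_at S (\<lambda>y. h (f y) (g y)) x"
    using assms(1,2) lfc_at_combine[of S f x g h] unfolding nice_at_def by simp
qed

lemma nice_at_add: "nice_at S f x \<Longrightarrow> nice_at S g x \<Longrightarrow> nice_at S (\<lambda>y. f y + g y) x"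
  by (rule nice_at_binary[where h="(+)"]) (simp_all add: smooth_add)

lemma nice_at_mult: "nice_at S f x \<Longrightarrow> nice_at S g x \<Longrightarrow> nice_at S (\<lambda>y. f y * g y) x"
  by (rule nice_at_binary[where h="(*)"]) (simp_all add: smooth_mult)

lemma nice_at_in: "nice_at S f x \<Longrightarrow> x \<in> S"
  using openin_imp_subset unfolding nice_at_def by blast

lemma nice_at_sum:
  "finite I \<Longrightarrow> x \<in> S \<Longrightarrow> (\<And>i. i \<in> I \<Longrightarrow> nice_at S (f i) x) \<Longrightarrow> nice_at S (\<lambda>y. \<Sum>i\<in>I. f i y) x"
proof (induction I rule: finite_induct)
  case empty
  then show ?case by (simp add: nice_at_const)
next
  case (insert i I)
  then have "nice_at S (f i) x" "nice_at S (\<lambda>y. \<Sum>i\<in>I. f i y) x" by simp_all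
  then have "nice_at S (\<lambda>y. f i y + (\<Sum>i\<in>I. f i y)) x" by (rule nice_at_add)
  then show ?case using insert(1,2) by simp
qed

lemma nice_at_prod:
  "finite I \<Longrightarrow> x \<in> S \<Longrightarrow> (\<And>i. i \<in> I \<Longrightarrow> nice_at S (f i) x) \<Longrightarrow> nice_at S (\<lambda>y. \<Prod>i\<in>I. f i y) x"
proof (induction I rule: finite_induct)
  case empty
  then show ?case by (simp add: nice_at_const)
next
  case (insert i I)
  then have "nice_at S (f i) x" "nice_at S (\<lambda>y. \<Prod>i\<in>I. f i y) x" by simp_all
  then have "nice_at S (\<lambda>y. f i y * (\<Prod>i\<in>I. f i y)) x" by (rule nice_at_mult)
  then show ?case using insert(1,2) by simp
qed

lemma nice_at_continuous:
  assumes "nice_at S f x" "open T" "f x \<in> T"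
  shows "\<exists>U. openin (top_of_set S) U \<and> x \<in> U \<and> f ` U \<subseteq> T"
proof -
  obtain W where W: "openin (top_of_set S) W" "x \<in> W" "continuous_on W f"
    using assms(1) smooth.simps(1) unfolding nice_at_def by blast
  have "openin (top_of_set W) (W \<inter> f -` T)"
    using continuous_openin_preimage_gen[OF W(3) assms(2)] .
  then have "openin (top_of_set S) (W \<inter> f -` T)" using W(1) openin_trans by blast
  then show ?thesis using W(2) assms(3) by (intro exI[of _ "W \<inter> f -` T"]) auto
qed

lemma nice_at_compose:
  assumes \<theta>: "smooth_real T \<theta>" "open T" and f: "nice_at S f x" "f x \<in> T"
  shows "nice_at S (\<lambda>y. \<theta> (f y)) x"
  unfolding nice_at_def
proof (intro conjI allI)
  fix k
  obtain W where W: "openin (top_of_set S) W" "x \<in> W" "smooth k S W f"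
    using f(1) unfolding nice_at_def by blast
  obtain U where U: "openin (top_of_set S) U" "x \<in> U" "f ` U \<subseteq> T"
    using nice_at_continuous[OF f(1) \<theta>(2) f(2)] by blast
  have o: "openin (top_of_set S) (U \<inter> W)" using U(1) W(1) by (rule openin_Int)
  have "smooth k S (U \<inter> W) (\<lambda>y. \<theta> (f y))"
    by (rule smooth_compose[OF \<theta>(1) smooth_subset[OF W(3)]]) (use openin_imp_subset[OF o] U(3) in auto)
  then show "\<exists>W. openin (top_of_set S) W \<and> x \<in> W \<and> smooth k S W (\<lambda>y. \<theta> (f y))"
    using o U(2) W(2) by blast
next
  show "lfc_at S (\<lambda>y. \<theta> (f y)) x"
    using lfc_at_combine[of S f x f "\<lambda>a b. \<theta> a"] f(1) unfolding nice_at_def by simp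
qed

lemma nice_at_inverse: "nice_at S f x \<Longrightarrow> f x \<noteq> 0 \<Longrightarrow> nice_at S (\<lambda>y. inverse (f y)) x"
proof (rule nice_at_compose[OF smooth_real_inverse])
  have "{t::real. t \<noteq> 0} = - {0}" by auto
  then show "open {t::real. t \<noteq> 0}" by (metis open_Compl closed_singleton)
qed auto

lemma openin_affine_vimage:
  fixes S :: "'a::real_normed_vector set"
  assumes "subspace S" "b \<in> S" "openin (top_of_set S) U"
  shows "openin (top_of_set S) {y \<in> S. c *\<^sub>R y + b \<in> U}"
proof -
  have "openin (top_of_set S) (S \<inter> (\<lambda>y. c *\<^sub>R y + b) -` U)"
    using assms by (intro continuous_openin_preimage[where T=S] continuous_intros)
      (auto intro: subspace_add subspace_scale)
  moreover have "S \<inter> (\<lambda>y. c *\<^sub>R y + b) -` U = {y \<in> S. c *\<^sub>R y + b \<in> U}" by auto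
  ultimately show ?thesis by simp
qed

lemma nice_at_affine:
  assumes S: "subspace S" "b \<in> S" "x \<in> S" and f: "nice_at S f (c *\<^sub>R x + b)"
  shows "nice_at S (\<lambda>y. f (c *\<^sub>R y + b)) x"
  unfolding nice_at_def
proof (intro conjI allI)
  fix k
  obtain W where W: "openin (top_of_set S) W" "c *\<^sub>R x + b \<in> W" "smooth k S W f"
    using f unfolding nice_at_def by blast
  have "smooth k S {y \<in> S. c *\<^sub>R y + b \<in> W} (\<lambda>y. f (c *\<^sub>R y + b))"
    by (rule smooth_affine[OF S(1,2) W(3)]) auto
  then show "\<exists>W. openin (top_of_set S) W \<and> x \<in> W \<and> smooth k S W (\<lambda>y. f (c *\<^sub>R y + b))"
    using openin_affine_vimage[OF S(1,2) W(1)] W(2) S(3) by blast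
next
  obtain U \<Psi> where U: "openin (top_of_set S) U" "c *\<^sub>R x + b \<in> U" "finite \<Psi>" "\<Psi> \<subseteq> dual_on S"
    "\<forall>y\<in>U. \<forall>z\<in>U. (\<forall>\<psi>\<in>\<Psi>. \<psi> y = \<psi> z) \<longrightarrow> f y = f z"
    using f unfolding nice_at_def by (elim conjE lfc_atE)
  \<comment> \<open>The functionals of \<open>f\<close> serve again: their values at the image point
    are determined by their values at \<open>y\<close>.\<close>
  have aff: "\<psi> (c *\<^sub>R y + b) = c * \<psi> y + \<psi> b" if "\<psi> \<in> \<Psi>" "y \<in> S" for \<psi> y
  proof -
    have "\<psi> \<in> dual_on S" using that(1) U(4) by blast
    then show ?thesis using that(2) S(1,2) by (simp add: dual_on_def subspace_scale)
  qed
  show "lfc_at S (\<lambda>y. f (c *\<^sub>R y + b)) x"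
  proof (rule lfc_atI[OF openin_affine_vimage[OF S(1,2) U(1), of c] _ U(3,4)])
    fix y z assume "y \<in> {y \<in> S. c *\<^sub>R y + b \<in> U}" "z \<in> {y \<in> S. c *\<^sub>R y + b \<in> U}"
      "\<And>\<psi>. \<psi> \<in> \<Psi> \<Longrightarrow> \<psi> y = \<psi> z"
    then show "f (c *\<^sub>R y + b) = f (c *\<^sub>R z + b)" by (intro U(5)[rule_format]) (auto simp: aff)
  qed (use U(2) S(3) in auto)
qed

subsection \<open>A flat convex function\<close>

text \<open>The polynomials in \<open>1 / s\<close> make this class closed under differentiation,
  also at 0.\<close>

definition expo :: "real poly \<Rightarrow> real \<Rightarrow> real" where
  "expo p s = (if s \<le> 0 then 0 else exp (- inverse s) * poly p (inverse s))"

text \<open>The factor \<open>s\<close> makes the function convex on the whole line;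
  \<open>exp (- inverse s)\<close> alone is convex only up to \<open>s = 1/2\<close>.\<close>

definition flat :: "real \<Rightarrow> real" where
  "flat s = (if s \<le> 0 then 0 else s * exp (- inverse s))"

lemma poly_over_exp_tendsto_0: "((\<lambda>u::real. poly p u / exp u) \<longlongrightarrow> 0) at_top"
proof -
  have "((\<lambda>u::real. \<Sum>i\<le>degree p. coeff p i * (u ^ i / exp u)) \<longlongrightarrow> (\<Sum>i\<le>degree p. coeff p i * 0)) at_top"
    by (intro tendsto_sum tendsto_mult_left tendsto_power_div_exp_0)
  then show ?thesis by (simp add: poly_altdef sum_divide_distrib)
qed

lemma expo_over_s_tendsto_0: "((\<lambda>s. expo p s / s) \<longlongrightarrow> 0) (at 0)"
  unfolding filterlim_at_split
proof
  have "\<forall>\<^sub>F s in at_left 0. expo p s / s = (0::real)"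
    by (simp add: eventually_at_filter expo_def)
  then show "((\<lambda>s. expo p s / s) \<longlongrightarrow> 0) (at_left 0)" by (rule tendsto_eventually)
  \<comment> \<open>The factor \<open>[:0, 1:]\<close> is the division by \<open>s\<close>, written
    in the variable \<open>u = 1 / s\<close>.\<close>
  have "((\<lambda>u::real. poly ([:0, 1:] * p) u / exp u) \<longlongrightarrow> 0) at_top" by (rule poly_over_exp_tendsto_0)
  moreover have "\<forall>\<^sub>F u in at_top. poly ([:0, 1:] * p) u / exp u = expo p (inverse u) / inverse u"
    using eventually_gt_at_top[of 0]
    by eventually_elim (simp add: expo_def exp_minus field_simps)
  ultimately show "((\<lambda>s. expo p s / s) \<longlongrightarrow> 0) (at_right 0)"
    unfolding filterlim_at_right_to_top by (rule Lim_transform_eventually)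
qed

text \<open>With \<open>u = 1 / s\<close> one differentiates \<open>exp (- u) * poly p u\<close> and
  multiplies by the derivative of \<open>u\<close>, which is minus the square of \<open>u\<close>;
  this is where \<open>[:0, 0, 1:]\<close> comes from.\<close>

lemma expo_has_derivative:
  "(expo p has_real_derivative expo ([:0, 0, 1:] * (p - pderiv p)) s) (at s)"
proof (cases s "0::real" rule: linorder_cases)
  case less
  have "((\<lambda>_. 0) has_real_derivative 0) (at s)" by simp
  then have "(expo p has_real_derivative 0) (at s)"
    by (rule has_field_derivative_transform_within_open[of _ _ _ "{..<0}"]) (use less in \<open>auto simp: expo_def\<close>)
  then show ?thesis using less by (simp add: expo_def)
next
  case equal
  have "((\<lambda>y. (expo p y - expo p 0) / (y - 0)) \<longlongrightarrow> 0) (at 0)"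
    using expo_over_s_tendsto_0[of p] by (simp add: expo_def)
  then have "(expo p has_real_derivative 0) (at 0)" by (simp add: has_field_derivative_iff)
  then show ?thesis using equal by (simp add: expo_def)
next
  case greater
  have "((\<lambda>s. exp (- inverse s) * poly p (inverse s)) has_real_derivative
      expo ([:0, 0, 1:] * (p - pderiv p)) s) (at s)"
    using greater
    by (auto intro!: derivative_eq_intros simp: expo_def algebra_simps power2_eq_square)
  then show ?thesis
    by (rule has_field_derivative_transform_within_open[of _ _ _ "{0<..}"]) (use greater in \<open>auto simp: expo_def\<close>)
qed

lemma flat_has_derivative: "(flat has_real_derivative expo [:1, 1:] s) (at s)"
proof -
  have "flat = (\<lambda>s. s * expo 1 s)" by (auto simp: flat_def expo_def fun_eq_iff)
  moreover have "((\<lambda>s. s * expo 1 s) has_real_derivative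
      1 * expo 1 s + expo ([:0, 0, 1:] * (1 - pderiv 1)) s * s) (at s)"
    by (intro DERIV_mult DERIV_ident expo_has_derivative)
  moreover have "1 * expo 1 s + expo ([:0, 0, 1:] * (1 - pderiv 1)) s * s = expo [:1, 1:] s"
    by (simp add: expo_def field_simps)
  ultimately show ?thesis by simp
qed

lemma smooth_real_expo: "smooth_real UNIV (expo p)"
  unfolding smooth_real_def using expo_has_derivative by (intro exI[of _ "range expo"]) blast

lemma smooth_real_flat: "smooth_real UNIV flat"
  unfolding smooth_real_def using expo_has_derivative flat_has_derivative
  by (intro exI[of _ "insert flat (range expo)"]) blast

lemma flat_nonneg: "0 \<le> flat s" and flat_eq_0_iff: "flat s = 0 \<longleftrightarrow> s \<le> 0"
  by (auto simp: flat_def)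

text \<open>For \<open>p = [:1, 1:]\<close> the polynomial of the derivative is the cube of the
  variable. As this \<open>expo\<close> is the derivative of \<open>flat\<close>, its monotonicity
  is the convexity of \<open>flat\<close>.\<close>

lemma expo_mono: "s \<le> t \<Longrightarrow> expo [:1, 1:] s \<le> expo [:1, 1:] t"
proof (rule DERIV_nonneg_imp_nondecreasing[of s t "expo [:1, 1:]"])
  fix x :: real
  have "0 \<le> expo ([:0, 0, 1:] * ([:1, 1:] - pderiv [:1, 1:])) x"
    by (simp add: expo_def pderiv_pCons)
  then show "\<exists>y. (expo [:1, 1:] has_real_derivative y) (at x) \<and> 0 \<le> y"
    using expo_has_derivative by blast
qed

lemma flat_mono: "s \<le> t \<Longrightarrow> flat s \<le> flat t"
proof (rule DERIV_nonneg_imp_nondecreasing[of s t flat])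
  fix x :: real
  have "0 \<le> expo [:1, 1:] x" by (simp add: expo_def)
  then show "\<exists>y. (flat has_real_derivative y) (at x) \<and> 0 \<le> y"
    using flat_has_derivative by blast
qed

section \<open>Adapted families on finite-dimensional subspaces\<close>

context normalized_biorthogonal
begin

lemma adapted_iff:
  "adapted N K I \<longleftrightarrow>
     (\<forall>i\<in>I. bounded_linear (fst i) \<and> (\<forall>x. \<bar>fst i x\<bar> \<le> K * N x) \<and> 1 < snd i) \<and>
     (\<forall>A. finite A \<and> A \<subseteq> \<Gamma> \<longrightarrow> (\<exists>J\<subseteq>I. finite J \<and>
        (\<forall>x\<in>span (e ` A). (\<forall>i\<in>I - J. \<bar>fst i x\<bar> \<le> N x) \<and>
           (x \<noteq> 0 \<longrightarrow> (\<exists>i\<in>J. snd i * N x < fst i x)))))"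
  unfolding adapted_def case_prod_beta ..

lemma adapted_span:
  assumes "adapted N K I" "finite A" "A \<subseteq> \<Gamma>"
  obtains J where "J \<subseteq> I" "finite J"
    "\<And>x i. x \<in> span (e ` A) \<Longrightarrow> i \<in> I - J \<Longrightarrow> \<bar>fst i x\<bar> \<le> N x"
    "\<And>x. x \<in> span (e ` A) \<Longrightarrow> x \<noteq> 0 \<Longrightarrow> \<exists>i\<in>J. snd i * N x < fst i x"
proof -
  have "\<exists>J\<subseteq>I. finite J \<and> (\<forall>x\<in>span (e ` A). (\<forall>i\<in>I - J. \<bar>fst i x\<bar> \<le> N x) \<and>
      (x \<noteq> 0 \<longrightarrow> (\<exists>i\<in>J. snd i * N x < fst i x)))"
    using assms unfolding adapted_iff by (elim conjE allE[of _ A] impE) (rule conjI)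
  then obtain J where J: "J \<subseteq> I" "finite J"
    "\<forall>x\<in>span (e ` A). (\<forall>i\<in>I - J. \<bar>fst i x\<bar> \<le> N x) \<and> (x \<noteq> 0 \<longrightarrow> (\<exists>i\<in>J. snd i * N x < fst i x))"
    by (elim exE conjE)
  show ?thesis
  proof (rule that[OF J(1,2)])
    fix x assume "x \<in> span (e ` A)"
    note * = bspec[OF J(3) this]
    show "\<bar>fst i x\<bar> \<le> N x" if "i \<in> I - J" for i using conjunct1[OF *] that by (rule bspec)
    show "\<exists>i\<in>J. snd i * N x < fst i x" if "x \<noteq> 0" using conjunct2[OF *] that by (rule mp)
  qed
qed

lemma adapted_at:
  assumes "adapted N K I" "x \<in> Y"
  obtains J where "J \<subseteq> I" "finite J" "\<And>i. i \<in> I - J \<Longrightarrow> \<bar>fst i x\<bar> \<le> N x"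
    "x \<noteq> 0 \<Longrightarrow> \<exists>i\<in>J. snd i * N x < fst i x"
proof -
  obtain J where J: "J \<subseteq> I" "finite J"
    "\<And>y i. y \<in> span (e ` supp x) \<Longrightarrow> i \<in> I - J \<Longrightarrow> \<bar>fst i y\<bar> \<le> N y"
    "\<And>y. y \<in> span (e ` supp x) \<Longrightarrow> y \<noteq> 0 \<Longrightarrow> \<exists>i\<in>J. snd i * N y < fst i y"
    using adapted_span[OF assms(1) finite_supp[OF assms(2)] supp_subset_\<Gamma>] by metis
  show ?thesis
    using J(3,4)[OF in_span_supp[OF assms(2)]] by (rule that[OF J(1,2)])
qed

text \<open>The union of the supports of a finite spanning set is finite, which reduces arbitrary
  finite-dimensional subspaces to coordinate spans.\<close>

lemma finite_dimensional_subset: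
  assumes "subspace F" "F \<subseteq> Y" "finite_dimensional F"
  obtains A where "finite A" "A \<subseteq> \<Gamma>" "F \<subseteq> span (e ` A)"
proof -
  obtain B where B: "finite B" "F = span B" using assms(3) unfolding finite_dimensional_def by blast
  have BY: "b \<in> Y" if "b \<in> B" for b using that B(2) assms(2) span_base by blast
  let ?A = "\<Union>(supp ` B)"
  have "b \<in> span (e ` ?A)" if "b \<in> B" for b
  proof -
    have "span (e ` supp b) \<subseteq> span (e ` ?A)" by (intro span_mono image_mono) (use that in blast)
    then show ?thesis using in_span_supp[OF BY[OF that]] by blast
  qed
  then have "F \<subseteq> span (e ` ?A)" unfolding B(2) by (intro span_minimal) auto
  moreover have "finite ?A" using B(1) BY finite_supp by blast
  moreover have "?A \<subseteq> \<Gamma>" using supp_subset_\<Gamma> by blast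
  ultimately show ?thesis by (intro that[of ?A])
qed

end

locale adapted_norm = normalized_biorthogonal \<Gamma> e \<phi>
  for \<Gamma> :: "'i set" and e :: "'i \<Rightarrow> 'a::real_normed_vector" and \<phi> +
  fixes N :: "'a \<Rightarrow> real" and K :: real and I
  assumes N_equivalent: "equivalent_norm_on UNIV N" and K_ge_1: "1 \<le> K" and adapted: "adapted N K I"
begin

lemma seminorm_on_N: "seminorm_on UNIV N"
  using N_equivalent unfolding equivalent_norm_on_def norm_on_iff_seminorm_on[OF subspace_UNIV] by blast

lemma N_nonneg: "0 \<le> N x" and N_triangle: "N (x + y) \<le> N x + N y"
  and N_scale: "N (c *\<^sub>R x) = \<bar>c\<bar> * N x" and N_0: "N 0 = 0" and N_minus: "N (- x) = N x"
  using seminorm_on_N seminorm_on_zero[OF seminorm_on_N] seminorm_on_uminus[OF seminorm_on_N]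
  by (simp_all add: seminorm_on_def)

lemma N_pos: "x \<noteq> 0 \<Longrightarrow> 0 < N x"
  using N_equivalent N_nonneg[of x] unfolding equivalent_norm_on_def norm_on_def by force

lemma N_bounds:
  obtains c C where "0 < c" "0 < C" "\<And>x. c * norm x \<le> N x" "\<And>x. N x \<le> C * norm x"
  using N_equivalent unfolding equivalent_norm_on_def by auto

lemma continuous_on_N: "continuous_on S N"
proof -
  obtain C where C: "\<And>x. N x \<le> C * norm x" using N_bounds by metis
  show ?thesis by (rule continuous_on_lipschitz) (use seminorm_on_lipschitz[OF seminorm_on_N C] in auto)
qed

lemma I_bounded_linear: "i \<in> I \<Longrightarrow> bounded_linear (fst i)"
  and I_le: "i \<in> I \<Longrightarrow> \<bar>fst i x\<bar> \<le> K * N x"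
  and I_gt_1: "i \<in> I \<Longrightarrow> 1 < snd i"
  using adapted unfolding adapted_iff by blast+

lemma I_diff: "i \<in> I \<Longrightarrow> \<bar>fst i y - fst i x\<bar> \<le> K * N (y - x)"
  using I_le[of i "y - x"] I_bounded_linear[of i] by (simp add: linear_simps)

subsection \<open>Polyhedral norms\<close>

text \<open>The zero functional keeps the supremum meaningful if \<open>I\<close> is empty.\<close>

definition P :: "'a \<Rightarrow> real" where
  "P x = (SUP g\<in>insert (\<lambda>_. 0) (fst ` I). \<bar>g x\<bar>)"

lemma bdd_above_P: "bdd_above ((\<lambda>g. \<bar>g x\<bar>) ` insert (\<lambda>_. 0) (fst ` I))"
  using I_le K_ge_1 N_nonneg by (intro bdd_aboveI[of _ "K * N x"]) auto

lemma le_P: "i \<in> I \<Longrightarrow> \<bar>fst i x\<bar> \<le> P x"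
  unfolding P_def by (rule cSUP_upper[OF _ bdd_above_P]) simp

lemma P_le: "0 \<le> b \<Longrightarrow> (\<And>i. i \<in> I \<Longrightarrow> \<bar>fst i x\<bar> \<le> b) \<Longrightarrow> P x \<le> b"
  unfolding P_def by (rule cSUP_least) auto

lemma seminorm_on_P: "seminorm_on UNIV P"
  unfolding P_def
proof (rule seminorm_on_SUP[OF subspace_UNIV _ _ bdd_above_P])
  fix g assume "g \<in> insert (\<lambda>_. 0) (fst ` I)"
  then have "bounded_linear g" using I_bounded_linear by (auto simp: bounded_linear_zero)
  then show "seminorm_on UNIV (\<lambda>x. \<bar>g x\<bar>)"
    by (auto simp: seminorm_on_def linear_simps abs_mult abs_triangle_ineq)
qed simp

lemma P_upper: "P x \<le> K * N x"
  using I_le K_ge_1 N_nonneg by (intro P_le) auto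

lemma P_lower:
  assumes "x \<in> Y" "x \<noteq> 0" shows "N x < P x"
proof -
  obtain i where i: "i \<in> I" "snd i * N x < fst i x"
    using adapted_at[OF adapted assms(1)] assms(2) by (metis subsetD)
  have "N x \<le> snd i * N x" using I_gt_1[OF i(1)] N_nonneg[of x] by (simp add: mult_le_cancel_right1)
  then show ?thesis using i(2) le_P[OF i(1), of x] by linarith
qed

lemma equivalent_norm_on_P: "equivalent_norm_on Y P"
proof -
  obtain c C where c: "0 < c" "0 < C" "\<And>x. c * norm x \<le> N x" "\<And>x. N x \<le> C * norm x" by (rule N_bounds) blast
  show ?thesis
  proof (rule equivalent_norm_onI[OF subspace_Y seminorm_on_mono[OF seminorm_on_P subset_UNIV] c(1), of "K * C"])
    show "0 < K * C" using c K_ge_1 by simp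
    fix x assume x: "x \<in> Y"
    show "c * norm x \<le> P x"
      using c(3)[of x] P_lower[OF x] seminorm_on_nonneg[OF seminorm_on_P, of x] by (cases "x = 0") auto
    have "K * N x \<le> K * (C * norm x)" using c(4)[of x] K_ge_1 by (intro mult_left_mono) auto
    then show "P x \<le> K * C * norm x" using P_upper[of x] by simp
  qed
qed

text \<open>On a span over a finite set the functionals outside \<open>J\<close> are at most
  \<open>N\<close>, while away from 0 some functional of \<open>J\<close> exceeds \<open>N\<close>.
  Hence \<open>J\<close> alone decides whether \<open>P x \<le> 1\<close>.\<close>

lemma polyhedral_norm_on_P: "polyhedral_norm_on Y P"
  unfolding polyhedral_norm_on_def
proof (intro allI impI)
  fix F assume F: "subspace F \<and> F \<subseteq> Y \<and> finite_dimensional F"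
  then obtain A where A: "finite A" "A \<subseteq> \<Gamma>" "F \<subseteq> span (e ` A)" using finite_dimensional_subset by blast
  obtain J where J: "J \<subseteq> I" "finite J"
    "\<And>x i. x \<in> span (e ` A) \<Longrightarrow> i \<in> I - J \<Longrightarrow> \<bar>fst i x\<bar> \<le> N x"
    "\<And>x. x \<in> span (e ` A) \<Longrightarrow> x \<noteq> 0 \<Longrightarrow> \<exists>i\<in>J. snd i * N x < fst i x"
    using adapted_span[OF adapted A(1,2)] by metis
  have le1: "P x \<le> 1 \<longleftrightarrow> (\<forall>i\<in>J. \<bar>fst i x\<bar> \<le> 1)" if x: "x \<in> F" for x
  proof
    assume "P x \<le> 1" then show "\<forall>i\<in>J. \<bar>fst i x\<bar> \<le> 1" using le_P J(1) order_trans by blast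
  next
    assume *: "\<forall>i\<in>J. \<bar>fst i x\<bar> \<le> 1"
    show "P x \<le> 1"
    proof (cases "x = 0")
      case True then show ?thesis using seminorm_on_zero[OF seminorm_on_P] by simp
    next
      case False
      have xA: "x \<in> span (e ` A)" using x A(3) by blast
      then obtain j where j: "j \<in> J" "snd j * N x < fst j x" using J(4)[OF xA False] by blast
      have "N x \<le> snd j * N x" using I_gt_1[of j] j(1) J(1) N_nonneg[of x] by (auto simp: mult_le_cancel_right1)
      then have N1: "N x \<le> 1" using j * by fastforce
      show ?thesis
      proof (rule P_le)
        fix i assume "i \<in> I"
        then show "\<bar>fst i x\<bar> \<le> 1" using * J(3)[OF xA, of i] N1 by (cases "i \<in> J") auto
      qed simp
    qed
  qed
  \<comment> \<open>Both signs occur, as half-spaces are one-sided. Functionals vanishing on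
    \<open>F\<close> define no half-space and impose no condition.\<close>
  define G where "G = {g. (\<exists>i\<in>J. g = fst i \<or> g = (\<lambda>x. - fst i x)) \<and> (\<exists>x\<in>F. g x \<noteq> 0)}"
  have "G \<subseteq> fst ` J \<union> (\<lambda>i x. - fst i x) ` J" by (auto simp: G_def)
  then have finG: "finite G" using J(2) finite_subset by blast
  have blG: "bounded_linear g" if "g \<in> G" for g
    using that J(1) I_bounded_linear by (auto simp: G_def intro!: bounded_linear_minus)
  show "polyhedral_ball F P"
    unfolding polyhedral_ball_def
  proof (intro exI[of _ "(\<lambda>g. {x\<in>F. g x \<le> 1}) ` G"] conjI ballI)
    show "finite ((\<lambda>g. {x\<in>F. g x \<le> 1}) ` G)" using finG by simp
    fix H assume "H \<in> (\<lambda>g. {x\<in>F. g x \<le> 1}) ` G"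
    then obtain g where g: "g \<in> G" "H = {x\<in>F. g x \<le> 1}" by blast
    have "\<exists>x\<in>F. g x \<noteq> 0" using g(1) by (simp add: G_def)
    then show "closed_halfspace_on F H"
      unfolding closed_halfspace_on_def
      by (intro bexI[OF _ dual_on_bounded_linear[OF blG[OF g(1)]]] exI[of _ 1] conjI g(2))
  next
    have "(\<forall>i\<in>J. \<bar>fst i x\<bar> \<le> 1) \<longleftrightarrow> (\<forall>g\<in>G. g x \<le> 1)" if x: "x \<in> F" for x
    proof
      assume "\<forall>i\<in>J. \<bar>fst i x\<bar> \<le> 1" then show "\<forall>g\<in>G. g x \<le> 1" by (fastforce simp: G_def)
    next
      assume *: "\<forall>g\<in>G. g x \<le> 1"
      show "\<forall>i\<in>J. \<bar>fst i x\<bar> \<le> 1"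
      proof
        fix i assume i: "i \<in> J"
        show "\<bar>fst i x\<bar> \<le> 1"
        proof (cases "fst i x = 0")
          case False
          have "fst i \<in> G" using i x False unfolding G_def by blast
          then have "fst i x \<le> 1" by (rule bspec[OF *])
          moreover have "(\<lambda>x. - fst i x) \<in> G"
            unfolding G_def mem_Collect_eq
            using i False by (intro conjI bexI[OF _ i] bexI[OF _ x] disjI2) simp_all
          then have "- fst i x \<le> 1" by (rule bspec[OF *])
          ultimately show ?thesis by simp
        qed simp
      qed
    qed
    then show "{x\<in>F. P x \<le> 1} = F \<inter> \<Inter>((\<lambda>g. {x\<in>F. g x \<le> 1}) ` G)" using le1 by auto
  qed
qed

lemma openin_N_ball: "openin (top_of_set S) {y \<in> S. K * N (y - x) < d}"
proof -
  have "continuous_on UNIV (\<lambda>y. K * N (y - x))"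
    by (intro continuous_intros continuous_on_compose2[OF continuous_on_N[of UNIV]]) auto
  then have "open {y. K * N (y - x) < d}" by (rule open_Collect_less[OF _ continuous_on_const])
  moreover have "{y \<in> S. K * N (y - x) < d} = S \<inter> {y. K * N (y - x) < d}" by auto
  ultimately show ?thesis by (simp add: openin_open_Int)
qed

lemma lfc_norm_on_P: "lfc_norm_on Y P"
  unfolding lfc_norm_on_def
proof (intro ballI impI)
  fix x assume x: "x \<in> Y" "P x = 1"
  then have "x \<noteq> 0" using seminorm_on_zero[OF seminorm_on_P] by auto
  obtain J where J: "J \<subseteq> I" "finite J" "\<And>i. i \<in> I - J \<Longrightarrow> \<bar>fst i x\<bar> \<le> N x" "\<exists>i\<in>J. snd i * N x < fst i x"
    using adapted_at[OF adapted x(1)] \<open>x \<noteq> 0\<close> by metis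
  then obtain j where j: "j \<in> J" "snd j * N x < fst j x" by blast
  have jI: "j \<in> I" using j(1) J(1) by blast
  have "N x \<le> snd j * N x" using I_gt_1[OF jI] N_nonneg[of x] by (simp add: mult_le_cancel_right1)
  then have gap: "N x < fst j x" using j(2) by linarith
  \<comment> \<open>Half of the gap for each side: within it the functionals outside
    \<open>J\<close> cannot catch up with \<open>fst j\<close>, as all have Lipschitz constant
    \<open>K\<close> with respect to \<open>N\<close>.\<close>
  define U where "U = {y \<in> Y. K * N (y - x) < (fst j x - N x) / 2}"
  have PU: "P y = (SUP g\<in>insert (\<lambda>_. 0) (fst ` J). \<bar>g y\<bar>)" (is "_ = ?s y") if y: "y \<in> U" for y
  proof (rule antisym)
    have fin: "finite (insert (\<lambda>_. 0) (fst ` J))" using J(2) by simp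
    then have le: "\<bar>g y\<bar> \<le> ?s y" if "g \<in> insert (\<lambda>_. 0) (fst ` J)" for g
      using that by (intro cSUP_upper) (auto intro: bdd_above_finite)
    show "P y \<le> ?s y"
    proof (rule P_le)
      show "0 \<le> ?s y" using le[of "\<lambda>_. 0"] by simp
      fix i assume i: "i \<in> I"
      show "\<bar>fst i y\<bar> \<le> ?s y"
      proof (cases "i \<in> J")
        case True then show ?thesis using le[of "fst i"] by simp
      next
        case False
        then have "\<bar>fst i x\<bar> \<le> N x" using i J(3) by blast
        moreover have "\<bar>fst j y\<bar> \<le> ?s y" using le[of "fst j"] j(1) by simp
        moreover have "\<bar>fst i y\<bar> \<le> \<bar>fst i x\<bar> + K * N (y - x)" using I_diff[OF i, of y x] by linarith
        moreover have "fst j x - K * N (y - x) \<le> \<bar>fst j y\<bar>" using I_diff[OF jI, of y x] by linarith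
        moreover have "2 * (K * N (y - x)) < fst j x - N x" using y by (simp add: U_def)
        ultimately show ?thesis by linarith
      qed
    qed
    show "?s y \<le> P y"
      unfolding P_def by (rule cSUP_subset_mono[OF _ bdd_above_P]) (use J(1) in auto)
  qed
  show "lfc_at Y P x"
  proof (rule lfc_atI[of Y U x "fst ` J"])
    show "openin (top_of_set Y) U" unfolding U_def by (rule openin_N_ball)
    show "x \<in> U" using x gap by (simp add: U_def N_0)
    show "finite (fst ` J)" using J(2) by simp
    show "fst ` J \<subseteq> dual_on Y" using J(1) I_bounded_linear dual_on_bounded_linear by blast
    fix y z assume yz: "y \<in> U" "z \<in> U" "\<And>\<psi>. \<psi> \<in> fst ` J \<Longrightarrow> \<psi> y = \<psi> z"
    have "(\<lambda>g. \<bar>g y\<bar>) ` insert (\<lambda>_. 0) (fst ` J) = (\<lambda>g. \<bar>g z\<bar>) ` insert (\<lambda>_. 0) (fst ` J)"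
    proof (rule image_cong)
      show "\<bar>g y\<bar> = \<bar>g z\<bar>" if "g \<in> insert (\<lambda>_. 0) (fst ` J)" for g
        using that yz(3)[of g] by (elim insertE) simp_all
    qed simp
    then show "P y = P z" by (simp only: PU[OF yz(1)] PU[OF yz(2)])
  qed
qed

end

subsection \<open>The penalty functions\<close>

text \<open>Even, convex, zero on the interval from -1 to 1, and scaled to take the value 2 at the
  margin \<open>\<tau> > 1\<close>, safely above the level 1 that defines the gauge.\<close>

definition pen :: "real \<Rightarrow> real \<Rightarrow> real" where
  "pen \<tau> s = 2 / flat (\<tau> - 1) * (flat (s - 1) + flat (- s - 1))"

definition pen' :: "real \<Rightarrow> real \<Rightarrow> real" where
  "pen' \<tau> s = 2 / flat (\<tau> - 1) * (expo [:1, 1:] (s - 1) - expo [:1, 1:] (- s - 1))"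

lemma pen_nonneg: "0 \<le> pen \<tau> s"
  by (simp add: pen_def flat_nonneg)

lemma pen_minus: "pen \<tau> (- s) = pen \<tau> s"
  by (simp add: pen_def add.commute)

lemma pen_eq_0: "\<bar>s\<bar> \<le> 1 \<Longrightarrow> pen \<tau> s = 0"
  by (auto simp: pen_def flat_def abs_le_iff)

lemma pen_ge_2:
  assumes "1 < \<tau>" "\<tau> \<le> s" shows "2 \<le> pen \<tau> s"
proof -
  have pos: "0 < flat (\<tau> - 1)" using assms(1) by (simp add: flat_def)
  have "flat (\<tau> - 1) \<le> flat (s - 1) + flat (- s - 1)"
    using flat_mono[of "\<tau> - 1" "s - 1"] flat_nonneg[of "- s - 1"] assms(2) by simp
  then have "2 / flat (\<tau> - 1) * flat (\<tau> - 1) \<le> pen \<tau> s"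
    unfolding pen_def using pos by (intro mult_left_mono) auto
  then show ?thesis using pos by simp
qed

lemma pen_has_derivative: "(pen \<tau> has_real_derivative pen' \<tau> s) (at s)"
proof -
  have "((\<lambda>s. flat (s - 1)) has_real_derivative expo [:1, 1:] (s - 1) * 1) (at s)"
    by (rule DERIV_chain'[OF _ flat_has_derivative]) (auto intro!: derivative_eq_intros)
  moreover have "((\<lambda>s. flat (- s - 1)) has_real_derivative expo [:1, 1:] (- s - 1) * - 1) (at s)"
    by (rule DERIV_chain'[OF _ flat_has_derivative]) (auto intro!: derivative_eq_intros)
  ultimately have "((\<lambda>s. 2 / flat (\<tau> - 1) * (flat (s - 1) + flat (- s - 1))) has_real_derivative
      2 / flat (\<tau> - 1) * (expo [:1, 1:] (s - 1) * 1 + expo [:1, 1:] (- s - 1) * - 1)) (at s)"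
    by (intro DERIV_cmult DERIV_add)
  then show ?thesis by (simp add: pen_def[abs_def] pen'_def)
qed

lemma convex_on_pen: "convex_on UNIV (pen \<tau>)"
proof (rule convex_on_realI[OF _ pen_has_derivative])
  fix x y :: real assume "x \<le> y"
  have "0 \<le> 2 / flat (\<tau> - 1)" by (simp add: flat_nonneg)
  then show "pen' \<tau> x \<le> pen' \<tau> y"
    unfolding pen'_def using expo_mono[of "x - 1" "y - 1"] expo_mono[of "- y - 1" "- x - 1"] \<open>x \<le> y\<close>
    by (intro mult_left_mono) auto
qed simp

text \<open>The tangent at \<open>s\<close> lies below the graph at 0, where \<open>pen\<close>
  vanishes. Summed over functionals, this bounds the denominator in the derivative of the gauge from
  below.\<close>

lemma pen_le_deriv: "pen \<tau> s \<le> pen' \<tau> s * s"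
proof -
  have "pen' \<tau> s * (0 - s) \<le> pen \<tau> 0 - pen \<tau> s"
    by (rule convex_on_imp_above_tangent[OF convex_on_pen]) (auto intro: pen_has_derivative)
  then show ?thesis using pen_eq_0[of 0 \<tau>] by simp
qed

lemma pen_scale_le: "0 \<le> t \<Longrightarrow> t \<le> 1 \<Longrightarrow> pen \<tau> (t * s) \<le> t * pen \<tau> s"
  using convex_onD[OF convex_on_pen, of t 0 s \<tau>] pen_eq_0[of 0 \<tau>] by simp

lemma smooth_pen':
  assumes "W \<subseteq> S" "smooth k S W f" shows "smooth k S W (\<lambda>y. pen' \<tau> (f y))"
proof -
  have lin: "smooth k S W (\<lambda>y. c * f y + d)" for c d
    using assms by (intro smooth_add smooth_mult smooth_const)
  have "smooth k S W (\<lambda>y. expo [:1, 1:] (c * f y + d))" for c d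
    by (rule smooth_compose[OF smooth_real_expo lin assms(1)]) simp
  from this[of 1 "- 1"] this[of "- 1" "- 1"]
  have 1: "smooth k S W (\<lambda>y. expo [:1, 1:] (f y - 1))" and 2: "smooth k S W (\<lambda>y. expo [:1, 1:] (- f y - 1))"
    by simp_all
  have "smooth k S W (\<lambda>y. 2 / flat (\<tau> - 1) * (expo [:1, 1:] (f y - 1) + (- 1) * expo [:1, 1:] (- f y - 1)))"
    by (intro smooth_mult smooth_add smooth_const assms(1) 1 2)
  then show ?thesis by (simp add: pen'_def)
qed

context adapted_norm
begin

subsection \<open>Smooth norms\<close>

definition active :: "'a \<Rightarrow> (('a \<Rightarrow> real) \<times> real) set" where
  "active z = {i\<in>I. 1 < \<bar>fst i z\<bar>}"

text \<open>Where \<open>N z\<close> is at least 1, \<open>active z\<close> may be infinite and the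
  sum is then 0 by convention. The value is therefore used only inside the open unit ball of
  \<open>N\<close>.\<close>

definition \<Phi> :: "'a \<Rightarrow> real" where
  "\<Phi> z = (\<Sum>i\<in>active z. pen (snd i) (fst i z))"

lemma \<Phi>_eq:
  assumes "active z \<subseteq> J" "finite J" "J \<subseteq> I"
  shows "\<Phi> z = (\<Sum>i\<in>J. pen (snd i) (fst i z))"
  unfolding \<Phi>_def using assms by (intro sum.mono_neutral_left) (auto simp: active_def intro!: pen_eq_0)

text \<open>At \<open>z\<close> all functionals outside a finite \<open>J\<close> are at most
  \<open>N z < 1\<close>. Having the common Lipschitz constant \<open>K\<close>, none of them passes
  1 within the stated radius; by homogeneity none does on the line through \<open>z\<close> up to
  the \<open>N\<close>-sphere.\<close>

lemma active_local:
  assumes "z \<in> Y" "N z < 1"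
  obtains J where "J \<subseteq> I" "finite J" "\<And>w. K * N (w - z) < 1 - N z \<Longrightarrow> active w \<subseteq> J \<and> N w < 1"
    "\<And>t. \<bar>t\<bar> * N z \<le> 1 \<Longrightarrow> active (t *\<^sub>R z) \<subseteq> J"
proof -
  obtain J where J: "J \<subseteq> I" "finite J" "\<And>i. i \<in> I - J \<Longrightarrow> \<bar>fst i z\<bar> \<le> N z"
    using adapted_at[OF adapted assms(1)] by metis
  show ?thesis
  proof (rule that[OF J(1,2)])
    fix w assume w: "K * N (w - z) < 1 - N z"
    have "N (w - z) \<le> K * N (w - z)" using K_ge_1 N_nonneg[of "w - z"] by (simp add: mult_le_cancel_right1)
    then have "N w < 1" using w N_triangle[of z "w - z"] by simp
    moreover have "\<bar>fst i w\<bar> \<le> 1" if "i \<in> I - J" for i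
      using J(3)[OF that] I_diff[of i w z] that w by simp
    then have "active w \<subseteq> J" unfolding active_def by force
    ultimately show "active w \<subseteq> J \<and> N w < 1" by simp
  next
    fix t assume t: "\<bar>t\<bar> * N z \<le> 1"
    have "\<bar>fst i (t *\<^sub>R z)\<bar> \<le> 1" if "i \<in> I - J" for i
    proof -
      have "bounded_linear (fst i)" using that I_bounded_linear by blast
      then have "\<bar>fst i (t *\<^sub>R z)\<bar> = \<bar>t\<bar> * \<bar>fst i z\<bar>" by (simp add: linear_simps abs_mult)
      also have "\<dots> \<le> \<bar>t\<bar> * N z" by (intro mult_left_mono J(3) that) simp
      finally show ?thesis using t by simp
    qed
    then show "active (t *\<^sub>R z) \<subseteq> J" unfolding active_def by force
  qed
qed

lemma finite_active:
  assumes "z \<in> Y" "N z < 1" shows "finite (active z)"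
proof -
  obtain J where J: "J \<subseteq> I" "finite J" "\<And>w. K * N (w - z) < 1 - N z \<Longrightarrow> active w \<subseteq> J \<and> N w < 1"
    using active_local[OF assms] by metis
  have "active z \<subseteq> J" using J(3)[of z] assms(2) by (simp add: N_0)
  then show ?thesis using J(2) by (rule finite_subset)
qed

lemma active_subset: "active z \<subseteq> I"
  by (auto simp: active_def)

lemma \<Phi>_minus: "\<Phi> (- z) = \<Phi> z"
proof -
  have bl: "fst i (- z) = - fst i z" if "i \<in> I" for i
    using I_bounded_linear[OF that] by (simp add: linear_simps)
  have "active (- z) = active z"
    unfolding active_def by (rule Collect_cong) (metis abs_minus_cancel bl)
  then show ?thesis
    unfolding \<Phi>_def
  proof (rule sum.cong)
    fix i assume "i \<in> active z"
    then have "i \<in> I" using active_subset by blast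
    then show "pen (snd i) (fst i (- z)) = pen (snd i) (fst i z)" by (simp add: bl pen_minus)
  qed
qed

lemma \<Phi>_convex:
  assumes u: "u \<in> Y" "N u < 1" and v: "v \<in> Y" "N v < 1" and t: "0 \<le> t" "t \<le> 1"
  shows "N ((1 - t) *\<^sub>R u + t *\<^sub>R v) < 1" "\<Phi> ((1 - t) *\<^sub>R u + t *\<^sub>R v) \<le> (1 - t) * \<Phi> u + t * \<Phi> v"
proof -
  let ?w = "(1 - t) *\<^sub>R u + t *\<^sub>R v"
  have "N ?w \<le> (1 - t) * N u + t * N v"
    using N_triangle[of "(1 - t) *\<^sub>R u" "t *\<^sub>R v"] t by (simp add: N_scale)
  also have "\<dots> < 1" using convex_bound_lt[OF u(2) v(2), of "1 - t" t] t by simp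
  finally show w: "N ?w < 1" .
  have wY: "?w \<in> Y" using u v subspace_Y by (intro subspace_add subspace_scale)
  \<comment> \<open>One finite index set for all three points, so that the sums can be compared term
    by term.\<close>
  define J where "J = active u \<union> active v \<union> active ?w"
  have J: "finite J" "J \<subseteq> I"
    using finite_active[OF u] finite_active[OF v] finite_active[OF wY w] active_subset by (auto simp: J_def)
  have "\<Phi> ?w = (\<Sum>i\<in>J. pen (snd i) (fst i ?w))" by (rule \<Phi>_eq[OF _ J]) (auto simp: J_def)
  also have "\<dots> \<le> (\<Sum>i\<in>J. (1 - t) * pen (snd i) (fst i u) + t * pen (snd i) (fst i v))"
  proof (rule sum_mono)
    fix i assume "i \<in> J"
    then have "fst i ?w = (1 - t) * fst i u + t * fst i v"
      using I_bounded_linear[of i] J(2) by (auto simp: linear_simps)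
    then show "pen (snd i) (fst i ?w) \<le> (1 - t) * pen (snd i) (fst i u) + t * pen (snd i) (fst i v)"
      using convex_onD[OF convex_on_pen, of t "fst i u" "fst i v" "snd i"] t by simp
  qed
  also have "\<dots> = (1 - t) * \<Phi> u + t * \<Phi> v"
    by (subst (1 2) \<Phi>_eq[OF _ J]) (auto simp: J_def sum.distrib sum_distrib_left)
  finally show "\<Phi> ?w \<le> (1 - t) * \<Phi> u + t * \<Phi> v" .
qed

lemma \<Phi>_0: "\<Phi> 0 = 0"
proof -
  have "active 0 = {}" using I_le[of _ 0] by (force simp: active_def N_0)
  then show ?thesis by (simp add: \<Phi>_def)
qed

lemma \<Phi>_scale_le:
  assumes "z \<in> Y" "N z < 1" "0 \<le> t" "t \<le> 1"
  shows "\<Phi> (t *\<^sub>R z) \<le> t * \<Phi> z"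
  using \<Phi>_convex(2)[OF subspace_0[OF subspace_Y] _ assms] by (simp add: N_0 \<Phi>_0)

text \<open>On the ray of \<open>x\<close> the penalties total at least 2 where some functional
  attains its margin, which happens inside the unit ball of \<open>N\<close>. The intermediate value
  theorem yields the level 1.\<close>

lemma level_exists:
  assumes x: "x \<in> Y" "x \<noteq> 0"
  shows "\<exists>t. N x < t \<and> \<Phi> ((1 / t) *\<^sub>R x) = 1"
proof -
  have Nx: "0 < N x" using x by (intro N_pos)
  \<comment> \<open>A point of the ray inside the unit ball of \<open>N\<close>; its set
    \<open>J\<close> serves the ray up to the \<open>N\<close>-sphere.\<close>
  let ?z = "(1 / (2 * N x)) *\<^sub>R x"
  have z: "?z \<in> Y" "N ?z < 1" using x Nx subspace_scale[OF subspace_Y] by (auto simp: N_scale)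
  obtain J where J: "J \<subseteq> I" "finite J" "\<And>t. \<bar>t\<bar> * N ?z \<le> 1 \<Longrightarrow> active (t *\<^sub>R ?z) \<subseteq> J"
    using active_local[OF z] by metis
  define r where "r l = (\<Sum>i\<in>J. pen (snd i) (l * fst i x))" for l
  have \<Phi>r: "\<Phi> (l *\<^sub>R x) = r l" if l: "0 \<le> l" "l * N x \<le> 1" for l
  proof -
    have eq: "l *\<^sub>R x = (2 * N x * l) *\<^sub>R ?z" using Nx by simp
    have "\<bar>2 * N x * l\<bar> * N ?z \<le> 1" using l Nx by (simp add: N_scale mult.commute)
    then have "active (l *\<^sub>R x) \<subseteq> J" unfolding eq by (rule J(3))
    moreover have "fst i (l *\<^sub>R x) = l * fst i x" if "i \<in> J" for i
      using I_bounded_linear[of i] that J(1) by (auto simp: linear_simps)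
    ultimately show ?thesis by (simp add: \<Phi>_eq[OF _ J(2,1)] r_def)
  qed
  obtain j where j: "j \<in> I" "snd j * N x < fst j x"
    using adapted_at[OF adapted x(1)] x(2) by (metis subsetD)
  have gj: "0 < fst j x" using j I_gt_1[OF j(1)] Nx by (smt (verit) mult_pos_pos)
  \<comment> \<open>There \<open>fst j\<close> has the value \<open>snd j\<close>, and
    \<open>l * N x < 1\<close> is the margin property of \<open>j\<close>.\<close>
  define l where "l = snd j / fst j x"
  have l: "0 < l" "l * N x < 1" using j(2) I_gt_1[OF j(1)] gj by (simp_all add: l_def field_simps)
  have "2 \<le> r l"
  proof -
    have "l * fst j x = snd j" using gj by (simp add: l_def)
    then have 2: "2 \<le> pen (snd j) (fst j (l *\<^sub>R x))" and 1: "1 < \<bar>fst j (l *\<^sub>R x)\<bar>"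
      using pen_ge_2[OF I_gt_1[OF j(1)] order_refl] I_gt_1[OF j(1)] I_bounded_linear[OF j(1)]
      by (simp_all add: linear_simps)
    have "finite (active (l *\<^sub>R x))"
      using l x by (intro finite_active subspace_scale[OF subspace_Y]) (auto simp: N_scale)
    moreover have "j \<in> active (l *\<^sub>R x)" using j(1) 1 by (simp add: active_def)
    ultimately have "pen (snd j) (fst j (l *\<^sub>R x)) \<le> \<Phi> (l *\<^sub>R x)"
      unfolding \<Phi>_def by (intro member_le_sum) (auto intro: pen_nonneg)
    then show ?thesis using 2 \<Phi>r[of l] l by simp
  qed
  moreover have "r 0 = 0" by (simp add: r_def pen_eq_0)
  moreover have "continuous_on {0..l} r"
  proof -
    have cp: "continuous_on UNIV (pen \<tau>)" for \<tau>
      using pen_has_derivative by (meson DERIV_continuous_on has_field_derivative_at_within)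
    then show ?thesis
      unfolding r_def
      by (intro continuous_on_sum continuous_on_compose2[OF cp] continuous_on_mult_right continuous_on_id subset_UNIV)
  qed
  ultimately obtain l' where l': "0 \<le> l'" "l' \<le> l" "r l' = 1"
    using IVT'[of r 0 1 l] l by auto
  then have "l' \<noteq> 0" using \<open>r 0 = 0\<close> by auto
  then have pos: "0 < l'" using l' by simp
  have "l' * N x \<le> l * N x" using l'(2) Nx by simp
  then have lN: "l' * N x < 1" using l(2) by linarith
  show ?thesis
  proof (intro exI[of _ "1 / l'"] conjI)
    show "N x < 1 / l'" using pos lN by (simp add: field_simps)
    show "\<Phi> ((1 / (1 / l')) *\<^sub>R x) = 1" using \<Phi>r[of l'] pos lN l'(3) by simp
  qed
qed

text \<open>As \<open>\<Phi>\<close> is convex and vanishes at 0, shrinking a point by a factor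
  below 1 shrinks its value at least by that factor. This makes the level on a ray unique.\<close>

lemma level_le:
  assumes x: "x \<in> Y" and m: "N x < m" "\<Phi> ((1 / m) *\<^sub>R x) = 1" and t: "N x < t" "\<Phi> ((1 / t) *\<^sub>R x) \<le> 1"
  shows "m \<le> t"
proof (rule ccontr)
  assume "\<not> m \<le> t"
  then have tm: "0 < t" "t < m" using t(1) N_nonneg[of x] by linarith+
  have eq: "(1 / m) *\<^sub>R x = (t / m) *\<^sub>R ((1 / t) *\<^sub>R x)" using tm by simp
  have "\<Phi> ((t / m) *\<^sub>R ((1 / t) *\<^sub>R x)) \<le> (t / m) * \<Phi> ((1 / t) *\<^sub>R x)"
    using x tm t(1) by (intro \<Phi>_scale_le subspace_scale[OF subspace_Y]) (auto simp: N_scale)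
  moreover have "(t / m) * \<Phi> ((1 / t) *\<^sub>R x) < 1"
  proof -
    have "(t / m) * \<Phi> ((1 / t) *\<^sub>R x) \<le> (t / m) * 1" using t(2) tm by (intro mult_left_mono) auto
    also have "\<dots> < 1" using tm by simp
    finally show ?thesis .
  qed
  ultimately show False using m(2) unfolding eq by linarith
qed

text \<open>The gauge of the set of \<open>z\<close> with \<open>N z < 1\<close> and
  \<open>\<Phi> z \<le> 1\<close>. The condition \<open>N x < t\<close> excludes points at which
  \<open>\<Phi>\<close> has a conventional value.\<close>

definition M :: "'a \<Rightarrow> real" where
  "M x = (if x = 0 then 0 else THE t. N x < t \<and> \<Phi> ((1 / t) *\<^sub>R x) = 1)"

lemma M_eqI:
  assumes "x \<in> Y" "x \<noteq> 0" "N x < t" "\<Phi> ((1 / t) *\<^sub>R x) = 1"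
  shows "M x = t"
proof -
  have "(THE t. N x < t \<and> \<Phi> ((1 / t) *\<^sub>R x) = 1) = t"
  proof (rule the_equality)
    show "N x < t \<and> \<Phi> ((1 / t) *\<^sub>R x) = 1" using assms by simp
    fix s assume s: "N x < s \<and> \<Phi> ((1 / s) *\<^sub>R x) = 1"
    show "s = t"
      using level_le[OF assms(1), of s t] level_le[OF assms(1), of t s] assms s by (intro antisym) auto
  qed
  then show ?thesis using assms(2) by (simp add: M_def)
qed

lemma M_level:
  assumes "x \<in> Y" "x \<noteq> 0" shows "N x < M x" "\<Phi> ((1 / M x) *\<^sub>R x) = 1"
  using level_exists[OF assms] M_eqI[OF assms] by auto

lemma M_pos: "x \<in> Y \<Longrightarrow> x \<noteq> 0 \<Longrightarrow> 0 < M x"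
  using M_level(1)[of x] N_nonneg[of x] by linarith

lemma M_le:
  assumes "x \<in> Y" "x \<noteq> 0" "N x < t" "\<Phi> ((1 / t) *\<^sub>R x) \<le> 1" shows "M x \<le> t"
  using level_le[OF assms(1) M_level[OF assms(1,2)] assms(3,4)] .

text \<open>If \<open>M x\<close> were larger, every functional would be at most 1 at the normalised
  point and all penalties would vanish, although they total 1.\<close>

lemma M_upper:
  assumes x: "x \<in> Y" "x \<noteq> 0" shows "M x \<le> K * N x"
proof (rule ccontr)
  assume *: "\<not> M x \<le> K * N x"
  have "\<bar>fst i ((1 / M x) *\<^sub>R x)\<bar> \<le> 1" if "i \<in> I" for i
    using I_le[OF that, of "(1 / M x) *\<^sub>R x"] * M_pos[OF x]
    by (simp add: N_scale) (smt (verit) divide_le_eq_1_pos)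
  then have "active ((1 / M x) *\<^sub>R x) = {}" unfolding active_def by force
  then have "\<Phi> ((1 / M x) *\<^sub>R x) = 0" by (simp add: \<Phi>_def)
  then show False using M_level(2)[OF x] by simp
qed

lemma seminorm_on_M: "seminorm_on Y M"
  unfolding seminorm_on_def
proof (intro conjI ballI allI)
  fix x assume x: "x \<in> Y"
  show "0 \<le> M x" using M_pos[OF x] by (cases "x = 0") (auto simp: M_def)
  fix c
  show "M (c *\<^sub>R x) = \<bar>c\<bar> * M x"
  proof (cases "c = 0 \<or> x = 0")
    case True then show ?thesis by (auto simp: M_def)
  next
    case False
    then have cx: "c *\<^sub>R x \<in> Y" "c *\<^sub>R x \<noteq> 0" and x0: "x \<noteq> 0" and c: "0 < \<bar>c\<bar>"
      using x subspace_scale[OF subspace_Y] by auto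
    show ?thesis
    proof (rule M_eqI[OF cx])
      show "N (c *\<^sub>R x) < \<bar>c\<bar> * M x" using M_level(1)[OF x x0] c by (simp add: N_scale)
      have "(1 / (\<bar>c\<bar> * M x)) *\<^sub>R c *\<^sub>R x = (if 0 < c then 1 else - 1) *\<^sub>R ((1 / M x) *\<^sub>R x)"
        using c by (auto simp: abs_if)
      then show "\<Phi> ((1 / (\<bar>c\<bar> * M x)) *\<^sub>R c *\<^sub>R x) = 1"
        using M_level(2)[OF x x0] \<Phi>_minus[of "(1 / M x) *\<^sub>R x"] by auto
    qed
  qed
next
  fix x y assume x: "x \<in> Y" and y: "y \<in> Y"
  have xy: "x + y \<in> Y" using x y by (rule subspace_add[OF subspace_Y])
  show "M (x + y) \<le> M x + M y"
  proof (cases "x = 0 \<or> y = 0 \<or> x + y = 0")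
    case True
    moreover have "0 \<le> M x" "0 \<le> M y"
      using M_pos[OF x] M_pos[OF y] by (cases "x = 0"; cases "y = 0"; simp add: M_def)+
    ultimately show ?thesis by (auto simp: M_def)
  next
    case False
    define a b where "a = M x" and "b = M y"
    have ab: "0 < a" "0 < b" using M_pos x y False by (auto simp: a_def b_def)
    \<comment> \<open>With the weight \<open>?t\<close> the convex combination of \<open>?u\<close>
      and \<open>?v\<close> is \<open>x + y\<close> divided by \<open>a + b\<close>, the classical
      argument for gauges.\<close>
    let ?u = "(1 / a) *\<^sub>R x" and ?v = "(1 / b) *\<^sub>R y" and ?t = "b / (a + b)"
    have u: "?u \<in> Y" "N ?u < 1" "\<Phi> ?u = 1"
      using M_level[OF x] x False ab subspace_scale[OF subspace_Y] by (auto simp: N_scale a_def)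
    have v: "?v \<in> Y" "N ?v < 1" "\<Phi> ?v = 1"
      using M_level[OF y] y False ab subspace_scale[OF subspace_Y] by (auto simp: N_scale b_def)
    have t: "0 \<le> ?t" "?t \<le> 1" using ab by auto
    have t1: "1 - ?t = a / (a + b)" using ab by (simp add: field_simps)
    have "(1 - ?t) *\<^sub>R ?u + ?t *\<^sub>R ?v = (1 / (a + b)) *\<^sub>R (x + y)"
      unfolding t1 using ab by (simp add: scaleR_add_right)
    then have w: "N ((1 / (a + b)) *\<^sub>R (x + y)) < 1" "\<Phi> ((1 / (a + b)) *\<^sub>R (x + y)) \<le> 1"
      using \<Phi>_convex[OF u(1,2) v(1,2) t] u(3) v(3) by (simp_all add: diff_divide_distrib)
    have "\<bar>1 / (a + b)\<bar> * N (x + y) < 1" using w(1) by (simp only: N_scale)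
    then have "N (x + y) < a + b" using ab by (simp add: pos_divide_less_eq)
    then show ?thesis using M_le[OF xy _ _ w(2)] False by (simp add: a_def b_def)
  qed
qed

lemma M_lower: "x \<in> Y \<Longrightarrow> N x \<le> M x"
  using M_level(1)[of x] by (cases "x = 0") (auto simp: M_def N_0)

lemma M_upper': "x \<in> Y \<Longrightarrow> M x \<le> K * N x"
  using M_upper[of x] by (cases "x = 0") (auto simp: M_def N_0)

lemma equivalent_norm_on_M: "equivalent_norm_on Y M"
proof -
  obtain c C where c: "0 < c" "0 < C" "\<And>x. c * norm x \<le> N x" "\<And>x. N x \<le> C * norm x" by (rule N_bounds) blast
  show ?thesis
  proof (rule equivalent_norm_onI[OF subspace_Y seminorm_on_M c(1), of "K * C"])
    show "0 < K * C" using c K_ge_1 by simp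
    fix x assume x: "x \<in> Y"
    show "c * norm x \<le> M x" using c(3)[of x] M_lower[OF x] by linarith
    have "K * N x \<le> K * (C * norm x)" using c(4)[of x] K_ge_1 by (intro mult_left_mono) auto
    then show "M x \<le> K * C * norm x" using M_upper'[OF x] by simp
  qed
qed

lemma M_lipschitz:
  obtains L where "0 < L" "\<And>x y. x \<in> Y \<Longrightarrow> y \<in> Y \<Longrightarrow> \<bar>M x - M y\<bar> \<le> L * norm (x - y)"
proof -
  obtain C where C: "0 < C" "\<And>x. x \<in> Y \<Longrightarrow> M x \<le> C * norm x"
    using equivalent_norm_on_M unfolding equivalent_norm_on_def by blast
  have "\<bar>M x - M y\<bar> \<le> C * norm (x - y)" if "x \<in> Y" "y \<in> Y" for x y
    using seminorm_on_diff_le[OF seminorm_on_M subspace_Y that] C(2)[OF subspace_diff[OF subspace_Y that]]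
    by simp
  then show ?thesis by (rule that[OF C(1)])
qed

end

section \<open>Derivatives of the gauge\<close>

text \<open>The equation \<open>h (u / F u) = 1\<close> is differentiated by hand. Multiplying the
  increment of \<open>u / F u\<close> by \<open>F u\<close> gives \<open>u - y\<close> minus the
  increment of \<open>F\<close> times the normalised point; \<open>dh\<close> of the left side is a
  remainder, and solving for the increment of \<open>F\<close> divides by \<open>s\<close>.\<close>

lemma implicit_gauge_derivative:
  fixes F h :: "'a::real_normed_vector \<Rightarrow> real"
  assumes V: "openin (top_of_set S) V" "y \<in> V"
    and F: "\<And>u. u \<in> V \<Longrightarrow> 0 < F u" "0 < L" "\<And>u. u \<in> V \<Longrightarrow> \<bar>F u - F y\<bar> \<le> L * norm (u - y)"
    and h: "(h has_derivative dh) (at ((1 / F y) *\<^sub>R y))" "\<And>u. u \<in> V \<Longrightarrow> h ((1 / F u) *\<^sub>R u) = 1"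
    and s: "s = dh ((1 / F y) *\<^sub>R y)" "0 < s"
  shows "(F has_derivative (\<lambda>v. dh v / s)) (at y within S)"
  unfolding has_derivative_within_alt
proof (intro conjI allI impI)
  have dh: "bounded_linear dh" using h(1) by (rule has_derivative_bounded_linear)
  then show "bounded_linear (\<lambda>v. dh v / s)" by (rule bounded_linear_compose[OF bounded_linear_divide])
  let ?m = "F y" and ?w = "(1 / F y) *\<^sub>R y"
  \<comment> \<open>Bounds \<open>F u\<close> times the increment of the normalised point, relative
    to \<open>norm (u - y)\<close>.\<close>
  define B where "B = 1 + L * norm ?w"
  have B: "0 < B" using F(2) by (simp add: B_def add_pos_nonneg)
  have m: "0 < ?m" using F(1) V(2) by blast
  fix \<epsilon> :: real assume "0 < \<epsilon>"
  define \<eta> where "\<eta> = \<epsilon> * s / B"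
  have \<eta>: "0 < \<eta>" using \<open>0 < \<epsilon>\<close> s B by (simp add: \<eta>_def)
  obtain d1 where d1: "0 < d1" "\<And>w. norm (w - ?w) < d1 \<Longrightarrow> \<bar>h w - h ?w - dh (w - ?w)\<bar> \<le> \<eta> * norm (w - ?w)"
    using h(1) \<eta> unfolding has_derivative_within_alt by (metis UNIV_I real_norm_def)
  obtain d2 where d2: "0 < d2" "\<And>u. u \<in> S \<Longrightarrow> dist u y < d2 \<Longrightarrow> u \<in> V"
    using V unfolding openin_euclidean_subtopology_iff by blast
  \<comment> \<open>The three bounds keep \<open>u\<close> in \<open>V\<close>, keep
    \<open>F u\<close> above half of \<open>F y\<close>, and keep the normalised point within
    \<open>d1\<close>, in this order.\<close>
  define d where "d = min d2 (min (?m / (2 * L)) (d1 * ?m / (2 * B)))"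
  have d: "0 < d" using d1(1) d2(1) m F(2) B by (simp add: d_def)
  have "norm (F u - F y - dh (u - y) / s) \<le> \<epsilon> * norm (u - y)" if u: "u \<in> S" "norm (u - y) < d" for u
  proof -
    have uV: "u \<in> V" using u d2(2)[of u] by (simp add: d_def dist_norm)
    let ?m' = "F u" and ?w' = "(1 / F u) *\<^sub>R u"
    have m': "0 < ?m'" using F(1) uV by blast
    have "L * norm (u - y) \<le> L * (?m / (2 * L))" using u(2) F(2) by (intro mult_left_mono) (auto simp: d_def)
    then have "L * norm (u - y) \<le> ?m / 2" using F(2) by simp
    then have half: "?m / 2 \<le> ?m'" using F(3)[OF uV] by linarith
    have eq: "?m' *\<^sub>R (?w' - ?w) = (u - y) - (?m' - ?m) *\<^sub>R ?w"
      using m m' by (simp add: algebra_simps)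
    have "?m' * norm (?w' - ?w) = norm (?m' *\<^sub>R (?w' - ?w))" using m' by simp
    also have "\<dots> \<le> norm (u - y) + norm ((?m' - ?m) *\<^sub>R ?w)" unfolding eq by (rule norm_triangle_ineq4)
    also have "\<dots> \<le> norm (u - y) + (L * norm (u - y)) * norm ?w"
      using F(3)[OF uV] by (simp only: norm_scaleR real_norm_def) (intro add_left_mono mult_right_mono, auto)
    also have "\<dots> = B * norm (u - y)" by (simp add: B_def algebra_simps)
    finally have mw: "?m' * norm (?w' - ?w) \<le> B * norm (u - y)" .
    have "?m / 2 * norm (?w' - ?w) \<le> ?m' * norm (?w' - ?w)" using half by (rule mult_right_mono) simp
    also have "\<dots> \<le> B * norm (u - y)" by (rule mw)
    also have "\<dots> < B * (d1 * ?m / (2 * B))" using u(2) B by (intro mult_strict_left_mono) (auto simp: d_def)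
    also have "\<dots> = ?m / 2 * d1" using B by simp
    finally have "norm (?w' - ?w) < d1" using m by (simp only: mult_less_cancel_left_pos half_gt_zero)
    \<comment> \<open>\<open>h\<close> is 1 at both points, so its increment drops out and
      \<open>dh\<close> of the difference is the remainder alone.\<close>
    from d1(2)[OF this] have "\<bar>dh (?w' - ?w)\<bar> \<le> \<eta> * norm (?w' - ?w)"
      using h(2)[OF uV] h(2)[OF V(2)] by simp
    then have "?m' * \<bar>dh (?w' - ?w)\<bar> \<le> ?m' * (\<eta> * norm (?w' - ?w))" using m' by (intro mult_left_mono) auto
    also have "\<dots> = \<eta> * (?m' * norm (?w' - ?w))" by simp
    also have "\<dots> \<le> \<eta> * (B * norm (u - y))" using mw \<eta> by (intro mult_left_mono) auto
    also have "\<dots> = \<epsilon> * s * norm (u - y)" using B by (simp add: \<eta>_def)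
    finally have bound: "?m' * \<bar>dh (?w' - ?w)\<bar> \<le> \<epsilon> * s * norm (u - y)" .
    have "?m' * dh (?w' - ?w) = dh (?m' *\<^sub>R (?w' - ?w))" using dh by (simp add: linear_simps)
    also have "\<dots> = dh (u - y) - (?m' - ?m) * s" unfolding eq s(1) using dh by (simp add: linear_simps)
    finally have "dh (u - y) = ?m' * dh (?w' - ?w) + (?m' - ?m) * s" by simp
    then have "?m' - ?m - dh (u - y) / s = - (?m' * dh (?w' - ?w)) / s" using s(2) by (simp only: add_divide_distrib) simp
    then have "norm (?m' - ?m - dh (u - y) / s) = (?m' * \<bar>dh (?w' - ?w)\<bar>) / s"
      using s(2) m' by (simp add: abs_mult)
    also have "\<dots> \<le> (\<epsilon> * s * norm (u - y)) / s" using bound s(2) by (intro divide_right_mono) auto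
    finally show ?thesis using s(2) by simp
  qed
  then show "\<exists>d>0. \<forall>u\<in>S. norm (u - y) < d \<longrightarrow> norm (F u - F y - dh (u - y) / s) \<le> \<epsilon> * norm (u - y)"
    using d by blast
qed

context adapted_norm
begin

lemma openin_Y_minus_0: "openin (top_of_set Y) (Y - {0})"
proof -
  have "Y - {0} = Y \<inter> - {0}" by auto
  then show ?thesis by (metis openin_open_Int open_Compl closed_singleton)
qed

text \<open>Normalisation by \<open>M\<close> is continuous away from 0 and carries a neighbourhood
  of \<open>x\<close> into the region where \<open>active_local\<close> supplies a single finite
  \<open>J\<close>.\<close>

lemma M_local:
  assumes x: "x \<in> Y" "x \<noteq> 0"
  obtains J V where "J \<subseteq> I" "finite J" "openin (top_of_set Y) V" "x \<in> V" "0 \<notin> V"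
    "\<forall>y\<in>V. (\<Sum>i\<in>J. pen (snd i) (fst i y * inverse (M y))) = 1"
proof -
  define z where "z = (1 / M x) *\<^sub>R x"
  have z: "z \<in> Y" "N z < 1"
    using x M_level(1)[OF x] M_pos[OF x] subspace_scale[OF subspace_Y] by (auto simp: z_def N_scale)
  obtain J where J: "J \<subseteq> I" "finite J" "\<And>w. K * N (w - z) < 1 - N z \<Longrightarrow> active w \<subseteq> J \<and> N w < 1"
    using active_local[OF z] by metis
  define T where "T = {w. K * N (w - z) < 1 - N z}"
  have "continuous_on UNIV (\<lambda>w. N (w - z))"
    by (rule continuous_on_compose2[OF continuous_on_N[of UNIV]]) (auto intro!: continuous_intros)
  then have "continuous_on UNIV (\<lambda>w. K * N (w - z))" by (rule continuous_on_mult_left)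
  then have T: "open T" unfolding T_def by (rule open_Collect_less[OF _ continuous_on_const])
  obtain L where L: "0 < L" "\<And>x y. x \<in> Y \<Longrightarrow> y \<in> Y \<Longrightarrow> \<bar>M x - M y\<bar> \<le> L * norm (x - y)"
    using M_lipschitz by metis
  have "continuous_on (Y - {0}) M" by (rule continuous_on_lipschitz[of _ _ L]) (use L(2) in auto)
  then have "continuous_on (Y - {0}) (\<lambda>y. (1 / M y) *\<^sub>R y)"
    using M_pos by (intro continuous_intros) force+
  then have "openin (top_of_set (Y - {0})) ((Y - {0}) \<inter> (\<lambda>y. (1 / M y) *\<^sub>R y) -` T)"
    using T by (rule continuous_openin_preimage_gen)
  then have V: "openin (top_of_set Y) ((Y - {0}) \<inter> (\<lambda>y. (1 / M y) *\<^sub>R y) -` T)" (is "openin _ ?V")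
    using openin_Y_minus_0 by (rule openin_trans)
  show ?thesis
  proof (rule that[OF J(1,2) V _ _ ballI])
    show "x \<in> ?V" using x z by (simp add: T_def N_0 flip: z_def)
    show "0 \<notin> ?V" by simp
    fix y assume y: "y \<in> ?V"
    then have y': "y \<in> Y" "y \<noteq> 0" by auto
    have "active ((1 / M y) *\<^sub>R y) \<subseteq> J" using y J(3) by (auto simp: T_def)
    then have "(\<Sum>i\<in>J. pen (snd i) (fst i ((1 / M y) *\<^sub>R y))) = 1"
      using M_level(2)[OF y'] \<Phi>_eq[OF _ J(2,1)] by simp
    moreover have "fst i ((1 / M y) *\<^sub>R y) = fst i y * inverse (M y)" if "i \<in> J" for i
      using I_bounded_linear[of i] that J(1) by (auto simp: linear_simps inverse_eq_divide)
    ultimately show "(\<Sum>i\<in>J. pen (snd i) (fst i y * inverse (M y))) = 1" by simp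
  qed
qed

text \<open>The coefficients of the derivative are smooth functions of \<open>M\<close> and of the
  functionals in \<open>J\<close>, so smoothness of order \<open>k\<close> gives order
  \<open>k + 1\<close>. Local dependence on \<open>J\<close> follows as the equation for
  \<open>M\<close> involves no other functionals.\<close>

lemma nice_at_M:
  assumes x: "x \<in> Y" "x \<noteq> 0"
  shows "nice_at Y M x"
proof -
  obtain J V where J: "J \<subseteq> I" "finite J" and V: "openin (top_of_set Y) V" "x \<in> V" "0 \<notin> V"
    and "\<forall>y\<in>V. (\<Sum>i\<in>J. pen (snd i) (fst i y * inverse (M y))) = 1"
    by (rule M_local[OF x])
  then have one: "(\<Sum>i\<in>J. pen (snd i) (fst i y * inverse (M y))) = 1" if "y \<in> V" for y
    using that by blast
  have VY: "V \<subseteq> Y" using V(1) by (rule openin_imp_subset)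
  have Mpos: "0 < M y" if "y \<in> V" for y using that VY V(3) by (intro M_pos) auto
  have bl: "bounded_linear (fst i)" if "i \<in> J" for i using that J(1) I_bounded_linear by blast
  obtain L where L: "0 < L" "\<And>x y. x \<in> Y \<Longrightarrow> y \<in> Y \<Longrightarrow> \<bar>M x - M y\<bar> \<le> L * norm (x - y)"
    using M_lipschitz by metis
  define q where "q i y = pen' (snd i) (fst i y * inverse (M y))" for i y
  define s where "s y = (\<Sum>i\<in>J. q i y * (fst i y * inverse (M y)))" for y
  \<comment> \<open>The radial derivative of a convex function vanishing at 0 is at least its value,
    here 1; so the denominator stays away from 0.\<close>
  have s: "1 \<le> s y" if "y \<in> V" for y
    unfolding s_def q_def one[OF that, symmetric] by (intro sum_mono pen_le_deriv)
  have deriv: "(M has_derivative (\<lambda>v. (\<Sum>i\<in>J. q i y * fst i v) / s y)) (at y within Y)" if y: "y \<in> V" for y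
  proof -
    let ?w = "(1 / M y) *\<^sub>R y"
    have w: "fst i ((1 / M u) *\<^sub>R u) = fst i u * inverse (M u)" if "i \<in> J" for i u
      using bl[OF that] by (simp add: linear_simps inverse_eq_divide)
    have "((\<lambda>u. pen (snd i) (fst i u)) has_derivative (\<lambda>v. q i y * fst i v)) (at ?w)" if "i \<in> J" for i
    proof -
      have "(pen (snd i) has_derivative (*) (q i y)) (at (fst i ?w))"
        using pen_has_derivative[of "snd i" "fst i ?w"] w[OF that, of y]
        by (simp add: has_field_derivative_def q_def)
      then show ?thesis
        by (rule has_derivative_compose[OF bounded_linear_imp_has_derivative[OF bl[OF that]]])
    qed
    then have hd: "((\<lambda>u. \<Sum>i\<in>J. pen (snd i) (fst i u)) has_derivative (\<lambda>v. \<Sum>i\<in>J. q i y * fst i v)) (at ?w)"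
      by (rule has_derivative_sum)
    show ?thesis
    proof (rule implicit_gauge_derivative[where F=M and y=y and s="s y"
          and h="\<lambda>u. \<Sum>i\<in>J. pen (snd i) (fst i u)" and dh="\<lambda>v. \<Sum>i\<in>J. q i y * fst i v",
          OF V(1) y Mpos L(1) _ hd])
      show "\<bar>M u - M y\<bar> \<le> L * norm (u - y)" if "u \<in> V" for u
        using that y VY by (intro L(2)) auto
      show "(\<Sum>i\<in>J. pen (snd i) (fst i ((1 / M u) *\<^sub>R u))) = 1" if "u \<in> V" for u
        using one[OF that] by (simp add: w)
      show "s y = (\<Sum>i\<in>J. q i y * fst i ?w)" unfolding s_def by (intro sum.cong refl) (simp only: w)
      show "0 < s y" using s[OF y] by simp
    qed
  qed
  have "smooth k Y V M" for k
  proof (induction k)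
    case 0
    show ?case using continuous_on_lipschitz[of V M L] L(2) VY by (simp add: subset_iff)
  next
    case (Suc k)
    \<comment> \<open>\<open>lform\<close> takes a list; distinctness turns its sum into the sum
      over \<open>J\<close>.\<close>
    obtain l where l: "distinct l" "set l = J" using finite_distinct_list[OF J(2)] by blast
    let ?L = "map (\<lambda>i. (\<lambda>y. q i y * inverse (s y), fst i)) l"
    have inv: "smooth k Y V (\<lambda>y. inverse (M y))"
      by (rule smooth_compose[OF smooth_real_inverse Suc VY]) (use Mpos in force)
    have lin: "smooth k Y V (\<lambda>y. fst i y * inverse (M y))" if "i \<in> J" for i
      by (intro smooth_mult VY inv smooth_bounded_linear bl that)
    have q: "smooth k Y V (q i)" if "i \<in> J" for i
      unfolding q_def by (intro smooth_pen' VY lin that)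
    have "smooth k Y V s"
      unfolding s_def by (intro smooth_sum J(2) smooth_mult VY q lin)
    then have "smooth k Y V (\<lambda>y. inverse (s y))"
      by (rule smooth_compose[OF smooth_real_inverse _ VY]) (use s in force)
    then have coeff: "smooth k Y V (\<lambda>y. q i y * inverse (s y))" if "i \<in> J" for i
      by (intro smooth_mult VY q that)
    show ?case
      unfolding smooth.simps(2)
    proof (intro exI[of _ ?L] conjI ballI)
      fix p assume "p \<in> set ?L"
      then show "case p of (a, \<psi>) \<Rightarrow> smooth k Y V a \<and> bounded_linear \<psi>" using coeff bl l(2) by auto
    next
      fix y assume y: "y \<in> V"
      have "lform ?L y v = (\<Sum>i\<in>J. q i y * fst i v) / s y" for v
      proof -
        have "lform ?L y v = (\<Sum>i\<in>J. q i y * inverse (s y) * fst i v)"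
          by (simp add: lform_def comp_def sum_list_distinct_conv_sum_set[OF l(1)] l(2))
        also have "\<dots> = (\<Sum>i\<in>J. q i y * fst i v / s y)" by (simp add: divide_inverse mult_ac)
        finally show ?thesis by (simp add: sum_divide_distrib)
      qed
      then show "(M has_derivative lform ?L y) (at y within Y)" using deriv[OF y] by presburger
    qed
  qed
  moreover have "lfc_at Y M x"
  proof (rule lfc_atI[OF V(1,2)])
    show "finite (fst ` J)" using J(2) by simp
    show "fst ` J \<subseteq> dual_on Y" using bl dual_on_bounded_linear by blast
    \<comment> \<open>With equal coordinates the normalised points are multiples of each other as
      far as \<open>J\<close> can see. If \<open>M z\<close> were larger, convexity of the penalties
      would give \<open>1 \<le> M y / M z < 1\<close>.\<close>
    have le: "M z \<le> M y" if yz: "y \<in> V" "z \<in> V" "\<And>i. i \<in> J \<Longrightarrow> fst i y = fst i z" for y z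
    proof (rule ccontr)
      assume "\<not> M z \<le> M y"
      then have t: "0 \<le> M y / M z" "M y / M z \<le> 1" "M y / M z < 1"
        using Mpos[OF yz(1)] Mpos[OF yz(2)] by simp_all
      have "1 = (\<Sum>i\<in>J. pen (snd i) (M y / M z * (fst i y * inverse (M y))))"
        unfolding one[OF yz(2), symmetric]
      proof (rule sum.cong)
        fix i assume "i \<in> J"
        then have "M y / M z * (fst i y * inverse (M y)) = fst i z * inverse (M z)"
          using yz(3) Mpos[OF yz(1)] by (simp add: field_simps)
        then show "pen (snd i) (fst i z * inverse (M z)) = pen (snd i) (M y / M z * (fst i y * inverse (M y)))"
          by simp
      qed simp
      also have "\<dots> \<le> (\<Sum>i\<in>J. M y / M z * pen (snd i) (fst i y * inverse (M y)))"
        by (intro sum_mono pen_scale_le t)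
      also have "\<dots> = M y / M z" unfolding sum_distrib_left[symmetric] one[OF yz(1)] by simp
      finally show False using t(3) by simp
    qed
    fix y z assume yz: "y \<in> V" "z \<in> V" "\<And>\<psi>. \<psi> \<in> fst ` J \<Longrightarrow> \<psi> y = \<psi> z"
    have "fst i y = fst i z" if "i \<in> J" for i using yz(3)[of "fst i"] that by simp
    then show "M y = M z" using le[OF yz(1,2)] le[OF yz(2,1)] by (intro antisym) auto
  qed
  ultimately show ?thesis unfolding nice_at_def using V(1,2) by blast
qed

lemma Cinf_norm_on_M: "Cinf_norm_on Y M"
proof -
  have "Cinf_on Y (Y - {0}) M"
    by (rule Cinf_on_if_nice_at[OF subspace_Y openin_Y_minus_0]) (simp add: nice_at_M)
  then show ?thesis by (simp add: Cinf_norm_on_def Ck_norm_on_def Cinf_on_def)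
qed

lemma lfc_norm_on_M: "lfc_norm_on Y M"
  unfolding lfc_norm_on_def
proof (intro ballI impI)
  fix x assume "x \<in> Y" "M x = 1"
  then have "nice_at Y M x" by (intro nice_at_M) (auto simp: M_def)
  then show "lfc_at Y M x" by (simp add: nice_at_def)
qed

end

subsection \<open>Partitions of unity\<close>

lemma nice_at_flat:
  assumes "nice_at S f x" shows "nice_at S (\<lambda>y. flat (c * f y + d)) x"
proof (rule nice_at_compose[OF smooth_real_flat open_UNIV])
  have x: "x \<in> S" using assms by (rule nice_at_in)
  show "nice_at S (\<lambda>y. c * f y + d) x"
    by (rule nice_at_add[OF nice_at_mult[OF nice_at_const[OF x] assms] nice_at_const[OF x]])
qed simp

text \<open>Members of level \<open>m\<close> are cut off where the sum over a previous level exceeds \<open>1/(m+1)\<close>: this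
  makes the family locally finite and keeps the sum of all members positive.\<close>

lemma partition_of_unity_from_sigma_discrete:
  fixes S :: "'a::real_normed_vector set" and \<F> :: "nat \<Rightarrow> ('a \<Rightarrow> real) set"
  assumes S: "subspace S"
    and nice: "\<And>m u x. u \<in> \<F> m \<Longrightarrow> x \<in> S \<Longrightarrow> nice_at S u x"
    and nonneg: "\<And>m u x. u \<in> \<F> m \<Longrightarrow> x \<in> S \<Longrightarrow> 0 \<le> u x"
    and sub: "\<And>m u. u \<in> \<F> m \<Longrightarrow> \<exists>V\<in>\<U>. {x\<in>S. u x \<noteq> 0} \<subseteq> V"
    and discrete: "\<And>m. \<exists>d>0. \<forall>u\<in>\<F> m. \<forall>v\<in>\<F> m. u \<noteq> v \<longrightarrow>
        (\<forall>x\<in>S. \<forall>y\<in>S. u x \<noteq> 0 \<longrightarrow> v y \<noteq> 0 \<longrightarrow> d \<le> dist x y)"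
    and cover: "\<And>x. x \<in> S \<Longrightarrow> \<exists>m. \<exists>u\<in>\<F> m. 0 < u x"
  shows "\<exists>(\<Lambda> :: (nat \<times> ('a \<Rightarrow> real)) set) f.
          partition_of_unity_on S \<Lambda> f \<and> subordinated_on S \<Lambda> f \<U> \<and>
          locally_finite_on S \<Lambda> f \<and> sigma_uniformly_discrete_on S \<Lambda> f \<and>
          (\<forall>\<gamma>\<in>\<Lambda>. Cinf_on S S (f \<gamma>) \<and> lfc_on S (f \<gamma>))"
proof -
  obtain d where d: "\<And>m. 0 < d m"
    "\<And>m u v x y. u \<in> \<F> m \<Longrightarrow> v \<in> \<F> m \<Longrightarrow> u \<noteq> v \<Longrightarrow> x \<in> S \<Longrightarrow> y \<in> S \<Longrightarrow> u x \<noteq> 0 \<Longrightarrow> v y \<noteq> 0 \<Longrightarrow> d m \<le> dist x y"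
    using discrete by metis
  define B where "B m x = S \<inter> ball x (d m / 2)" for m x
  \<comment> \<open>By discreteness a ball of radius \<open>d m / 2\<close> meets the support of at
    most one member, so the sum over a level is locally a single term.\<close>
  define A where "A m x = {u\<in>\<F> m. \<exists>y\<in>B m x. u y \<noteq> 0}" for m x
  have B: "openin (top_of_set S) (B m x)" for m x by (auto simp: B_def openin_open_Int)
  have xB: "x \<in> B m x" if "x \<in> S" for m x using that d(1)[of m] by (simp add: B_def)
  have A_single: "u = v" if uv: "u \<in> A m x" "v \<in> A m x" for m x u v
  proof (rule ccontr)
    assume "u \<noteq> v"
    obtain y z where yz: "y \<in> B m x" "z \<in> B m x" "u y \<noteq> 0" "v z \<noteq> 0" using uv unfolding A_def by blast
    have "d m \<le> dist y z" using uv yz \<open>u \<noteq> v\<close> by (intro d(2)[of u m v]) (auto simp: A_def B_def)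
    moreover have "dist y z < d m" using yz(1,2) dist_triangle_half_r[of x y "d m" z] by (simp add: B_def)
    ultimately show False by simp
  qed
  have finA: "finite (A m x)" for m x
  proof (cases "A m x = {}")
    case False
    then obtain u where "u \<in> A m x" by blast
    then have "A m x \<subseteq> {u}" using A_single by blast
    then show ?thesis by (rule finite_subset) simp
  qed simp
  define v where "v m x = (\<Sum>u\<in>A m x. u x)" for m x
  have v_local: "v m y = (\<Sum>u\<in>A m x. u y)" if x: "x \<in> S" and y: "y \<in> B m x" for m x y
  proof -
    have yS: "y \<in> S" using y by (simp add: B_def)
    have "v m y = (\<Sum>u\<in>A m x \<union> A m y. u y)"
      unfolding v_def using finA xB[OF yS]
      by (intro sum.mono_neutral_left) (auto simp: A_def)
    also have "\<dots> = (\<Sum>u\<in>A m x. u y)"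
      using finA y by (intro sum.mono_neutral_right) (auto simp: A_def)
    finally show ?thesis .
  qed
  have AF: "u \<in> A m x \<Longrightarrow> u \<in> \<F> m" for m x u by (simp add: A_def)
  have nice_v: "nice_at S (v m) x" if x: "x \<in> S" for m x
  proof (rule nice_at_cong[OF B[of m x] xB[OF x]])
    show "nice_at S (\<lambda>y. \<Sum>u\<in>A m x. u y) x" using nice[OF AF x] by (intro nice_at_sum finA x)
    show "(\<Sum>u\<in>A m x. u y) = v m y" if "y \<in> B m x" for y using v_local[OF x that] by simp
  qed
  have v_nonneg: "0 \<le> v m x" if "x \<in> S" for m x
    unfolding v_def using nonneg[OF AF that] by (intro sum_nonneg)
  have v_pos: "0 < v m x" if "u \<in> \<F> m" "0 < u x" "x \<in> S" for m u x
  proof -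
    have "u \<in> A m x" using that xB[OF that(3)] by (auto simp: A_def intro!: bexI[of _ x])
    then have "u x \<le> v m x"
      unfolding v_def using finA nonneg[OF AF that(3)] by (intro member_le_sum) auto
    then show ?thesis using that(2) by simp
  qed
  define h where "h m t = flat (1 / (real m + 1) - t)" for m t
  define \<psi> where "\<psi> m u x = u x * (\<Prod>j<m. h m (v j x))" for m u x
  have nice_\<psi>: "nice_at S (\<psi> m u) x" if "u \<in> \<F> m" "x \<in> S" for m u x
  proof -
    have "nice_at S (\<lambda>y. h m (v j y)) x" for j
      using nice_at_flat[OF nice_v[OF that(2), of j], of "-1" "1 / (real m + 1)"] by (simp add: h_def)
    then have "nice_at S (\<lambda>y. \<Prod>j<m. h m (v j y)) x" by (intro nice_at_prod that(2)) auto
    then show ?thesis unfolding \<psi>_def by (rule nice_at_mult[OF nice[OF that]])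
  qed
  have \<psi>_nonneg: "0 \<le> \<psi> m u x" if "u \<in> \<F> m" "x \<in> S" for m u x
    unfolding \<psi>_def h_def using nonneg[OF that] by (intro mult_nonneg_nonneg prod_nonneg) (auto simp: flat_nonneg)
  have \<psi>_0: "u x \<noteq> 0" if "\<psi> m u x \<noteq> 0" for m u x using that by (auto simp: \<psi>_def)
  define \<Lambda> where "\<Lambda> = (SIGMA m:UNIV. \<F> m)"
  have loc: "\<exists>W Q. openin (top_of_set S) W \<and> x \<in> W \<and> finite Q \<and> Q \<subseteq> \<Lambda> \<and>
      (\<forall>y\<in>W. \<forall>p\<in>\<Lambda>. \<psi> (fst p) (snd p) y \<noteq> 0 \<longrightarrow> p \<in> Q)" if x: "x \<in> S" for x
  proof -
    obtain j u where ju: "u \<in> \<F> j" "0 < u x" using cover[OF x] by blast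
    define c where "c = v j x"
    have c: "0 < c" using v_pos[OF ju x] by (simp add: c_def)
    obtain W1 where W1: "openin (top_of_set S) W1" "x \<in> W1" "v j ` W1 \<subseteq> {c/2<..}"
      using nice_at_continuous[OF nice_v[OF x], of "{c/2<..}" j] c by (auto simp: c_def)
    obtain m0 :: nat where m0: "2 / c < m0" using reals_Archimedean2 by blast
    \<comment> \<open>Near \<open>x\<close> the sum over level \<open>j\<close> exceeds
      \<open>c / 2\<close>, and beyond \<open>m1\<close> this exceeds \<open>1 / (m + 1)\<close>; so
      level \<open>j\<close> annihilates all these later levels there.\<close>
    define m1 where "m1 = max j m0"
    define W where "W = W1 \<inter> (\<Inter>m\<le>m1. B m x)"
    define Q where "Q = (SIGMA m:{..m1}. A m x)"
    have "openin (top_of_set S) W"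
      unfolding W_def by (intro openin_Int W1(1) openin_INT2 B) auto
    moreover have "x \<in> W" using W1(2) xB[OF x] by (simp add: W_def)
    moreover have "finite Q" using finA by (auto simp: Q_def)
    moreover have "Q \<subseteq> \<Lambda>" using AF by (auto simp: Q_def \<Lambda>_def)
    moreover have "(m, u) \<in> Q" if y: "y \<in> W" and u: "u \<in> \<F> m" "\<psi> m u y \<noteq> 0" for y m u
    proof -
      have "m \<le> m1"
      proof (rule ccontr)
        assume "\<not> m \<le> m1"
        then have m: "j < m" "m0 < m" by (auto simp: m1_def)
        have "2 / c < real m + 1" using m0 m(2) by simp
        then have "1 / (real m + 1) < c / 2" using c by (simp add: field_simps)
        moreover have "c / 2 < v j y" using y W1(3) by (auto simp: W_def)
        ultimately have "h m (v j y) = 0" unfolding h_def flat_eq_0_iff by linarith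
        then have "(\<Prod>j<m. h m (v j y)) = 0" using m(1) by (intro prod_zero) auto
        then show False using u(2) by (simp add: \<psi>_def)
      qed
      moreover have "u \<in> A m x"
        using u(1) \<psi>_0[OF u(2)] y \<open>m \<le> m1\<close> by (auto simp: A_def W_def)
      ultimately show ?thesis by (simp add: Q_def)
    qed
    ultimately show ?thesis by (intro exI[of _ W] exI[of _ Q]) (auto simp: \<Lambda>_def)
  qed
  define R where "R x = {p\<in>\<Lambda>. \<psi> (fst p) (snd p) x \<noteq> 0}" for x
  define s where "s x = (\<Sum>p\<in>R x. \<psi> (fst p) (snd p) x)" for x
  have finR: "finite (R x)" if x: "x \<in> S" for x
  proof -
    obtain W Q where "x \<in> W" "finite Q" "\<forall>y\<in>W. \<forall>p\<in>\<Lambda>. \<psi> (fst p) (snd p) y \<noteq> 0 \<longrightarrow> p \<in> Q"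
      using loc[OF x] by blast
    then have "R x \<subseteq> Q" unfolding R_def by blast
    then show ?thesis using \<open>finite Q\<close> by (rule finite_subset)
  qed
  have \<Lambda>: "snd p \<in> \<F> (fst p)" if "p \<in> \<Lambda>" for p using that by (auto simp: \<Lambda>_def)
  have nice_s: "nice_at S s x" if x: "x \<in> S" for x
  proof -
    obtain W Q where W: "openin (top_of_set S) W" "x \<in> W" "finite Q" "Q \<subseteq> \<Lambda>"
      "\<forall>y\<in>W. \<forall>p\<in>\<Lambda>. \<psi> (fst p) (snd p) y \<noteq> 0 \<longrightarrow> p \<in> Q"
      using loc[OF x] by blast
    have "nice_at S (\<psi> (fst p) (snd p)) x" if "p \<in> Q" for p
      by (rule nice_\<psi>[OF \<Lambda> x]) (use that W(4) in blast)
    then have "nice_at S (\<lambda>y. \<Sum>p\<in>Q. \<psi> (fst p) (snd p) y) x" by (rule nice_at_sum[OF W(3) x])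
    then show ?thesis
    proof (rule nice_at_cong[OF W(1,2), rotated])
      fix y assume "y \<in> W"
      then show "(\<Sum>p\<in>Q. \<psi> (fst p) (snd p) y) = s y"
        unfolding s_def using W(3,4,5) by (intro sum.mono_neutral_right) (auto simp: R_def)
    qed
  qed
  have s_ge: "\<psi> (fst p) (snd p) x \<le> s x" if x: "x \<in> S" and p: "p \<in> \<Lambda>" for p x
  proof (cases "p \<in> R x")
    case True
    show ?thesis
      unfolding s_def using True finR[OF x] \<psi>_nonneg[OF \<Lambda> x]
      by (intro member_le_sum[of p]) (auto simp: R_def)
  next
    case False
    then have "\<psi> (fst p) (snd p) x = 0" using p by (simp add: R_def)
    moreover have "0 \<le> s x" unfolding s_def using \<psi>_nonneg[OF \<Lambda> x] by (intro sum_nonneg) (auto simp: R_def)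
    ultimately show ?thesis by simp
  qed
  have s_pos: "0 < s x" if x: "x \<in> S" for x
  proof -
    \<comment> \<open>At the first level with a member positive at \<open>x\<close> the sums over
      earlier levels vanish, so every cut-off factor is positive.\<close>
    define m where "m = (LEAST m. \<exists>u\<in>\<F> m. 0 < u x)"
    obtain u where u: "u \<in> \<F> m" "0 < u x"
      using LeastI_ex[OF cover[OF x]] unfolding m_def by blast
    have "v j x = 0" if "j < m" for j
    proof -
      have "\<not> (\<exists>u\<in>\<F> j. 0 < u x)" using that not_less_Least unfolding m_def by blast
      then have "u x = 0" if "u \<in> A j x" for u using nonneg[OF AF x] AF that by (metis antisym_conv3 not_le)
      then show ?thesis unfolding v_def by (intro sum.neutral) auto
    qed
    then have "0 < (\<Prod>j<m. h m (v j x))" by (intro prod_pos) (auto simp: h_def flat_def)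
    then have "0 < \<psi> m u x" using u(2) by (simp add: \<psi>_def)
    then show ?thesis using s_ge[OF x, of "(m, u)"] u(1) by (simp add: \<Lambda>_def)
  qed
  define f where "f p x = \<psi> (fst p) (snd p) x * inverse (s x)" for p x
  have f0: "f p x \<noteq> 0 \<Longrightarrow> \<psi> (fst p) (snd p) x \<noteq> 0" for p x by (auto simp: f_def)
  have fu: "snd p x \<noteq> 0" if "f p x \<noteq> 0" for p x using \<psi>_0[OF f0[OF that]] .
  have "partition_of_unity_on S \<Lambda> f"
    unfolding partition_of_unity_on_def
  proof (intro conjI ballI)
    fix p x assume p: "p \<in> \<Lambda>" and x: "x \<in> S"
    show "f p x \<in> {0..1}"
      using \<psi>_nonneg[OF \<Lambda>[OF p] x] s_ge[OF x p] s_pos[OF x] by (simp add: f_def field_simps)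
  next
    fix x assume x: "x \<in> S"
    have "(\<Sum>p\<in>R x. f p x) = s x * inverse (s x)" by (simp add: f_def s_def sum_distrib_right)
    then have "(\<Sum>p\<in>R x. f p x) = 1" using s_pos[OF x] by simp
    then have "((\<lambda>p. f p x) has_sum 1) (R x)" using has_sum_finite[OF finR[OF x], of "\<lambda>p. f p x"] by simp
    moreover have "((\<lambda>p. f p x) has_sum 1) (R x) \<longleftrightarrow> ((\<lambda>p. f p x) has_sum 1) \<Lambda>"
      by (rule has_sum_cong_neutral) (auto simp: R_def f_def)
    ultimately show "((\<lambda>p. f p x) has_sum 1) \<Lambda>" by simp
  qed
  moreover have "subordinated_on S \<Lambda> f \<U>"
    unfolding subordinated_on_def
  proof
    fix p assume "p \<in> \<Lambda>"
    then obtain V where "V \<in> \<U>" "{x\<in>S. snd p x \<noteq> 0} \<subseteq> V" using sub[OF \<Lambda>] by blast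
    then show "\<exists>V\<in>\<U>. {x\<in>S. f p x \<noteq> 0} \<subseteq> V" using fu by blast
  qed
  moreover have "locally_finite_on S \<Lambda> f"
    unfolding locally_finite_on_def
  proof
    fix x assume x: "x \<in> S"
    obtain W Q where W: "openin (top_of_set S) W" "x \<in> W" "finite Q"
      "\<forall>y\<in>W. \<forall>p\<in>\<Lambda>. \<psi> (fst p) (snd p) y \<noteq> 0 \<longrightarrow> p \<in> Q"
      using loc[OF x] by blast
    have "{p\<in>\<Lambda>. \<exists>y\<in>W. f p y \<noteq> 0} \<subseteq> Q" using W(4) f0 by blast
    then have "finite {p\<in>\<Lambda>. \<exists>y\<in>W. f p y \<noteq> 0}" using W(3) by (rule finite_subset)
    then show "\<exists>U. openin (top_of_set S) U \<and> x \<in> U \<and> finite {p\<in>\<Lambda>. \<exists>y\<in>U. f p y \<noteq> 0}"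
      using W(1,2) by blast
  qed
  moreover have "sigma_uniformly_discrete_on S \<Lambda> f"
    unfolding sigma_uniformly_discrete_on_def
  proof (intro exI[of _ "\<lambda>n. {n} \<times> \<F> n"] conjI allI)
    show "\<Lambda> = (\<Union>n. {n} \<times> \<F> n)" by (auto simp: \<Lambda>_def)
    fix n
    show "uniformly_discrete_on S ({n} \<times> \<F> n) f"
      unfolding uniformly_discrete_on_def
    proof (intro exI[of _ "d n"] conjI ballI impI d(1))
      fix p q x y assume p: "p \<in> {n} \<times> \<F> n" and q: "q \<in> {n} \<times> \<F> n" and "p \<noteq> q"
        and "x \<in> S" "y \<in> S" "f p x \<noteq> 0" "f q y \<noteq> 0"
      then show "d n \<le> dist x y"
        using fu[of p x] fu[of q y] by (intro d(2)[of "snd p" n "snd q"]) (auto simp: prod_eq_iff)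
    qed
  qed
  moreover have nice_f: "nice_at S (f p) x" if "p \<in> \<Lambda>" "x \<in> S" for p x
    unfolding f_def
    by (intro nice_at_mult nice_\<psi>[OF \<Lambda>] that nice_at_inverse nice_s) (use s_pos[OF that(2)] in simp)
  then have "\<forall>p\<in>\<Lambda>. Cinf_on S S (f p) \<and> lfc_on S (f p)"
    using Cinf_on_if_nice_at[OF S, of S] by (auto simp: lfc_on_def nice_at_def)
  ultimately show ?thesis by blast
qed

context adapted_norm
begin

text \<open>The inner \<open>flat\<close> hides the singularity of \<open>M\<close> at 0, being 0
  where \<open>M\<close> is at most 1. The outer one vanishes as soon as the inner one reaches
  1.\<close>

lemma nice_bump:
  assumes x0: "x0 \<in> Y" and r: "0 < r"
  obtains u \<rho> where "\<And>y. y \<in> Y \<Longrightarrow> nice_at Y u y" "\<And>y. 0 \<le> u y"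
    "0 < \<rho>" "\<And>y. y \<in> Y \<Longrightarrow> norm (y - x0) < \<rho> \<Longrightarrow> 0 < u y"
    "\<And>y. y \<in> Y \<Longrightarrow> u y \<noteq> 0 \<Longrightarrow> norm (y - x0) < r"
proof -
  obtain c C where c: "0 < c" "0 < C" "\<And>x. c * norm x \<le> N x" "\<And>x. N x \<le> C * norm x" by (rule N_bounds) blast
  \<comment> \<open>At distance \<open>r\<close> from \<open>x0\<close> this makes
    \<open>M (w y)\<close> at least 3, hence the inner \<open>flat\<close> at least
    \<open>flat 2\<close>.\<close>
  define a where "a = 3 / (c * r)"
  have a: "0 < a" using c(1) r by (simp add: a_def)
  define w where "w y = a *\<^sub>R y + - (a *\<^sub>R x0)" for y
  have w: "w y = a *\<^sub>R (y - x0)" for y by (simp add: w_def algebra_simps)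
  have wY: "w y \<in> Y" if "y \<in> Y" for y
    unfolding w using that x0 subspace_Y by (intro subspace_scale subspace_diff)
  \<comment> \<open>This is \<open>flat (1 - flat (M (w y) - 1))\<close>, with explicit coefficients
    to match \<open>nice_at_flat\<close>.\<close>
  define u where "u y = flat (- 1 * flat (1 * M (w y) + - 1) + 1)" for y
  have one: "u y = flat 1" if "y \<in> Y" "K * N (y - x0) < 1 / a" for y
  proof -
    have "M (w y) \<le> K * N (w y)" using wY[OF that(1)] by (rule M_upper')
    also have "\<dots> = a * (K * N (y - x0))" using a by (simp add: w N_scale)
    also have "\<dots> < a * (1 / a)" using that(2) a by (intro mult_strict_left_mono)
    finally have "M (w y) < 1" using a by simp
    then show ?thesis by (simp add: u_def flat_def)
  qed
  have nice: "nice_at Y u y" if y: "y \<in> Y" for y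
  proof (cases "y = x0")
    case True
    have "nice_at Y (\<lambda>_. flat 1) y" using y by (rule nice_at_const)
    then show ?thesis
      by (rule nice_at_cong[OF openin_N_ball[of Y x0 "1 / a"], rotated 2]) (use one y True a in \<open>auto simp: N_0\<close>)
  next
    case False
    then have "w y \<noteq> 0" using a by (simp add: w)
    then have "nice_at Y M (a *\<^sub>R y + - (a *\<^sub>R x0))"
      using nice_at_M[OF wY[OF y]] by (simp only: w_def simp_thms)
    then have "nice_at Y (\<lambda>y. M (w y)) y"
      unfolding w_def using x0 y subspace_Y
      by (intro nice_at_affine) (auto intro: subspace_neg subspace_scale)
    then have "nice_at Y (\<lambda>y. flat (1 * M (w y) + - 1)) y" by (rule nice_at_flat)
    then show ?thesis unfolding u_def by (rule nice_at_flat)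
  qed
  have small: "norm (y - x0) < r" if y: "y \<in> Y" "u y \<noteq> 0" for y
  proof (rule ccontr)
    assume "\<not> norm (y - x0) < r"
    then have "3 \<le> a * (c * norm (y - x0))" using c(1) r by (simp add: a_def field_simps)
    also have "\<dots> \<le> a * N (y - x0)" using c(3) a by (intro mult_left_mono) auto
    also have "\<dots> = N (w y)" using a by (simp add: w N_scale)
    also have "\<dots> \<le> M (w y)" using wY[OF y(1)] by (rule M_lower)
    finally have "flat 2 \<le> flat (M (w y) - 1)" by (intro flat_mono) simp
    \<comment> \<open>\<open>flat 2\<close> is \<open>2 * exp (- 1/2)\<close>, and the exponential
      is at least \<open>1 - 1/2\<close>.\<close>
    moreover have "1 \<le> flat (2 :: real)" using exp_ge_add_one_self[of "- (1/2) :: real"] by (simp add: flat_def)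
    ultimately have "u y = 0" by (simp add: u_def flat_eq_0_iff)
    then show False using y(2) by simp
  qed
  show ?thesis
  proof (rule that[OF nice])
    show "0 \<le> u y" for y by (simp add: u_def flat_nonneg)
    show "0 < 1 / (a * K * C)" using a K_ge_1 c(2) by simp
    show "0 < u y" if "y \<in> Y" "norm (y - x0) < 1 / (a * K * C)" for y
    proof -
      have "K * N (y - x0) \<le> K * (C * norm (y - x0))" using c(4) K_ge_1 by (intro mult_left_mono) auto
      also have "\<dots> < K * (C * (1 / (a * K * C)))" using that(2) K_ge_1 c(2) by (intro mult_strict_left_mono) auto
      also have "\<dots> = 1 / a" using K_ge_1 c(2) by simp
      finally show ?thesis using one[OF that(1)] by (simp add: flat_def)
    qed
  qed (use small in auto)
qed

lemma smooth_lfc_bump: "\<exists>f. bump_on Y f \<and> Cinf_on Y Y f \<and> lfc_on Y f"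
proof -
  obtain u \<rho> where u: "\<And>y. y \<in> Y \<Longrightarrow> nice_at Y u y" "0 < \<rho>" "\<And>y. y \<in> Y \<Longrightarrow> norm (y - 0) < \<rho> \<Longrightarrow> 0 < u y"
    "\<And>y. y \<in> Y \<Longrightarrow> u y \<noteq> 0 \<Longrightarrow> norm (y - 0) < 1"
    using nice_bump[OF subspace_0[OF subspace_Y] zero_less_one] by metis
  have "bounded {x\<in>Y. u x \<noteq> 0}"
    unfolding bounded_iff using u(4) by (intro exI[of _ 1]) force
  moreover have "0 < u 0" using u(2) u(3)[OF subspace_0[OF subspace_Y]] by simp
  ultimately have "bump_on Y u" unfolding bump_on_def using subspace_0[OF subspace_Y] by force
  moreover have "Cinf_on Y Y u" by (rule Cinf_on_if_nice_at[OF subspace_Y _ u(1)]) auto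
  moreover have "lfc_on Y u" using u(1) by (simp add: lfc_on_def nice_at_def)
  ultimately show ?thesis by blast
qed

text \<open>The lower bound on the coordinates forces the support to be all of \<open>A\<close> and
  does so quantitatively, which separates different \<open>A\<close>; the upper bound gives
  compactness.\<close>

definition E :: "'i set \<Rightarrow> nat \<Rightarrow> 'a set" where
  "E A k = {x \<in> span (e ` A). norm x \<le> real k + 1 \<and> (\<forall>\<alpha>\<in>A. 1 / (real k + 1) \<le> \<bar>\<phi> \<alpha> x\<bar>)}"

lemma compact_E:
  assumes A: "finite A" "A \<subseteq> \<Gamma>" shows "compact (E A k)"
proof -
  let ?B = "(\<lambda>c. \<Sum>\<alpha>\<in>A. c \<alpha> *\<^sub>R e \<alpha>) ` {c. \<forall>\<alpha>\<in>A. \<bar>c \<alpha>\<bar> \<le> real k + 1}"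
  let ?C = "{x. norm x \<le> real k + 1} \<inter> (\<Inter>\<alpha>\<in>A. {x. 1 / (real k + 1) \<le> \<bar>\<phi> \<alpha> x\<bar>})"
  have "x \<in> ?B" if x: "x \<in> E A k" for x
  proof -
    have "\<bar>\<phi> \<alpha> x\<bar> \<le> real k + 1" if "\<alpha> \<in> A" for \<alpha>
      using abs_\<phi>_le[of \<alpha> x] that A(2) x by (auto simp: E_def)
    moreover have "x = (\<Sum>\<alpha>\<in>A. \<phi> \<alpha> x *\<^sub>R e \<alpha>)" using x by (intro span_expansion A) (simp add: E_def)
    ultimately show ?thesis by (intro image_eqI[of _ _ "\<lambda>\<alpha>. \<phi> \<alpha> x"]) auto
  qed
  moreover have "x \<in> span (e ` A)" if "x \<in> ?B" for x
    using that by (auto simp: span_sum span_scale span_base)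
  ultimately have "E A k = ?B \<inter> ?C" unfolding E_def by blast
  moreover have "closed ?C"
    by (intro closed_Int closed_INT ballI closed_Collect_le continuous_intros)
  ultimately show ?thesis
    by (simp only: compact_Int_closed compact_coefficient_box[OF A(1)])
qed

lemma E_covers:
  assumes x: "x \<in> Y" obtains k where "x \<in> E (supp x) k"
proof -
  obtain k0 :: nat where k0: "norm x < k0" using reals_Archimedean2 by blast
  have "\<forall>\<alpha>\<in>supp x. \<exists>q::nat. 1 / \<bar>\<phi> \<alpha> x\<bar> < q" using reals_Archimedean2 by blast
  then obtain q :: "'i \<Rightarrow> nat" where q: "\<And>\<alpha>. \<alpha> \<in> supp x \<Longrightarrow> 1 / \<bar>\<phi> \<alpha> x\<bar> < q \<alpha>" by metis
  define k where "k = k0 + sum q (supp x)"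
  have "1 / (real k + 1) \<le> \<bar>\<phi> \<alpha> x\<bar>" if a: "\<alpha> \<in> supp x" for \<alpha>
  proof -
    have "q \<alpha> \<le> k" using member_le_sum[OF a, of q] finite_supp[OF x] by (simp add: k_def)
    then have "1 / \<bar>\<phi> \<alpha> x\<bar> < real k + 1" using q[OF a] by linarith
    moreover have "0 < \<bar>\<phi> \<alpha> x\<bar>" using a by (simp add: supp_def)
    ultimately show ?thesis by (simp add: field_simps)
  qed
  moreover have "norm x \<le> real k + 1"
  proof -
    have "real k0 \<le> real k" by (simp only: of_nat_le_iff) (simp add: k_def)
    then show ?thesis using k0 by linarith
  qed
  ultimately show ?thesis using in_span_supp[OF x] by (intro that[of k]) (simp add: E_def)
qed

text \<open>Equal cardinality is what provides an index in \<open>A\<close> outside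
  \<open>B\<close>; its coordinate is large at \<open>x\<close> and 0 at \<open>y\<close>.\<close>

lemma E_separated:
  assumes "A \<subseteq> \<Gamma>" "B \<subseteq> \<Gamma>" "finite A" "finite B" "card A = card B" "A \<noteq> B" "x \<in> E A k" "y \<in> E B k"
  shows "1 / (real k + 1) \<le> norm (x - y)"
proof -
  obtain \<alpha> where \<alpha>: "\<alpha> \<in> A" "\<alpha> \<notin> B" using assms(3-6) card_subset_eq by blast
  have "\<phi> \<alpha> y = 0" using assms(1,2,8) \<alpha> by (intro \<phi>_eq_0[of B]) (auto simp: E_def)
  moreover have "1 / (real k + 1) \<le> \<bar>\<phi> \<alpha> x\<bar>" using assms(7) \<alpha>(1) by (simp add: E_def)
  moreover have "\<bar>\<phi> \<alpha> (x - y)\<bar> \<le> norm (x - y)" using assms(1) \<alpha>(1) by (intro abs_\<phi>_le) auto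
  ultimately show ?thesis by (simp add: blinfun.bilinear_simps)
qed

text \<open>Compactness leaves finitely many bumps, numbered by \<open>i\<close> and padded with
  zero functions so that \<open>i\<close> can become part of the level. The radius is a quarter of
  the separation in \<open>E_separated\<close>.\<close>

lemma bumps_on_E:
  assumes A: "finite A" "A \<subseteq> \<Gamma>" and \<U>: "\<And>V. V \<in> \<U> \<Longrightarrow> openin (top_of_set Y) V" "Y \<subseteq> \<Union>\<U>"
  shows "\<exists>w :: nat \<Rightarrow> 'a \<Rightarrow> real. (\<forall>i. (\<forall>y\<in>Y. nice_at Y (w i) y \<and> 0 \<le> w i y) \<and>
      (\<exists>V\<in>\<U>. {y\<in>Y. w i y \<noteq> 0} \<subseteq> V) \<and>
      (\<forall>y\<in>Y. w i y \<noteq> 0 \<longrightarrow> (\<exists>x\<in>E A k. norm (y - x) < 1 / (4 * (real k + 1))))) \<and>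
    (\<forall>x\<in>E A k. \<exists>i. 0 < w i x)"
proof -
  let ?r = "1 / (4 * (real k + 1))"
  have EY: "x \<in> Y" if "x \<in> E A k" for x using that span_subset_Y[OF A(2)] by (auto simp: E_def)
  define Q where "Q x u \<rho> \<longleftrightarrow> (\<forall>y\<in>Y. nice_at Y u y \<and> 0 \<le> u y) \<and> (\<exists>V\<in>\<U>. {y\<in>Y. u y \<noteq> 0} \<subseteq> V) \<and>
      (\<forall>y\<in>Y. u y \<noteq> 0 \<longrightarrow> norm (y - x) < ?r) \<and> 0 < \<rho> \<and> (\<forall>y\<in>Y. norm (y - x) < \<rho> \<longrightarrow> 0 < u y)"
    for x u and \<rho> :: real
  have "\<exists>u \<rho>. Q x u \<rho>" if x: "x \<in> E A k" for x
  proof -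
    obtain V where V: "V \<in> \<U>" "x \<in> V" using \<U>(2) EY[OF x] by blast
    obtain r where r: "0 < r" "\<And>y. y \<in> Y \<Longrightarrow> dist y x < r \<Longrightarrow> y \<in> V"
      using \<U>(1)[OF V(1)] V(2) unfolding openin_euclidean_subtopology_iff by blast
    have "0 < min r ?r" using r(1) by simp
    then obtain u \<rho> where u: "\<And>y. y \<in> Y \<Longrightarrow> nice_at Y u y" "\<And>y. 0 \<le> u y"
      "0 < \<rho>" "\<And>y. y \<in> Y \<Longrightarrow> norm (y - x) < \<rho> \<Longrightarrow> 0 < u y"
      "\<And>y. y \<in> Y \<Longrightarrow> u y \<noteq> 0 \<Longrightarrow> norm (y - x) < min r ?r"
      using nice_bump[OF EY[OF x]] by metis
    have "{y\<in>Y. u y \<noteq> 0} \<subseteq> V" using u(5) r(2) by (auto simp: dist_norm)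
    then have "Q x u \<rho>" unfolding Q_def using u V(1) by auto
    then show ?thesis by blast
  qed
  then obtain u \<rho> where "\<And>x. x \<in> E A k \<Longrightarrow> Q x (u x) (\<rho> x)"
    by metis
  then have u: "\<And>x y. x \<in> E A k \<Longrightarrow> y \<in> Y \<Longrightarrow> nice_at Y (u x) y \<and> 0 \<le> u x y"
    "\<And>x. x \<in> E A k \<Longrightarrow> \<exists>V\<in>\<U>. {y\<in>Y. u x y \<noteq> 0} \<subseteq> V"
    "\<And>x y. x \<in> E A k \<Longrightarrow> y \<in> Y \<Longrightarrow> u x y \<noteq> 0 \<Longrightarrow> norm (y - x) < ?r"
    "\<And>x. x \<in> E A k \<Longrightarrow> 0 < \<rho> x"
    "\<And>x y. x \<in> E A k \<Longrightarrow> y \<in> Y \<Longrightarrow> norm (y - x) < \<rho> x \<Longrightarrow> 0 < u x y"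
    unfolding Q_def by simp_all
  have "E A k \<subseteq> (\<Union>x\<in>E A k. ball x (\<rho> x))" using u(4) by auto
  then obtain D where D: "D \<subseteq> E A k" "finite D" "E A k \<subseteq> (\<Union>x\<in>D. ball x (\<rho> x))"
    using compactE_image[OF compact_E[OF A], of "E A k" "\<lambda>x. ball x (\<rho> x)"] by auto
  obtain l where l: "set l = D" using finite_list[OF D(2)] by blast
  define w where "w i = (if i < length l then u (l ! i) else (\<lambda>_. 0))" for i
  have lE: "l ! i \<in> E A k" if "i < length l" for i using that l D(1) nth_mem by blast
  \<comment> \<open>The padding needs a member of the cover too; there is one because
    \<open>Y\<close> contains 0.\<close>
  obtain V0 where V0: "V0 \<in> \<U>" using \<U>(2) subspace_0[OF subspace_Y] by blast
  have "(\<forall>y\<in>Y. nice_at Y (w i) y \<and> 0 \<le> w i y) \<and> (\<exists>V\<in>\<U>. {y\<in>Y. w i y \<noteq> 0} \<subseteq> V) \<and>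
      (\<forall>y\<in>Y. w i y \<noteq> 0 \<longrightarrow> (\<exists>x\<in>E A k. norm (y - x) < ?r))" for i
  proof (cases "i < length l")
    case True
    note x = lE[OF True]
    show ?thesis using True u(1-3)[OF x] x unfolding w_def by auto
  next
    case False
    then show ?thesis using V0 nice_at_const by (auto simp: w_def)
  qed
  moreover have "\<exists>i. 0 < w i x" if x: "x \<in> E A k" for x
  proof -
    obtain z where z: "z \<in> D" "x \<in> ball z (\<rho> z)" using D(3) x by blast
    obtain i where i: "i < length l" "l ! i = z" using z(1) l by (metis in_set_conv_nth)
    have "norm (x - z) < \<rho> z" using z(2) by (simp add: dist_norm norm_minus_commute)
    then have "0 < u z x" using u(5)[of z x] z(1) D(1) EY[OF x] by blast
    then show ?thesis using i by (intro exI[of _ i]) (simp add: w_def)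
  qed
  ultimately show ?thesis by (intro exI[of _ w]) blast
qed

theorem admits_smooth_lfc_partitions: "admits_smooth_lfc_partitions_on Y"
  unfolding admits_smooth_lfc_partitions_on_def
proof (intro allI impI)
  fix \<U> assume *: "(\<forall>V\<in>\<U>. openin (top_of_set Y) V) \<and> Y \<subseteq> \<Union>\<U>"
  define good :: "'i set \<Rightarrow> nat \<Rightarrow> (nat \<Rightarrow> 'a \<Rightarrow> real) \<Rightarrow> bool" where
    "good A k w \<longleftrightarrow> (\<forall>i. (\<forall>y\<in>Y. nice_at Y (w i) y \<and> 0 \<le> w i y) \<and>
      (\<exists>V\<in>\<U>. {y\<in>Y. w i y \<noteq> 0} \<subseteq> V) \<and>
      (\<forall>y\<in>Y. w i y \<noteq> 0 \<longrightarrow> (\<exists>x\<in>E A k. norm (y - x) < 1 / (4 * (real k + 1))))) \<and>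
    (\<forall>x\<in>E A k. \<exists>i. 0 < w i x)" for A k w
  have "\<exists>w. good A k w" if "finite A" "A \<subseteq> \<Gamma>" for A k
    unfolding good_def using bumps_on_E[OF that, of \<U> k] * by blast
  then obtain w where w: "\<And>A k. finite A \<Longrightarrow> A \<subseteq> \<Gamma> \<Longrightarrow> good A k (w A k)" by metis
  \<comment> \<open>A level fixes the cardinality of \<open>A\<close>, the constant \<open>k\<close>
    and the number of the bump. This leaves one function for each \<open>A\<close>, and
    \<open>E_separated\<close> keeps those apart.\<close>
  define n where "n m = fst (prod_decode m)" for m
  define k where "k m = fst (prod_decode (snd (prod_decode m)))" for m
  define i where "i m = snd (prod_decode (snd (prod_decode m)))" for m
  define \<F> where "\<F> m = {w A (k m) (i m) | A. finite A \<and> A \<subseteq> \<Gamma> \<and> card A = n m}" for m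
  have \<F>: "\<exists>A. finite A \<and> A \<subseteq> \<Gamma> \<and> card A = n m \<and> u = w A (k m) (i m) \<and> good A (k m) (w A (k m))"
    if "u \<in> \<F> m" for u m
    using that w unfolding \<F>_def by blast
  show "\<exists>(\<Lambda> :: (nat \<times> ('a \<Rightarrow> real)) set) f.
          partition_of_unity_on Y \<Lambda> f \<and> subordinated_on Y \<Lambda> f \<U> \<and>
          locally_finite_on Y \<Lambda> f \<and> sigma_uniformly_discrete_on Y \<Lambda> f \<and>
          (\<forall>\<gamma>\<in>\<Lambda>. Cinf_on Y Y (f \<gamma>) \<and> lfc_on Y (f \<gamma>))"
  proof (rule partition_of_unity_from_sigma_discrete[OF subspace_Y, of \<F>])
    fix m u x assume u: "u \<in> \<F> m" and x: "x \<in> Y"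
    show "nice_at Y u x" "0 \<le> u x" using \<F>[OF u] x unfolding good_def by blast+
  next
    fix m u assume u: "u \<in> \<F> m"
    show "\<exists>V\<in>\<U>. {x\<in>Y. u x \<noteq> 0} \<subseteq> V" using \<F>[OF u] unfolding good_def by blast
  next
    fix m
    let ?r = "1 / (4 * (real (k m) + 1))"
    \<comment> \<open>The sets \<open>E\<close> are \<open>4 * ?r\<close> apart, and each of the two
      bumps uses up \<open>?r\<close> of this.\<close>
    have "2 * ?r \<le> dist x y"
      if u: "u \<in> \<F> m" and v: "v \<in> \<F> m" and "u \<noteq> v" and xy: "x \<in> Y" "y \<in> Y" "u x \<noteq> 0" "v y \<noteq> 0" for u v x y
    proof -
      obtain A where A: "finite A" "A \<subseteq> \<Gamma>" "card A = n m" "u = w A (k m) (i m)" "good A (k m) (w A (k m))"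
        using \<F>[OF u] by blast
      obtain B where B: "finite B" "B \<subseteq> \<Gamma>" "card B = n m" "v = w B (k m) (i m)" "good B (k m) (w B (k m))"
        using \<F>[OF v] by blast
      obtain x' where x': "x' \<in> E A (k m)" "norm (x - x') < ?r" using A(4,5) xy unfolding good_def by blast
      obtain y' where y': "y' \<in> E B (k m)" "norm (y - y') < ?r" using B(4,5) xy unfolding good_def by blast
      define r where "r = ?r"
      have "1 / (real (k m) + 1) \<le> norm (x' - y')"
        using A B \<open>u \<noteq> v\<close> x'(1) y'(1) by (intro E_separated[of A B]) auto
      moreover have "1 / (real (k m) + 1) = 4 * r" by (simp add: r_def field_simps)
      ultimately have "4 * r \<le> norm (x' - y')" by simp
      moreover have "norm (x - x') < r" "norm (y - y') < r" using x'(2) y'(2) by (simp_all only: r_def)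
      moreover have "norm (x' - y') \<le> norm (x - x') + norm (x - y) + norm (y - y')"
        using norm_triangle_ineq[of "x' - x" "x - y'"] norm_triangle_ineq[of "x - y" "y - y'"]
        by (simp add: norm_minus_commute)
      ultimately show ?thesis unfolding dist_norm r_def[symmetric] by linarith
    qed
    then show "\<exists>d>0. \<forall>u\<in>\<F> m. \<forall>v\<in>\<F> m. u \<noteq> v \<longrightarrow>
        (\<forall>x\<in>Y. \<forall>y\<in>Y. u x \<noteq> 0 \<longrightarrow> v y \<noteq> 0 \<longrightarrow> d \<le> dist x y)"
      by (intro exI[of _ "2 * ?r"]) auto
  next
    fix x assume x: "x \<in> Y"
    obtain q where q: "x \<in> E (supp x) q" by (rule E_covers[OF x])
    have "good (supp x) q (w (supp x) q)" using w finite_supp[OF x] supp_subset_\<Gamma> by blast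
    then obtain j where j: "0 < w (supp x) q j x" using q unfolding good_def by blast
    define m where "m = prod_encode (card (supp x), prod_encode (q, j))"
    have "n m = card (supp x)" "k m = q" "i m = j" by (simp_all add: m_def n_def k_def i_def)
    then have "w (supp x) q j \<in> \<F> m"
      unfolding \<F>_def mem_Collect_eq using finite_supp[OF x] supp_subset_\<Gamma>
      by (intro exI[of _ "supp x"]) simp
    then show "\<exists>m. \<exists>u\<in>\<F> m. 0 < u x" using j by blast
  qed
qed

end

subsection \<open>Continuously differentiable norms\<close>

lemma uniform_limit_const_null:
  fixes a :: "'b \<Rightarrow> real"
  assumes "(a \<longlongrightarrow> 0) F" shows "uniform_limit V (\<lambda>y v. a y) (\<lambda>_. 0) F"
proof (rule uniform_limitI)
  fix \<epsilon> :: real assume "0 < \<epsilon>"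
  then show "\<forall>\<^sub>F y in F. \<forall>v\<in>V. dist (a y) 0 < \<epsilon>"
    using tendstoD[OF assms] by (auto elim: eventually_mono)
qed

lemma uniform_limit_null_mult:
  fixes a b :: "'b \<Rightarrow> 'v \<Rightarrow> real"
  assumes a: "uniform_limit V a (\<lambda>_. 0) F" and b: "\<forall>\<^sub>F y in F. \<forall>v\<in>V. \<bar>b y v\<bar> \<le> B"
  shows "uniform_limit V (\<lambda>y v. b y v * a y v) (\<lambda>_. 0) F"
proof (rule uniform_limitI)
  fix \<epsilon> :: real assume "0 < \<epsilon>"
  then have "0 < \<epsilon> / (\<bar>B\<bar> + 1)" by simp
  from uniform_limitD[OF a this] b
  show "\<forall>\<^sub>F y in F. \<forall>v\<in>V. dist (b y v * a y v) 0 < \<epsilon>"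
  proof eventually_elim
    case (elim y)
    show ?case
    proof
      fix v assume v: "v \<in> V"
      have "\<bar>b y v\<bar> * \<bar>a y v\<bar> \<le> (\<bar>B\<bar> + 1) * \<bar>a y v\<bar>"
        using elim(2) v by (intro mult_right_mono) force+
      also have "\<dots> < \<epsilon>" using elim(1) v by (simp add: field_simps)
      finally show "dist (b y v * a y v) 0 < \<epsilon>" by (simp add: abs_mult)
    qed
  qed
qed

text \<open>Dominated convergence for series: the tail is small by \<open>B\<close>, uniformly in
  all variables, and the head consists of finitely many null families.\<close>

lemma uniform_limit_suminf_null:
  fixes a :: "nat \<Rightarrow> 'b \<Rightarrow> 'v \<Rightarrow> real"
  assumes B: "summable B" and a: "\<And>n. uniform_limit V (a n) (\<lambda>_. 0) F"
    and le: "\<forall>\<^sub>F y in F. \<forall>n. \<forall>v\<in>V. \<bar>a n y v\<bar> \<le> B n"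
  shows "uniform_limit V (\<lambda>y v. \<Sum>n. a n y v) (\<lambda>_. 0) F"
proof (rule uniform_limitI)
  fix \<epsilon> :: real assume "0 < \<epsilon>"
  then obtain k where k: "norm (\<Sum>i. B (i + k)) < \<epsilon> / 2"
    using suminf_exist_split[OF _ B, of "\<epsilon> / 2"] by auto
  \<comment> \<open>The \<open>k\<close> terms of the head share \<open>\<epsilon> / 2\<close>; the
    added 1 covers \<open>k = 0\<close>.\<close>
  have "0 < \<epsilon> / (2 * (real k + 1))" using \<open>0 < \<epsilon>\<close> by simp
  then have "\<forall>\<^sub>F y in F. \<forall>n\<in>{..<k}. \<forall>v\<in>V. dist (a n y v) 0 < \<epsilon> / (2 * (real k + 1))"
    using uniform_limitD[OF a] by (intro eventually_ball_finite) auto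
  with le show "\<forall>\<^sub>F y in F. \<forall>v\<in>V. dist (\<Sum>n. a n y v) 0 < \<epsilon>"
  proof eventually_elim
    case (elim y)
    show ?case
    proof
      fix v assume v: "v \<in> V"
      have le: "\<bar>a n y v\<bar> \<le> B n" for n using elim(1) v by blast
      have sm: "summable (\<lambda>n. \<bar>a n y v\<bar>)"
        by (rule summable_comparison_test'[OF B, of 0]) (use le in simp)
      have "\<bar>\<Sum>n. a n y v\<bar> \<le> (\<Sum>n. \<bar>a n y v\<bar>)" by (rule summable_rabs[OF sm])
      also have "\<dots> = (\<Sum>n. \<bar>a (n + k) y v\<bar>) + (\<Sum>n<k. \<bar>a n y v\<bar>)"
        by (rule suminf_split_initial_segment[OF sm])
      also have "\<dots> < \<epsilon>"
      proof -
        have "(\<Sum>n. \<bar>a (n + k) y v\<bar>) \<le> (\<Sum>n. B (n + k))"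
          by (rule suminf_le[OF le summable_ignore_initial_segment[OF sm] summable_ignore_initial_segment[OF B]])
        then have 1: "(\<Sum>n. \<bar>a (n + k) y v\<bar>) < \<epsilon> / 2" using k by simp
        have "(\<Sum>n<k. \<bar>a n y v\<bar>) \<le> (\<Sum>n<k. \<epsilon> / (2 * (real k + 1)))"
          using elim(2) v by (intro sum_mono) force
        also have "\<dots> \<le> \<epsilon> / 2" using \<open>0 < \<epsilon>\<close> by (simp add: field_simps)
        finally show ?thesis using 1 by linarith
      qed
      finally show "dist (\<Sum>n. a n y v) 0 < \<epsilon>" by simp
    qed
  qed
qed

lemma tuples_1: "tuples S (Suc 0) = (\<lambda>v. [v]) ` S"
proof (intro equalityI subsetI)
  fix vs assume "vs \<in> tuples S (Suc 0)"
  then show "vs \<in> (\<lambda>v. [v]) ` S" by (cases vs) (auto simp: tuples_def)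
qed (auto simp: tuples_def)

lemma unit_tuples_0: "unit_tuples S 0 = {[]}"
  by (auto simp: unit_tuples_def tuples_def)

lemma bounded_multilinear_on_1_iff:
  "bounded_multilinear_on S (Suc 0) T \<longleftrightarrow>
     (\<forall>v\<in>S. \<forall>w\<in>S. T [v + w] = T [v] + T [w]) \<and> (\<forall>c. \<forall>v\<in>S. T [c *\<^sub>R v] = c * T [v]) \<and>
     (\<exists>C. \<forall>v\<in>S. \<bar>T [v]\<bar> \<le> C * norm v)"
  unfolding bounded_multilinear_on_def tuples_1 by auto

text \<open>\<open>Ck_on\<close> of order 1 with its derivative named, so that the derivative of a
  series can be written down.\<close>

definition C1_deriv :: "'a::real_normed_vector set \<Rightarrow> 'a set \<Rightarrow> ('a \<Rightarrow> real) \<Rightarrow> ('a \<Rightarrow> 'a list \<Rightarrow> real) \<Rightarrow> bool" where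
  "C1_deriv S U f g \<longleftrightarrow> (\<forall>x\<in>U. bounded_multilinear_on S (Suc 0) (g x) \<and>
     ((\<lambda>y. (f y - f x - g x [y - x]) / norm (y - x)) \<longlongrightarrow> 0) (at x within U) \<and>
     uniform_limit (unit_tuples S (Suc 0)) g (g x) (at x within U))"

lemma Ck_on_1_iff: "Ck_on S U 1 f \<longleftrightarrow> (\<exists>g. C1_deriv S U f g)"
proof
  assume "Ck_on S U 1 f"
  then obtain D where D: "\<forall>x\<in>U. D 0 x [] = f x"
    "\<forall>x\<in>U. has_frechet_derivative_on S U 0 (D 0) (D (Suc 0) x) x"
    "\<forall>x\<in>U. uniform_limit (unit_tuples S (Suc 0)) (D (Suc 0)) (D (Suc 0) x) (at x within U)"
    unfolding Ck_on_def by auto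
  have "C1_deriv S U f (D (Suc 0))"
    unfolding C1_deriv_def
  proof
    fix x assume x: "x \<in> U"
    have d: "has_frechet_derivative_on S U 0 (D 0) (D (Suc 0) x) x" using D(2) x by blast
    then have "((\<lambda>y. (D 0 y [] - D 0 x [] - D (Suc 0) x [y - x]) / norm (y - x)) \<longlongrightarrow> 0) (at x within U)"
      unfolding has_frechet_derivative_on_def unit_tuples_0 by simp
    moreover have "\<forall>\<^sub>F y in at x within U. (D 0 y [] - D 0 x [] - D (Suc 0) x [y - x]) / norm (y - x) =
        (f y - f x - D (Suc 0) x [y - x]) / norm (y - x)"
      unfolding eventually_at_filter using D(1) x by (intro always_eventually) simp
    ultimately have "((\<lambda>y. (f y - f x - D (Suc 0) x [y - x]) / norm (y - x)) \<longlongrightarrow> 0) (at x within U)"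
      by (rule Lim_transform_eventually)
    then show "bounded_multilinear_on S (Suc 0) (D (Suc 0) x) \<and>
        ((\<lambda>y. (f y - f x - D (Suc 0) x [y - x]) / norm (y - x)) \<longlongrightarrow> 0) (at x within U) \<and>
        uniform_limit (unit_tuples S (Suc 0)) (D (Suc 0)) (D (Suc 0) x) (at x within U)"
      using d D(3) x unfolding has_frechet_derivative_on_def by blast
  qed
  then show "\<exists>g. C1_deriv S U f g" by blast
next
  assume "\<exists>g. C1_deriv S U f g"
  then obtain g where g: "C1_deriv S U f g" by blast
  show "Ck_on S U 1 f"
    unfolding Ck_on_def
    by (rule exI[of _ "\<lambda>j x vs. if j = 0 then f x else g x vs"])
      (use g in \<open>simp add: C1_deriv_def has_frechet_derivative_on_def unit_tuples_0\<close>)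
qed

text \<open>Difference quotients of a Lipschitz function are bounded by its constant. In the series
  below this gives a bound that is uniform in the terms.\<close>

lemma C1_deriv_bound:
  fixes S :: "'a::real_normed_vector set"
  assumes S: "subspace S" and g: "C1_deriv S (S - {0}) f g" and x: "x \<in> S - {0}" and v: "v \<in> S"
    and lip: "\<And>x y. x \<in> S \<Longrightarrow> y \<in> S \<Longrightarrow> \<bar>f x - f y\<bar> \<le> C * norm (x - y)"
  shows "\<bar>g x [v]\<bar> \<le> C * norm v"
proof (cases "v = 0")
  case True
  have "g x [0 *\<^sub>R v] = 0 * g x [v]"
    using g x v unfolding C1_deriv_def bounded_multilinear_on_1_iff by blast
  then show ?thesis using True by simp
next
  case False
  show ?thesis
  proof (rule field_le_epsilon)
    fix \<epsilon> :: real assume "0 < \<epsilon>"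
    define \<eta> where "\<eta> = \<epsilon> / norm v"
    have \<eta>: "0 < \<eta>" using \<open>0 < \<epsilon>\<close> False by (simp add: \<eta>_def)
    have "((\<lambda>y. (f y - f x - g x [y - x]) / norm (y - x)) \<longlongrightarrow> 0) (at x within S - {0})"
      using g x unfolding C1_deriv_def by blast
    from tendstoD[OF this \<eta>] obtain d where d: "0 < d"
      "\<And>y. y \<in> S - {0} \<Longrightarrow> y \<noteq> x \<Longrightarrow> dist y x < d \<Longrightarrow> dist ((f y - f x - g x [y - x]) / norm (y - x)) 0 < \<eta>"
      unfolding eventually_at by blast
    \<comment> \<open>The increment has length half of \<open>min d (norm x)\<close>: short enough
      for the difference quotient and for staying away from 0.\<close>
    define t where "t = min d (norm x) / (2 * norm v)"
    have t: "0 < t" using d(1) x False by (simp add: t_def)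
    have "0 < min d (norm x)" using d(1) x by simp
    then have tv: "norm (t *\<^sub>R v) = min d (norm x) / 2" using False by (simp add: t_def)
    let ?y = "x + t *\<^sub>R v"
    have "?y \<noteq> 0"
    proof
      assume "?y = 0"
      then have "t *\<^sub>R v = - x" by (simp add: eq_neg_iff_add_eq_0 add.commute)
      then have "norm (t *\<^sub>R v) = norm x" by (metis norm_minus_cancel)
      moreover have "min d (norm x) \<le> norm x" "0 < norm x" using x by simp_all
      ultimately show False using tv by linarith
    qed
    then have yS: "?y \<in> S - {0}" using S x v by (auto intro: subspace_add subspace_scale)
    have "dist ((f ?y - f x - g x [?y - x]) / norm (?y - x)) 0 < \<eta>"
    proof (rule d(2)[OF yS])
      show "?y \<noteq> x" using t False by simp
      show "dist ?y x < d" using tv d(1) x by (simp add: dist_norm)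
    qed
    then have "\<bar>f ?y - f x - g x [t *\<^sub>R v]\<bar> \<le> \<eta> * norm (t *\<^sub>R v)"
      using t False by (simp add: field_simps)
    moreover have "\<bar>f ?y - f x\<bar> \<le> C * norm (t *\<^sub>R v)" using lip[of ?y x] yS x by simp
    moreover have "g x [t *\<^sub>R v] = t * g x [v]"
      using g x v unfolding C1_deriv_def bounded_multilinear_on_1_iff by blast
    ultimately have "\<bar>t * g x [v]\<bar> \<le> C * norm (t *\<^sub>R v) + \<eta> * norm (t *\<^sub>R v)" by linarith
    also have "\<dots> = t * (C * norm v + \<eta> * norm v)" using t by (simp add: algebra_simps)
    finally have "\<bar>g x [v]\<bar> \<le> C * norm v + \<eta> * norm v" using t by (simp add: abs_mult)
    then show "\<bar>g x [v]\<bar> \<le> C * norm v + \<epsilon>" using False by (simp add: \<eta>_def)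
  qed
qed

text \<open>The increment of the root is the increment of \<open>F\<close> divided by the sum of the
  two roots; all limits then come from products of a bounded and a null factor.\<close>

lemma C1_deriv_sqrt:
  fixes S :: "'a::real_normed_vector set"
  assumes S: "subspace S" and f: "C1_deriv S U F G" and pos: "\<And>x. x \<in> U \<Longrightarrow> 0 < F x"
    and cont: "\<And>x. x \<in> U \<Longrightarrow> ((\<lambda>y. sqrt (F y)) \<longlongrightarrow> sqrt (F x)) (at x within U)" and U: "U \<subseteq> S"
  shows "C1_deriv S U (\<lambda>x. sqrt (F x)) (\<lambda>x vs. G x vs / (2 * sqrt (F x)))"
  unfolding C1_deriv_def
proof
  fix x assume x: "x \<in> U"
  let ?A = "at x within U"
  have G: "bounded_multilinear_on S (Suc 0) (G x)"
    "((\<lambda>y. (F y - F x - G x [y - x]) / norm (y - x)) \<longlongrightarrow> 0) ?A"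
    "uniform_limit (unit_tuples S (Suc 0)) G (G x) ?A"
    using f x unfolding C1_deriv_def by blast+
  obtain B where B: "\<And>v. v \<in> S \<Longrightarrow> \<bar>G x [v]\<bar> \<le> B * norm v"
    using G(1) unfolding bounded_multilinear_on_1_iff by blast
  have r: "0 < sqrt (F x)" using pos[OF x] by simp
  have inv: "((\<lambda>y. 1 / (2 * sqrt (F y))) \<longlongrightarrow> 1 / (2 * sqrt (F x))) ?A"
    using r by (intro tendsto_intros cont[OF x]) simp
  have inU: "\<forall>\<^sub>F y in ?A. y \<in> U \<and> y \<noteq> x" by (simp add: eventually_at_filter)
  have "bounded_multilinear_on S (Suc 0) (\<lambda>vs. G x vs / (2 * sqrt (F x)))"
  proof -
    have "\<bar>G x [v] / (2 * sqrt (F x))\<bar> \<le> (B / (2 * sqrt (F x))) * norm v" if "v \<in> S" for v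
      using B[OF that] r by (simp add: divide_right_mono)
    then have "\<exists>C. \<forall>v\<in>S. \<bar>G x [v] / (2 * sqrt (F x))\<bar> \<le> C * norm v" by blast
    then show ?thesis
      using G(1) unfolding bounded_multilinear_on_1_iff by (simp add: add_divide_distrib)
  qed
  moreover have "((\<lambda>y. (sqrt (F y) - sqrt (F x) - G x [y - x] / (2 * sqrt (F x))) / norm (y - x)) \<longlongrightarrow> 0) ?A"
  proof -
    have q: "((\<lambda>y. 1 / (sqrt (F y) + sqrt (F x))) \<longlongrightarrow> 1 / (sqrt (F x) + sqrt (F x))) ?A"
      using r by (intro tendsto_intros cont[OF x]) simp
    have 1: "((\<lambda>y. (F y - F x - G x [y - x]) / norm (y - x) * (1 / (sqrt (F y) + sqrt (F x)))) \<longlongrightarrow> 0) ?A"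
      using tendsto_mult[OF G(2) q] by simp
    have "((\<lambda>y. 1 / (sqrt (F y) + sqrt (F x)) - 1 / (2 * sqrt (F x))) \<longlongrightarrow>
        1 / (sqrt (F x) + sqrt (F x)) - 1 / (2 * sqrt (F x))) ?A"
      by (intro tendsto_diff q tendsto_const)
    then have "((\<lambda>y. 1 / (sqrt (F y) + sqrt (F x)) - 1 / (2 * sqrt (F x))) \<longlongrightarrow> 0) ?A" by simp
    \<comment> \<open>Over a one-point set a uniform limit is an ordinary one, so
      \<open>uniform_limit_null_mult\<close> covers both kinds.\<close>
    then have "uniform_limit {()} (\<lambda>y v. G x [y - x] / norm (y - x) *
        (1 / (sqrt (F y) + sqrt (F x)) - 1 / (2 * sqrt (F x)))) (\<lambda>_. 0) ?A"
    proof (intro uniform_limit_null_mult[of _ _ _ _ B] uniform_limit_const_null)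
      show "\<forall>\<^sub>F y in ?A. \<forall>v\<in>{()}. \<bar>G x [y - x] / norm (y - x)\<bar> \<le> B"
        using inU
      proof eventually_elim
        case (elim y)
        then have "\<bar>G x [y - x]\<bar> \<le> B * norm (y - x)" using x U S by (intro B subspace_diff) auto
        then show ?case using elim by (simp add: field_simps)
      qed
    qed
    then have 2: "((\<lambda>y. G x [y - x] / norm (y - x) * (1 / (sqrt (F y) + sqrt (F x)) - 1 / (2 * sqrt (F x)))) \<longlongrightarrow> 0) ?A"
      by simp
    have "\<forall>\<^sub>F y in ?A. (F y - F x - G x [y - x]) / norm (y - x) * (1 / (sqrt (F y) + sqrt (F x))) +
          G x [y - x] / norm (y - x) * (1 / (sqrt (F y) + sqrt (F x)) - 1 / (2 * sqrt (F x))) =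
        (sqrt (F y) - sqrt (F x) - G x [y - x] / (2 * sqrt (F x))) / norm (y - x)"
      using inU
    proof eventually_elim
      case (elim y)
      define a b where "a = sqrt (F y)" and "b = sqrt (F x)"
      have ab: "0 < a" "0 < b" using pos elim x by (simp_all add: a_def b_def)
      have "F y = a * a" "F x = b * b" using pos elim x by (simp_all add: a_def b_def less_imp_le)
      then have "F y - F x = (a - b) * (a + b)" by (simp add: algebra_simps)
      then have "(F y - F x) * (1 / (a + b)) = a - b" using ab by simp
      then have "(F y - F x - G x [y - x]) * (1 / (a + b)) + G x [y - x] * (1 / (a + b) - 1 / (2 * b)) =
          a - b - G x [y - x] / (2 * b)"
        by (simp only: left_diff_distrib right_diff_distrib) simp
      then have "((F y - F x - G x [y - x]) * (1 / (a + b)) + G x [y - x] * (1 / (a + b) - 1 / (2 * b))) / norm (y - x) =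
          (a - b - G x [y - x] / (2 * b)) / norm (y - x)" by simp
      then show ?case by (simp add: a_def b_def add_divide_distrib mult.commute)
    qed
    then show ?thesis using Lim_transform_eventually[OF tendsto_add[OF 1 2]] by simp
  qed
  moreover have "uniform_limit (unit_tuples S (Suc 0)) (\<lambda>y vs. G y vs / (2 * sqrt (F y))) (\<lambda>vs. G x vs / (2 * sqrt (F x))) ?A"
  proof -
    have d: "uniform_limit (unit_tuples S (Suc 0)) (\<lambda>y vs. G y vs - G x vs) (\<lambda>_. 0) ?A"
      using G(3) by (simp add: uniform_limit_iff dist_real_def)
    have "\<forall>\<^sub>F y in ?A. dist (1 / (2 * sqrt (F y))) (1 / (2 * sqrt (F x))) < 1"
      using inv by (rule tendstoD) simp
    then have "\<forall>\<^sub>F y in ?A. \<forall>vs\<in>unit_tuples S (Suc 0). \<bar>1 / (2 * sqrt (F y))\<bar> \<le> \<bar>1 / (2 * sqrt (F x))\<bar> + 1"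
    proof eventually_elim
      case (elim y)
      then show ?case unfolding dist_real_def by (intro ballI) linarith
    qed
    with d have 1: "uniform_limit (unit_tuples S (Suc 0)) (\<lambda>y vs. 1 / (2 * sqrt (F y)) * (G y vs - G x vs)) (\<lambda>_. 0) ?A"
      by (rule uniform_limit_null_mult)
    have "((\<lambda>y. 1 / (2 * sqrt (F y)) - 1 / (2 * sqrt (F x))) \<longlongrightarrow> 0) ?A"
      using tendsto_diff[OF inv tendsto_const[of "1 / (2 * sqrt (F x))"]] by simp
    then have "uniform_limit (unit_tuples S (Suc 0)) (\<lambda>y vs. 1 / (2 * sqrt (F y)) - 1 / (2 * sqrt (F x))) (\<lambda>_. 0) ?A"
      by (rule uniform_limit_const_null)
    moreover have "\<forall>\<^sub>F y in ?A. \<forall>vs\<in>unit_tuples S (Suc 0). \<bar>G x vs\<bar> \<le> \<bar>B\<bar>"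
    proof (intro always_eventually allI ballI)
      fix vs assume "vs \<in> unit_tuples S (Suc 0)"
      then obtain v where v: "vs = [v]" "v \<in> S" "norm v \<le> 1" unfolding unit_tuples_def tuples_1 by auto
      have "\<bar>G x [v]\<bar> \<le> \<bar>B\<bar> * norm v" using B[OF v(2)] by (smt (verit) mult_right_mono norm_ge_zero)
      also have "\<dots> \<le> \<bar>B\<bar>" using v(3) by (simp add: mult_left_le)
      finally show "\<bar>G x vs\<bar> \<le> \<bar>B\<bar>" by (simp add: v(1))
    qed
    ultimately have 2: "uniform_limit (unit_tuples S (Suc 0))
        (\<lambda>y vs. G x vs * (1 / (2 * sqrt (F y)) - 1 / (2 * sqrt (F x)))) (\<lambda>_. 0) ?A"
      by (rule uniform_limit_null_mult)
    have eq: "1 / (2 * sqrt (F y)) * (G y vs - G x vs) + G x vs * (1 / (2 * sqrt (F y)) - 1 / (2 * sqrt (F x))) =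
        G y vs / (2 * sqrt (F y)) - G x vs / (2 * sqrt (F x))" for y vs
      by (simp add: diff_divide_distrib right_diff_distrib)
    from uniform_limit_add[OF 1 2] show ?thesis
      unfolding eq uniform_limit_iff dist_real_def by simp
  qed
  ultimately show "bounded_multilinear_on S (Suc 0) (\<lambda>vs. G x vs / (2 * sqrt (F x))) \<and>
      ((\<lambda>y. (sqrt (F y) - sqrt (F x) - G x [y - x] / (2 * sqrt (F x))) / norm (y - x)) \<longlongrightarrow> 0) ?A \<and>
      uniform_limit (unit_tuples S (Suc 0)) (\<lambda>y vs. G y vs / (2 * sqrt (F y))) (\<lambda>vs. G x vs / (2 * sqrt (F x))) ?A"
    by blast
qed

text \<open>Termwise differentiation of a weighted sum of squares. The common bound \<open>C\<close>
  makes all terms Lipschitz alike, so the weights dominate every series that occurs.\<close>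

lemma C1_deriv_series:
  fixes S :: "'a::real_normed_vector set" and p :: "nat \<Rightarrow> 'a \<Rightarrow> real"
  assumes S: "subspace S" and p: "\<And>n. seminorm_on S (p n)"
    and C: "0 \<le> C" "\<And>n x. x \<in> S \<Longrightarrow> p n x \<le> C * norm x"
    and g: "\<And>n. C1_deriv S (S - {0}) (p n) (g n)"
    and c: "\<And>n. 0 \<le> c n" "summable c"
  shows "C1_deriv S (S - {0}) (\<lambda>x. \<Sum>n. c n * (p n x)\<^sup>2) (\<lambda>x vs. \<Sum>n. c n * (2 * p n x * g n x vs))"
  unfolding C1_deriv_def
proof
  fix x assume x: "x \<in> S - {0}"
  let ?A = "at x within S - {0}"
  have nn: "0 \<le> p n y" if "y \<in> S" for n y using seminorm_on_nonneg[OF p that] .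
  have abs_p: "\<bar>p n y\<bar> \<le> C * norm y" if "y \<in> S" for n y using nn[OF that] C(2)[OF that] by simp
  have lip: "\<bar>p n y - p n z\<bar> \<le> C * norm (y - z)" if "y \<in> S" "z \<in> S" for n y z
    using seminorm_on_diff_le[OF p S that] C(2)[OF subspace_diff[OF S that]] by (rule order_trans)
  have gb: "\<bar>g n y [v]\<bar> \<le> C * norm v" if "y \<in> S - {0}" "v \<in> S" for n y v
    by (rule C1_deriv_bound[OF S g that lip])
  have gx: "bounded_multilinear_on S (Suc 0) (g n x)"
    "((\<lambda>y. (p n y - p n x - g n x [y - x]) / norm (y - x)) \<longlongrightarrow> 0) ?A"
    "uniform_limit (unit_tuples S (Suc 0)) (g n) (g n x) ?A" for n
    using g[of n] x unfolding C1_deriv_def by blast+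
  have add: "g n x [v + w] = g n x [v] + g n x [w]" if "v \<in> S" "w \<in> S" for n v w
    using gx(1)[of n] that unfolding bounded_multilinear_on_1_iff by blast
  have scale: "g n x [r *\<^sub>R v] = r * g n x [v]" if "v \<in> S" for n r v
    using gx(1)[of n] that unfolding bounded_multilinear_on_1_iff by blast
  have sq: "(p n y)\<^sup>2 \<le> (C * norm y)\<^sup>2" if "y \<in> S" for n y
    using C(2)[OF that] nn[OF that] by (rule power_mono)
  have sF: "summable (\<lambda>n. c n * (p n y)\<^sup>2)" if "y \<in> S" for y
    by (rule summable_comparison_test'[OF summable_mult2[OF c(2), of "(C * norm y)\<^sup>2"], of 0])
      (use sq[OF that] c(1) in \<open>simp add: mult_left_mono abs_mult\<close>)
  have Gb: "\<bar>c n * (2 * p n x * g n x [v])\<bar> \<le> c n * (2 * (C * norm x) * (C * norm v))" if "v \<in> S" for n v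
  proof -
    have "\<bar>p n x\<bar> * \<bar>g n x [v]\<bar> \<le> (C * norm x) * (C * norm v)"
      using abs_p[of x n] gb[OF x that, of n] x C(1) by (intro mult_mono) auto
    then show ?thesis using c(1)[of n] by (simp add: abs_mult mult_left_mono)
  qed
  have sG: "summable (\<lambda>n. c n * (2 * p n x * g n x [v]))" if "v \<in> S" for v
    by (rule summable_comparison_test'[OF summable_mult2[OF c(2)], of 0]) (use Gb[OF that] in simp)
  have 1: "bounded_multilinear_on S (Suc 0) (\<lambda>vs. \<Sum>n. c n * (2 * p n x * g n x vs))"
    unfolding bounded_multilinear_on_1_iff
  proof (intro conjI ballI allI)
    fix v w assume vw: "v \<in> S" "w \<in> S"
    show "(\<Sum>n. c n * (2 * p n x * g n x [v + w])) =
        (\<Sum>n. c n * (2 * p n x * g n x [v])) + (\<Sum>n. c n * (2 * p n x * g n x [w]))"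
      unfolding suminf_add[OF sG[OF vw(1)] sG[OF vw(2)]] by (simp add: add vw algebra_simps)
  next
    fix r v assume v: "v \<in> S"
    show "(\<Sum>n. c n * (2 * p n x * g n x [r *\<^sub>R v])) = r * (\<Sum>n. c n * (2 * p n x * g n x [v]))"
      unfolding suminf_mult[OF sG[OF v], symmetric] by (simp add: scale v mult_ac)
  next
    have "\<bar>\<Sum>n. c n * (2 * p n x * g n x [v])\<bar> \<le> (suminf c * (2 * (C * norm x) * C)) * norm v" if v: "v \<in> S" for v
    proof -
      have sa: "summable (\<lambda>n. \<bar>c n * (2 * p n x * g n x [v])\<bar>)"
        by (rule summable_comparison_test'[OF summable_mult2[OF c(2)], of 0]) (use Gb[OF v] in simp)
      have "\<bar>\<Sum>n. c n * (2 * p n x * g n x [v])\<bar> \<le> (\<Sum>n. \<bar>c n * (2 * p n x * g n x [v])\<bar>)"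
        by (rule summable_rabs[OF sa])
      also have "\<dots> \<le> (\<Sum>n. c n * (2 * (C * norm x) * (C * norm v)))"
        by (rule suminf_le[OF Gb[OF v] sa summable_mult2[OF c(2)]])
      also have "\<dots> = suminf c * (2 * (C * norm x) * (C * norm v))" by (rule suminf_mult2[OF c(2), symmetric])
      finally show ?thesis by (simp add: mult_ac)
    qed
    then show "\<exists>B. \<forall>v\<in>S. \<bar>\<Sum>n. c n * (2 * p n x * g n x [v])\<bar> \<le> B * norm v" by blast
  qed
  have inU: "\<forall>\<^sub>F y in ?A. y \<in> S - {0} \<and> y \<noteq> x" by (simp add: eventually_at_filter)
  have near: "\<forall>\<^sub>F y in ?A. norm (y - x) < 1"
    unfolding eventually_at by (intro exI[of _ 1]) (simp add: dist_norm)
  have "((\<lambda>y. C * norm (y - x)) \<longlongrightarrow> C * norm (x - x)) ?A" by (intro tendsto_intros)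
  then have lim0: "((\<lambda>y. C * norm (y - x)) \<longlongrightarrow> 0) ?A" by simp
  have lim_p: "((\<lambda>y. p n y - p n x) \<longlongrightarrow> 0) ?A" for n
  proof (rule Lim_null_comparison[OF _ lim0])
    show "\<forall>\<^sub>F y in ?A. norm (p n y - p n x) \<le> C * norm (y - x)"
      using inU by eventually_elim (use lip x in auto)
  qed
  \<comment> \<open>The remainder of the square of \<open>p n\<close> is split into the squared
    increment and \<open>2 * p n x\<close> times the remainder of \<open>p n\<close>, both divided
    by \<open>norm (y - x)\<close>.\<close>
  let ?a = "\<lambda>n y. c n * ((p n y - p n x) / norm (y - x) * (p n y - p n x) +
      2 * p n x * ((p n y - p n x - g n x [y - x]) / norm (y - x)))"
  have quot: "\<bar>(p n y - p n x) / norm (y - x)\<bar> \<le> C" if "y \<in> S - {0} \<and> y \<noteq> x" for n y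
    using lip[of y x n] that x by (simp add: field_simps)
  have "((\<lambda>y. \<Sum>n. ?a n y) \<longlongrightarrow> 0) ?A"
  proof -
    have "uniform_limit {()} (\<lambda>y v. \<Sum>n. ?a n y) (\<lambda>_. 0) ?A"
    proof (rule uniform_limit_suminf_null[where B="\<lambda>n. c n * (C * C + 2 * (C * norm x) * (2 * C))"])
      show "summable (\<lambda>n. c n * (C * C + 2 * (C * norm x) * (2 * C)))" by (rule summable_mult2[OF c(2)])
      fix n
      have "uniform_limit {()} (\<lambda>y v. (p n y - p n x) / norm (y - x) * (p n y - p n x)) (\<lambda>_. 0) ?A"
      proof (rule uniform_limit_null_mult[OF uniform_limit_const_null[OF lim_p], where B=C])
        show "\<forall>\<^sub>F y in ?A. \<forall>v\<in>{()}. \<bar>(p n y - p n x) / norm (y - x)\<bar> \<le> C"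
          using inU by eventually_elim (use quot in simp)
      qed
      then have "((\<lambda>y. (p n y - p n x) / norm (y - x) * (p n y - p n x)) \<longlongrightarrow> 0) ?A" by simp
      then have "((\<lambda>y. ?a n y) \<longlongrightarrow> c n * (0 + 2 * p n x * 0)) ?A"
        by (intro tendsto_intros gx(2))
      then show "uniform_limit {()} (\<lambda>y v. ?a n y) (\<lambda>_. 0) ?A" by simp
    next
      show "\<forall>\<^sub>F y in ?A. \<forall>n. \<forall>v\<in>{()}. \<bar>?a n y\<bar> \<le> c n * (C * C + 2 * (C * norm x) * (2 * C))"
        using inU near
      proof eventually_elim
        case (elim y)
        have y: "y \<in> S" "y - x \<in> S" using elim(1) x S by (auto intro: subspace_diff)
        have "\<bar>?a n y\<bar> \<le> c n * (C * C + 2 * (C * norm x) * (2 * C))" for n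
        proof -
          have q: "\<bar>(p n y - p n x) / norm (y - x)\<bar> \<le> C" using quot elim(1) by blast
          have "\<bar>p n y - p n x\<bar> \<le> C * norm (y - x)" using lip y x by blast
          also have "\<dots> \<le> C * 1" using elim(2) C(1) by (intro mult_left_mono) auto
          finally have d: "\<bar>p n y - p n x\<bar> \<le> C" by simp
          have i1: "\<bar>(p n y - p n x) / norm (y - x) * (p n y - p n x)\<bar> \<le> C * C"
            unfolding abs_mult by (rule mult_mono[OF q d C(1)]) simp
          have "\<bar>g n x [y - x]\<bar> \<le> C * norm (y - x)" using gb[OF x y(2)] .
          then have "\<bar>g n x [y - x] / norm (y - x)\<bar> \<le> C" using elim(1) by (simp add: field_simps)
          then have q2: "\<bar>(p n y - p n x - g n x [y - x]) / norm (y - x)\<bar> \<le> 2 * C"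
            using q unfolding diff_divide_distrib by linarith
          have "\<bar>2 * p n x\<bar> \<le> 2 * (C * norm x)" using abs_p[of x n] x by simp
          then have i2: "\<bar>2 * p n x * ((p n y - p n x - g n x [y - x]) / norm (y - x))\<bar> \<le> 2 * (C * norm x) * (2 * C)"
            unfolding abs_mult[of "2 * p n x"] using q2 C(1) by (intro mult_mono) auto
          have "\<bar>(p n y - p n x) / norm (y - x) * (p n y - p n x) +
              2 * p n x * ((p n y - p n x - g n x [y - x]) / norm (y - x))\<bar> \<le> C * C + 2 * (C * norm x) * (2 * C)"
            using i1 i2 by linarith
          then show ?thesis using c(1)[of n] by (simp only: abs_mult abs_of_nonneg mult_left_mono)
        qed
        then show ?case by blast
      qed
    qed
    then show ?thesis by simp
  qed
  moreover have "\<forall>\<^sub>F y in ?A. (\<Sum>n. ?a n y) =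
      ((\<Sum>n. c n * (p n y)\<^sup>2) - (\<Sum>n. c n * (p n x)\<^sup>2) - (\<Sum>n. c n * (2 * p n x * g n x [y - x]))) / norm (y - x)"
    using inU
  proof eventually_elim
    case (elim y)
    have y: "y \<in> S" "x \<in> S" "y - x \<in> S" using elim x S by (auto intro: subspace_diff)
    have "?a n y = (c n * (p n y)\<^sup>2 - c n * (p n x)\<^sup>2 - c n * (2 * p n x * g n x [y - x])) / norm (y - x)" for n
    proof -
      have "norm (y - x) \<noteq> 0" using elim by simp
      then show ?thesis by (simp add: field_simps power2_eq_square)
    qed
    then have "(\<Sum>n. ?a n y) = (\<Sum>n. (c n * (p n y)\<^sup>2 - c n * (p n x)\<^sup>2 - c n * (2 * p n x * g n x [y - x])) / norm (y - x))"
      by presburger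
    also have "\<dots> = (\<Sum>n. c n * (p n y)\<^sup>2 - c n * (p n x)\<^sup>2 - c n * (2 * p n x * g n x [y - x])) / norm (y - x)"
      by (rule suminf_divide[OF summable_diff[OF summable_diff[OF sF[OF y(1)] sF[OF y(2)]] sG[OF y(3)]]])
    also have "(\<Sum>n. c n * (p n y)\<^sup>2 - c n * (p n x)\<^sup>2 - c n * (2 * p n x * g n x [y - x])) =
        (\<Sum>n. c n * (p n y)\<^sup>2 - c n * (p n x)\<^sup>2) - (\<Sum>n. c n * (2 * p n x * g n x [y - x]))"
      by (rule suminf_diff[OF summable_diff[OF sF[OF y(1)] sF[OF y(2)]] sG[OF y(3)], symmetric])
    also have "(\<Sum>n. c n * (p n y)\<^sup>2 - c n * (p n x)\<^sup>2) = (\<Sum>n. c n * (p n y)\<^sup>2) - (\<Sum>n. c n * (p n x)\<^sup>2)"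
      by (rule suminf_diff[OF sF[OF y(1)] sF[OF y(2)], symmetric])
    finally show ?case .
  qed
  ultimately have 2: "((\<lambda>y. ((\<Sum>n. c n * (p n y)\<^sup>2) - (\<Sum>n. c n * (p n x)\<^sup>2) - (\<Sum>n. c n * (2 * p n x * g n x [y - x]))) / norm (y - x)) \<longlongrightarrow> 0) ?A"
    by (rule Lim_transform_eventually)
  have unit: "\<exists>v. vs = [v] \<and> v \<in> S \<and> norm v \<le> 1" if "vs \<in> unit_tuples S (Suc 0)" for vs
    using that unfolding unit_tuples_def tuples_1 by auto
  have g1: "\<bar>g n y vs\<bar> \<le> C" if "y \<in> S - {0}" and vs: "vs \<in> unit_tuples S (Suc 0)" for n y vs
  proof -
    obtain v where v: "vs = [v]" "v \<in> S" "norm v \<le> 1" using unit[OF vs] by blast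
    have "\<bar>g n y [v]\<bar> \<le> C * norm v" by (rule gb[OF that(1) v(2)])
    also have "\<dots> \<le> C * 1" using v(3) C(1) by (rule mult_left_mono)
    finally show ?thesis by (simp add: v(1))
  qed
  \<comment> \<open>The increment of \<open>2 * p n * g n\<close> is split so that each summand is a
    bounded factor times a null one.\<close>
  let ?b = "\<lambda>n y vs. 2 * c n * (g n y vs * (p n y - p n x) + p n x * (g n y vs - g n x vs))"
  have "uniform_limit (unit_tuples S (Suc 0)) (\<lambda>y vs. \<Sum>n. ?b n y vs) (\<lambda>_. 0) ?A"
  proof (rule uniform_limit_suminf_null[where B="\<lambda>n. c n * (2 * (C * C + C * norm x * (2 * C)))"])
    show "summable (\<lambda>n. c n * (2 * (C * C + C * norm x * (2 * C))))" by (rule summable_mult2[OF c(2)])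
    fix n
    have i1: "uniform_limit (unit_tuples S (Suc 0)) (\<lambda>y vs. g n y vs * (p n y - p n x)) (\<lambda>_. 0) ?A"
    proof (rule uniform_limit_null_mult[OF uniform_limit_const_null[OF lim_p], where B=C])
      show "\<forall>\<^sub>F y in ?A. \<forall>vs\<in>unit_tuples S (Suc 0). \<bar>g n y vs\<bar> \<le> C"
        using inU by eventually_elim (use g1 in blast)
    qed
    have "uniform_limit (unit_tuples S (Suc 0)) (\<lambda>y vs. g n y vs - g n x vs) (\<lambda>_. 0) ?A"
      using gx(3)[of n] by (simp add: uniform_limit_iff dist_real_def)
    then have i2: "uniform_limit (unit_tuples S (Suc 0)) (\<lambda>y vs. p n x * (g n y vs - g n x vs)) (\<lambda>_. 0) ?A"
      by (rule uniform_limit_null_mult[where B="\<bar>p n x\<bar>"]) simp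
    from uniform_limit_add[OF i1 i2]
    have "uniform_limit (unit_tuples S (Suc 0)) (\<lambda>y vs. g n y vs * (p n y - p n x) + p n x * (g n y vs - g n x vs)) (\<lambda>_. 0) ?A"
      by simp
    then show "uniform_limit (unit_tuples S (Suc 0)) (\<lambda>y vs. ?b n y vs) (\<lambda>_. 0) ?A"
      by (rule uniform_limit_null_mult[where b="\<lambda>y vs. 2 * c n" and B="\<bar>2 * c n\<bar>"]) simp
  next
    show "\<forall>\<^sub>F y in ?A. \<forall>n. \<forall>vs\<in>unit_tuples S (Suc 0). \<bar>?b n y vs\<bar> \<le> c n * (2 * (C * C + C * norm x * (2 * C)))"
      using inU near
    proof eventually_elim
      case (elim y)
      have "\<bar>?b n y vs\<bar> \<le> c n * (2 * (C * C + C * norm x * (2 * C)))" if vs: "vs \<in> unit_tuples S (Suc 0)" for n vs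
      proof -
        have gy: "\<bar>g n y vs\<bar> \<le> C" and gxv: "\<bar>g n x vs\<bar> \<le> C" using g1 vs elim(1) x by blast+
        have "\<bar>p n y - p n x\<bar> \<le> C * norm (y - x)" using lip elim(1) x by blast
        also have "\<dots> \<le> C * 1" using elim(2) C(1) by (intro mult_left_mono) auto
        finally have d: "\<bar>p n y - p n x\<bar> \<le> C" by simp
        have i1: "\<bar>g n y vs * (p n y - p n x)\<bar> \<le> C * C"
          unfolding abs_mult by (rule mult_mono[OF gy d C(1)]) simp
        have "\<bar>g n y vs - g n x vs\<bar> \<le> 2 * C" using gy gxv by linarith
        then have i2: "\<bar>p n x * (g n y vs - g n x vs)\<bar> \<le> C * norm x * (2 * C)"
          unfolding abs_mult using abs_p[of x n] x C(1) by (intro mult_mono) auto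
        have "\<bar>g n y vs * (p n y - p n x) + p n x * (g n y vs - g n x vs)\<bar> \<le> C * C + C * norm x * (2 * C)"
          using i1 i2 by linarith
        then have "2 * c n * \<bar>g n y vs * (p n y - p n x) + p n x * (g n y vs - g n x vs)\<bar> \<le>
            2 * c n * (C * C + C * norm x * (2 * C))"
          using c(1)[of n] by (intro mult_left_mono) auto
        moreover have "\<bar>?b n y vs\<bar> = 2 * c n * \<bar>g n y vs * (p n y - p n x) + p n x * (g n y vs - g n x vs)\<bar>"
          using c(1)[of n] by (subst abs_mult) simp
        moreover have "2 * c n * (C * C + C * norm x * (2 * C)) = c n * (2 * (C * C + C * norm x * (2 * C)))"
          by (simp only: mult_ac)
        ultimately show ?thesis by linarith
      qed
      then show ?case by blast
    qed
  qed
  moreover have "\<forall>\<^sub>F y in ?A. \<forall>vs\<in>unit_tuples S (Suc 0). (\<Sum>n. ?b n y vs) =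
      (\<Sum>n. c n * (2 * p n y * g n y vs)) - (\<Sum>n. c n * (2 * p n x * g n x vs))"
    using inU
  proof eventually_elim
    case (elim y)
    show ?case
    proof
      fix vs assume vs: "vs \<in> unit_tuples S (Suc 0)"
      have sm: "summable (\<lambda>n. c n * (2 * p n z * g n z vs))" if z: "z \<in> S - {0}" for z
      proof (rule summable_comparison_test'[OF summable_mult2[OF c(2), of "2 * (C * norm z) * C"], of 0])
        fix n
        have "\<bar>p n z\<bar> * \<bar>g n z vs\<bar> \<le> (C * norm z) * C"
          using abs_p[of z n] g1[OF z vs, of n] z C(1) by (intro mult_mono) auto
        then show "norm (c n * (2 * p n z * g n z vs)) \<le> c n * (2 * (C * norm z) * C)"
          using c(1)[of n] by (simp add: abs_mult mult_left_mono)
      qed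
      have ys: "y \<in> S - {0}" using elim by blast
      have "(\<Sum>n. c n * (2 * p n y * g n y vs)) - (\<Sum>n. c n * (2 * p n x * g n x vs)) =
          (\<Sum>n. c n * (2 * p n y * g n y vs) - c n * (2 * p n x * g n x vs))"
        by (rule suminf_diff[OF sm[OF ys] sm[OF x]])
      also have "\<dots> = (\<Sum>n. ?b n y vs)" by (simp add: algebra_simps)
      finally show "(\<Sum>n. ?b n y vs) =
        (\<Sum>n. c n * (2 * p n y * g n y vs)) - (\<Sum>n. c n * (2 * p n x * g n x vs))" ..
    qed
  qed
  ultimately have "uniform_limit (unit_tuples S (Suc 0))
      (\<lambda>y vs. (\<Sum>n. c n * (2 * p n y * g n y vs)) - (\<Sum>n. c n * (2 * p n x * g n x vs))) (\<lambda>_. 0) ?A"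
    by (subst (asm) uniform_limit_cong) auto
  then have 3: "uniform_limit (unit_tuples S (Suc 0)) (\<lambda>y vs. \<Sum>n. c n * (2 * p n y * g n y vs))
      (\<lambda>vs. \<Sum>n. c n * (2 * p n x * g n x vs)) ?A"
    by (simp add: uniform_limit_iff dist_real_def)
  show "bounded_multilinear_on S (Suc 0) (\<lambda>vs. \<Sum>n. c n * (2 * p n x * g n x vs)) \<and>
      ((\<lambda>y. ((\<Sum>n. c n * (p n y)\<^sup>2) - (\<Sum>n. c n * (p n x)\<^sup>2) - (\<Sum>n. c n * (2 * p n x * g n x [y - x]))) / norm (y - x)) \<longlongrightarrow> 0) ?A \<and>
      uniform_limit (unit_tuples S (Suc 0)) (\<lambda>y vs. \<Sum>n. c n * (2 * p n y * g n y vs))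
        (\<lambda>vs. \<Sum>n. c n * (2 * p n x * g n x vs)) ?A"
    using 1 2 3 by blast
qed

text \<open>A small defect of the square sum makes the defect of every \<open>p n\<close> small. As
  \<open>p n\<close> approximates \<open>N\<close> arbitrarily well for large \<open>n\<close>, the
  defect of \<open>N\<close> becomes small too, and rotundity of \<open>N\<close> applies; the
  \<open>p n\<close> themselves need not be rotund.\<close>

theorem C1_rotund_norm:
  fixes S :: "'a::real_normed_vector set"
  assumes S: "subspace S" and N: "equivalent_norm_on S N" and rot: "rotund_on S N" and "0 < \<epsilon>"
    and p: "\<And>n. seminorm_on S (p n)" "\<And>n. Ck_norm_on S 1 (p n)"
    and le: "\<And>n x. x \<in> S \<Longrightarrow> N x \<le> p n x" "\<And>n x. x \<in> S \<Longrightarrow> p n x \<le> (1 + \<epsilon> / (real n + 1)) * N x"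
  shows "\<exists>M. equivalent_norm_on S M \<and> rotund_on S M \<and> Ck_norm_on S 1 M \<and>
    (\<forall>x\<in>S. N x \<le> M x \<and> M x \<le> (1 + \<epsilon>) * N x)"
proof -
  obtain a b where ab: "0 < a" "0 < b" "\<forall>x\<in>S. a * norm x \<le> N x \<and> N x \<le> b * norm x"
    using N unfolding equivalent_norm_on_def by blast
  have ab3: "a * norm x \<le> N x" and ab4: "N x \<le> b * norm x" if "x \<in> S" for x
    using ab(3) that by blast+
  have sN: "seminorm_on S N"
    using N unfolding equivalent_norm_on_def norm_on_iff_seminorm_on[OF S] by (elim conjE)
  have Nnn: "0 \<le> N x" if "x \<in> S" for x using seminorm_on_nonneg[OF sN that] .
  have pnn: "0 \<le> p n x" if "x \<in> S" for n x using seminorm_on_nonneg[OF p(1) that] .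
  have p_le: "p n x \<le> (1 + \<epsilon>) * N x" if "x \<in> S" for n x
  proof -
    have "\<epsilon> / (real n + 1) \<le> \<epsilon>" using \<open>0 < \<epsilon>\<close> by (simp add: field_simps)
    then have "(1 + \<epsilon> / (real n + 1)) * N x \<le> (1 + \<epsilon>) * N x"
      using Nnn[OF that] by (intro mult_right_mono) auto
    then show ?thesis using le(2)[OF that, of n] by linarith
  qed
  \<comment> \<open>The weights sum to 1, so common bounds of the \<open>p n\<close> in terms of
    \<open>N\<close> pass to \<open>M\<close> unchanged.\<close>
  define c where "c n = (1/2 :: real) ^ Suc n" for n
  have c: "0 < c n" for n by (simp add: c_def)
  have c1: "c sums 1" unfolding c_def by (rule power_half_series)
  define q where "q n x = sqrt (c n) * p n x" for n x
  have q2: "(q n x)\<^sup>2 = c n * (p n x)\<^sup>2" for n x using c[of n] by (simp add: q_def power_mult_distrib)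
  have q: "seminorm_on S (q n)" for n
    using p(1)[of n] c[of n] unfolding seminorm_on_def q_def by (simp flip: distrib_left)
  have sq_le: "(q n x)\<^sup>2 \<le> c n * ((1 + \<epsilon>) * N x)\<^sup>2" if "x \<in> S" for n x
    unfolding q2 using p_le[OF that] pnn[OF that] c[of n] by (intro mult_left_mono power_mono) auto
  have sm: "summable (\<lambda>n. (q n x)\<^sup>2)" if "x \<in> S" for x
    by (rule summable_comparison_test'[OF summable_mult2[OF sums_summable[OF c1]], of 0])
      (use sq_le[OF that] in simp)
  define M where "M x = sqrt (\<Sum>n. (q n x)\<^sup>2)" for x
  have sM: "seminorm_on S M" unfolding M_def by (rule seminorm_on_sqrt_suminf[OF S q sm])
  have upper: "M x \<le> (1 + \<epsilon>) * N x" if "x \<in> S" for x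
  proof -
    have "(\<Sum>n. (q n x)\<^sup>2) \<le> (\<Sum>n. c n * ((1 + \<epsilon>) * N x)\<^sup>2)"
      by (rule suminf_le[OF sq_le[OF that] sm[OF that] summable_mult2[OF sums_summable[OF c1]]])
    also have "\<dots> = ((1 + \<epsilon>) * N x)\<^sup>2" using sums_mult2[OF c1] by (simp add: sums_iff)
    finally show ?thesis unfolding M_def using Nnn[OF that] \<open>0 < \<epsilon>\<close> by (intro real_le_lsqrt) auto
  qed
  have lower: "N x \<le> M x" if x: "x \<in> S" for x
  proof -
    have "(N x)\<^sup>2 = (\<Sum>n. c n * (N x)\<^sup>2)" using sums_mult2[OF c1] by (simp add: sums_iff)
    also have "\<dots> \<le> (\<Sum>n. (q n x)\<^sup>2)"
    proof (rule suminf_le[OF _ summable_mult2[OF sums_summable[OF c1]] sm[OF x]])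
      show "c n * (N x)\<^sup>2 \<le> (q n x)\<^sup>2" for n
        unfolding q2 using le(1)[OF x] Nnn[OF x] c[of n] by (intro mult_left_mono power_mono) auto
    qed
    finally show ?thesis unfolding M_def by (rule real_le_rsqrt)
  qed
  have eqM: "equivalent_norm_on S M"
  proof (rule equivalent_norm_onI[OF S sM ab(1), of "(1 + \<epsilon>) * b"])
    show "0 < (1 + \<epsilon>) * b" using ab \<open>0 < \<epsilon>\<close> by simp
    fix x assume x: "x \<in> S"
    show "a * norm x \<le> M x" using ab3[OF x] lower[OF x] by linarith
    have "(1 + \<epsilon>) * N x \<le> (1 + \<epsilon>) * (b * norm x)" using ab4[OF x] \<open>0 < \<epsilon>\<close> by (intro mult_left_mono) auto
    then show "M x \<le> (1 + \<epsilon>) * b * norm x" using upper[OF x] by simp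
  qed
  have "rotund_on S M"
    unfolding rotund_on_def
  proof (intro ballI allI impI)
    fix x u assume x: "x \<in> S" and u: "\<forall>k::nat. u k \<in> S" and lim: "(\<lambda>k. defect M x (u k)) \<longlonglongrightarrow> 0"
    have uS: "u k \<in> S" for k using u by blast
    have limp: "(\<lambda>k. defect (p n) x (u k)) \<longlonglongrightarrow> 0" for n
    proof -
      have b: "norm (defect (p n) x (u k)) \<le> defect M x (u k) / c n" for k
      proof -
        have "defect (q n) x (u k) \<le> defect M x (u k)"
          unfolding M_def by (rule defect_sqrt_suminf[OF S q sm x uS])
        moreover have "defect (q n) x (u k) = c n * defect (p n) x (u k)"
          unfolding defect_def q2 by (simp add: algebra_simps)
        ultimately show ?thesis
          using defect_nonneg[OF p(1) S x uS, of n k] c[of n] by (simp add: field_simps)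
      qed
      have "(\<lambda>k. defect M x (u k) / c n) \<longlonglongrightarrow> 0" using lim by (rule tendsto_divide_zero)
      then show ?thesis by (rule Lim_null_comparison[OF always_eventually[OF allI[OF b]]])
    qed
    have limN: "(\<lambda>k. defect N x (u k)) \<longlonglongrightarrow> 0"
    proof (rule tendstoI)
      fix \<delta> :: real assume "0 < \<delta>"
      \<comment> \<open>Bounds the square of \<open>p n (x + u k)\<close> once
        \<open>p n (u k)\<close> is within 1 of \<open>p n x\<close>. It does not depend on
        \<open>n\<close>, so \<open>n\<close> can be chosen afterwards to make the error
        \<open>2 * t * B\<close> small.\<close>
      define B where "B = (2 * ((1 + \<epsilon>) * N x + 1))\<^sup>2"
      have B: "0 \<le> B" by (simp add: B_def)
      obtain n :: nat where n: "4 * \<epsilon> * B / \<delta> < n" using reals_Archimedean2 by blast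
      define t where "t = \<epsilon> / (real n + 1)"
      have t: "0 < t" using \<open>0 < \<epsilon>\<close> by (simp add: t_def)
      have tB: "2 * t * B < \<delta> / 2"
      proof -
        have "4 * \<epsilon> * B < \<delta> * (real n + 1)" using n \<open>0 < \<delta>\<close> by (simp add: field_simps)
        then have "4 * (\<epsilon> * B / (real n + 1)) < \<delta>" by (simp add: field_simps)
        then show ?thesis by (simp add: t_def)
      qed
      have lpu: "(\<lambda>k. p n x - p n (u k)) \<longlonglongrightarrow> 0"
      proof -
        have "norm ((p n x - p n (u k))\<^sup>2) \<le> defect (p n) x (u k)" for k
          using defect_ge_square[OF p(1) S x uS] by simp
        then have "(\<lambda>k. (p n x - p n (u k))\<^sup>2) \<longlonglongrightarrow> 0"
          by (intro Lim_null_comparison[OF _ limp[of n]] always_eventually allI)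
        then have "(\<lambda>k. sqrt ((p n x - p n (u k))\<^sup>2)) \<longlonglongrightarrow> sqrt 0" by (rule tendsto_real_sqrt)
        then show ?thesis by (simp add: tendsto_rabs_zero_iff)
      qed
      have "\<forall>\<^sub>F k in sequentially. dist (p n x - p n (u k)) 0 < 1" using lpu by (rule tendstoD) simp
      moreover have "\<forall>\<^sub>F k in sequentially. dist (defect (p n) x (u k)) 0 < \<delta> / 2"
        using limp[of n] by (rule tendstoD) (use \<open>0 < \<delta>\<close> in simp)
      ultimately show "\<forall>\<^sub>F k in sequentially. dist (defect N x (u k)) 0 < \<delta>"
      proof eventually_elim
        case (elim k)
        have xu: "x + u k \<in> S" using S x uS by (rule subspace_add)
        let ?z = "p n (x + u k)"
        have "?z \<le> p n x + p n (u k)" by (rule seminorm_on_triangle[OF p(1) x uS])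
        then have "?z \<le> 2 * ((1 + \<epsilon>) * N x + 1)" using elim(1) p_le[OF x, of n] by (simp add: dist_real_def)
        then have "?z\<^sup>2 \<le> (2 * ((1 + \<epsilon>) * N x + 1))\<^sup>2" using pnn[OF xu] by (intro power_mono)
        then have zB: "?z\<^sup>2 \<le> B" unfolding B_def .
        have "?z \<le> (1 + t) * N (x + u k)" using le(2)[OF xu, of n] by (simp add: t_def)
        then have "?z\<^sup>2 \<le> ((1 + t) * N (x + u k))\<^sup>2" using pnn[OF xu] by (intro power_mono)
        then have zN: "?z\<^sup>2 / (1 + t)\<^sup>2 \<le> (N (x + u k))\<^sup>2" using t unfolding power_mult_distrib by (subst pos_divide_le_eq) (simp_all add: mult.commute)
        \<comment> \<open>Turns the ratio between \<open>p n\<close> and \<open>N\<close> into an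
          additive error proportional to \<open>t\<close>.\<close>
        have "1 - 2 * t \<le> 1 / (1 + t)\<^sup>2"
        proof -
          have "(1 - 2 * t) * (1 + t)\<^sup>2 = 1 - (3 * t\<^sup>2 + 2 * t ^ 3)" by (simp add: power2_eq_square power3_eq_cube algebra_simps)
          also have "\<dots> \<le> 1"
            using zero_le_power[OF less_imp_le[OF t], of 2] zero_le_power[OF less_imp_le[OF t], of 3] by linarith
          finally show ?thesis using t by (simp add: pos_le_divide_eq)
        qed
        then have "(1 - 2 * t) * ?z\<^sup>2 \<le> 1 / (1 + t)\<^sup>2 * ?z\<^sup>2" by (intro mult_right_mono) auto
        then have "?z\<^sup>2 - (N (x + u k))\<^sup>2 \<le> 2 * t * ?z\<^sup>2" using zN by (simp add: algebra_simps)
        also have "\<dots> \<le> 2 * t * B" using zB t by (intro mult_left_mono) auto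
        finally have diff: "?z\<^sup>2 - (N (x + u k))\<^sup>2 < \<delta> / 2" using tB by linarith
        have "(N x)\<^sup>2 \<le> (p n x)\<^sup>2" "(N (u k))\<^sup>2 \<le> (p n (u k))\<^sup>2"
          using le(1) Nnn x uS by (auto intro!: power_mono)
        then have "defect N x (u k) < \<delta>" using diff elim(2) unfolding defect_def dist_real_def by linarith
        then show ?case using defect_nonneg[OF sN S x uS, of k] by (simp add: dist_real_def)
      qed
    qed
    have "(\<lambda>k. N (u k - x)) \<longlonglongrightarrow> 0" using rot x u limN unfolding rotund_on_def by blast
    then have "(\<lambda>k. (1 + \<epsilon>) * N (u k - x)) \<longlonglongrightarrow> 0" by (rule tendsto_mult_right_zero)
    then show "(\<lambda>k. M (u k - x)) \<longlonglongrightarrow> 0"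
    proof (rule Lim_null_comparison[OF always_eventually[OF allI], rotated])
      fix k
      have "u k - x \<in> S" using S uS x by (rule subspace_diff)
      then show "norm (M (u k - x)) \<le> (1 + \<epsilon>) * N (u k - x)"
        using upper seminorm_on_nonneg[OF sM] by simp
    qed
  qed
  moreover have "Ck_norm_on S 1 M"
  proof -
    have "\<exists>g. C1_deriv S (S - {0}) (p n) g" for n using p(2)[of n] unfolding Ck_norm_on_def Ck_on_1_iff .
    then obtain g where g: "\<And>n. C1_deriv S (S - {0}) (p n) (g n)" by metis
    have "p n x \<le> (1 + \<epsilon>) * b * norm x" if "x \<in> S" for n x
    proof -
      have "(1 + \<epsilon>) * N x \<le> (1 + \<epsilon>) * (b * norm x)" using ab4[OF that] \<open>0 < \<epsilon>\<close> by (intro mult_left_mono) auto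
      then show ?thesis using p_le[OF that, of n] by simp
    qed
    then have F: "C1_deriv S (S - {0}) (\<lambda>x. \<Sum>n. c n * (p n x)\<^sup>2) (\<lambda>x vs. \<Sum>n. c n * (2 * p n x * g n x vs))"
      using ab(2) \<open>0 < \<epsilon>\<close> c sums_summable[OF c1]
      by (intro C1_deriv_series[OF S p(1), of "(1 + \<epsilon>) * b"] g) (auto simp: less_imp_le)
    have MF: "M x = sqrt (\<Sum>n. c n * (p n x)\<^sup>2)" for x by (simp add: M_def q2)
    have pos: "0 < (\<Sum>n. c n * (p n x)\<^sup>2)" if "x \<in> S - {0}" for x
    proof -
      have "0 < a * norm x" using that ab(1) by simp
      then have "0 < M x" using ab3[of x] lower[of x] that by auto
      then show ?thesis by (simp add: MF)
    qed
    have "C1_deriv S (S - {0}) (\<lambda>x. sqrt (\<Sum>n. c n * (p n x)\<^sup>2))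
        (\<lambda>x vs. (\<Sum>n. c n * (2 * p n x * g n x vs)) / (2 * sqrt (\<Sum>n. c n * (p n x)\<^sup>2)))"
    proof (rule C1_deriv_sqrt[OF S F pos])
      fix x assume x: "x \<in> S - {0}"
      have "\<bar>M y - M z\<bar> \<le> (1 + \<epsilon>) * b * norm (y - z)" if "y \<in> S - {0}" "z \<in> S - {0}" for y z
      proof -
        have yz: "y \<in> S" "z \<in> S" "y - z \<in> S" using that S by (auto intro: subspace_diff)
        have "(1 + \<epsilon>) * N (y - z) \<le> (1 + \<epsilon>) * (b * norm (y - z))"
          using ab4[OF yz(3)] \<open>0 < \<epsilon>\<close> by (intro mult_left_mono) auto
        then show ?thesis
          using seminorm_on_diff_le[OF sM S yz(1,2)] upper[OF yz(3)] by simp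
      qed
      then have "continuous_on (S - {0}) M" by (rule continuous_on_lipschitz)
      then show "((\<lambda>y. sqrt (\<Sum>n. c n * (p n y)\<^sup>2)) \<longlongrightarrow> sqrt (\<Sum>n. c n * (p n x)\<^sup>2)) (at x within S - {0})"
        using x unfolding MF[symmetric] by (simp add: continuous_on_def)
    qed auto
    then show ?thesis unfolding Ck_norm_on_def Ck_on_1_iff MF[abs_def] by blast
  qed
  ultimately show ?thesis using eqM lower upper by (intro exI[of _ M] conjI) simp_all
qed

section \<open>Density of the norms and proof of the theorem\<close>

lemma equivalent_norm_on_norm: "equivalent_norm_on S norm"
  unfolding equivalent_norm_on_def norm_on_def
proof (intro conjI)
  show "\<exists>c>0. \<exists>C>0. \<forall>x\<in>S. c * norm x \<le> norm x \<and> norm x \<le> C * norm x"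
    by (intro exI[of _ 1] conjI zero_less_one ballI) simp_all
qed (simp_all add: norm_triangle_ineq)

lemma equivalent_norm_on_subset:
  assumes "equivalent_norm_on T N" "S \<subseteq> T" shows "equivalent_norm_on S N"
proof -
  have "norm_on S N"
    using conjunct1[OF assms(1)[unfolded equivalent_norm_on_def]] assms(2) unfolding norm_on_def by (simp add: subset_iff)
  moreover have "\<exists>c>0. \<exists>C>0. \<forall>x\<in>S. c * norm x \<le> N x \<and> N x \<le> C * norm x"
    using conjunct2[OF assms(1)[unfolded equivalent_norm_on_def]] assms(2) by (meson subsetD)
  ultimately show ?thesis unfolding equivalent_norm_on_def by (rule conjI)
qed

lemma admits_norm_if_norms_dense: "norms_dense S Q \<Longrightarrow> admits_norm S Q"
  using equivalent_norm_on_norm zero_less_one unfolding norms_dense_def admits_norm_def by blast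

context normalized_biorthogonal
begin

lemma adapted_norm_exists:
  assumes "equivalent_norm_on UNIV N" "rotund_on Y N" "0 < \<epsilon>"
  obtains I where "adapted_norm \<Gamma> e \<phi> N (1 + \<epsilon>) I"
proof -
  obtain I where "adapted N (1 + \<epsilon>) I" using assms by (rule adapted_family)
  then have "adapted_norm \<Gamma> e \<phi> N (1 + \<epsilon>) I" using assms(1,3) by unfold_locales auto
  then show ?thesis by (rule that)
qed

lemma rotund_norm_exists:
  assumes "equivalent_norm_on Y N" "0 < \<epsilon>"
  obtains N' where "equivalent_norm_on UNIV N'" "rotund_on Y N'"
    "\<And>x. x \<in> Y \<Longrightarrow> N x \<le> N' x" "\<And>x. x \<in> Y \<Longrightarrow> N' x \<le> (1 + \<epsilon>) * N x"
proof -
  obtain N0 where N0: "equivalent_norm_on UNIV N0" "\<And>x. x \<in> Y \<Longrightarrow> N0 x = N x"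
    by (rule equivalent_norm_on_extend[OF subspace_Y assms(1)]) blast
  obtain N' where N': "equivalent_norm_on UNIV N'" "rotund_on Y N'"
    "\<And>x. N0 x \<le> N' x" "\<And>x. N' x \<le> (1 + \<epsilon>) * N0 x"
    by (rule rotund_renorming[OF N0(1) assms(2)]) blast
  show ?thesis
  proof (rule that[OF N'(1,2)])
    show "N x \<le> N' x" "N' x \<le> (1 + \<epsilon>) * N x" if "x \<in> Y" for x
      using N'(3,4)[of x] N0(2)[OF that] by simp_all
  qed
qed

text \<open>Every equivalent norm is first replaced by a nearby rotund one, so that only rotund
  norms have to be approximated, and only from above. The two-sided estimate follows since
  \<open>(1 - \<epsilon>) * (1 + \<epsilon>)\<close> is at most 1.\<close>

lemma norms_denseI:
  assumes approx: "\<And>N \<epsilon>. equivalent_norm_on UNIV N \<Longrightarrow> rotund_on Y N \<Longrightarrow> 0 < \<epsilon> \<Longrightarrow>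
    \<exists>M. equivalent_norm_on Y M \<and> Q M \<and> (\<forall>x\<in>Y. N x \<le> M x \<and> M x \<le> (1 + \<epsilon>) * N x)"
  shows "norms_dense Y Q"
  unfolding norms_dense_def
proof (intro allI impI)
  fix N \<epsilon> assume N: "equivalent_norm_on Y N" and \<epsilon>: "(0::real) < \<epsilon>"
  \<comment> \<open>Two approximations cost the square of \<open>1 + \<delta>\<close>, which is at
    most \<open>1 + 3 * \<delta>\<close> because \<open>\<delta> \<le> 1\<close>.\<close>
  define \<delta> where "\<delta> = min (\<epsilon> / 3) 1"
  have \<delta>: "0 < \<delta>" "\<delta> \<le> 1" "3 * \<delta> \<le> \<epsilon>" using \<epsilon> by (simp_all add: \<delta>_def)
  obtain N' where N': "equivalent_norm_on UNIV N'" "rotund_on Y N'"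
    "\<And>x. x \<in> Y \<Longrightarrow> N x \<le> N' x" "\<And>x. x \<in> Y \<Longrightarrow> N' x \<le> (1 + \<delta>) * N x"
    by (rule rotund_norm_exists[OF N \<delta>(1)]) blast
  obtain M where M: "equivalent_norm_on Y M" "Q M" "\<forall>x\<in>Y. N' x \<le> M x \<and> M x \<le> (1 + \<delta>) * N' x"
    using approx[OF N'(1,2) \<delta>(1)] by blast
  have "(1 - \<epsilon>) * M x \<le> N x \<and> N x \<le> (1 + \<epsilon>) * M x" if x: "x \<in> Y" for x
  proof -
    have nn: "0 \<le> N x" "0 \<le> M x"
      using conjunct1[OF N[unfolded equivalent_norm_on_def]] conjunct1[OF M(1)[unfolded equivalent_norm_on_def]] x
      unfolding norm_on_def by simp_all
    have N'M: "N' x \<le> M x" and MN': "M x \<le> (1 + \<delta>) * N' x" using M(3) x by blast+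
    note MN'
    also have "(1 + \<delta>) * N' x \<le> (1 + \<delta>) * ((1 + \<delta>) * N x)"
      using N'(4)[OF x] \<delta>(1) by (intro mult_left_mono) auto
    also have "\<dots> = (1 + 2 * \<delta> + \<delta> * \<delta>) * N x" by (simp add: algebra_simps)
    also have "\<dots> \<le> (1 + 3 * \<delta>) * N x"
      using \<delta> nn(1) mult_left_le[of \<delta> \<delta>] by (intro mult_right_mono) auto
    also have "\<dots> \<le> (1 + \<epsilon>) * N x" using \<delta>(3) nn(1) by (intro mult_right_mono) auto
    finally have upper: "M x \<le> (1 + \<epsilon>) * N x" .
    have "(1 - \<epsilon>) * M x \<le> N x"
    proof (cases "\<epsilon> < 1")
      case True
      then have "(1 - \<epsilon>) * M x \<le> (1 - \<epsilon>) * ((1 + \<epsilon>) * N x)" using upper by (intro mult_left_mono) auto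
      also have "\<dots> = N x - \<epsilon> * \<epsilon> * N x" by (simp add: algebra_simps)
      also have "\<dots> \<le> N x" using \<epsilon> nn(1) by simp
      finally show ?thesis .
    next
      case False
      then have "(1 - \<epsilon>) * M x \<le> 0" using nn(2) by (intro mult_nonpos_nonneg) auto
      then show ?thesis using nn(1) by linarith
    qed
    moreover have "N x \<le> M x" using N'(3)[OF x] N'M by linarith
    moreover have "M x \<le> (1 + \<epsilon>) * M x" using nn(2) \<epsilon> by (simp add: distrib_right)
    ultimately show ?thesis by linarith
  qed
  with M(1,2) show "\<exists>M. equivalent_norm_on Y M \<and> Q M \<and>
      (\<forall>x\<in>Y. (1 - \<epsilon>) * M x \<le> N x \<and> N x \<le> (1 + \<epsilon>) * M x)" by blast
qed

lemma norms_dense_polyhedral: "norms_dense Y (\<lambda>N. polyhedral_norm_on Y N \<and> lfc_norm_on Y N)"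
proof (rule norms_denseI)
  fix N \<epsilon> assume "equivalent_norm_on UNIV N" "rotund_on Y N" "(0::real) < \<epsilon>"
  then obtain I where "adapted_norm \<Gamma> e \<phi> N (1 + \<epsilon>) I" by (rule adapted_norm_exists)
  then interpret A: adapted_norm \<Gamma> e \<phi> N "1 + \<epsilon>" I .
  have "N x \<le> A.P x" if "x \<in> Y" for x
  proof (cases "x = 0")
    case True
    then show ?thesis using seminorm_on_zero[OF A.seminorm_on_N] seminorm_on_zero[OF A.seminorm_on_P] by simp
  next
    case False
    then show ?thesis using A.P_lower[OF that] by simp
  qed
  then show "\<exists>M. equivalent_norm_on Y M \<and> (polyhedral_norm_on Y M \<and> lfc_norm_on Y M) \<and>
      (\<forall>x\<in>Y. N x \<le> M x \<and> M x \<le> (1 + \<epsilon>) * N x)"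
    using A.equivalent_norm_on_P A.polyhedral_norm_on_P A.lfc_norm_on_P A.P_upper
    by (intro exI[of _ A.P]) simp
qed

lemma norms_dense_Cinf: "norms_dense Y (\<lambda>N. Cinf_norm_on Y N \<and> lfc_norm_on Y N)"
proof (rule norms_denseI)
  fix N \<epsilon> assume "equivalent_norm_on UNIV N" "rotund_on Y N" "(0::real) < \<epsilon>"
  then obtain I where "adapted_norm \<Gamma> e \<phi> N (1 + \<epsilon>) I" by (rule adapted_norm_exists)
  then interpret A: adapted_norm \<Gamma> e \<phi> N "1 + \<epsilon>" I .
  show "\<exists>M. equivalent_norm_on Y M \<and> (Cinf_norm_on Y M \<and> lfc_norm_on Y M) \<and>
      (\<forall>x\<in>Y. N x \<le> M x \<and> M x \<le> (1 + \<epsilon>) * N x)"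
    using A.equivalent_norm_on_M A.Cinf_norm_on_M A.lfc_norm_on_M A.M_lower A.M_upper'
    by (intro exI[of _ A.M]) simp
qed

text \<open>The smooth norms \<open>p n\<close> come from separate adapted families for the same
  \<open>N\<close>, with tolerances \<open>\<epsilon> / (n + 1)\<close> tending to 0 so that they
  converge to \<open>N\<close>.\<close>

lemma norms_dense_LUR: "norms_dense Y (\<lambda>N. Ck_norm_on Y 1 N \<and> LUR_norm_on Y N)"
proof (rule norms_denseI)
  fix N \<epsilon> assume N: "equivalent_norm_on UNIV N" "rotund_on Y N" and \<epsilon>: "(0::real) < \<epsilon>"
  have "\<exists>M. seminorm_on Y M \<and> Ck_norm_on Y 1 M \<and> (\<forall>x\<in>Y. N x \<le> M x \<and> M x \<le> (1 + \<epsilon> / (real n + 1)) * N x)" for n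
  proof -
    have "0 < \<epsilon> / (real n + 1)" using \<epsilon> by simp
    with N obtain I where "adapted_norm \<Gamma> e \<phi> N (1 + \<epsilon> / (real n + 1)) I" by (rule adapted_norm_exists)
    then interpret A: adapted_norm \<Gamma> e \<phi> N "1 + \<epsilon> / (real n + 1)" I .
    have "Ck_norm_on Y 1 A.M" using A.Cinf_norm_on_M unfolding Cinf_norm_on_def by (rule spec)
    then show ?thesis using A.seminorm_on_M A.M_lower A.M_upper' by (intro exI[of _ A.M]) simp
  qed
  then have "\<exists>p. \<forall>n. seminorm_on Y (p n) \<and> Ck_norm_on Y 1 (p n) \<and>
      (\<forall>x\<in>Y. N x \<le> p n x \<and> p n x \<le> (1 + \<epsilon> / (real n + 1)) * N x)"
    by (intro choice allI)
  then obtain p where p: "\<forall>n. seminorm_on Y (p n) \<and> Ck_norm_on Y 1 (p n) \<and>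
      (\<forall>x\<in>Y. N x \<le> p n x \<and> p n x \<le> (1 + \<epsilon> / (real n + 1)) * N x)" by (rule exE)
  have NY: "equivalent_norm_on Y N" using N(1) by (rule equivalent_norm_on_subset) simp
  have pn: "seminorm_on Y (p n)" "Ck_norm_on Y 1 (p n)" for n using spec[OF p, of n] by simp_all
  have le: "N x \<le> p n x" "p n x \<le> (1 + \<epsilon> / (real n + 1)) * N x" if "x \<in> Y" for n x
    using spec[OF p, of n] that by simp_all
  have "\<exists>M. equivalent_norm_on Y M \<and> rotund_on Y M \<and> Ck_norm_on Y 1 M \<and>
      (\<forall>x\<in>Y. N x \<le> M x \<and> M x \<le> (1 + \<epsilon>) * N x)"
    by (rule C1_rotund_norm[OF subspace_Y NY N(2) \<epsilon> pn]) (rule le, assumption)+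
  then obtain M where M: "equivalent_norm_on Y M" "rotund_on Y M" "Ck_norm_on Y 1 M"
    "\<forall>x\<in>Y. N x \<le> M x \<and> M x \<le> (1 + \<epsilon>) * N x"
    by (elim exE conjE)
  then show "\<exists>M. equivalent_norm_on Y M \<and> (Ck_norm_on Y 1 M \<and> LUR_norm_on Y M) \<and>
      (\<forall>x\<in>Y. N x \<le> M x \<and> M x \<le> (1 + \<epsilon>) * N x)"
    using LUR_norm_on_if_rotund_on[OF M(2)] by (intro exI[of _ M] conjI)
qed

lemma bump_and_partitions:
  "(\<exists>f. bump_on Y f \<and> Cinf_on Y Y f \<and> lfc_on Y f) \<and> admits_smooth_lfc_partitions_on Y"
proof -
  obtain N where N: "equivalent_norm_on UNIV N" "rotund_on Y N"
    by (rule rotund_norm_exists[OF equivalent_norm_on_norm zero_less_one]) blast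
  obtain I where "adapted_norm \<Gamma> e \<phi> N (1 + 1) I" using N zero_less_one by (rule adapted_norm_exists)
  then interpret A: adapted_norm \<Gamma> e \<phi> N "1 + 1" I .
  show ?thesis using A.smooth_lfc_bump A.admits_smooth_lfc_partitions by (rule conjI)
qed

end

text \<open>Moving the norm of each functional to its vector preserves biorthogonality and the span.
  No functional has norm 0, since each takes the value 1.\<close>

lemma normalize_biorthogonal_system:
  fixes e :: "'i \<Rightarrow> 'a::real_normed_vector" and \<phi> :: "'i \<Rightarrow> 'a \<Rightarrow>\<^sub>L real"
  assumes "biorthogonal_system \<Gamma> e \<phi>"
  shows "normalized_biorthogonal \<Gamma> (\<lambda>\<alpha>. norm (\<phi> \<alpha>) *\<^sub>R e \<alpha>) (\<lambda>\<alpha>. \<phi> \<alpha> /\<^sub>R norm (\<phi> \<alpha>))"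
    and "span ((\<lambda>\<alpha>. norm (\<phi> \<alpha>) *\<^sub>R e \<alpha>) ` \<Gamma>) = span (e ` \<Gamma>)"
proof -
  have \<phi>: "\<phi> \<alpha> (e \<beta>) = (if \<alpha> = \<beta> then 1 else 0)" if "\<alpha> \<in> \<Gamma>" "\<beta> \<in> \<Gamma>" for \<alpha> \<beta>
    using assms that unfolding biorthogonal_system_def by blast
  have nz: "norm (\<phi> \<alpha>) \<noteq> 0" if "\<alpha> \<in> \<Gamma>" for \<alpha> using \<phi>[OF that that] by auto
  show "normalized_biorthogonal \<Gamma> (\<lambda>\<alpha>. norm (\<phi> \<alpha>) *\<^sub>R e \<alpha>) (\<lambda>\<alpha>. \<phi> \<alpha> /\<^sub>R norm (\<phi> \<alpha>))"
    by unfold_locales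
      (use nz in \<open>auto simp: biorthogonal_system_def blinfun.scaleR_left blinfun.scaleR_right \<phi>\<close>)
  show "span ((\<lambda>\<alpha>. norm (\<phi> \<alpha>) *\<^sub>R e \<alpha>) ` \<Gamma>) = span (e ` \<Gamma>)" (is "span ?A = span ?B")
  proof (rule span_eq[THEN iffD2], intro conjI subsetI)
    fix x assume "x \<in> ?A"
    then show "x \<in> span ?B" by (auto intro: span_scale span_base)
  next
    fix x assume "x \<in> ?B"
    then obtain \<alpha> where \<alpha>: "\<alpha> \<in> \<Gamma>" "x = e \<alpha>" by blast
    have "inverse (norm (\<phi> \<alpha>)) *\<^sub>R (norm (\<phi> \<alpha>) *\<^sub>R e \<alpha>) \<in> span ?A"
      using \<alpha>(1) by (intro span_scale span_base) blast
    then show "x \<in> span ?A" using nz[OF \<alpha>(1)] \<alpha>(2) by simp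
  qed
qed

theorem theoremA:
  fixes \<Gamma> :: "'i set" and e :: "'i \<Rightarrow> 'a::banach" and \<phi> :: "'i \<Rightarrow> 'a \<Rightarrow>\<^sub>L real"
    and Y :: "'a set"
  assumes "\<not> finite_dimensional (UNIV :: 'a set)"
    and "fundamental_biorthogonal_system \<Gamma> e \<phi>"
    and "Y = span (e ` \<Gamma>)"
  shows "admits_norm Y (\<lambda>N. polyhedral_norm_on Y N \<and> lfc_norm_on Y N)
    \<and> admits_norm Y (\<lambda>N. Cinf_norm_on Y N \<and> lfc_norm_on Y N)
    \<and> (\<exists>f. bump_on Y f \<and> Cinf_on Y Y f \<and> lfc_on Y f)
    \<and> admits_smooth_lfc_partitions_on Y
    \<and> admits_norm Y (\<lambda>N. Ck_norm_on Y 1 N \<and> LUR_norm_on Y N)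
    \<and> norms_dense Y (\<lambda>N. polyhedral_norm_on Y N \<and> lfc_norm_on Y N)
    \<and> norms_dense Y (\<lambda>N. Cinf_norm_on Y N \<and> lfc_norm_on Y N)
    \<and> norms_dense Y (\<lambda>N. Ck_norm_on Y 1 N \<and> LUR_norm_on Y N)"
proof -
  let ?e = "\<lambda>\<alpha>. norm (\<phi> \<alpha>) *\<^sub>R e \<alpha>" and ?\<phi> = "\<lambda>\<alpha>. \<phi> \<alpha> /\<^sub>R norm (\<phi> \<alpha>)"
  have b: "biorthogonal_system \<Gamma> e \<phi>" using assms(2) unfolding fundamental_biorthogonal_system_def by blast
  interpret B: normalized_biorthogonal \<Gamma> ?e ?\<phi> by (rule normalize_biorthogonal_system(1)[OF b])
  have Y: "B.Y = Y" unfolding B.Y_def normalize_biorthogonal_system(2)[OF b] assms(3) ..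
  show ?thesis
    using B.bump_and_partitions B.norms_dense_polyhedral B.norms_dense_Cinf B.norms_dense_LUR
      admits_norm_if_norms_dense[OF B.norms_dense_polyhedral]
      admits_norm_if_norms_dense[OF B.norms_dense_Cinf]
      admits_norm_if_norms_dense[OF B.norms_dense_LUR]
    unfolding Y by (intro conjI) simp_all
qed

end
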